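(* Let $H_1$ be the Heisenberg group of all real matrices $$\left[\begin{array}{ccc}1&x&z\\0&1&y\\0&0&1\end{array}\right],\qquad x,y,z\in\mathbb{R},$$ let $\phi:\mathbb{R}\to\operatorname{Aut}(H_1)$ be the homomorphism given by $$\phi(t)\left(\left[\begin{array}{ccc}1&x&z\\0&1&y\\0&0&1\end{array}\right]\right)=\left[\begin{array}{ccc}1&e^{-t}x&z\\0&1&e^{t}y\\0&0&1\end{array}\right],$$ and let $G_{4,9}(0):=H_1\times_\phi\mathbb{R}$ be the corresponding semidirect product, a locally compact group. Then $G_{4,9}(0)$ is not weakly Wiener.
   Context: A locally compact group $G$ is called weakly Wiener if the Banach algebra $L^1(G)$ (with convolution) is weakly Wiener. For a Banach algebra $B$, let $\operatorname{Prim}(B)$ be the space of its primitive ideals (kernels of algebraically irreducible representations) with the Jacobson topology, and for a closed two-sided ideal $I$ let $\operatorname{hull}(I)=\{P\in\operatorname{Prim}(B): I\subset P\}$. A closed set $F\subset\operatorname{Prim}(B)$ is a set of synthesis if $\ker(F)=\bigcap_{P\in F}P$ is the only closed ideal $I$ with $\operatorname{hull}(I)=F$. $B$ is weakly Wiener if $\emptyset$ is a set of synthesis for $B$; equivalently (since $\ker(\emptyset)=B$), if every proper closed two-sided ideal of $B$ is contained in a primitive ideal. *)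

theory Defs
  imports
    "HOL-Analysis.Analysis"
    "HOL-Algebra.Module"
    "HOL-Algebra.Bij"
    "HOL-Algebra.Coset"
begin

section \<open>Primitive ideals and weakly Wiener Banach algebras\<close>

definition complex_ring :: "complex ring" where
  "complex_ring = \<lparr>carrier = UNIV, monoid.mult = (*), one = 1, ring.zero = 0, add = (+)\<rparr>"

text \<open>
  Complex algebras with a norm, not necessarily unital: the field \<open>one\<close> inherited from the record
  of modules is never used (it is present in every record that extends \<^typ>\<open>'a ring\<close>).
\<close>

record 'a normed_alg = "(complex, 'a) module" +
  alg_norm :: "'a \<Rightarrow> real"

definition closed_ideal :: "'a normed_alg \<Rightarrow> 'a set \<Rightarrow> bool" where
  "closed_ideal B I \<longleftrightarrow>
     submodule I complex_ring B \<and>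
     (\<forall>a\<in>carrier B. \<forall>x\<in>I. a \<otimes>\<^bsub>B\<^esub> x \<in> I \<and> x \<otimes>\<^bsub>B\<^esub> a \<in> I) \<and>
     (\<forall>x\<in>carrier B. (\<forall>e>0. \<exists>y\<in>I. alg_norm B (x \<ominus>\<^bsub>B\<^esub> y) < e) \<longrightarrow> x \<in> I)"

locale alg_representation = V: Module.module complex_ring V
  for B :: "'a normed_alg" and V :: "(complex, 'v) module" and \<pi> :: "'a \<Rightarrow> 'v \<Rightarrow> 'v" +
  assumes rep_closed: "\<lbrakk>a \<in> carrier B; v \<in> carrier V\<rbrakk> \<Longrightarrow> \<pi> a v \<in> carrier V"
    and rep_add: "\<lbrakk>a \<in> carrier B; v \<in> carrier V; w \<in> carrier V\<rbrakk>
      \<Longrightarrow> \<pi> a (v \<oplus>\<^bsub>V\<^esub> w) = \<pi> a v \<oplus>\<^bsub>V\<^esub> \<pi> a w"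
    and rep_smult: "\<lbrakk>a \<in> carrier B; v \<in> carrier V\<rbrakk> \<Longrightarrow> \<pi> a (c \<odot>\<^bsub>V\<^esub> v) = c \<odot>\<^bsub>V\<^esub> \<pi> a v"
    and alg_add: "\<lbrakk>a \<in> carrier B; b \<in> carrier B; v \<in> carrier V\<rbrakk>
      \<Longrightarrow> \<pi> (a \<oplus>\<^bsub>B\<^esub> b) v = \<pi> a v \<oplus>\<^bsub>V\<^esub> \<pi> b v"
    and alg_smult: "\<lbrakk>a \<in> carrier B; v \<in> carrier V\<rbrakk> \<Longrightarrow> \<pi> (c \<odot>\<^bsub>B\<^esub> a) v = c \<odot>\<^bsub>V\<^esub> \<pi> a v"
    and alg_mult: "\<lbrakk>a \<in> carrier B; b \<in> carrier B; v \<in> carrier V\<rbrakk>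
      \<Longrightarrow> \<pi> (a \<otimes>\<^bsub>B\<^esub> b) v = \<pi> a (\<pi> b v)"

text \<open>
  As usual for algebras without unit, the zero representation on a one-dimensional space does not
  count as irreducible; otherwise \<open>B\<close> itself would be a primitive ideal and every \<open>B\<close> would be
  weakly Wiener.
\<close>

locale irreducible_representation = alg_representation B V \<pi>
  for B :: "'a normed_alg" and V :: "(complex, 'v) module" and \<pi> :: "'a \<Rightarrow> 'v \<Rightarrow> 'v" +
  assumes nontrivial: "\<exists>a\<in>carrier B. \<exists>v\<in>carrier V. \<pi> a v \<noteq> \<zero>\<^bsub>V\<^esub>"
    and irreducible: "\<lbrakk>submodule W complex_ring V; \<And>a w. \<lbrakk>a \<in> carrier B; w \<in> W\<rbrakk> \<Longrightarrow> \<pi> a w \<in> W\<rbrakk>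
      \<Longrightarrow> W = {\<zero>\<^bsub>V\<^esub>} \<or> W = carrier V"

definition rep_kernel :: "'a normed_alg \<Rightarrow> (complex, 'v) module \<Rightarrow> ('a \<Rightarrow> 'v \<Rightarrow> 'v) \<Rightarrow> 'a set" where
  "rep_kernel B V \<pi> = {a \<in> carrier B. \<forall>v\<in>carrier V. \<pi> a v = \<zero>\<^bsub>V\<^esub>}"

text \<open>
  The representation space is carried by a set of elements of the type \<open>'a\<close> of \<open>B\<close>. This is no
  restriction, because every irreducible representation space is a quotient of \<open>B\<close>;
  see \<open>rep_kernel_in_Prim\<close> below.
\<close>

definition Prim :: "'a normed_alg \<Rightarrow> 'a set set" where
  "Prim B = {rep_kernel B V \<pi> | (V :: (complex, 'a) module) \<pi>. irreducible_representation B V \<pi>}"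

definition ideal_hull :: "'a normed_alg \<Rightarrow> 'a set \<Rightarrow> 'a set set" where
  "ideal_hull B I = {P \<in> Prim B. I \<subseteq> P}"

definition ideal_ker :: "'a normed_alg \<Rightarrow> 'a set set \<Rightarrow> 'a set" where
  "ideal_ker B F = {a \<in> carrier B. \<forall>P\<in>F. a \<in> P}"

text \<open>The Jacobson topology is given by the closure operator \<open>F \<mapsto> ideal_hull (ideal_ker F)\<close>.\<close>

definition jacobson_closed :: "'a normed_alg \<Rightarrow> 'a set set \<Rightarrow> bool" where
  "jacobson_closed B F \<longleftrightarrow> F \<subseteq> Prim B \<and> ideal_hull B (ideal_ker B F) = F"

definition set_of_synthesis :: "'a normed_alg \<Rightarrow> 'a set set \<Rightarrow> bool" where
  "set_of_synthesis B F \<longleftrightarrow>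
     jacobson_closed B F \<and> (\<forall>I. closed_ideal B I \<and> ideal_hull B I = F \<longrightarrow> I = ideal_ker B F)"

definition weakly_wiener :: "'a normed_alg \<Rightarrow> bool" where
  "weakly_wiener B \<longleftrightarrow> set_of_synthesis B {}"

lemma jacobson_closed_empty: "jacobson_closed B {}"
proof -
  have "\<not> carrier B \<subseteq> P" if "P \<in> Prim B" for P
    using that irreducible_representation.nontrivial
    unfolding Prim_def rep_kernel_def by fastforce
  then show ?thesis
    by (auto simp: jacobson_closed_def ideal_hull_def ideal_ker_def)
qed

lemma weakly_wiener_iff:
  "weakly_wiener B \<longleftrightarrow>
     (\<forall>I. closed_ideal B I \<and> I \<noteq> carrier B \<longrightarrow> (\<exists>P\<in>Prim B. I \<subseteq> P))"
  using jacobson_closed_empty[of B]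
  by (auto simp: weakly_wiener_def set_of_synthesis_def ideal_ker_def ideal_hull_def)

lemma module_transport:
  fixes V :: "(complex, 'v) module" and f :: "'v \<Rightarrow> 'a"
  assumes V: "Module.module complex_ring V" and inj: "inj_on f (carrier V)"
  defines "g \<equiv> inv_into (carrier V) f"
  defines "(V' :: (complex, 'a) module) \<equiv> \<lparr>carrier = f ` carrier V, monoid.mult = undefined, one = undefined, ring.zero = f \<zero>\<^bsub>V\<^esub>,
     add = (\<lambda>x y. f (g x \<oplus>\<^bsub>V\<^esub> g y)), smult = (\<lambda>c x. f (c \<odot>\<^bsub>V\<^esub> g x))\<rparr>"
  shows "Module.module complex_ring V'"
proof -
  interpret V: Module.module complex_ring V by (rule V)
  have C [simp]: "c \<in> carrier complex_ring" for c
    by (simp add: complex_ring_def)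
  have g [simp]: "g (f v) = v" if "v \<in> carrier V" for v
    using that inj by (simp add: g_def)
  show ?thesis
  proof (rule moduleI)
    show "abelian_group V'"
    proof (rule abelian_groupI)
      fix x assume "x \<in> carrier V'"
      then obtain v where v: "v \<in> carrier V" "x = f v" by (auto simp: V'_def)
      then show "\<exists>y\<in>carrier V'. y \<oplus>\<^bsub>V'\<^esub> x = \<zero>\<^bsub>V'\<^esub>"
        by (intro bexI[of _ "f (\<ominus>\<^bsub>V\<^esub> v)"]) (auto simp: V'_def V.M.l_neg)
    qed (auto simp: V'_def V.M.a_ac)
  qed (auto simp: V'_def V.R.cring_axioms V.smult_l_distr V.smult_r_distr V.smult_assoc1
       intro!: V.smult_one)
qed

lemma rep_kernel_in_Prim:
  fixes B :: "'a normed_alg" and V :: "(complex, 'v) module"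
  assumes B: "Module.module complex_ring B"
    and Bm: "\<And>a b. \<lbrakk>a \<in> carrier B; b \<in> carrier B\<rbrakk> \<Longrightarrow> a \<otimes>\<^bsub>B\<^esub> b \<in> carrier B"
    and irr: "irreducible_representation B V \<pi>"
  shows "rep_kernel B V \<pi> \<in> Prim B"
proof -
  interpret B: Module.module complex_ring B by (rule B)
  interpret irreducible_representation B V \<pi> by (rule irr)
  have C [simp]: "c \<in> carrier complex_ring" for c
    by (simp add: complex_ring_def)
  obtain a0 v0 where a0: "a0 \<in> carrier B" and v0: "v0 \<in> carrier V" and nz: "\<pi> a0 v0 \<noteq> \<zero>\<^bsub>V\<^esub>"
    using nontrivial by blast
  define W where "W = (\<lambda>a. \<pi> a v0) ` carrier B"
  have "submodule W complex_ring V"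
  proof (rule V.submoduleI)
    show "W \<subseteq> carrier V" using v0 by (auto simp: W_def rep_closed)
    have sm: "c \<odot>\<^bsub>V\<^esub> x \<in> W" if "x \<in> W" for c x
      using that v0 by (auto simp: W_def alg_smult[symmetric])
    show "c \<odot>\<^bsub>V\<^esub> x \<in> W" if "x \<in> W" for c x using sm that .
    show ad: "x \<oplus>\<^bsub>V\<^esub> y \<in> W" if "x \<in> W" "y \<in> W" for x y
      using that v0 by (auto simp: W_def alg_add[symmetric])
    have neg: "\<ominus>\<^bsub>V\<^esub> x \<in> W" if x: "x \<in> W" for x
    proof -
      obtain a where a: "a \<in> carrier B" "x = \<pi> a v0" using x by (auto simp: W_def)
      have xV: "x \<in> carrier V" using a v0 by (simp add: rep_closed)
      have "\<pi> (\<zero>\<^bsub>B\<^esub> \<oplus>\<^bsub>B\<^esub> \<zero>\<^bsub>B\<^esub>) v0 = \<pi> \<zero>\<^bsub>B\<^esub> v0 \<oplus>\<^bsub>V\<^esub> \<pi> \<zero>\<^bsub>B\<^esub> v0" by (rule alg_add) (use v0 in auto)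
      then have z: "\<pi> \<zero>\<^bsub>B\<^esub> v0 = \<zero>\<^bsub>V\<^esub>"
        using rep_closed[OF B.M.zero_closed v0] by (metis B.M.r_zero B.M.zero_closed V.M.add.r_cancel_one')
      have "\<pi> (\<ominus>\<^bsub>B\<^esub> a) v0 \<oplus>\<^bsub>V\<^esub> x = \<zero>\<^bsub>V\<^esub>"
        using alg_add[of "\<ominus>\<^bsub>B\<^esub> a" a v0] a v0 z by (simp add: B.M.l_neg)
      then have "\<ominus>\<^bsub>V\<^esub> x = \<pi> (\<ominus>\<^bsub>B\<^esub> a) v0"
        using a v0 xV by (intro V.M.minus_equality) (auto simp: rep_closed)
      then show ?thesis using a by (auto simp: W_def)
    qed
    show "\<ominus>\<^bsub>V\<^esub> x \<in> W" if "x \<in> W" for x using neg that .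
    have x: "\<pi> a0 v0 \<in> W" using a0 by (auto simp: W_def)
    have "\<pi> a0 v0 \<oplus>\<^bsub>V\<^esub> \<ominus>\<^bsub>V\<^esub> \<pi> a0 v0 \<in> W" by (rule ad[OF x neg[OF x]])
    then show "\<zero>\<^bsub>V\<^esub> \<in> W" using a0 v0 by (simp add: V.M.r_neg rep_closed)
  qed
  moreover have "\<pi> a w \<in> W" if "a \<in> carrier B" "w \<in> W" for a w
    using that v0 Bm by (auto simp: W_def alg_mult[symmetric])
  ultimately have "W = {\<zero>\<^bsub>V\<^esub>} \<or> W = carrier V" by (rule irreducible)
  moreover have "\<pi> a0 v0 \<in> W" using a0 by (auto simp: W_def)
  ultimately have W: "W = carrier V" using nz by auto
  define f where "f = inv_into (carrier B) (\<lambda>a. \<pi> a v0)"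
  have inj: "inj_on f (carrier V)" unfolding W[symmetric] W_def f_def by (rule inj_on_inv_into) simp
  define g where "g = inv_into (carrier V) f"
  define V' :: "(complex, 'a) module" where "V' = \<lparr>carrier = f ` carrier V, monoid.mult = undefined, one = undefined, ring.zero = f \<zero>\<^bsub>V\<^esub>,
     add = (\<lambda>x y. f (g x \<oplus>\<^bsub>V\<^esub> g y)), smult = (\<lambda>c x. f (c \<odot>\<^bsub>V\<^esub> g x))\<rparr>"
  have g [simp]: "g (f v) = v" if "v \<in> carrier V" for v
    using that inj by (simp add: g_def)
  have feq [simp]: "f v = f w \<longleftrightarrow> v = w" if "v \<in> carrier V" "w \<in> carrier V" for v w
    using that inj by (auto dest: inj_onD)
  define \<pi>' where "\<pi>' = (\<lambda>a x. f (\<pi> a (g x)))"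
  interpret V': Module.module complex_ring V'
    unfolding V'_def g_def by (rule module_transport[OF V.module_axioms inj])
  have "irreducible_representation B V' \<pi>'"
  proof
    show "\<exists>a\<in>carrier B. \<exists>v\<in>carrier V'. \<pi>' a v \<noteq> \<zero>\<^bsub>V'\<^esub>"
      using a0 v0 nz by (intro bexI[of _ a0] bexI[of _ "f v0"]) (auto simp: V'_def \<pi>'_def rep_closed)
    fix W' assume W': "submodule W' complex_ring V'"
      and inv: "\<And>a w. a \<in> carrier B \<Longrightarrow> w \<in> W' \<Longrightarrow> \<pi>' a w \<in> W'"
    note E = V'.submoduleE[OF W']
    define U where "U = {v \<in> carrier V. f v \<in> W'}"
    have W'U: "W' = f ` U" using E(1) by (auto simp: U_def V'_def)
    have U0: "\<zero>\<^bsub>V\<^esub> \<in> U"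
    proof -
      obtain x where x: "x \<in> W'" using E(2) by auto
      then have "x \<oplus>\<^bsub>V'\<^esub> \<ominus>\<^bsub>V'\<^esub> x \<in> W'" using E(3,5) by blast
      then have "\<zero>\<^bsub>V'\<^esub> \<in> W'" using x E(1) by (simp add: V'.M.r_neg subset_iff)
      then show ?thesis by (simp add: U_def V'_def)
    qed
    have sm: "c \<odot>\<^bsub>V\<^esub> x \<in> U" if "x \<in> U" for c x
      using that E(4)[of c "f x"] by (auto simp: U_def V'_def)
    have "submodule U complex_ring V"
    proof (rule V.submoduleI)
      show "x \<oplus>\<^bsub>V\<^esub> y \<in> U" if "x \<in> U" "y \<in> U" for x y
        using that E(5)[of "f x" "f y"] by (auto simp: U_def V'_def)
      show "\<ominus>\<^bsub>V\<^esub> x \<in> U" if x: "x \<in> U" for x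
      proof -
        have xV: "x \<in> carrier V" using x by (simp add: U_def)
        have "\<ominus>\<^bsub>V'\<^esub> f x = f (\<ominus>\<^bsub>V\<^esub> x)"
          using xV by (intro V'.M.minus_equality) (auto simp: V'_def V.M.l_neg)
        then show ?thesis using x E(3)[of "f x"] xV by (auto simp: U_def)
      qed
    qed (use U0 sm in \<open>auto simp: U_def\<close>)
    moreover have "\<pi> a w \<in> U" if "a \<in> carrier B" "w \<in> U" for a w
      using that inv[of a "f w"] by (auto simp: U_def \<pi>'_def rep_closed)
    ultimately have "U = {\<zero>\<^bsub>V\<^esub>} \<or> U = carrier V" by (rule irreducible)
    then show "W' = {\<zero>\<^bsub>V'\<^esub>} \<or> W' = carrier V'" unfolding W'U by (auto simp: V'_def)
  qed (auto simp: V'_def \<pi>'_def rep_closed rep_add rep_smult alg_add alg_smult alg_mult)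
  moreover have "rep_kernel B V' \<pi>' = rep_kernel B V \<pi>"
    by (auto simp: rep_kernel_def V'_def \<pi>'_def rep_closed)
  ultimately show ?thesis
    unfolding Prim_def by blast
qed

section \<open>The group algebra of a locally compact group\<close>

locale locally_compact_group = group G for G (structure) +
  fixes T :: "'a topology"
  assumes topspace_eq: "topspace T = carrier G"
    and Hausdorff: "Hausdorff_space T"
    and locally_compact: "locally_compact_space T"
    and continuous_mult: "continuous_map (prod_topology T T) T (\<lambda>(x, y). x \<otimes> y)"
    and continuous_inv: "continuous_map T T (\<lambda>x. inv x)"

definition borel_sigma :: "'a topology \<Rightarrow> 'a measure" where
  "borel_sigma T = sigma (topspace T) {U. openin T U}"

definition left_haar_measure :: "('a, 'm) monoid_scheme \<Rightarrow> 'a topology \<Rightarrow> 'a measure \<Rightarrow> bool" where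
  "left_haar_measure G T \<mu> \<longleftrightarrow>
     sets \<mu> = sets (borel_sigma T) \<and>
     emeasure \<mu> (carrier G) \<noteq> 0 \<and>
     (\<forall>K. compactin T K \<longrightarrow> emeasure \<mu> K < \<infinity>) \<and>
     (\<forall>A\<in>sets \<mu>. emeasure \<mu> A = (INF U\<in>{U. openin T U \<and> A \<subseteq> U}. emeasure \<mu> U)) \<and>
     (\<forall>U. openin T U \<longrightarrow> emeasure \<mu> U = (SUP K\<in>{K. compactin T K \<and> K \<subseteq> U}. emeasure \<mu> K)) \<and>
     (\<forall>g\<in>carrier G. \<forall>A\<in>sets \<mu>. emeasure \<mu> (g <#\<^bsub>G\<^esub> A) = emeasure \<mu> A)"

definition l1_rel :: "'a measure \<Rightarrow> (('a \<Rightarrow> complex) \<times> ('a \<Rightarrow> complex)) set" where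
  "l1_rel \<mu> = {(f, h). integrable \<mu> f \<and> integrable \<mu> h \<and> (AE x in \<mu>. f x = h x)}"

definition l1_class :: "'a measure \<Rightarrow> ('a \<Rightarrow> complex) \<Rightarrow> ('a \<Rightarrow> complex) set" where
  "l1_class \<mu> f = l1_rel \<mu> `` {f}"

definition l1_rep :: "('a \<Rightarrow> complex) set \<Rightarrow> 'a \<Rightarrow> complex" where
  "l1_rep F = (SOME f. f \<in> F)"

definition convolution ::
  "('a, 'm) monoid_scheme \<Rightarrow> 'a measure \<Rightarrow> ('a \<Rightarrow> complex) \<Rightarrow> ('a \<Rightarrow> complex) \<Rightarrow> 'a \<Rightarrow> complex" where
  "convolution G \<mu> f h x = (LINT y|\<mu>. f y * h (inv\<^bsub>G\<^esub> y \<otimes>\<^bsub>G\<^esub> x))"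

definition L1 :: "('a, 'm) monoid_scheme \<Rightarrow> 'a measure \<Rightarrow> ('a \<Rightarrow> complex) set normed_alg" where
  "L1 G \<mu> = \<lparr>carrier = {f. integrable \<mu> f} // l1_rel \<mu>,
     monoid.mult = (\<lambda>F H. l1_class \<mu> (convolution G \<mu> (l1_rep F) (l1_rep H))),
     one = undefined,
     ring.zero = l1_class \<mu> (\<lambda>x. 0),
     add = (\<lambda>F H. l1_class \<mu> (\<lambda>x. l1_rep F x + l1_rep H x)),
     smult = (\<lambda>c F. l1_class \<mu> (\<lambda>x. c * l1_rep F x)),
     alg_norm = (\<lambda>F. LINT x|\<mu>. cmod (l1_rep F x))\<rparr>"

text \<open>
  A left Haar measure is unique up to a factor \<open>c > 0\<close>, and \<open>f \<mapsto> f / c\<close> is an isometric algebra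
  isomorphism from \<open>L1 G \<mu>\<close> onto \<open>L1 G (c\<mu>)\<close>, so the choice of \<open>\<mu>\<close> is immaterial.
\<close>

definition weakly_wiener_group :: "('a, 'm) monoid_scheme \<Rightarrow> 'a topology \<Rightarrow> bool" where
  "weakly_wiener_group G T \<longleftrightarrow> (\<forall>\<mu>. left_haar_measure G T \<mu> \<longrightarrow> weakly_wiener (L1 G \<mu>))"

section \<open>The group \<open>G\<^sub>4\<^sub>,\<^sub>9(0)\<close>\<close>

definition semidirect_product ::
  "('a, 'm) monoid_scheme \<Rightarrow> ('b, 'n) monoid_scheme \<Rightarrow> ('b \<Rightarrow> 'a \<Rightarrow> 'a) \<Rightarrow> ('a \<times> 'b) monoid" where
  "semidirect_product H K \<phi> = \<lparr>carrier = carrier H \<times> carrier K,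
     monoid.mult = (\<lambda>(h, k) (h', k'). (h \<otimes>\<^bsub>H\<^esub> \<phi> k h', k \<otimes>\<^bsub>K\<^esub> k')),
     one = (\<one>\<^bsub>H\<^esub>, \<one>\<^bsub>K\<^esub>)\<rparr>"

definition real_group :: "real monoid" where
  "real_group = \<lparr>carrier = UNIV, monoid.mult = (+), one = 0\<rparr>"

definition heis :: "real \<Rightarrow> real \<Rightarrow> real \<Rightarrow> real^3^3" where
  "heis x y z = vector [vector [1, x, z], vector [0, 1, y], vector [0, 0, 1]]"

definition heisenberg_group :: "(real^3^3) monoid" where
  "heisenberg_group = \<lparr>carrier = {heis x y z | x y z. True}, monoid.mult = (**), one = mat 1\<rparr>"

definition heis_action :: "real \<Rightarrow> real^3^3 \<Rightarrow> real^3^3" where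
  "heis_action t = (\<lambda>A\<in>carrier heisenberg_group. heis (exp (- t) * A$1$2) (exp t * A$2$3) (A$1$3))"

definition G49 :: "((real^3^3) \<times> real) monoid" where
  "G49 = semidirect_product heisenberg_group real_group heis_action"

definition G49_topology :: "((real^3^3) \<times> real) topology" where
  "G49_topology = prod_topology (subtopology euclidean (carrier heisenberg_group)) euclidean"

lemma heis_entries [simp]:
  "heis x y z $ 1 $ 1 = 1" "heis x y z $ 1 $ 2 = x" "heis x y z $ 1 $ 3 = z"
  "heis x y z $ 2 $ 1 = 0" "heis x y z $ 2 $ 2 = 1" "heis x y z $ 2 $ 3 = y"
  "heis x y z $ 3 $ 1 = 0" "heis x y z $ 3 $ 2 = 0" "heis x y z $ 3 $ 3 = 1"
  by (simp_all add: heis_def)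

lemma heis_mult: "heis a b c ** heis x y z = heis (a + x) (b + y) (c + z + a * y)"
  by (simp add: vec_eq_iff forall_3 matrix_matrix_mult_def sum_3)

lemma heis_eq_iff [simp]: "heis a b c = heis x y z \<longleftrightarrow> a = x \<and> b = y \<and> c = z"
  by (metis heis_entries(2,3,6))

lemma mat_1_heis: "mat 1 = heis 0 0 0"
  by (simp add: vec_eq_iff forall_3 mat_def)

lemma heis_in_carrier [simp]: "heis x y z \<in> carrier heisenberg_group"
  by (auto simp: heisenberg_group_def)

lemma heis_cases:
  assumes "A \<in> carrier heisenberg_group" obtains x y z where "A = heis x y z"
  using assms by (auto simp: heisenberg_group_def)

lemma heis_mult' [simp]:
  "heis a b c \<otimes>\<^bsub>heisenberg_group\<^esub> heis x y z = heis (a + x) (b + y) (c + z + a * y)"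
  by (simp add: heisenberg_group_def heis_mult)

lemma heis_one [simp]: "\<one>\<^bsub>heisenberg_group\<^esub> = heis 0 0 0"
  by (simp add: heisenberg_group_def mat_1_heis)

lemma group_heisenberg: "group heisenberg_group"
proof (rule groupI)
  fix A assume "A \<in> carrier heisenberg_group"
  then obtain x y z where "A = heis x y z" by (rule heis_cases)
  then show "\<exists>B\<in>carrier heisenberg_group. B \<otimes>\<^bsub>heisenberg_group\<^esub> A = \<one>\<^bsub>heisenberg_group\<^esub>"
    by (intro bexI[of _ "heis (- x) (- y) (x * y - z)"]) auto
qed (auto elim!: heis_cases simp: algebra_simps)

lemma group_real: "group real_group"
  by (rule groupI) (auto simp: real_group_def intro: exI[of _ "- x" for x])

lemma heis_action_heis [simp]: "heis_action t (heis x y z) = heis (exp (- t) * x) (exp t * y) z"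
  by (simp add: heis_action_def)

lemma heis_action_hom: "heis_action \<in> hom real_group (AutoGroup heisenberg_group)"
proof -
  have auto: "heis_action t \<in> auto heisenberg_group" for t
  proof -
    have "heis_action t \<in> hom heisenberg_group heisenberg_group"
      by (rule homI) (auto elim!: heis_cases simp: algebra_simps exp_minus)
    moreover have "bij_betw (heis_action t) (carrier heisenberg_group) (carrier heisenberg_group)"
      by (rule bij_betw_byWitness[where f' = "heis_action (- t)"])
         (auto elim!: heis_cases simp: exp_minus)
    ultimately show ?thesis
      by (auto simp: auto_def Bij_def heis_action_def)
  qed
  have "heis_action (s + t) = compose (carrier heisenberg_group) (heis_action s) (heis_action t)"
    for s t
  proof
    fix A
    show "heis_action (s + t) A = compose (carrier heisenberg_group) (heis_action s) (heis_action t) A"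
      by (cases "A \<in> carrier heisenberg_group")
         (auto elim!: heis_cases simp: compose_def exp_add exp_minus, auto simp: heis_action_def exp_diff exp_minus field_simps)
  qed
  then show ?thesis
    using auto by (auto simp: hom_def AutoGroup_def BijGroup_def real_group_def auto_def)
qed

lemma group_semidirect_product:
  assumes "group H" "group K" and \<phi>: "\<phi> \<in> hom K (AutoGroup H)"
  shows "group (semidirect_product H K \<phi>)"
proof -
  interpret H: group H by fact
  interpret K: group K by fact
  have aut: "\<phi> k \<in> hom H H" "bij_betw (\<phi> k) (carrier H) (carrier H)" if "k \<in> carrier K" for k
    using \<phi> that by (auto simp: hom_def AutoGroup_def auto_def Bij_def)
  have cl [simp]: "\<phi> k h \<in> carrier H" if "k \<in> carrier K" "h \<in> carrier H" for k h
    using aut(1)[OF that(1)] that(2) by (auto simp: hom_def)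
  have mu: "\<phi> k (h \<otimes>\<^bsub>H\<^esub> h') = \<phi> k h \<otimes>\<^bsub>H\<^esub> \<phi> k h'"
    if "k \<in> carrier K" "h \<in> carrier H" "h' \<in> carrier H" for k h h'
    using aut(1)[OF that(1)] that(2,3) by (auto simp: hom_def)
  have co: "\<phi> (k \<otimes>\<^bsub>K\<^esub> l) h = \<phi> k (\<phi> l h)"
    if "k \<in> carrier K" "l \<in> carrier K" "h \<in> carrier H" for k l h
  proof -
    have "\<phi> k \<in> Bij (carrier H)" "\<phi> l \<in> Bij (carrier H)"
      using \<phi> that by (auto simp: hom_def AutoGroup_def auto_def)
    then show ?thesis
      using \<phi> that by (auto simp: hom_def AutoGroup_def BijGroup_def compose_def)
  qed
  have one: "\<phi> \<one>\<^bsub>K\<^esub> h = h" if h: "h \<in> carrier H" for h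
  proof -
    have "\<phi> \<one>\<^bsub>K\<^esub> (\<phi> \<one>\<^bsub>K\<^esub> h) = \<phi> \<one>\<^bsub>K\<^esub> h"
      using co[of "\<one>\<^bsub>K\<^esub>" "\<one>\<^bsub>K\<^esub>" h] h by simp
    then show ?thesis
      using aut(2)[of "\<one>\<^bsub>K\<^esub>"] h by (auto simp: bij_betw_def dest: inj_onD)
  qed
  show ?thesis
  proof (rule groupI)
    fix p assume "p \<in> carrier (semidirect_product H K \<phi>)"
    then obtain h k where p: "p = (h, k)" "h \<in> carrier H" "k \<in> carrier K"
      by (auto simp: semidirect_product_def)
    let ?q = "(\<phi> (inv\<^bsub>K\<^esub> k) (inv\<^bsub>H\<^esub> h), inv\<^bsub>K\<^esub> k)"
    have "\<phi> (inv\<^bsub>K\<^esub> k) (inv\<^bsub>H\<^esub> h) \<otimes>\<^bsub>H\<^esub> \<phi> (inv\<^bsub>K\<^esub> k) h = \<phi> (inv\<^bsub>K\<^esub> k) \<one>\<^bsub>H\<^esub>"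
      using p mu[of "inv\<^bsub>K\<^esub> k" "inv\<^bsub>H\<^esub> h" h] by simp
    also have "\<dots> = \<one>\<^bsub>H\<^esub>"
      using p aut(1)[of "inv\<^bsub>K\<^esub> k"] by (intro hom_one assms) auto
    finally show "\<exists>q\<in>carrier (semidirect_product H K \<phi>).
        q \<otimes>\<^bsub>semidirect_product H K \<phi>\<^esub> p = \<one>\<^bsub>semidirect_product H K \<phi>\<^esub>"
      using p by (intro bexI[of _ ?q]) (auto simp: semidirect_product_def)
  qed (auto simp: semidirect_product_def H.m_assoc K.m_assoc mu co one)
qed

lemma group_G49: "group G49"
  unfolding G49_def by (intro group_semidirect_product group_heisenberg group_real heis_action_hom)

lemma carrier_G49: "carrier G49 = carrier heisenberg_group \<times> UNIV"
  by (simp add: G49_def semidirect_product_def real_group_def)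

lemma G49_mult:
  "(heis a b c, s) \<otimes>\<^bsub>G49\<^esub> (heis x y z, t) =
     (heis (a + exp (- s) * x) (b + exp s * y) (c + z + a * (exp s * y)), s + t)"
  by (simp add: G49_def semidirect_product_def real_group_def)

lemma G49_one: "\<one>\<^bsub>G49\<^esub> = (heis 0 0 0, 0)"
  by (simp add: G49_def semidirect_product_def real_group_def)

lemma G49_inv:
  "inv\<^bsub>G49\<^esub> (heis a b c, s) = (heis (- exp s * a) (- exp (- s) * b) (a * b - c), - s)"
  by (rule group.inv_equality[OF group_G49])
     (auto simp: G49_mult G49_one carrier_G49 exp_minus algebra_simps)

definition G49_coord :: "real \<times> real \<times> real \<times> real \<Rightarrow> (real^3^3) \<times> real" where
  "G49_coord = (\<lambda>(x, y, z, t). (heis x y z, t))"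

definition G49_coord_inv :: "(real^3^3) \<times> real \<Rightarrow> real \<times> real \<times> real \<times> real" where
  "G49_coord_inv = (\<lambda>(A, t). (A$1$2, A$2$3, A$1$3, t))"

lemma G49_topology_eq: "G49_topology = subtopology euclidean (carrier G49)"
  unfolding G49_topology_def carrier_G49
  by (metis prod_topology_subtopology_eu subtopology_UNIV)

lemma topspace_G49: "topspace G49_topology = carrier G49"
  by (simp add: G49_topology_eq)

lemma continuous_on_heis:
  assumes "continuous_on S f" "continuous_on S g" "continuous_on S h"
  shows "continuous_on S (\<lambda>p. heis (f p) (g p) (h p))"
proof -
  have eq: "(\<lambda>p. heis (f p) (g p) (h p)) = (\<lambda>p. \<chi> i j. heis (f p) (g p) (h p) $ i $ j)"
    by (simp add: vec_eq_iff)
  have "continuous_on S (\<lambda>p. heis (f p) (g p) (h p) $ i $ j)" for i j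
    using exhaust_3[of i] exhaust_3[of j] assms by auto
  then show ?thesis
    by (subst eq) (intro continuous_on_vec_lambda)
qed

lemma G49_coord_homeo: "homeomorphic_maps euclidean G49_topology G49_coord G49_coord_inv"
proof -
  have 1: "continuous_on UNIV G49_coord"
    unfolding G49_coord_def case_prod_unfold
    by (intro continuous_intros continuous_on_heis)
  have 2: "continuous_on S G49_coord_inv" for S
    unfolding G49_coord_inv_def case_prod_unfold by (intro continuous_intros)
  have "continuous_map euclidean G49_topology G49_coord"
    using 1 by (auto simp: G49_topology_eq continuous_map_in_subtopology carrier_G49 G49_coord_def)
  moreover have "continuous_map G49_topology euclidean G49_coord_inv"
    using 2 by (simp add: G49_topology_eq)
  ultimately show ?thesis
    by (auto simp: homeomorphic_maps_def G49_coord_def G49_coord_inv_def topspace_G49 carrier_G49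
        elim!: heis_cases)
qed

theorem locally_compact_group_G49: "locally_compact_group G49 G49_topology"
proof -
  interpret G: group G49 by (rule group_G49)
  show ?thesis
  proof
    show "topspace G49_topology = carrier G49" by (rule topspace_G49)
    show "Hausdorff_space G49_topology"
      by (simp add: G49_topology_eq Hausdorff_space_subtopology Hausdorff_space_euclidean)
    have "(euclidean :: (real \<times> real \<times> real \<times> real) topology) homeomorphic_space G49_topology"
      using G49_coord_homeo unfolding homeomorphic_space_def by blast
    moreover have "locally_compact_space (euclidean :: (real \<times> real \<times> real \<times> real) topology)"
      by (rule locally_compact_space_euclidean)
    ultimately show "locally_compact_space G49_topology"
      using homeomorphic_locally_compact_space by blast
    let ?m = "\<lambda>(p, q). (heis (fst p $ 1 $ 2 + exp (- snd p) * fst q $ 1 $ 2)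
        (fst p $ 2 $ 3 + exp (snd p) * fst q $ 2 $ 3)
        (fst p $ 1 $ 3 + fst q $ 1 $ 3 + fst p $ 1 $ 2 * (exp (snd p) * fst q $ 2 $ 3)),
        snd p + snd q)"
    have T2: "prod_topology G49_topology G49_topology
        = subtopology euclidean (carrier G49 \<times> carrier G49)"
      unfolding G49_topology_eq by (metis prod_topology_subtopology_eu)
    have "continuous_on (carrier G49 \<times> carrier G49) ?m"
      unfolding case_prod_unfold by (intro continuous_intros continuous_on_heis)
    moreover have eq: "?m pq = (\<lambda>(p, q). p \<otimes>\<^bsub>G49\<^esub> q) pq" if "pq \<in> carrier G49 \<times> carrier G49" for pq
      using that by (auto simp: carrier_G49 G49_mult elim!: heis_cases)
    ultimately have "continuous_on (carrier G49 \<times> carrier G49) (\<lambda>(p, q). p \<otimes>\<^bsub>G49\<^esub> q)"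
      using continuous_on_cong by (metis (no_types, lifting))
    then show "continuous_map (prod_topology G49_topology G49_topology) G49_topology
        (\<lambda>(p, q). p \<otimes>\<^bsub>G49\<^esub> q)"
      unfolding T2 G49_topology_eq by (auto simp: continuous_map_in_subtopology)
    let ?i = "\<lambda>p. (heis (- exp (snd p) * fst p $ 1 $ 2) (- exp (- snd p) * fst p $ 2 $ 3)
        (fst p $ 1 $ 2 * fst p $ 2 $ 3 - fst p $ 1 $ 3), - snd p)"
    have "continuous_on (carrier G49) ?i"
      by (intro continuous_intros continuous_on_heis)
    moreover have "?i p = inv\<^bsub>G49\<^esub> p" if "p \<in> carrier G49" for p
      using that by (auto simp: carrier_G49 G49_inv elim!: heis_cases)
    ultimately have "continuous_on (carrier G49) (\<lambda>p. inv\<^bsub>G49\<^esub> p)"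
      using continuous_on_cong by (metis (no_types, lifting))
    then show "continuous_map G49_topology G49_topology (\<lambda>p. inv\<^bsub>G49\<^esub> p)"
      unfolding G49_topology_eq by (auto simp: continuous_map_in_subtopology)
  qed
qed

definition G49_haar :: "((real^3^3) \<times> real) measure" where
  "G49_haar = distr lborel (borel_sigma G49_topology) G49_coord"

lemma sets_borel_sigma: "sets (borel_sigma T) = sigma_sets (topspace T) {U. openin T U}"
  unfolding borel_sigma_def by (rule sets_measure_of) (auto dest: openin_subset)

lemma space_borel_sigma: "space (borel_sigma T) = topspace T"
  unfolding borel_sigma_def by (rule space_measure_of) (auto dest: openin_subset)

lemma open_in_borel_sigma: "openin T U \<Longrightarrow> U \<in> sets (borel_sigma T)"
  by (auto simp: sets_borel_sigma)

lemma nn_integral_4: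
  fixes f :: "real \<times> real \<times> real \<times> real \<Rightarrow> ennreal"
  assumes [measurable]: "f \<in> borel_measurable borel"
  shows "(\<integral>\<^sup>+p. f p \<partial>lborel) =
    (\<integral>\<^sup>+x. \<integral>\<^sup>+y. \<integral>\<^sup>+z. \<integral>\<^sup>+t. f (x, y, z, t) \<partial>lborel \<partial>lborel \<partial>lborel \<partial>lborel)"
proof -
  have *: "(\<integral>\<^sup>+p. g p \<partial>lborel) = (\<integral>\<^sup>+x. \<integral>\<^sup>+q. g (x, q) \<partial>lborel \<partial>lborel)"
    if [measurable]: "g \<in> borel_measurable borel"
    for g :: "real \<times> 'c::euclidean_space \<Rightarrow> ennreal"
    by (subst lborel_prod[symmetric], subst lborel.nn_integral_fst[symmetric]) (auto simp: lborel_prod)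
  show ?thesis
    by (subst *, simp, intro nn_integral_cong, subst *, simp, intro nn_integral_cong, subst *, simp)
       (rule refl)
qed

lemma lborel_G49_translation:
  "distr lborel borel (\<lambda>(x, y, z, t).
     (a + exp (- s) * x, b + exp s * y, c + z + a * (exp s * y), s + t)) = (lborel :: (real \<times> real \<times> real \<times> real) measure)"
    (is "distr _ _ ?L = _")
proof (rule measure_eqI)
  have "continuous_on UNIV ?L"
    unfolding case_prod_unfold by (intro continuous_intros)
  then have L [measurable]: "?L \<in> borel_measurable borel"
    by (rule borel_measurable_continuous_onI)
  fix A assume "A \<in> sets (distr lborel borel ?L)"
  then have A [measurable]: "A \<in> sets borel" by simp
  let ?f = "indicator A :: real \<times> real \<times> real \<times> real \<Rightarrow> ennreal"
  have f [measurable]: "?f \<in> borel_measurable borel" by simp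
  have "emeasure (distr lborel borel ?L) A = (\<integral>\<^sup>+p. ?f p \<partial>distr lborel borel ?L)"
    by simp
  also have "\<dots> = (\<integral>\<^sup>+p. ?f (?L p) \<partial>lborel)"
    by (subst nn_integral_distr) auto
  also have "\<dots> = (\<integral>\<^sup>+x. \<integral>\<^sup>+y. \<integral>\<^sup>+z. \<integral>\<^sup>+t. ?f (a + exp (- s) * x, b + exp s * y, c + z + a * (exp s * y), s + t)
      \<partial>lborel \<partial>lborel \<partial>lborel \<partial>lborel)"
    by (subst nn_integral_4) auto
  also have "\<dots> = (\<integral>\<^sup>+x. \<integral>\<^sup>+y. \<integral>\<^sup>+z. \<integral>\<^sup>+t. ?f (a + exp (- s) * x, b + exp s * y, c + z + a * (exp s * y), t)
      \<partial>lborel \<partial>lborel \<partial>lborel \<partial>lborel)"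
  proof -
    have "(\<integral>\<^sup>+t. ?f (a + exp (- s) * x, b + exp s * y, c + z + a * (exp s * y), s + t) \<partial>lborel)
        = (\<integral>\<^sup>+t. ?f (a + exp (- s) * x, b + exp s * y, c + z + a * (exp s * y), t) \<partial>lborel)"
      for x y z
      by (subst (2) nn_integral_real_affine[where c = 1 and t = s]) auto
    then show ?thesis by (simp only:)
  qed
  also have "\<dots> = (\<integral>\<^sup>+x. \<integral>\<^sup>+y. \<integral>\<^sup>+z. \<integral>\<^sup>+t. ?f (a + exp (- s) * x, b + exp s * y, z, t)
      \<partial>lborel \<partial>lborel \<partial>lborel \<partial>lborel)"
  proof -
    have "(\<integral>\<^sup>+z. \<integral>\<^sup>+t. ?f (a + exp (- s) * x, b + exp s * y, c + z + a * (exp s * y), t) \<partial>lborel \<partial>lborel)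
        = (\<integral>\<^sup>+z. \<integral>\<^sup>+t. ?f (a + exp (- s) * x, b + exp s * y, z, t) \<partial>lborel \<partial>lborel)"
      for x y
      by (subst (2) nn_integral_real_affine[where c = 1 and t = "c + a * (exp s * y)"])
         (auto simp: algebra_simps)
    then show ?thesis by (simp only:)
  qed
  also have "\<dots> = (\<integral>\<^sup>+x. ennreal (exp (- s)) * (\<integral>\<^sup>+y. \<integral>\<^sup>+z. \<integral>\<^sup>+t. ?f (a + exp (- s) * x, y, z, t)
      \<partial>lborel \<partial>lborel \<partial>lborel) \<partial>lborel)"
  proof -
    have 1: "ennreal (exp (- s)) * (ennreal (exp s) * u) = u" for u
      by (simp add: mult.assoc[symmetric] ennreal_mult[symmetric] exp_minus)
    have "(\<integral>\<^sup>+y. \<integral>\<^sup>+z. \<integral>\<^sup>+t. ?f (a + exp (- s) * x, b + exp s * y, z, t) \<partial>lborel \<partial>lborel \<partial>lborel)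
        = ennreal (exp (- s)) * (\<integral>\<^sup>+y. \<integral>\<^sup>+z. \<integral>\<^sup>+t. ?f (a + exp (- s) * x, y, z, t) \<partial>lborel \<partial>lborel \<partial>lborel)"
      for x
      by (subst (2) nn_integral_real_affine[where c = "exp s" and t = b]) (auto simp: 1)
    then show ?thesis by (simp only:)
  qed
  also have "\<dots> = (\<integral>\<^sup>+x. \<integral>\<^sup>+y. \<integral>\<^sup>+z. \<integral>\<^sup>+t. ?f (x, y, z, t) \<partial>lborel \<partial>lborel \<partial>lborel \<partial>lborel)"
    by (subst (2) nn_integral_real_affine[where c = "exp (- s)" and t = a])
       (auto simp: nn_integral_cmult)
  also have "\<dots> = (\<integral>\<^sup>+p. ?f p \<partial>lborel)"
    by (subst nn_integral_4) auto
  also have "\<dots> = emeasure lborel A" by simp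
  finally show "emeasure (distr lborel borel ?L) A = emeasure lborel A" .
qed simp

theorem left_haar_measure_G49: "left_haar_measure G49 G49_topology G49_haar"
proof -
  interpret G: group G49 by (rule group_G49)
  note H = G49_coord_homeo
  let ?T = G49_topology and ?c = G49_coord and ?d = G49_coord_inv and ?\<mu> = G49_haar
  have dc [simp]: "?d (?c p) = p" for p
    by (auto simp: G49_coord_def G49_coord_inv_def split: prod.splits)
  have cd: "?c (?d g) = g" if "g \<in> carrier G49" for g
    using that by (auto simp: G49_coord_def G49_coord_inv_def carrier_G49 elim!: heis_cases)
  have c_in [simp]: "?c p \<in> carrier G49" for p
    by (auto simp: G49_coord_def carrier_G49 split: prod.splits)
  have cont_c: "continuous_map euclidean ?T ?c" and cont_d: "continuous_map ?T euclidean ?d"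
    using H by (auto simp: homeomorphic_maps_def)
  have c_meas [measurable]: "?c \<in> lborel \<rightarrow>\<^sub>M borel_sigma ?T"
    unfolding borel_sigma_def
  proof (rule measurable_measure_of)
    fix U :: "((real^3^3) \<times> real) set" assume "U \<in> {U. openin ?T U}"
    then have "openin euclidean {p \<in> topspace euclidean. ?c p \<in> U}"
      using cont_c by (auto simp: continuous_map_def)
    then show "?c -` U \<inter> space lborel \<in> sets lborel"
      by (simp add: vimage_def)
  next
    show "{U. openin ?T U} \<subseteq> Pow (topspace ?T)"
      using openin_subset by blast
    show "?c \<in> space lborel \<rightarrow> topspace ?T"
      using c_in by (simp add: topspace_G49)
  qed
  have d_meas: "?d \<in> borel_sigma ?T \<rightarrow>\<^sub>M borel"
  proof (rule borel_measurableI)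
    fix S :: "(real \<times> real \<times> real \<times> real) set" assume "open S"
    then have "openin ?T {g \<in> topspace ?T. ?d g \<in> S}"
      using cont_d by (auto simp: continuous_map_def)
    then show "?d -` S \<inter> space (borel_sigma ?T) \<in> sets (borel_sigma ?T)"
      by (intro open_in_borel_sigma) (simp add: space_borel_sigma vimage_def Int_def conj_commute)
  qed
  have sets: "sets ?\<mu> = sets (borel_sigma ?T)" by (simp add: G49_haar_def)
  have em: "emeasure ?\<mu> A = emeasure lborel (?c -` A)" if "A \<in> sets ?\<mu>" for A
    using that by (simp add: G49_haar_def emeasure_distr)
  have vim: "?c -` A \<in> sets borel" if "A \<in> sets ?\<mu>" for A
    using measurable_sets[OF c_meas, of A] that by (simp add: sets)
  have img_eq: "?c ` S = ?d -` S \<inter> carrier G49" for S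
  proof (intro equalityI subsetI)
    fix g assume g: "g \<in> ?d -` S \<inter> carrier G49"
    then have "?c (?d g) = g" by (simp add: cd)
    then show "g \<in> ?c ` S" using g by (intro image_eqI[where x = "?d g"]) auto
  qed auto
  have img: "?c ` S \<in> sets ?\<mu>" if "S \<in> sets borel" for S
    using measurable_sets[OF d_meas that] by (simp add: sets img_eq space_borel_sigma topspace_G49)
  have vim_img [simp]: "?c -` (?c ` S) = S" for S
  proof (intro equalityI subsetI)
    fix p assume "p \<in> ?c -` (?c ` S)"
    then obtain q where q: "q \<in> S" "?c p = ?c q" by blast
    have "p = ?d (?c p)" by (rule dc[symmetric])
    also have "\<dots> = q" by (subst q(2)) (rule dc)
    finally show "p \<in> S" using q(1) by (simp only:)
  qed auto
  have img_vim: "?c ` (?c -` A) = A" if "A \<subseteq> carrier G49" for A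
  proof (intro equalityI subsetI)
    fix g assume g: "g \<in> A"
    then have "?c (?d g) = g" using that by (intro cd) (rule subsetD)
    then show "g \<in> ?c ` (?c -` A)" using g by (intro image_eqI[where x = "?d g"] vimageI2) simp_all
  qed auto
  have sub: "A \<subseteq> carrier G49" if "A \<in> sets ?\<mu>" for A
    using sets.sets_into_space[OF that] by (simp add: G49_haar_def space_borel_sigma topspace_G49)
  have op_vim: "open (?c -` U)" if "openin ?T U" for U
    using that cont_c by (auto simp: continuous_map_def vimage_def)
  have op_img: "openin ?T (?c ` U)" if "open U" for U
    using that cont_d by (auto simp: continuous_map_def img_eq topspace_G49 vimage_def Int_def conj_commute)
  have comp_img: "compactin ?T (?c ` K)" if "compact K" for K
    using image_compactin[OF _ cont_c] that by simp
  have comp_vim: "compact (?c -` K)" if K: "compactin ?T K" for K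
  proof -
    have "compactin euclidean (?d ` K)"
      by (rule image_compactin[OF K cont_d])
    moreover have "?d ` K = ?c -` K"
    proof (intro equalityI subsetI)
      fix p assume "p \<in> ?d ` K"
      then obtain g where g: "g \<in> K" "p = ?d g" by blast
      have "g \<in> carrier G49"
        using g(1) compactin_subset_topspace[OF K] by (auto simp: topspace_G49)
      then have "?c p = g" unfolding g(2) by (rule cd)
      then show "p \<in> ?c -` K" using g(1) by (simp only: vimage_eq)
    next
      fix p assume "p \<in> ?c -` K"
      then show "p \<in> ?d ` K" by (intro image_eqI[where x = "?c p"]) simp_all
    qed
    ultimately show ?thesis by simp
  qed
  have comp_sets: "K \<in> sets ?\<mu>" if "compactin ?T K" for K
  proof -
    have "?c -` K \<in> sets borel"
      using comp_vim[OF that] by (intro borel_closed compact_imp_closed)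
    moreover have "K \<subseteq> carrier G49"
      using compactin_subset_topspace[OF that] by (simp only: topspace_G49)
    ultimately show ?thesis
      using img img_vim by metis
  qed
  have op_sets: "U \<in> sets ?\<mu>" if "openin ?T U" for U
    using that by (simp add: sets open_in_borel_sigma)
  show ?thesis
    unfolding left_haar_measure_def
  proof (intro conjI allI ballI impI)
    show "sets ?\<mu> = sets (borel_sigma ?T)" by (rule sets)
    have "carrier G49 \<in> sets ?\<mu>"
      using op_sets[OF openin_topspace] by (simp add: topspace_G49)
    moreover have "?c -` carrier G49 = UNIV" by auto
    ultimately show "emeasure ?\<mu> (carrier G49) \<noteq> 0"
      by (simp add: em emeasure_lborel_UNIV)
  next
    fix K assume K: "compactin ?T K"
    then show "emeasure ?\<mu> K < \<infinity>"
      using emeasure_compact_finite[OF comp_vim[OF K]] by (simp add: em comp_sets)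
  next
    fix A assume A: "A \<in> sets ?\<mu>"
    show "emeasure ?\<mu> A = (INF U\<in>{U. openin ?T U \<and> A \<subseteq> U}. emeasure ?\<mu> U)"
    proof (rule antisym)
      show "emeasure ?\<mu> A \<le> (INF U\<in>{U. openin ?T U \<and> A \<subseteq> U}. emeasure ?\<mu> U)"
        by (intro INF_greatest emeasure_mono) (auto simp: op_sets)
      show "(INF U\<in>{U. openin ?T U \<and> A \<subseteq> U}. emeasure ?\<mu> U) \<le> emeasure ?\<mu> A"
      proof (rule ennreal_le_epsilon)
        fix e :: real assume "0 < e"
        then obtain U where U: "open U" "?c -` A \<subseteq> U" "emeasure lborel (U - ?c -` A) < e"
          using outer_regular_lborel[OF vim[OF A]] by blast
        have "A \<subseteq> ?c ` U"
          using img_vim[OF sub[OF A]] U(2) by blast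
        then have "(INF U\<in>{U. openin ?T U \<and> A \<subseteq> U}. emeasure ?\<mu> U) \<le> emeasure ?\<mu> (?c ` U)"
          using op_img[OF U(1)] by (intro INF_lower) auto
        also have "\<dots> = emeasure lborel (?c -` A \<union> (U - ?c -` A))"
          using op_sets[OF op_img[OF U(1)]] U(2) by (simp add: em Un_absorb1)
        also have "\<dots> \<le> emeasure lborel (?c -` A) + emeasure lborel (U - ?c -` A)"
          using U(1) vim[OF A] by (intro emeasure_subadditive) auto
        also have "\<dots> \<le> emeasure ?\<mu> A + ennreal e"
          using U(3) by (auto simp: em[OF A] intro: add_left_mono less_imp_le)
        finally show "(INF U\<in>{U. openin ?T U \<and> A \<subseteq> U}. emeasure ?\<mu> U) \<le> emeasure ?\<mu> A + ennreal e" .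
      qed
    qed
  next
    fix U assume U: "openin ?T U"
    show "emeasure ?\<mu> U = (SUP K\<in>{K. compactin ?T K \<and> K \<subseteq> U}. emeasure ?\<mu> K)"
    proof (rule antisym)
      show "(SUP K\<in>{K. compactin ?T K \<and> K \<subseteq> U}. emeasure ?\<mu> K) \<le> emeasure ?\<mu> U"
        by (intro SUP_least emeasure_mono) (auto simp: op_sets[OF U])
      obtain C :: "nat \<Rightarrow> (real \<times> real \<times> real \<times> real) set"
        where C: "\<And>n. compact (C n)" "\<And>n. C n \<subseteq> ?c -` U" "\<And>n. C n \<subseteq> interior (C (Suc n))"
          "\<Union> (range C) = ?c -` U"
        using open_Union_compact_subsets[OF op_vim[OF U]] by metis
      have "incseq C"
        by (rule incseq_SucI) (use C(3) interior_subset in blast)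
      then have "emeasure lborel (?c -` U) = (SUP n. emeasure lborel (C n))"
        using C(1) by (subst C(4)[symmetric], intro SUP_emeasure_incseq[symmetric])
          (auto intro: borel_closed compact_imp_closed)
      also have "\<dots> \<le> (SUP K\<in>{K. compactin ?T K \<and> K \<subseteq> U}. emeasure ?\<mu> K)"
      proof (rule SUP_least)
        fix n
        have "emeasure lborel (C n) = emeasure ?\<mu> (?c ` C n)"
          using comp_sets[OF comp_img[OF C(1)]] by (simp add: em)
        also have "\<dots> \<le> (SUP K\<in>{K. compactin ?T K \<and> K \<subseteq> U}. emeasure ?\<mu> K)"
          using C(1,2) comp_img by (intro SUP_upper) blast
        finally show "emeasure lborel (C n) \<le> (SUP K\<in>{K. compactin ?T K \<and> K \<subseteq> U}. emeasure ?\<mu> K)" .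
      qed
      finally show "emeasure ?\<mu> U \<le> (SUP K\<in>{K. compactin ?T K \<and> K \<subseteq> U}. emeasure ?\<mu> K)"
        by (simp add: em op_sets[OF U])
    qed
  next
    fix g A assume g: "g \<in> carrier G49" and A: "A \<in> sets ?\<mu>"
    note Asub = sub[OF A]
    have ig: "inv\<^bsub>G49\<^esub> g \<in> carrier G49" using g by simp
    obtain a b c s where abc: "inv\<^bsub>G49\<^esub> g = (heis a b c, s)"
      using ig by (auto simp: carrier_G49 elim!: heis_cases)
    let ?L = "\<lambda>(x, y, z, t). (a + exp (- s) * x, b + exp s * y, c + z + a * (exp s * y), s + t)"
    have cL: "?c (?L p) = inv\<^bsub>G49\<^esub> g \<otimes>\<^bsub>G49\<^esub> ?c p" for p
      by (cases p) (simp add: G49_coord_def abc G49_mult)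
    have "continuous_on UNIV ?L"
      unfolding case_prod_unfold by (intro continuous_intros)
    then have L [measurable]: "?L \<in> borel_measurable borel"
      by (rule borel_measurable_continuous_onI)
    have mem: "h \<in> g <#\<^bsub>G49\<^esub> A \<longleftrightarrow> inv\<^bsub>G49\<^esub> g \<otimes>\<^bsub>G49\<^esub> h \<in> A" if h: "h \<in> carrier G49" for h
    proof
      assume "h \<in> g <#\<^bsub>G49\<^esub> A"
      then obtain k where "k \<in> A" "h = g \<otimes>\<^bsub>G49\<^esub> k" by (auto simp: l_coset_def)
      then show "inv\<^bsub>G49\<^esub> g \<otimes>\<^bsub>G49\<^esub> h \<in> A"
        using g subsetD[OF Asub] by (simp add: G.m_assoc[symmetric])
    next
      assume "inv\<^bsub>G49\<^esub> g \<otimes>\<^bsub>G49\<^esub> h \<in> A"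
      moreover have "h = g \<otimes>\<^bsub>G49\<^esub> (inv\<^bsub>G49\<^esub> g \<otimes>\<^bsub>G49\<^esub> h)"
        using g h by (simp add: G.m_assoc[symmetric])
      ultimately show "h \<in> g <#\<^bsub>G49\<^esub> A" by (auto simp: l_coset_def)
    qed
    have v: "?c -` (g <#\<^bsub>G49\<^esub> A) = ?L -` (?c -` A)"
    proof (rule Set.set_eqI)
      fix p
      show "p \<in> ?c -` (g <#\<^bsub>G49\<^esub> A) \<longleftrightarrow> p \<in> ?L -` (?c -` A)"
        using mem[OF c_in[of p]] cL[of p] by simp
    qed
    have Lb: "?L -` (?c -` A) \<in> sets borel"
      using measurable_sets[OF L vim[OF A]] by simp
    have "g <#\<^bsub>G49\<^esub> A \<subseteq> carrier G49"
      using g Asub by (auto simp: l_coset_def)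
    then have gA: "g <#\<^bsub>G49\<^esub> A \<in> sets ?\<mu>"
      using img[OF Lb] img_vim[of "g <#\<^bsub>G49\<^esub> A"] by (simp only: v)
    have "emeasure ?\<mu> (g <#\<^bsub>G49\<^esub> A) = emeasure lborel (?L -` (?c -` A))"
      by (simp add: em[OF gA] v)
    also have "\<dots> = emeasure (distr lborel borel ?L) (?c -` A)"
      using vim[OF A] by (simp add: emeasure_distr)
    also have "\<dots> = emeasure ?\<mu> A"
      by (simp add: lborel_G49_translation em[OF A])
    finally show "emeasure ?\<mu> (g <#\<^bsub>G49\<^esub> A) = emeasure ?\<mu> A" .
  qed
qed

end

theory Submission
  imports Defs "HOL-Probability.Characteristic_Functions" "HOL-Probability.Sinc_Integral"
    "HOL-Complex_Analysis.Complex_Analysis" "HOL-Real_Asymp.Real_Asymp"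
begin

text \<open>
  Twisting the Schroedinger representation on \<open>L\<^sup>2(\<real>)\<close> by the characters
  \<open>t \<mapsto> exp (- i \<lambda> t)\<close> gives irreducible representations whose coefficient \<open>\<kappa>\<close> at the Gaussian
  is still bounded for complex \<open>\<lambda>\<close> with \<open>\<bar>Im \<lambda>\<bar> \<le> 1/2\<close>. With \<open>w = exp (\<pi> \<lambda>)\<close> this strip becomes the
  right half plane, and \<open>f\<close> in \<open>L\<^sup>1\<close> has bounded holomorphic coefficients
  \<open>w \<mapsto> \<integral> f(g) \<kappa>\<^sub>w(h g h') dg\<close> there. As for algebras of bounded holomorphic functions, divisibility by
  \<open>exp (- \<tau> w)\<close> for a fixed \<open>\<tau> > 0\<close> defines a proper closed ideal \<open>J\<close> that only lives at infinity.

  Suppose an irreducible representation \<open>\<rho>\<close> kills \<open>J\<close>. By Schur orthogonality there are elements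
  \<open>e\<^sub>\<epsilon>\<close> whose coefficient is a constant times \<open>exp (- \<sigma> \<lambda>\<^sup>2 - \<epsilon> w) \<kappa>\<^sub>w(h) \<kappa>\<^sub>w(h')\<close>. If
  \<open>\<rho>(e\<^sub>\<epsilon>) v \<noteq> 0\<close>, irreducibility yields \<open>b\<close> with \<open>\<rho>(b) \<rho>(e\<^sub>\<epsilon>) v = v\<close>; then
  \<open>e\<^sub>\<epsilon> b e\<^sub>\<epsilon> b \<dots> b e\<^sub>\<epsilon>\<close> acts on \<open>v\<close> as \<open>e\<^sub>\<epsilon>\<close> does, although it lies in \<open>J\<close> once it has at least
  \<open>\<tau>/\<epsilon>\<close> factors \<open>e\<^sub>\<epsilon>\<close>. So \<open>\<rho>\<close> kills every \<open>e\<^sub>\<epsilon>\<close>, hence \<open>e\<^sub>0\<close>, and the closed ideal generated by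
  \<open>e\<^sub>0\<close> and \<open>J\<close> is all of \<open>L\<^sup>1\<close>: dilating \<open>e\<^sub>0\<close> in the directions \<open>z, t\<close>, then multiplying by
  trigonometric functions in \<open>x, y\<close> (conjugation by the Heisenberg group) and dilating in \<open>x, y\<close>
  produces an approximate identity.
\<close>

section \<open>Convolution in coordinates\<close>

text \<open>The width of the strip is forced: the Gaussian coefficient decays like exp (-|t|/2) in
  t, just enough to absorb the growth exp (t Im \<lambda>) of the character for |Im \<lambda>| \<le>
  1/2. Divisibility by exp (- \<tau> w) is a growth condition; it is made linear and closed by
  asking that exp (\<tau> w) / w^2 times the coefficient have integral zero over the line Re w = 1,
  because for a divisible coefficient this line can be pushed to infinity. The role of \<epsilon> >
  0 is that each factor \<open>e\<^sub>\<epsilon>\<close> contributes exp (- \<epsilon> w), so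
  finitely many of them reach exp (- \<tau> w); \<open>e\<^sub>0\<close> is reached only as a limit.
  That limit needs closed kernels, although V carries no topology: exact transitivity of an
  algebraically irreducible representation and the Neumann series supply them. Finally, J contains
  every function whose coefficients vanish, so modulo J only coefficients count. Since the centre
  acts in all of them by the same scalar exp (i z), conjugation by the Heisenberg group becomes
  multiplication by an exponential.\<close>

type_synonym r4 = "real \<times> real \<times> real \<times> real"

text \<open>The group law of \<open>G49\<close> in the chart \<open>G49_coord\<close>, in which left
  Haar measure is \<open>lborel\<close>.\<close>

definition gmul :: "r4 \<Rightarrow> r4 \<Rightarrow> r4" (infixl "\<cdot>" 70) where
  "p \<cdot> q = (case p of (a, b, c, s) \<Rightarrow> case q of (x, y, z, t) \<Rightarrow>
     (a + exp (- s) * x, b + exp s * y, c + z + a * (exp s * y), s + t))"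

definition ginv :: "r4 \<Rightarrow> r4" where
  "ginv = (\<lambda>(a, b, c, s). (- exp s * a, - exp (- s) * b, a * b - c, - s))"

lemma gmul_simp [simp]:
  "(a, b, c, s) \<cdot> (x, y, z, t) = (a + exp (- s) * x, b + exp s * y, c + z + a * (exp s * y), s + t)"
  by (simp add: gmul_def)

lemma ginv_simp [simp]: "ginv (a, b, c, s) = (- exp s * a, - exp (- s) * b, a * b - c, - s)"
  by (simp add: ginv_def)

lemma gmul_assoc: "(p \<cdot> q) \<cdot> r = p \<cdot> (q \<cdot> r)"
  by (cases p; cases q; cases r) (simp add: algebra_simps exp_add exp_minus exp_diff divide_inverse)

lemma gmul_one [simp]: "0 \<cdot> p = p" "p \<cdot> 0 = p"
  by (cases p; simp add: zero_prod_def)+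

lemma gmul_inv [simp]: "p \<cdot> ginv p = 0" "ginv p \<cdot> p = 0"
  by (cases p; simp add: zero_prod_def algebra_simps exp_minus)+

lemma gmul_inv_cancel [simp]: "p \<cdot> (ginv p \<cdot> q) = q" "ginv p \<cdot> (p \<cdot> q) = q"
  by (simp_all add: gmul_assoc[symmetric])

lemma ginv_gmul: "ginv (p \<cdot> q) = ginv q \<cdot> ginv p"
proof -
  have "(p \<cdot> q) \<cdot> (ginv q \<cdot> ginv p) = 0"
    by (simp add: gmul_assoc)
  then show ?thesis
    by (metis gmul_assoc gmul_inv(2) gmul_one)
qed

lemma ginv_zero [simp]: "ginv 0 = 0"
  by (simp add: zero_prod_def)

lemma continuous_gmul [continuous_intros]:
  assumes "continuous_on S f" "continuous_on S g"
  shows "continuous_on S (\<lambda>x. f x \<cdot> g x)"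
  unfolding gmul_def case_prod_unfold by (intro continuous_intros assms)

lemma continuous_ginv [continuous_intros]:
  assumes "continuous_on S f"
  shows "continuous_on S (\<lambda>x. ginv (f x))"
  unfolding ginv_def case_prod_unfold by (intro continuous_intros assms)

lemma measurable_gmul [measurable (raw)]:
  assumes [measurable]: "f \<in> borel_measurable M" "g \<in> borel_measurable M"
  shows "(\<lambda>x. f x \<cdot> g x) \<in> borel_measurable M"
proof -
  have "(\<lambda>p::r4 \<times> r4. fst p \<cdot> snd p) \<in> borel_measurable borel"
    by (intro borel_measurable_continuous_onI continuous_intros)
  then have "(\<lambda>x. (\<lambda>p. fst p \<cdot> snd p) (f x, g x)) \<in> borel_measurable M"
    by (rule measurable_compose[rotated]) simp
  then show ?thesis by simp
qed

lemma measurable_ginv [measurable (raw)]: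
  assumes [measurable]: "f \<in> borel_measurable M"
  shows "(\<lambda>x. ginv (f x)) \<in> borel_measurable M"
proof -
  have "ginv \<in> borel_measurable borel"
    by (intro borel_measurable_continuous_onI continuous_intros)
  then show ?thesis
    by (rule measurable_compose[rotated]) simp
qed

lemma distr_gmul: "distr lborel borel (\<lambda>p. g \<cdot> p) = lborel"
proof -
  obtain a b c s where g: "g = (a, b, c, s)" by (cases g)
  have "(\<lambda>p. g \<cdot> p) = (\<lambda>(x, y, z, t).
     (a + exp (- s) * x, b + exp s * y, c + z + a * (exp s * y), s + t))"
    by (simp add: g gmul_def)
  then show ?thesis
    using lborel_G49_translation[of a s b c] by simp
qed

lemma gmul_measurable1: "(\<lambda>p. g \<cdot> p) \<in> measurable lborel borel"
  by simp

lemma integral_gmul: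
  fixes f :: "r4 \<Rightarrow> 'b::{banach, second_countable_topology}"
  assumes [measurable]: "f \<in> borel_measurable borel"
  shows "(LINT p|lborel. f (g \<cdot> p)) = (LINT p|lborel. f p)"
  by (subst (2) distr_gmul[of g, symmetric], subst integral_distr) auto

lemma integrable_gmul:
  fixes f :: "r4 \<Rightarrow> 'b::{banach, second_countable_topology}"
  assumes f: "integrable lborel f"
  shows "integrable lborel (\<lambda>p. f (g \<cdot> p))"
proof (rule integrable_distr[OF gmul_measurable1])
  show "integrable (distr lborel borel ((\<cdot>) g)) f"
    using f by (simp add: distr_gmul)
qed

text \<open>For \<open>j = id\<close> this is convolution; when \<open>j\<close> is a degenerate dilation, it is a limit of convolutions.\<close>

definition act :: "(r4 \<Rightarrow> r4) \<Rightarrow> (r4 \<Rightarrow> complex) \<Rightarrow> (r4 \<Rightarrow> complex) \<Rightarrow> r4 \<Rightarrow> complex" where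
  "act j W b g = (LINT p|lborel. W p * b (ginv (j p) \<cdot> g))"

section \<open>Superpositions of left translates in L^1\<close>

abbreviation L1norm :: "(r4 \<Rightarrow> complex) \<Rightarrow> real" where
  "L1norm f \<equiv> LINT p|lborel. cmod (f p)"

abbreviation trl :: "r4 \<Rightarrow> (r4 \<Rightarrow> complex) \<Rightarrow> r4 \<Rightarrow> complex" where
  "trl h f \<equiv> (\<lambda>g. f (ginv h \<cdot> g))"

abbreviation conv :: "(r4 \<Rightarrow> complex) \<Rightarrow> (r4 \<Rightarrow> complex) \<Rightarrow> r4 \<Rightarrow> complex" where
  "conv \<equiv> act (\<lambda>p. p)"

lemma L1norm_trl:
  assumes "integrable lborel f" shows "L1norm (trl h f) = L1norm f"
  by (rule integral_gmul[of "\<lambda>p. cmod (f p)"]) (use assms in auto)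

lemma L1norm_nonneg [simp]: "L1norm f \<ge> 0"
  by (rule Bochner_Integration.integral_nonneg) simp

lemma L1norm_triangle:
  assumes "integrable lborel f" "integrable lborel g" "integrable lborel h"
  shows "L1norm (\<lambda>p. f p - h p) \<le> L1norm (\<lambda>p. f p - g p) + L1norm (\<lambda>p. g p - h p)"
proof -
  have "L1norm (\<lambda>p. f p - h p) \<le> (LINT p|lborel. cmod (f p - g p) + cmod (g p - h p))"
    using assms by (intro integral_mono) (auto intro: norm_diff_triangle_le)
  also have "\<dots> = L1norm (\<lambda>p. f p - g p) + L1norm (\<lambda>p. g p - h p)"
    using assms by (intro Bochner_Integration.integral_add) auto
  finally show ?thesis .
qed

lemma L1norm_eq_0_iff:
  assumes "integrable lborel f"
  shows "L1norm f = 0 \<longleftrightarrow> (AE p in lborel. f p = 0)"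
proof -
  have "L1norm f = 0 \<longleftrightarrow> (AE p in lborel. cmod (f p) = 0)"
    using assms by (intro integral_nonneg_eq_0_iff_AE) auto
  then show ?thesis by simp
qed

lemma act_integrable2:
  assumes j [measurable]: "j \<in> borel_measurable borel"
    and W: "integrable lborel W" and b: "integrable lborel b"
  shows "integrable (lborel \<Otimes>\<^sub>M lborel) (\<lambda>(p, g). W p * trl (j p) b g)"
proof -
  have [measurable]: "W \<in> borel_measurable borel" "b \<in> borel_measurable borel"
    using W b by auto
  show ?thesis
  proof (rule lborel_pair.Fubini_integrable)
    have "(LINT g|lborel. norm (case (p, g) of (p, g) \<Rightarrow> W p * trl (j p) b g)) = norm (W p) * L1norm b" for p
      using L1norm_trl[OF b, of "j p"] by (simp add: norm_mult)
    then show "integrable lborel (\<lambda>p. LINT g|lborel. norm (case (p, g) of (p, g) \<Rightarrow> W p * trl (j p) b g))"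
      using W by simp
    show "AE p in lborel. integrable lborel (\<lambda>g. case (p, g) of (p, g) \<Rightarrow> W p * trl (j p) b g)"
      using integrable_gmul[OF b] by simp
  qed (auto simp: case_prod_unfold)
qed

lemma act_integrable:
  assumes "j \<in> borel_measurable borel" "integrable lborel W" "integrable lborel b"
  shows "integrable lborel (act j W b)"
  using lborel_pair.integrable_snd[OF act_integrable2[OF assms]]
  by (simp add: act_def[abs_def])

lemma conv_integrable:
  "integrable lborel f \<Longrightarrow> integrable lborel b \<Longrightarrow> integrable lborel (conv f b)"
  by (rule act_integrable) auto

text \<open>Minkowski's integral inequality for a superposition of translates. The norm bound, the
  Lipschitz estimate and the limit theorem for \<open>act\<close> are all read off from it.\<close>

lemma act_diff_bound:
  assumes "j \<in> borel_measurable borel" "integrable lborel W" "integrable lborel b"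
    and "j' \<in> borel_measurable borel" "integrable lborel W'" "integrable lborel b'"
  shows "integrable lborel (\<lambda>p. L1norm (\<lambda>g. W p * trl (j p) b g - W' p * trl (j' p) b' g))" (is ?A)
    and "L1norm (\<lambda>g. act j W b g - act j' W' b' g)
      \<le> (LINT p|lborel. L1norm (\<lambda>g. W p * trl (j p) b g - W' p * trl (j' p) b' g))" (is ?B)
proof -
  let ?F = "\<lambda>(p, g). W p * trl (j p) b g - W' p * trl (j' p) b' g"
  note I = act_integrable2[OF assms(1-3)] and I' = act_integrable2[OF assms(4-6)]
  have F: "integrable (lborel \<Otimes>\<^sub>M lborel) ?F"
    using Bochner_Integration.integrable_diff[OF I I'] by (simp add: case_prod_unfold)
  show ?A
    using lborel_pair.integrable_fst'[OF integrable_norm[OF F]] by simp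
  \<comment> \<open>A Bochner integral is 0 by default where the slice is not integrable, so the
    difference of the two integrals is the integral of the difference only for those g with both
    slices integrable.\<close>
  have ae: "AE g in lborel. act j W b g - act j' W' b' g = (LINT p|lborel. ?F (p, g))"
    using lborel_pair.AE_integrable_snd[of "\<lambda>p g. W p * trl (j p) b g", OF I]
      lborel_pair.AE_integrable_snd[of "\<lambda>p g. W' p * trl (j' p) b' g", OF I']
    by eventually_elim (simp add: act_def)
  have int1: "integrable lborel (\<lambda>g. LINT p|lborel. ?F (p, g))"
    using lborel_pair.integrable_snd[OF F] by simp
  have int2: "integrable lborel (\<lambda>g. LINT p|lborel. norm (?F (p, g)))"
    using lborel_pair.integrable_snd[of "\<lambda>p g. norm (?F (p, g))"] integrable_norm[OF F]
    by (simp add: case_prod_unfold)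
  have "L1norm (\<lambda>g. act j W b g - act j' W' b' g) = (LINT g|lborel. norm (LINT p|lborel. ?F (p, g)))"
    using ae act_integrable[OF assms(1-3)] act_integrable[OF assms(4-6)] int1
    by (intro integral_cong_AE) (auto elim: eventually_mono)
  also have "\<dots> \<le> (LINT g|lborel. LINT p|lborel. norm (?F (p, g)))"
    using int1 int2 by (intro integral_mono) auto
  also have "\<dots> = (LINT p|lborel. LINT g|lborel. norm (?F (p, g)))"
    using lborel_pair.Fubini_integral[of "\<lambda>p g. norm (?F (p, g))"] integrable_norm[OF F]
    by (simp add: case_prod_unfold)
  finally show ?B by simp
qed

lemma act_norm:
  assumes "j \<in> borel_measurable borel" "integrable lborel W" "integrable lborel b"
  shows "L1norm (act j W b) \<le> L1norm W * L1norm b"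
proof -
  have "L1norm (\<lambda>g. act j W b g - act j W (\<lambda>p. 0) g)
      \<le> (LINT p|lborel. L1norm (\<lambda>g. W p * trl (j p) b g - W p * 0))"
    using act_diff_bound(2)[OF assms assms(1-2), of "\<lambda>p. 0"] by simp
  then show ?thesis
    using L1norm_trl[OF assms(3)] by (simp add: act_def norm_mult)
qed

text \<open>Telescoping W b - W' b' = (W - W') b + W' (b - b') inside the integral, together with
  the invariance of the norm under left translation.\<close>

lemma act_diff:
  assumes "j \<in> borel_measurable borel" "integrable lborel W" "integrable lborel b"
    and "integrable lborel W'" "integrable lborel b'"
  shows "L1norm (\<lambda>g. act j W b g - act j W' b' g)
    \<le> L1norm (\<lambda>p. W p - W' p) * L1norm b + L1norm W' * L1norm (\<lambda>p. b p - b' p)"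
proof -
  note * = act_diff_bound[OF assms(1-3,1,4,5)]
  have d: "integrable lborel (\<lambda>p. b p - b' p)" using assms by simp
  have "L1norm (\<lambda>g. W p * trl (j p) b g - W' p * trl (j p) b' g)
      \<le> cmod (W p - W' p) * L1norm b + cmod (W' p) * L1norm (\<lambda>p. b p - b' p)" for p
  proof -
    have "L1norm (\<lambda>g. W p * trl (j p) b g - W' p * trl (j p) b' g)
      \<le> (LINT g|lborel. cmod (W p - W' p) * cmod (trl (j p) b g)
           + cmod (W' p) * cmod (trl (j p) (\<lambda>p. b p - b' p) g))"
    proof (intro integral_mono)
      fix g
      have "W p * trl (j p) b g - W' p * trl (j p) b' g
          = (W p - W' p) * trl (j p) b g + W' p * trl (j p) (\<lambda>p. b p - b' p) g"
        by (simp add: algebra_simps)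
      then show "cmod (W p * trl (j p) b g - W' p * trl (j p) b' g)
        \<le> cmod (W p - W' p) * cmod (trl (j p) b g) + cmod (W' p) * cmod (trl (j p) (\<lambda>p. b p - b' p) g)"
        by (metis norm_mult norm_triangle_ineq)
    qed (use integrable_gmul[OF assms(3)] integrable_gmul[OF assms(5)] in auto)
    also have "\<dots> = cmod (W p - W' p) * L1norm b + cmod (W' p) * L1norm (\<lambda>p. b p - b' p)"
      using integrable_gmul[OF assms(3)] integrable_gmul[OF d]
        L1norm_trl[OF assms(3), of "j p"] L1norm_trl[OF d, of "j p"]
      by (subst Bochner_Integration.integral_add) auto
    finally show ?thesis .
  qed
  then have "(LINT p|lborel. L1norm (\<lambda>g. W p * trl (j p) b g - W' p * trl (j p) b' g))
      \<le> (LINT p|lborel. cmod (W p - W' p) * L1norm b + cmod (W' p) * L1norm (\<lambda>p. b p - b' p))"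
    using assms *(1) by (intro integral_mono) auto
  also have "\<dots> = L1norm (\<lambda>p. W p - W' p) * L1norm b + L1norm W' * L1norm (\<lambda>p. b p - b' p)"
    using assms by (subst Bochner_Integration.integral_add) auto
  finally show ?thesis using *(2) by linarith
qed

text \<open>Fubini, then the substitution of \<open>j p \<cdot> g\<close> for g. A bounded k
  suffices; the coefficients to be paired with are bounded but not integrable.\<close>

lemma integral_act:
  assumes j [measurable]: "j \<in> borel_measurable borel"
    and W: "integrable lborel W" and b: "integrable lborel b"
    and k [measurable]: "k \<in> borel_measurable borel" and bound: "\<And>g. cmod (k g) \<le> C"
  shows "(LINT g|lborel. act j W b g * k g) = (LINT p|lborel. W p * (LINT g|lborel. b g * k (j p \<cdot> g)))"
    and "integrable lborel (\<lambda>p. W p * (LINT g|lborel. b g * k (j p \<cdot> g)))"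
proof -
  let ?F = "\<lambda>p g. W p * trl (j p) b g * k g"
  have [measurable]: "W \<in> borel_measurable borel" "b \<in> borel_measurable borel"
    using W b by auto
  have C: "C \<ge> 0" using bound[of 0] norm_ge_zero order_trans by blast
  have F: "integrable (lborel \<Otimes>\<^sub>M lborel) (\<lambda>(p, g). ?F p g)"
  proof (rule Bochner_Integration.integrable_bound)
    show "integrable (lborel \<Otimes>\<^sub>M lborel) (\<lambda>x. C * norm (case x of (p, g) \<Rightarrow> W p * trl (j p) b g))"
      using act_integrable2[OF j W b] by (intro integrable_mult_right) auto
    show "AE x in lborel \<Otimes>\<^sub>M lborel. norm (case x of (p, g) \<Rightarrow> ?F p g)
        \<le> norm (C * norm (case x of (p, g) \<Rightarrow> W p * trl (j p) b g))"
    proof (rule AE_I2)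
      fix x :: "r4 \<times> r4"
      obtain p g where x: "x = (p, g)" by (cases x)
      have "cmod (W p * trl (j p) b g) * cmod (k g) \<le> cmod (W p * trl (j p) b g) * C"
        by (intro mult_left_mono bound) simp
      then show "norm (case x of (p, g) \<Rightarrow> ?F p g)
        \<le> norm (C * norm (case x of (p, g) \<Rightarrow> W p * trl (j p) b g))"
        using C by (simp add: x norm_mult mult.commute[of C])
    qed
  qed (simp add: case_prod_unfold)
  have eq: "(LINT g|lborel. ?F p g) = W p * (LINT g|lborel. b g * k (j p \<cdot> g))" for p
    using integral_gmul[of "\<lambda>g. trl (j p) b g * k g" "j p"] by (simp add: mult.assoc)
  have "(LINT g|lborel. act j W b g * k g) = (LINT g|lborel. LINT p|lborel. ?F p g)"
    by (simp add: act_def)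
  also have "\<dots> = (LINT p|lborel. LINT g|lborel. ?F p g)"
    by (rule lborel_pair.Fubini_integral[OF F])
  finally show "(LINT g|lborel. act j W b g * k g) = (LINT p|lborel. W p * (LINT g|lborel. b g * k (j p \<cdot> g)))"
    by (simp only: eq)
  show "integrable lborel (\<lambda>p. W p * (LINT g|lborel. b g * k (j p \<cdot> g)))"
    using lborel_pair.integrable_fst'[OF F] by (simp add: eq)
qed

section \<open>Strong continuity of left translation in L^1\<close>

lemma open_indicator_approx:
  fixes U :: "r4 set"
  assumes U: "open U" and fin: "emeasure lborel U < \<infinity>" and e: "e > 0"
  shows "\<exists>c::r4 \<Rightarrow> complex. continuous_on UNIV c \<and> (\<exists>R. \<forall>x. norm x > R \<longrightarrow> c x = 0) \<and>
    L1norm (\<lambda>p. indicator U p - c p) < e"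
proof -
  \<comment> \<open>The first factor tends to 1 on U because the distance to the complement is
    positive there and is 0 off U; the second one cuts off outside the ball of radius n.\<close>
  define c :: "nat \<Rightarrow> r4 \<Rightarrow> real" where
    "c n x = min 1 (real n * setdist {x} (- U)) * max 0 (min 1 (real n - norm x))" for n x
  have cont: "continuous_on UNIV (c n)" for n
    unfolding c_def by (intro continuous_intros continuous_on_setdist)
  have bd: "0 \<le> c n x \<and> c n x \<le> indicator U x" for n x
  proof (cases "x \<in> U")
    case True
    have "min 1 (real n * setdist {x} (- U)) * max 0 (min 1 (real n - norm x)) \<le> 1 * 1"
      by (intro mult_mono) auto
    then show ?thesis using True by (auto simp: c_def setdist_pos_le)
  next
    case False
    then have "setdist {x} (- U) = 0" by (simp add: setdist_sing_in_set)
    then show ?thesis by (simp add: c_def)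
  qed
  have lim: "(\<lambda>n. c n x) \<longlonglongrightarrow> indicator U x" for x
  proof (cases "x \<in> U")
    case True
    \<comment> \<open>The distance to the empty set is 0 by convention, so U must be seen to differ
      from the whole space; its finite measure shows this.\<close>
    have ne: "- U \<noteq> {}"
      using fin emeasure_lborel_UNIV[where 'a = r4] by (metis Compl_empty_eq double_complement order_less_irrefl infinity_ennreal_def)
    have "eventually (\<lambda>n. c n x = 1) sequentially"
    proof -
      have "setdist {x} (- U) > 0"
        using True ne U by (metis Compl_iff closed_Compl closure_closed order_le_less setdist_eq_0_sing_1 setdist_pos_le)
      then obtain N where N: "real N * setdist {x} (- U) > 1"
        using reals_Archimedean3 by blast
      obtain M :: nat where M: "real M > norm x + 1" using reals_Archimedean2 by blast
      have "c n x = 1" if n: "n \<ge> max N M" for n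
      proof -
        have "real n * setdist {x} (- U) \<ge> real N * setdist {x} (- U)"
          using n by (intro mult_right_mono) (auto simp: setdist_pos_le)
        then have 1: "min 1 (real n * setdist {x} (- U)) = 1" using N by simp
        have "real M \<le> real n" using n by simp
        then have "min 1 (real n - norm x) = 1" using M by linarith
        then show ?thesis using 1 by (simp add: c_def)
      qed
      then show ?thesis by (intro eventually_sequentiallyI[of "max N M"])
    qed
    then show ?thesis using True by (simp add: tendsto_eventually)
  next
    case False
    then have "c n x = 0" for n using bd[of n x] by simp
    then show ?thesis using False by simp
  qed
  have iU: "integrable lborel (indicator U :: r4 \<Rightarrow> real)"
    using U fin by (intro integrable_real_indicator) auto
  have meas [measurable]: "c n \<in> borel_measurable borel" for n
    by (intro borel_measurable_continuous_onI cont)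
  have [measurable]: "U \<in> sets borel" using U by simp
  have "(\<lambda>n. L1norm (\<lambda>p. indicator U p - complex_of_real (c n p))) \<longlonglongrightarrow> (LINT p::r4|lborel. (0::real))"
  proof (rule integral_dominated_convergence[where w = "indicator U"])
    show "AE x in lborel. (\<lambda>n. cmod (indicator U x - complex_of_real (c n x))) \<longlonglongrightarrow> 0"
    proof (rule AE_I2)
      fix x
      have "(\<lambda>n. cmod (complex_of_real (indicator U x) - complex_of_real (c n x))) \<longlonglongrightarrow> cmod (complex_of_real (indicator U x) - complex_of_real (indicator U x))"
        by (intro tendsto_intros lim)
      then show "(\<lambda>n. cmod (indicator U x - complex_of_real (c n x))) \<longlonglongrightarrow> 0"
        by (simp add: of_real_indicator)
    qed
    show "AE x in lborel. norm (cmod (indicator U x - complex_of_real (c n x))) \<le> indicator U x" for n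
    proof (rule AE_I2)
      fix x
      have "indicator U x - complex_of_real (c n x) = complex_of_real (indicator U x - c n x)"
        by (simp add: of_real_indicator)
      then show "norm (cmod (indicator U x - complex_of_real (c n x))) \<le> indicator U x"
        using bd[of n x] by (simp del: of_real_diff)
    qed
  qed (use iU in auto)
  then have "eventually (\<lambda>n. L1norm (\<lambda>p. indicator U p - complex_of_real (c n p)) < e) sequentially"
    using e by (intro order_tendstoD(2)[of _ 0]) auto
  then obtain n where n: "L1norm (\<lambda>p. indicator U p - complex_of_real (c n p)) < e"
    by (auto simp: eventually_sequentially)
  show ?thesis
  proof (intro exI[of _ "\<lambda>p. complex_of_real (c n p)"] conjI n)
    show "continuous_on UNIV (\<lambda>p. complex_of_real (c n p))"
      by (intro continuous_intros cont)
    show "\<exists>R. \<forall>x. norm x > R \<longrightarrow> complex_of_real (c n x) = 0"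
      by (intro exI[of _ "real n"]) (auto simp: c_def)
  qed
qed

lemma tendsto_squeeze_0:
  fixes a u :: "nat \<Rightarrow> real"
  assumes "u \<longlonglongrightarrow> 0" "\<And>n. 0 \<le> a n" "\<And>n. a n \<le> u n"
  shows "a \<longlonglongrightarrow> 0"
  by (rule tendsto_sandwich[OF _ _ tendsto_const assms(1)]) (simp_all add: assms)

definition trl_cont :: "(r4 \<Rightarrow> complex) \<Rightarrow> bool" where
  "trl_cont b \<longleftrightarrow> (\<forall>g h. g \<longlonglongrightarrow> h \<longrightarrow> (\<lambda>n. L1norm (\<lambda>x. trl (g n) b x - trl h b x)) \<longlonglongrightarrow> 0)"

lemma trl_contD:
  "trl_cont b \<Longrightarrow> g \<longlonglongrightarrow> h \<Longrightarrow> (\<lambda>n. L1norm (\<lambda>x. trl (g n) b x - trl h b x)) \<longlonglongrightarrow> 0"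
  by (simp only: trl_cont_def)

lemma trl_cont_compact_support:
  assumes c: "continuous_on UNIV c" and R: "\<And>x. norm x > R \<Longrightarrow> c x = 0"
  shows "trl_cont c" "integrable lborel c"
proof -
  have meas [measurable]: "c \<in> borel_measurable borel"
    by (intro borel_measurable_continuous_onI c)
  obtain B where B: "\<And>x. norm (c x) \<le> B" "B \<ge> 0"
  proof -
    have "bounded (c ` cball 0 R)"
      by (intro compact_imp_bounded compact_continuous_image continuous_on_subset[OF c]) auto
    then obtain B where B: "\<And>x. x \<in> cball 0 R \<Longrightarrow> norm (c x) \<le> B"
      unfolding bounded_iff by fast
    have "norm (c x) \<le> max B 0" for x
      using B[of x] R[of x] by (cases "norm x > R") (simp_all add: le_max_iff_disj)
    then show thesis using that[of "max B 0"] by auto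
  qed
  have icomp: "integrable lborel (\<lambda>x. B * indicator K x)" if "compact K" for K :: "r4 set"
    using that emeasure_compact_finite[OF that]
    by (intro integrable_mult_right integrable_real_indicator) (simp_all add: borel_compact)
  show "integrable lborel c"
  proof (rule Bochner_Integration.integrable_bound[OF icomp[of "cball 0 R"]])
    show "AE x in lborel. norm (c x) \<le> norm (B * indicator (cball 0 R) x)"
      using B R by (auto intro!: AE_I2 split: split_indicator)
  qed auto
  show "trl_cont c"
    unfolding trl_cont_def
  proof (intro allI impI)
    fix g :: "nat \<Rightarrow> r4" and h assume g: "g \<longlonglongrightarrow> h"
    define S where "S = insert h (range g)"
    have S: "compact S" unfolding S_def by (rule compact_sequence_with_limit[OF g])
    \<comment> \<open>All translates by \<open>g n\<close> and by \<open>h\<close> live in one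
      compact set, the product of the compact set of positions with the ball. This gives the
      dominating function.\<close>
    define K where "K = (\<lambda>(p, q). p \<cdot> q) ` (S \<times> cball 0 R)"
    have K: "compact K"
      unfolding K_def case_prod_unfold
      by (intro compact_continuous_image compact_Times S continuous_intros) auto
    have supp: "norm (trl s c x) \<le> B * indicator K x" if s: "s \<in> S" for s x
    proof (cases "norm (ginv s \<cdot> x) > R")
      case True then show ?thesis using R B by auto
    next
      case False
      then have "(\<lambda>(p, q). p \<cdot> q) (s, ginv s \<cdot> x) \<in> K" unfolding K_def using s by (intro imageI) simp
      then show ?thesis using B by simp
    qed
    have "(\<lambda>n. L1norm (\<lambda>x. trl (g n) c x - trl h c x)) \<longlonglongrightarrow> (LINT x::r4|lborel. (0::real))"
    proof (rule integral_dominated_convergence[where w = "\<lambda>x. 2 * (B * indicator K x)"])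
      show "integrable lborel (\<lambda>x. 2 * (B * indicator K x))"
        using icomp[OF K] by (rule integrable_mult_right)
      show "AE x in lborel. (\<lambda>n. cmod (trl (g n) c x - trl h c x)) \<longlonglongrightarrow> 0"
      proof (rule AE_I2)
        fix x
        have "isCont (\<lambda>s. trl s c x) h"
          by (rule continuous_on_interior[of UNIV])
            (auto intro!: continuous_intros continuous_on_compose2[OF c])
        then have "(\<lambda>n. trl (g n) c x) \<longlonglongrightarrow> trl h c x"
          using g by (rule isCont_tendsto_compose)
        then show "(\<lambda>n. cmod (trl (g n) c x - trl h c x)) \<longlonglongrightarrow> 0"
          by (simp add: tendsto_norm_zero_iff LIM_zero_iff)
      qed
      show "AE x in lborel. norm (cmod (trl (g n) c x - trl h c x)) \<le> 2 * (B * indicator K x)" for n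
      proof (rule AE_I2)
        fix x
        have "cmod (trl (g n) c x - trl h c x) \<le> cmod (trl (g n) c x) + cmod (trl h c x)"
          by (rule norm_triangle_ineq4)
        also have "\<dots> \<le> 2 * (B * indicator K x)"
          using supp[of "g n" x] supp[of h x] by (simp add: S_def)
        finally show "norm (cmod (trl (g n) c x - trl h c x)) \<le> 2 * (B * indicator K x)" by simp
      qed
    qed auto
    then show "(\<lambda>n. L1norm (\<lambda>x. trl (g n) c x - trl h c x)) \<longlonglongrightarrow> 0" by simp
  qed
qed

text \<open>Translations are isometries of L^1, so an approximation of b is equally good after any
  translation and three small errors add up.\<close>

lemma trl_cont_approx:
  assumes b: "integrable lborel b"
    and approx: "\<And>e. e > 0 \<Longrightarrow> \<exists>c. integrable lborel c \<and> trl_cont c \<and> L1norm (\<lambda>p. b p - c p) < e"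
  shows "trl_cont b"
  unfolding trl_cont_def
proof (intro allI impI)
  fix g :: "nat \<Rightarrow> r4" and h assume g: "g \<longlonglongrightarrow> h"
  show "(\<lambda>n. L1norm (\<lambda>x. trl (g n) b x - trl h b x)) \<longlonglongrightarrow> 0"
  proof (rule LIMSEQ_I)
    fix e :: real assume e: "e > 0"
    obtain c where c: "integrable lborel c" "trl_cont c" "L1norm (\<lambda>p. b p - c p) < e / 4"
      using approx[of "e / 4"] e by auto
    have d: "integrable lborel (\<lambda>p. b p - c p)" using b c by simp
    have "(\<lambda>n. L1norm (\<lambda>x. trl (g n) c x - trl h c x)) \<longlonglongrightarrow> 0"
      by (rule trl_contD[OF c(2) g])
    then obtain N where N: "\<And>n. n \<ge> N \<Longrightarrow> L1norm (\<lambda>x. trl (g n) c x - trl h c x) < e / 2"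
      using e order_tendstoD(2)[of _ 0 sequentially "e/2"] by (fastforce simp: eventually_sequentially)
    show "\<exists>N. \<forall>n\<ge>N. norm (L1norm (\<lambda>x. trl (g n) b x - trl h b x) - 0) < e"
    proof (intro exI allI impI)
      fix n assume n: "n \<ge> N"
      note I = integrable_gmul[OF b] integrable_gmul[OF c(1)]
      have 1: "L1norm (\<lambda>x. trl k b x - trl k c x) < e / 4" for k
        using L1norm_trl[OF d, of k] c(3) by simp
      then have 2: "L1norm (\<lambda>x. trl k c x - trl k b x) < e / 4" for k
        by (simp add: norm_minus_commute)
      have "L1norm (\<lambda>x. trl (g n) b x - trl h b x) \<le> L1norm (\<lambda>x. trl (g n) b x - trl (g n) c x)
        + (L1norm (\<lambda>x. trl (g n) c x - trl h c x) + L1norm (\<lambda>x. trl h c x - trl h b x))"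
        using L1norm_triangle[OF I(1)[of "ginv (g n)"] I(2)[of "ginv (g n)"] I(1)[of "ginv h"]]
          L1norm_triangle[OF I(2)[of "ginv (g n)"] I(2)[of "ginv h"] I(1)[of "ginv h"]] by linarith
      also have "\<dots> < e" using 1[of "g n"] 2[of h] N[OF n] by linarith
      finally show "norm (L1norm (\<lambda>x. trl (g n) b x - trl h b x) - 0) < e" by simp
    qed
  qed
qed

text \<open>Two approximations: the set by an open set of finite measure, then the open set by a
  continuous function of compact support.\<close>

lemma trl_cont_indicator:
  assumes A: "A \<in> sets lborel" "emeasure lborel A < \<infinity>"
  shows "trl_cont (indicator A)"
proof (rule trl_cont_approx)
  have i: "integrable lborel (indicator S :: r4 \<Rightarrow> complex)" if "S \<in> sets lborel" "emeasure lborel S < \<infinity>" for S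
    using integrable_of_real[OF integrable_real_indicator[OF that]] by (simp add: of_real_indicator)
  show "integrable lborel (indicator A :: r4 \<Rightarrow> complex)" by (rule i[OF A])
  fix e :: real assume e: "e > 0"
  obtain U where U: "open U" "A \<subseteq> U" "emeasure lborel (U - A) < e / 2"
    using outer_regular_lborel[of A "e / 2"] A e by auto
  have Us: "U \<in> sets lborel" using U by simp
  have "emeasure lborel U \<le> emeasure lborel A + emeasure lborel (U - A)"
    using U(2) A Us emeasure_subadditive[of A lborel "U - A"] by (simp add: Un_absorb1)
  then have Uf: "emeasure lborel U < \<infinity>"
    using A(2) U(3) by (smt (verit) ennreal_add_less_top ennreal_less_top infinity_ennreal_def le_less_trans order_less_trans)
  obtain c :: "r4 \<Rightarrow> complex" and R where c: "continuous_on UNIV c" "\<And>x. norm x > R \<Longrightarrow> c x = 0"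
    "L1norm (\<lambda>p. indicator U p - c p) < e / 2"
    using open_indicator_approx[OF U(1) Uf, of "e / 2"] e by auto
  note tc = trl_cont_compact_support[of c R, OF c(1,2)]
  have "L1norm (\<lambda>p. indicator A p - indicator U p) = (LINT p|lborel. indicator (U - A) p)"
    using U(2) by (intro Bochner_Integration.integral_cong) (auto split: split_indicator)
  also have "\<dots> = measure lborel (U - A)" by simp
  also have "\<dots> < e / 2"
  proof -
    have "emeasure lborel (U - A) \<noteq> \<infinity>" using U(3) by auto
    then show ?thesis
      using U(3) e by (simp add: emeasure_eq_ennreal_measure ennreal_less_iff)
  qed
  finally have 1: "L1norm (\<lambda>p. indicator A p - indicator U p) < e / 2" .
  have "L1norm (\<lambda>p. indicator A p - c p) \<le> L1norm (\<lambda>p. indicator A p - indicator U p) + L1norm (\<lambda>p. indicator U p - c p)"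
    by (intro L1norm_triangle i A Us Uf tc)
  then show "\<exists>c. integrable lborel c \<and> trl_cont c \<and> L1norm (\<lambda>p. indicator A p - c p) < e"
    using tc c(3) 1 by (intro exI[of _ c]) auto
qed

lemma trl_cont_add:
  assumes f: "integrable lborel f" "trl_cont f" and g: "integrable lborel g" "trl_cont g"
  shows "trl_cont (\<lambda>x. f x + g x)"
  unfolding trl_cont_def
proof (intro allI impI)
  fix k :: "nat \<Rightarrow> r4" and h assume k: "k \<longlonglongrightarrow> h"
  let ?U = "\<lambda>n. L1norm (\<lambda>x. trl (k n) f x - trl h f x) + L1norm (\<lambda>x. trl (k n) g x - trl h g x)"
  let ?L = "\<lambda>n. L1norm (\<lambda>x. f (ginv (k n) \<cdot> x) + g (ginv (k n) \<cdot> x) - (f (ginv h \<cdot> x) + g (ginv h \<cdot> x)))"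
  note I = integrable_gmul[OF f(1)] integrable_gmul[OF g(1)]
  have lim: "?U \<longlonglongrightarrow> 0 + 0"
    by (intro tendsto_add trl_contD[OF f(2) k] trl_contD[OF g(2) k])
  have "?L n \<le> ?U n" for n
  proof -
    have "?L n \<le> (LINT x|lborel. cmod (trl (k n) f x - trl h f x) + cmod (trl (k n) g x - trl h g x))"
    proof (rule integral_mono)
      fix x
      show "cmod (f (ginv (k n) \<cdot> x) + g (ginv (k n) \<cdot> x) - (f (ginv h \<cdot> x) + g (ginv h \<cdot> x)))
        \<le> cmod (trl (k n) f x - trl h f x) + cmod (trl (k n) g x - trl h g x)"
        by (rule norm_diff_triangle_ineq)
    qed (use I in simp_all)
    also have "\<dots> = ?U n"
      by (rule Bochner_Integration.integral_add) (use I in simp_all)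
    finally show ?thesis .
  qed
  then show "?L \<longlonglongrightarrow> 0"
    using lim by (intro tendsto_sandwich[where f = "\<lambda>_. 0" and g = ?L and h = ?U, OF _ _ tendsto_const]) simp_all
qed

lemma trl_cont_scale:
  assumes "trl_cont f" shows "trl_cont (\<lambda>x. f x * c)"
  unfolding trl_cont_def
proof (intro allI impI)
  fix k :: "nat \<Rightarrow> r4" and h assume k: "k \<longlonglongrightarrow> h"
  have "(\<lambda>n. L1norm (\<lambda>x. trl (k n) f x - trl h f x) * cmod c) \<longlonglongrightarrow> 0 * cmod c"
    by (intro tendsto_mult_right trl_contD[OF assms k])
  then show "(\<lambda>n. L1norm (\<lambda>x. f (ginv (k n) \<cdot> x) * c - f (ginv h \<cdot> x) * c)) \<longlonglongrightarrow> 0"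
    by (simp add: left_diff_distrib[symmetric] norm_mult)
qed

lemma trl_continuous:
  assumes "integrable lborel b" shows "trl_cont b"
  using assms
proof (induction rule: integrable_induct)
  case (base A c)
  have "trl_cont (\<lambda>x. indicator A x * c)"
    by (intro trl_cont_scale trl_cont_indicator base)
  then show ?case by (simp add: scaleR_conv_of_real of_real_indicator)
next
  case (add f g)
  then show ?case by (intro trl_cont_add)
next
  case (lim f s)
  show ?case
  proof (rule trl_cont_approx[OF lim(4)])
    fix e :: real assume e: "e > 0"
    have [measurable]: "f \<in> borel_measurable borel" "s i \<in> borel_measurable borel" for i
      using lim(4) lim(1)[of i] borel_measurable_integrable by force+
    have "(\<lambda>i. L1norm (\<lambda>p. f p - s i p)) \<longlonglongrightarrow> (LINT p::r4|lborel. (0::real))"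
    proof (rule integral_dominated_convergence[where w = "\<lambda>x. 3 * norm (f x)"])
      show "AE x in lborel. (\<lambda>i. cmod (f x - s i x)) \<longlonglongrightarrow> 0"
      proof (rule AE_I2)
        fix x
        have "(\<lambda>i. cmod (f x - s i x)) \<longlonglongrightarrow> cmod (f x - f x)"
          using lim(2)[of x] by (intro tendsto_intros) auto
        then show "(\<lambda>i. cmod (f x - s i x)) \<longlonglongrightarrow> 0" by simp
      qed
      \<comment> \<open>The induction rule provides simple functions with |s i| \<le> 2 |f|, hence
        the factor 3.\<close>
      show "AE x in lborel. norm (cmod (f x - s i x)) \<le> 3 * norm (f x)" for i
      proof (rule AE_I2)
        fix x
        show "norm (cmod (f x - s i x)) \<le> 3 * norm (f x)"
          using lim(3)[of x i] norm_triangle_ineq4[of "f x" "s i x"] by simp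
      qed
    qed (use lim(4) in auto)
    then have "eventually (\<lambda>i. L1norm (\<lambda>p. f p - s i p) < e) sequentially"
      using e by (intro order_tendstoD(2)[of _ 0]) auto
    then obtain i where "L1norm (\<lambda>p. f p - s i p) < e" by (auto simp: eventually_sequentially)
    then show "\<exists>c. integrable lborel c \<and> trl_cont c \<and> L1norm (\<lambda>p. f p - c p) < e"
      using lim(1,5) by blast
  qed
qed

text \<open>Dominated convergence with values in L^1: at each p the integrand tends to 0 because the
  weights converge and translation is continuous, and it is at most 4 D(p) times the norm of b. The
  limit map j' may be degenerate, even constant; this is how elements of the algebra are contracted
  to lower-dimensional supports.\<close>

lemma act_limit:
  assumes j: "\<And>n. j n \<in> borel_measurable borel" "j' \<in> borel_measurable borel"
    and W: "\<And>n. W n \<in> borel_measurable borel" "W' \<in> borel_measurable borel"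
    and D: "integrable lborel D" "\<And>n p. cmod (W n p) \<le> D p"
    and lim: "\<And>p. (\<lambda>n. W n p) \<longlonglongrightarrow> W' p" "\<And>p. (\<lambda>n. j n p) \<longlonglongrightarrow> j' p"
    and b: "integrable lborel b"
  shows "(\<lambda>n. L1norm (\<lambda>g. act (j n) (W n) b g - act j' W' b g)) \<longlonglongrightarrow> 0"
    and "\<And>n. integrable lborel (W n)" and "integrable lborel W'"
proof -
  have [measurable]: "W n \<in> borel_measurable borel" "W' \<in> borel_measurable borel" "b \<in> borel_measurable borel"
      "j n \<in> borel_measurable borel" "j' \<in> borel_measurable borel" for n
    using W b j by auto
  have D': "cmod (W' p) \<le> D p" for p
    by (rule tendsto_upperbound[OF tendsto_norm[OF lim(1)] always_eventually[OF allI[OF D(2)]]]) simp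
  have D0: "0 \<le> D p" for p using D'[of p] norm_ge_zero order_trans by blast
  show W': "integrable lborel W'"
    by (rule Bochner_Integration.integrable_bound[OF D(1)]) (use D' D0 in \<open>simp_all add: AE_I2 del: split_paired_All\<close>)
  show Wn: "integrable lborel (W n)" for n
    by (rule Bochner_Integration.integrable_bound[OF D(1)]) (use D(2) D0 in \<open>simp_all add: AE_I2 del: split_paired_All\<close>)
  let ?H = "\<lambda>n p. L1norm (\<lambda>g. W n p * trl (j n p) b g - W' p * trl (j' p) b g)"
  note bnd = act_diff_bound[OF j(1) Wn b j(2) W' b]
  have I: "integrable lborel (trl h b)" for h by (rule integrable_gmul[OF b])
  have est: "?H n p \<le> cmod (W n p - W' p) * L1norm b + cmod (W' p) * L1norm (\<lambda>g. trl (j n p) b g - trl (j' p) b g)" for n p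
  proof -
    have "?H n p \<le> (LINT g|lborel. cmod (W n p - W' p) * cmod (trl (j n p) b g) + cmod (W' p) * cmod (trl (j n p) b g - trl (j' p) b g))"
    proof (rule integral_mono)
      fix g
      have "W n p * trl (j n p) b g - W' p * trl (j' p) b g
        = (W n p - W' p) * trl (j n p) b g + W' p * (trl (j n p) b g - trl (j' p) b g)"
        by (simp add: algebra_simps)
      then show "cmod (W n p * trl (j n p) b g - W' p * trl (j' p) b g)
        \<le> cmod (W n p - W' p) * cmod (trl (j n p) b g) + cmod (W' p) * cmod (trl (j n p) b g - trl (j' p) b g)"
        by (metis norm_mult norm_triangle_ineq)
    qed (use I in auto)
    also have "\<dots> = cmod (W n p - W' p) * L1norm b + cmod (W' p) * L1norm (\<lambda>g. trl (j n p) b g - trl (j' p) b g)"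
      using I L1norm_trl[OF b, of "j n p"] by (subst Bochner_Integration.integral_add) auto
    finally show ?thesis .
  qed
  have "(\<lambda>n. LINT p|lborel. ?H n p) \<longlonglongrightarrow> (LINT p::r4|lborel. (0::real))"
  proof (rule integral_dominated_convergence[where w = "\<lambda>p. 2 * D p * L1norm b + D p * (2 * L1norm b)"])
    show "AE p in lborel. (\<lambda>n. ?H n p) \<longlonglongrightarrow> 0"
    proof (rule AE_I2)
      fix p
      let ?U = "\<lambda>n. cmod (W n p - W' p) * L1norm b + cmod (W' p) * L1norm (\<lambda>g. trl (j n p) b g - trl (j' p) b g)"
      have "?U \<longlonglongrightarrow> cmod (W' p - W' p) * L1norm b + cmod (W' p) * 0"
        by (intro tendsto_intros lim trl_contD[OF trl_continuous[OF b]])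
      then show "(\<lambda>n. ?H n p) \<longlonglongrightarrow> 0"
        using est[of _ p]
        by (intro tendsto_sandwich[where f = "\<lambda>_. 0" and g = "\<lambda>n. ?H n p" and h = ?U, OF _ _ tendsto_const]) simp_all
    qed
    show "AE p in lborel. norm (?H n p) \<le> 2 * D p * L1norm b + D p * (2 * L1norm b)" for n
    proof (rule AE_I2)
      fix p
      have 1: "cmod (W n p - W' p) \<le> 2 * D p"
        using norm_triangle_ineq4[of "W n p" "W' p"] D(2)[of n p] D'[of p] by linarith
      have 2: "L1norm (\<lambda>g. trl (j n p) b g - trl (j' p) b g) \<le> 2 * L1norm b"
      proof -
        have "L1norm (\<lambda>g. trl (j n p) b g - trl (j' p) b g) \<le> (LINT g|lborel. cmod (trl (j n p) b g) + cmod (trl (j' p) b g))"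
          using I by (intro integral_mono) (auto intro: norm_triangle_ineq4)
        also have "\<dots> = 2 * L1norm b"
          using I L1norm_trl[OF b] by (subst Bochner_Integration.integral_add) auto
        finally show ?thesis .
      qed
      have "?H n p \<le> 2 * D p * L1norm b + D p * (2 * L1norm b)"
        by (rule order_trans[OF est]) (intro add_mono mult_mono 1 2 D' D0 L1norm_nonneg, auto simp: D0)
      then show "norm (?H n p) \<le> 2 * D p * L1norm b + D p * (2 * L1norm b)" by simp
    qed
    show "(\<lambda>p. ?H n p) \<in> borel_measurable lborel" for n
      by (rule borel_measurable_integrable[OF bnd(1)])
    show "integrable lborel (\<lambda>p. 2 * D p * L1norm b + D p * (2 * L1norm b))"
      by (intro Bochner_Integration.integrable_add integrable_mult_left integrable_mult_right D(1))
  qed simp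
  then have *: "(\<lambda>n. LINT p|lborel. ?H n p) \<longlonglongrightarrow> 0" by simp
  show "(\<lambda>n. L1norm (\<lambda>g. act (j n) (W n) b g - act j' W' b g)) \<longlonglongrightarrow> 0"
    by (rule tendsto_squeeze_0[OF * L1norm_nonneg bnd(2)])
qed

section \<open>Ideals and representations of the group algebra\<close>

abbreviation L1alg :: "((real^3^3) \<times> real \<Rightarrow> complex) set normed_alg" where
  "L1alg \<equiv> L1 G49 G49_haar"

text \<open>\<open>cls\<close> and \<open>repr\<close> pass between functions in coordinates and
  classes of functions on the matrix group. \<open>repr\<close> inherits an arbitrary choice, so it
  is controlled only up to null sets.\<close>

definition cls :: "(r4 \<Rightarrow> complex) \<Rightarrow> ((real^3^3) \<times> real \<Rightarrow> complex) set" where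
  "cls f = l1_class G49_haar (f \<circ> G49_coord_inv)"

definition repr :: "((real^3^3) \<times> real \<Rightarrow> complex) set \<Rightarrow> r4 \<Rightarrow> complex" where
  "repr F = l1_rep F \<circ> G49_coord"

lemma coord_inv_coord [simp]: "G49_coord_inv (G49_coord p) = p"
  by (auto simp: G49_coord_def G49_coord_inv_def split: prod.splits)

lemma coord_coord_inv: "g \<in> carrier G49 \<Longrightarrow> G49_coord (G49_coord_inv g) = g"
  by (auto simp: G49_coord_def G49_coord_inv_def carrier_G49 elim!: heis_cases)

lemma coord_carrier [simp]: "G49_coord p \<in> carrier G49"
  by (auto simp: G49_coord_def carrier_G49 split: prod.splits)

lemma coord_measurable: "G49_coord \<in> measurable lborel (borel_sigma G49_topology)"
  unfolding borel_sigma_def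
proof (rule measurable_measure_of)
  fix U :: "((real^3^3) \<times> real) set" assume "U \<in> {U. openin G49_topology U}"
  then have "openin euclidean {p \<in> topspace euclidean. G49_coord p \<in> U}"
    using G49_coord_homeo by (auto simp: homeomorphic_maps_def continuous_map_def)
  then show "G49_coord -` U \<inter> space lborel \<in> sets lborel"
    by (simp add: vimage_def)
next
  show "{U. openin G49_topology U} \<subseteq> Pow (topspace G49_topology)"
    using openin_subset by blast
  show "G49_coord \<in> space lborel \<rightarrow> topspace G49_topology"
    using coord_carrier by (simp add: topspace_G49)
qed

lemma coord_inv_measurable: "G49_coord_inv \<in> measurable G49_haar borel"
proof (rule borel_measurableI)
  fix S :: "r4 set" assume "open S"
  then have "openin G49_topology {g \<in> topspace G49_topology. G49_coord_inv g \<in> S}"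
    using G49_coord_homeo by (auto simp: homeomorphic_maps_def continuous_map_def)
  then have "{g \<in> topspace G49_topology. G49_coord_inv g \<in> S} \<in> sets (borel_sigma G49_topology)"
    by (rule open_in_borel_sigma)
  moreover have "{g \<in> topspace G49_topology. G49_coord_inv g \<in> S} = G49_coord_inv -` S \<inter> space G49_haar"
    by (auto simp: G49_haar_def space_borel_sigma)
  ultimately show "G49_coord_inv -` S \<inter> space G49_haar \<in> sets G49_haar"
    by (simp add: G49_haar_def)
qed

lemma space_haar: "space G49_haar = carrier G49"
  by (simp add: G49_haar_def space_borel_sigma topspace_G49)

lemma lborel_eq_distr_haar: "lborel = distr G49_haar borel G49_coord_inv"
proof -
  have "distr G49_haar borel G49_coord_inv = distr lborel borel (G49_coord_inv \<circ> G49_coord)"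
    unfolding G49_haar_def using coord_inv_measurable
    by (intro distr_distr[OF _ coord_measurable]) (simp add: G49_haar_def)
  also have "\<dots> = lborel"
    by (simp add: comp_def distr_id2)
  finally show ?thesis ..
qed

lemma haar_integrable_coord: "integrable G49_haar F \<Longrightarrow> integrable lborel (F \<circ> G49_coord)"
  for F :: "_ \<Rightarrow> complex"
  unfolding G49_haar_def comp_def by (rule integrable_distr[OF coord_measurable])

lemma integrable_coord_inv: "integrable lborel f \<Longrightarrow> integrable G49_haar (f \<circ> G49_coord_inv)"
  for f :: "_ \<Rightarrow> complex"
  unfolding comp_def by (rule integrable_distr[OF coord_inv_measurable]) (simp add: lborel_eq_distr_haar[symmetric])

lemma haar_integral:
  fixes F :: "_ \<Rightarrow> 'b::{banach, second_countable_topology}"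
  assumes "F \<in> borel_measurable G49_haar"
  shows "integral\<^sup>L G49_haar F = (LINT p|lborel. F (G49_coord p))"
  using assms unfolding G49_haar_def by (intro integral_distr coord_measurable) auto

lemma AE_haar_coord: "AE g in G49_haar. P g \<Longrightarrow> AE p in lborel. P (G49_coord p)"
  unfolding G49_haar_def by (rule AE_distrD[OF coord_measurable])

lemma AE_coord_inv_haar: "AE p in lborel. P p \<Longrightarrow> AE g in G49_haar. P (G49_coord_inv g)"
  using AE_distrD[OF coord_inv_measurable] lborel_eq_distr_haar by metis

lemma l1_rel_iff: "(F, H) \<in> l1_rel G49_haar \<longleftrightarrow>
    integrable G49_haar F \<and> integrable G49_haar H \<and> (AE x in G49_haar. F x = H x)"
  by (simp add: l1_rel_def)

lemma l1_class_eq: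
  assumes "(F, H) \<in> l1_rel G49_haar" shows "l1_class G49_haar F = l1_class G49_haar H"
proof -
  have ae: "AE x in G49_haar. F x = H x" and i: "integrable G49_haar F" "integrable G49_haar H"
    using assms by (auto simp: l1_rel_iff)
  have "(AE x in G49_haar. F x = K x) \<longleftrightarrow> (AE x in G49_haar. H x = K x)" for K
    using ae by (auto elim: eventually_elim2)
  then show ?thesis
    using i by (auto simp: l1_class_def l1_rel_iff)
qed

lemma l1_class_cls:
  assumes F: "integrable G49_haar F"
  shows "l1_class G49_haar F = cls (F \<circ> G49_coord)"
proof -
  have "AE x in G49_haar. F x = (F \<circ> G49_coord \<circ> G49_coord_inv) x"
    by (rule AE_I2) (simp add: space_haar coord_coord_inv)
  then show ?thesis
    unfolding cls_def
    using F integrable_coord_inv[OF haar_integrable_coord[OF F]] by (intro l1_class_eq) (auto simp: l1_rel_iff)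
qed

lemma carrier_L1: "carrier L1alg = {f. integrable G49_haar f} // l1_rel G49_haar"
  by (simp add: L1_def)

lemma cls_carrier: "integrable lborel f \<Longrightarrow> cls f \<in> carrier L1alg"
  unfolding carrier_L1 cls_def l1_class_def by (intro quotientI) (simp add: integrable_coord_inv)

lemma cls_eq:
  assumes "integrable lborel f" "integrable lborel g" "AE p in lborel. f p = g p"
  shows "cls f = cls g"
  unfolding cls_def using assms AE_coord_inv_haar[OF assms(3)]
  by (intro l1_class_eq) (auto simp: l1_rel_iff integrable_coord_inv)

lemma repr_props:
  assumes "F \<in> carrier L1alg"
  shows "integrable G49_haar (l1_rep F)" "integrable lborel (repr F)" "cls (repr F) = F"
proof -
  obtain f where f: "integrable G49_haar f" "F = l1_class G49_haar f"
    using assms by (auto simp: carrier_L1 quotient_def l1_class_def)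
  have "f \<in> F" using f by (auto simp: l1_class_def l1_rel_iff)
  then have "l1_rep F \<in> F" unfolding l1_rep_def by (rule someI[of "\<lambda>f. f \<in> F"])
  then have r: "(f, l1_rep F) \<in> l1_rel G49_haar" using f by (auto simp: l1_class_def)
  then show i: "integrable G49_haar (l1_rep F)" by (auto simp: l1_rel_iff)
  then show "integrable lborel (repr F)" unfolding repr_def by (rule haar_integrable_coord)
  show "cls (repr F) = F"
    unfolding repr_def l1_class_cls[OF i, symmetric] using l1_class_eq[OF r] f(2) by simp
qed

lemma repr_cls:
  assumes f: "integrable lborel f"
  shows "AE p in lborel. repr (cls f) p = f p"
proof -
  have "f \<circ> G49_coord_inv \<in> cls f"
    using integrable_coord_inv[OF f] by (auto simp: cls_def l1_class_def l1_rel_iff)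
  then have "l1_rep (cls f) \<in> cls f" unfolding l1_rep_def by (rule someI[of "\<lambda>h. h \<in> cls f"])
  then have "AE g in G49_haar. (f \<circ> G49_coord_inv) g = l1_rep (cls f) g"
    by (auto simp: cls_def l1_class_def l1_rel_iff)
  from AE_haar_coord[OF this] show ?thesis
    by eventually_elim (simp add: repr_def)
qed

lemma cls_eq_iff:
  assumes f: "integrable lborel f" and g: "integrable lborel g"
  shows "cls f = cls g \<longleftrightarrow> (AE p in lborel. f p = g p)"
proof
  assume *: "cls f = cls g"
  show "AE p in lborel. f p = g p"
    using repr_cls[OF f] repr_cls[OF g] unfolding * by eventually_elim simp
qed (rule cls_eq[OF assms])

lemma convolution_eq:
  assumes F: "integrable G49_haar F" and H: "integrable G49_haar H"
  shows "integrable G49_haar (Defs.convolution G49 G49_haar F H)"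
    and "cls (Defs.convolution G49 G49_haar F H \<circ> G49_coord) = cls (conv (F \<circ> G49_coord) (H \<circ> G49_coord))"
proof -
  interpret G: group G49 by (rule group_G49)
  have m: "G49_coord (p \<cdot> q) = G49_coord p \<otimes>\<^bsub>G49\<^esub> G49_coord q" for p q
    by (cases p; cases q) (simp add: G49_coord_def G49_mult)
  have i: "G49_coord (ginv p) = inv\<^bsub>G49\<^esub> (G49_coord p)" for p
    by (cases p) (simp add: G49_coord_def G49_inv)
  have eq: "Defs.convolution G49 G49_haar F H (G49_coord g) = conv (F \<circ> G49_coord) (H \<circ> G49_coord) g" for g
  proof -
    have H': "H \<in> borel_measurable G49_haar" and F': "F \<in> borel_measurable G49_haar"
      using F H by auto
    have cm: "G49_coord \<in> borel \<rightarrow>\<^sub>M G49_haar"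
      using coord_measurable by (simp add: G49_haar_def cong: measurable_cong_sets)
    \<comment> \<open>Measurability is shown for the expression in coordinates, where the group
      operations are continuous; on the carrier it agrees with the expression in matrices.\<close>
    have "(\<lambda>x. H (G49_coord (ginv (G49_coord_inv x) \<cdot> g))) \<in> borel_measurable G49_haar"
      by (rule measurable_compose[OF _ H'], rule measurable_compose[OF _ cm],
          intro measurable_gmul measurable_ginv coord_inv_measurable) simp
    then have "(\<lambda>x. F x * H (G49_coord (ginv (G49_coord_inv x) \<cdot> g))) \<in> borel_measurable G49_haar"
      using F' by (rule borel_measurable_times[rotated])
    moreover have "F x * H (G49_coord (ginv (G49_coord_inv x) \<cdot> g)) = F x * H (inv\<^bsub>G49\<^esub> x \<otimes>\<^bsub>G49\<^esub> G49_coord g)"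
      if "x \<in> space G49_haar" for x
      using that by (simp add: m i space_haar coord_coord_inv)
    ultimately have "(\<lambda>x. F x * H (inv\<^bsub>G49\<^esub> x \<otimes>\<^bsub>G49\<^esub> G49_coord g)) \<in> borel_measurable G49_haar"
      by (simp cong: measurable_cong)
    from haar_integral[OF this] show ?thesis
      by (simp add: Defs.convolution_def act_def m i)
  qed
  have c: "integrable lborel (conv (F \<circ> G49_coord) (H \<circ> G49_coord))"
    by (intro conv_integrable haar_integrable_coord F H)
  have "integrable G49_haar (conv (F \<circ> G49_coord) (H \<circ> G49_coord) \<circ> G49_coord_inv)"
    by (rule integrable_coord_inv[OF c])
  moreover have "(conv (F \<circ> G49_coord) (H \<circ> G49_coord) \<circ> G49_coord_inv) x
      = Defs.convolution G49 G49_haar F H x" if "x \<in> space G49_haar" for x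
    using that by (simp add: eq[symmetric] space_haar coord_coord_inv)
  ultimately show "integrable G49_haar (Defs.convolution G49 G49_haar F H)"
    by (simp cong: Bochner_Integration.integrable_cong)
  have "Defs.convolution G49 G49_haar F H \<circ> G49_coord = conv (F \<circ> G49_coord) (H \<circ> G49_coord)"
    by (rule ext) (simp add: eq)
  then show "cls (Defs.convolution G49 G49_haar F H \<circ> G49_coord) = cls (conv (F \<circ> G49_coord) (H \<circ> G49_coord))"
    by simp
qed

text \<open>The product of the algebra convolves chosen representatives. By \<open>act_diff\<close>,
  replacing them by functions equal almost everywhere moves the convolution by L^1 distance
  0.\<close>

lemma L1_mult:
  assumes f: "integrable lborel f" and g: "integrable lborel g"
  shows "cls f \<otimes>\<^bsub>L1alg\<^esub> cls g = cls (conv f g)"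
proof -
  note F = repr_props[OF cls_carrier[OF f]] and G = repr_props[OF cls_carrier[OF g]]
  have "cls f \<otimes>\<^bsub>L1alg\<^esub> cls g = cls (conv (repr (cls f)) (repr (cls g)))"
    using convolution_eq[OF F(1) G(1)] by (simp add: L1_def l1_class_cls repr_def)
  also have "\<dots> = cls (conv f g)"
  proof (intro cls_eq conv_integrable F G f g)
    have "L1norm (\<lambda>p. repr (cls f) p - f p) = 0" "L1norm (\<lambda>p. repr (cls g) p - g p) = 0"
      using repr_cls[OF f] repr_cls[OF g] F(2) G(2) f g
      by (auto simp: L1norm_eq_0_iff elim: eventually_mono)
    then have "L1norm (\<lambda>p. conv (repr (cls f)) (repr (cls g)) p - conv f g p) \<le> 0"
      using act_diff[of "\<lambda>p. p" "repr (cls f)" "repr (cls g)" f g] F(2) G(2) f g by simp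
    then have "L1norm (\<lambda>p. conv (repr (cls f)) (repr (cls g)) p - conv f g p) = 0"
      using L1norm_nonneg by (intro antisym)
    then have "AE p in lborel. conv (repr (cls f)) (repr (cls g)) p - conv f g p = 0"
      using conv_integrable[OF F(2) G(2)] conv_integrable[OF f g] by (subst (asm) L1norm_eq_0_iff) auto
    then show "AE p in lborel. conv (repr (cls f)) (repr (cls g)) p = conv f g p" by simp
  qed
  finally show ?thesis .
qed

lemma L1_add:
  assumes f: "integrable lborel f" and g: "integrable lborel g"
  shows "cls f \<oplus>\<^bsub>L1alg\<^esub> cls g = cls (\<lambda>p. f p + g p)"
proof -
  note F = repr_props[OF cls_carrier[OF f]] and G = repr_props[OF cls_carrier[OF g]]
  have "cls f \<oplus>\<^bsub>L1alg\<^esub> cls g = cls (\<lambda>p. repr (cls f) p + repr (cls g) p)"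
    using F(1) G(1) by (simp add: L1_def l1_class_cls repr_def comp_def)
  also have "\<dots> = cls (\<lambda>p. f p + g p)"
    using F(2) G(2) f g repr_cls[OF f] repr_cls[OF g] by (intro cls_eq) (auto elim: eventually_elim2)
  finally show ?thesis .
qed

lemma L1_smult:
  assumes f: "integrable lborel f"
  shows "c \<odot>\<^bsub>L1alg\<^esub> cls f = cls (\<lambda>p. c * f p)"
proof -
  note F = repr_props[OF cls_carrier[OF f]]
  have "c \<odot>\<^bsub>L1alg\<^esub> cls f = cls (\<lambda>p. c * repr (cls f) p)"
    using F(1) by (simp add: L1_def l1_class_cls repr_def comp_def)
  also have "\<dots> = cls (\<lambda>p. c * f p)"
    using F(2) f repr_cls[OF f] by (intro cls_eq) (auto elim: eventually_mono)
  finally show ?thesis .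
qed

lemma L1_zero: "\<zero>\<^bsub>L1alg\<^esub> = cls (\<lambda>p. 0)"
  by (simp add: L1_def cls_def comp_def)

lemma L1_norm:
  assumes f: "integrable lborel f"
  shows "alg_norm L1alg (cls f) = L1norm f"
proof -
  note F = repr_props[OF cls_carrier[OF f]]
  have "alg_norm L1alg (cls f) = L1norm (repr (cls f))"
    using F(1) by (simp add: L1_def haar_integral repr_def)
  also have "\<dots> = L1norm f"
    using F(2) f repr_cls[OF f] by (intro integral_cong_AE) (auto elim: eventually_mono)
  finally show ?thesis .
qed

lemma L1_carrierE:
  assumes "F \<in> carrier L1alg"
  obtains f where "integrable lborel f" "F = cls f"
  using repr_props[OF assms] that by metis

lemma L1_inv:
  assumes f: "integrable lborel f"
  shows "m_inv (add_monoid L1alg) (cls f) = cls (\<lambda>p. - f p)"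
  unfolding m_inv_def
proof (rule the_equality, goal_cases)
  case 1
  have nf: "integrable lborel (\<lambda>p. - f p)" using f by simp
  show ?case
    using cls_carrier[OF nf] L1_add[OF f nf] L1_add[OF nf f] by (simp add: L1_zero)
next
  case (2 y)
  then obtain g where g: "integrable lborel g" "y = cls g" by (auto elim: L1_carrierE)
  have "cls (\<lambda>p. f p + g p) = cls (\<lambda>p. 0)"
    using 2 g by (simp add: L1_add[OF f g(1)] L1_zero)
  then have "AE p in lborel. f p + g p = 0"
    using f g by (subst (asm) cls_eq_iff) auto
  then have "AE p in lborel. g p = - f p"
    by eventually_elim (simp add: eq_neg_iff_add_eq_0 add.commute)
  then show ?case using f g by (simp add: cls_eq_iff)
qed

lemma L1_minus:
  assumes f: "integrable lborel f" and g: "integrable lborel g"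
  shows "cls f \<ominus>\<^bsub>L1alg\<^esub> cls g = cls (\<lambda>p. f p - g p)"
proof -
  have ng: "integrable lborel (\<lambda>p. - g p)" using g by simp
  show ?thesis
    using L1_add[OF f ng] L1_inv[OF g] by (simp add: a_minus_def a_inv_def)
qed

section \<open>Representations and closed ideals on the level of functions\<close>

text \<open>An irreducible representation of \<open>L1alg\<close> pulled back along
  \<open>cls\<close>, so that later arguments can handle functions; \<open>cong_AE\<close> keeps the
  information that it came from classes. V carries no norm and no continuity is assumed.\<close>

locale L1_representation = V: Module.module complex_ring V
  for V :: "(complex, 'v) module" and \<rho> :: "(r4 \<Rightarrow> complex) \<Rightarrow> 'v \<Rightarrow> 'v" +
  assumes closed: "\<lbrakk>integrable lborel f; v \<in> carrier V\<rbrakk> \<Longrightarrow> \<rho> f v \<in> carrier V"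
    and add_vec: "\<lbrakk>integrable lborel f; v \<in> carrier V; w \<in> carrier V\<rbrakk>
      \<Longrightarrow> \<rho> f (v \<oplus>\<^bsub>V\<^esub> w) = \<rho> f v \<oplus>\<^bsub>V\<^esub> \<rho> f w"
    and smult_vec: "\<lbrakk>integrable lborel f; v \<in> carrier V\<rbrakk> \<Longrightarrow> \<rho> f (c \<odot>\<^bsub>V\<^esub> v) = c \<odot>\<^bsub>V\<^esub> \<rho> f v"
    and add_fun: "\<lbrakk>integrable lborel f; integrable lborel g; v \<in> carrier V\<rbrakk>
      \<Longrightarrow> \<rho> (\<lambda>p. f p + g p) v = \<rho> f v \<oplus>\<^bsub>V\<^esub> \<rho> g v"
    and smult_fun: "\<lbrakk>integrable lborel f; v \<in> carrier V\<rbrakk> \<Longrightarrow> \<rho> (\<lambda>p. c * f p) v = c \<odot>\<^bsub>V\<^esub> \<rho> f v"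
    and conv_fun: "\<lbrakk>integrable lborel f; integrable lborel g; v \<in> carrier V\<rbrakk>
      \<Longrightarrow> \<rho> (conv f g) v = \<rho> f (\<rho> g v)"
    and cong_AE: "\<lbrakk>integrable lborel f; integrable lborel g; AE p in lborel. f p = g p\<rbrakk> \<Longrightarrow> \<rho> f = \<rho> g"
    and nontriv: "\<exists>f v. integrable lborel f \<and> v \<in> carrier V \<and> \<rho> f v \<noteq> \<zero>\<^bsub>V\<^esub>"
    and irred: "\<lbrakk>submodule W complex_ring V; \<And>f w. \<lbrakk>integrable lborel f; w \<in> W\<rbrakk> \<Longrightarrow> \<rho> f w \<in> W\<rbrakk>
      \<Longrightarrow> W = {\<zero>\<^bsub>V\<^esub>} \<or> W = carrier V"

lemma L1_representation_cls:
  assumes "irreducible_representation L1alg V \<pi>"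
  shows "L1_representation V (\<lambda>f. \<pi> (cls f))"
proof -
  interpret irreducible_representation L1alg V \<pi> by (rule assms)
  show ?thesis
  proof
    show "\<exists>f v. integrable lborel f \<and> v \<in> carrier V \<and> \<pi> (cls f) v \<noteq> \<zero>\<^bsub>V\<^esub>"
      using nontrivial by (metis L1_carrierE)
    show "W = {\<zero>\<^bsub>V\<^esub>} \<or> W = carrier V" if "submodule W complex_ring V"
      and "\<And>f w. \<lbrakk>integrable lborel f; w \<in> W\<rbrakk> \<Longrightarrow> \<pi> (cls f) w \<in> W" for W
      using that by (intro irreducible) (auto elim!: L1_carrierE)
    show "\<pi> (cls f) = \<pi> (cls g)" if "integrable lborel f" "integrable lborel g" "AE p in lborel. f p = g p" for f g
      using cls_eq[OF that] by simp
  qed (simp_all add: cls_carrier rep_closed rep_add rep_smult L1_add[symmetric] L1_smult[symmetric]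
      L1_mult[symmetric] alg_add alg_smult alg_mult)
qed

text \<open>The closure condition also makes J stable under equality almost everywhere, because such
  functions have distance 0. Hence a function outside J still has its class outside the image of
  J.\<close>

definition L1_ideal :: "(r4 \<Rightarrow> complex) set \<Rightarrow> bool" where
  "L1_ideal J \<longleftrightarrow> (\<forall>f\<in>J. integrable lborel f) \<and> (\<lambda>p. 0) \<in> J \<and>
     (\<forall>f\<in>J. \<forall>g\<in>J. (\<lambda>p. f p + g p) \<in> J) \<and> (\<forall>f\<in>J. \<forall>c. (\<lambda>p. c * f p) \<in> J) \<and>
     (\<forall>f\<in>J. \<forall>g. integrable lborel g \<longrightarrow> conv f g \<in> J \<and> conv g f \<in> J) \<and>
     (\<forall>f. integrable lborel f \<and> (\<forall>e>0. \<exists>g\<in>J. L1norm (\<lambda>p. f p - g p) < e) \<longrightarrow> f \<in> J)"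

lemma L1_idealD:
  assumes "L1_ideal J"
  shows "f \<in> J \<Longrightarrow> integrable lborel f" "(\<lambda>p. 0) \<in> J"
    "f \<in> J \<Longrightarrow> g \<in> J \<Longrightarrow> (\<lambda>p. f p + g p) \<in> J" "f \<in> J \<Longrightarrow> (\<lambda>p. c * f p) \<in> J"
    "f \<in> J \<Longrightarrow> integrable lborel g \<Longrightarrow> conv f g \<in> J" "f \<in> J \<Longrightarrow> integrable lborel g \<Longrightarrow> conv g f \<in> J"
    "integrable lborel f \<Longrightarrow> (\<And>e. e > 0 \<Longrightarrow> \<exists>g\<in>J. L1norm (\<lambda>p. f p - g p) < e) \<Longrightarrow> f \<in> J"
  using assms unfolding L1_ideal_def by blast+

lemma closed_ideal_cls:
  assumes J: "L1_ideal J"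
  shows "closed_ideal L1alg (cls ` J)"
  unfolding closed_ideal_def
proof (intro conjI ballI impI)
  note D = L1_idealD[OF J]
  show "submodule (cls ` J) complex_ring L1alg"
  proof (intro submodule.intro subgroup.intro submodule_axioms.intro)
    show "cls ` J \<subseteq> carrier (add_monoid L1alg)" using D(1) by (auto intro: cls_carrier)
    show "x \<otimes>\<^bsub>add_monoid L1alg\<^esub> y \<in> cls ` J" if "x \<in> cls ` J" "y \<in> cls ` J" for x y
      using that D(1,3) by (auto simp: L1_add)
    show "\<one>\<^bsub>add_monoid L1alg\<^esub> \<in> cls ` J" using D(2) by (simp add: L1_zero)
    show "inv\<^bsub>add_monoid L1alg\<^esub> x \<in> cls ` J" if "x \<in> cls ` J" for x
      using that D(1) D(4)[of _ "-1"] by (auto simp: L1_inv)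
    show "a \<odot>\<^bsub>L1alg\<^esub> x \<in> cls ` J" if "a \<in> carrier complex_ring" "x \<in> cls ` J" for a x
      using that D(1,4) by (auto simp: L1_smult)
  qed
  fix a x assume a: "a \<in> carrier L1alg"
  then obtain f where f: "integrable lborel f" "a = cls f" by (rule L1_carrierE)
  show "a \<otimes>\<^bsub>L1alg\<^esub> x \<in> cls ` J" "x \<otimes>\<^bsub>L1alg\<^esub> a \<in> cls ` J" if "x \<in> cls ` J"
    using that f D(1,5,6) by (auto simp: L1_mult)
next
  note D = L1_idealD[OF J]
  fix x assume x: "x \<in> carrier L1alg" and cl: "\<forall>e>0. \<exists>y\<in>cls ` J. alg_norm L1alg (x \<ominus>\<^bsub>L1alg\<^esub> y) < e"
  obtain f where f: "integrable lborel f" "x = cls f" using x by (rule L1_carrierE)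
  have "f \<in> J"
  proof (rule D(7)[OF f(1)])
    fix e :: real assume "e > 0"
    then obtain g where g: "g \<in> J" "alg_norm L1alg (cls f \<ominus>\<^bsub>L1alg\<^esub> cls g) < e"
      using cl f by blast
    have "L1norm (\<lambda>p. f p - g p) < e"
      using g(2) f(1) D(1)[OF g(1)] by (simp add: L1_minus L1_norm)
    then show "\<exists>g\<in>J. L1norm (\<lambda>p. f p - g p) < e" using g(1) by auto
  qed
  then show "x \<in> cls ` J" using f by simp
qed

lemma not_weakly_wiener_L1I:
  assumes J: "L1_ideal J" and proper: "\<exists>f. integrable lborel f \<and> f \<notin> J"
    and no_rep: "\<And>(V :: (complex, ((real^3^3) \<times> real \<Rightarrow> complex) set) module) \<rho>. L1_representation V \<rho> \<Longrightarrow>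
      (\<And>f v. f \<in> J \<Longrightarrow> v \<in> carrier V \<Longrightarrow> \<rho> f v = \<zero>\<^bsub>V\<^esub>) \<Longrightarrow> False"
  shows "\<not> weakly_wiener L1alg"
proof
  assume "weakly_wiener L1alg"
  note D = L1_idealD[OF J]
  obtain f where f: "integrable lborel f" "f \<notin> J" using proper by blast
  have "cls f \<notin> cls ` J"
  proof
    assume "cls f \<in> cls ` J"
    then obtain g where g: "g \<in> J" "cls f = cls g" by auto
    have "AE p in lborel. f p - g p = 0"
      using g(2) cls_eq_iff[OF f(1) D(1)[OF g(1)]] by simp
    then have "L1norm (\<lambda>p. f p - g p) = 0"
      using f(1) D(1)[OF g(1)] by (subst L1norm_eq_0_iff) auto
    then have "f \<in> J" using g(1) by (intro D(7)[OF f(1)] bexI[of _ g]) simp_all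
    then show False using f(2) by simp
  qed
  then have "cls ` J \<noteq> carrier L1alg" using cls_carrier[OF f(1)] by auto
  with \<open>weakly_wiener L1alg\<close> closed_ideal_cls[OF J] obtain P where P: "P \<in> Prim L1alg" "cls ` J \<subseteq> P"
    unfolding weakly_wiener_iff by blast
  then obtain V :: "(complex, ((real^3^3) \<times> real \<Rightarrow> complex) set) module" and \<pi>
    where V: "P = rep_kernel L1alg V \<pi>" "irreducible_representation L1alg V \<pi>"
    unfolding Prim_def by blast
  show False
    by (rule no_rep[OF L1_representation_cls[OF V(2)]]) (use P(2) V(1) in \<open>auto simp: rep_kernel_def\<close>)
qed

section \<open>Dilations of R^4 and product densities\<close>

text \<open>The pair x, y and the pair z, t get separate factors because they are contracted at
  different stages.\<close>

definition dil :: "real \<Rightarrow> real \<Rightarrow> r4 \<Rightarrow> r4" where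
  "dil a b = (\<lambda>(x, y, z, t). (a * x, a * y, b * z, b * t))"

lemma dil_simp [simp]: "dil a b (x, y, z, t) = (a * x, a * y, b * z, b * t)"
  by (simp add: dil_def)

lemma continuous_on_dil: "continuous_on S (dil a b)"
  unfolding dil_def case_prod_unfold by (intro continuous_intros)

lemma measurable_dil [measurable]: "dil a b \<in> borel_measurable borel"
  by (intro borel_measurable_continuous_onI continuous_on_dil)

lemma dil_inverse: "a > 0 \<Longrightarrow> b > 0 \<Longrightarrow> dil (1/a) (1/b) (dil a b p) = p" "a > 0 \<Longrightarrow> b > 0 \<Longrightarrow> dil a b (dil (1/a) (1/b) p) = p"
  by (cases p; simp)+

lemma nn_integral_dil:
  assumes [measurable]: "f \<in> borel_measurable borel" and a: "a > 0" and b: "b > 0"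
  shows "(\<integral>\<^sup>+p. f p \<partial>lborel) = ennreal (a\<^sup>2 * b\<^sup>2) * (\<integral>\<^sup>+p. f (dil a b p) \<partial>lborel)"
proof -
  have "(\<integral>\<^sup>+p. f p \<partial>lborel) = (\<integral>\<^sup>+x. \<integral>\<^sup>+y. \<integral>\<^sup>+z. \<integral>\<^sup>+t. f (x, y, z, t) \<partial>lborel \<partial>lborel \<partial>lborel \<partial>lborel)"
    by (rule nn_integral_4) simp
  also have "\<dots> = (\<integral>\<^sup>+x. \<integral>\<^sup>+y. \<integral>\<^sup>+z. ennreal b * (\<integral>\<^sup>+t. f (x, y, z, b * t) \<partial>lborel) \<partial>lborel \<partial>lborel \<partial>lborel)"
    using b by (subst nn_integral_real_affine[where c = b and t = 0]) auto
  also have "\<dots> = (\<integral>\<^sup>+x. \<integral>\<^sup>+y. ennreal b * (ennreal b * (\<integral>\<^sup>+z. \<integral>\<^sup>+t. f (x, y, b * z, b * t) \<partial>lborel \<partial>lborel)) \<partial>lborel \<partial>lborel)"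
    using b by (subst nn_integral_cmult, simp, subst nn_integral_real_affine[where c = b and t = 0]) auto
  also have "\<dots> = (\<integral>\<^sup>+x. ennreal a * (ennreal b * (ennreal b * (\<integral>\<^sup>+y. \<integral>\<^sup>+z. \<integral>\<^sup>+t. f (x, a * y, b * z, b * t) \<partial>lborel \<partial>lborel \<partial>lborel))) \<partial>lborel)"
    using a by (subst nn_integral_real_affine[where c = a and t = 0]) (auto simp: nn_integral_cmult)
  also have "\<dots> = ennreal a * (ennreal a * (ennreal b * (ennreal b * (\<integral>\<^sup>+x. \<integral>\<^sup>+y. \<integral>\<^sup>+z. \<integral>\<^sup>+t. f (a * x, a * y, b * z, b * t) \<partial>lborel \<partial>lborel \<partial>lborel \<partial>lborel))))"
    using a by (subst nn_integral_real_affine[where c = a and t = 0]) (auto simp: nn_integral_cmult)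
  also have "\<dots> = ennreal (a\<^sup>2 * b\<^sup>2) * (\<integral>\<^sup>+x. \<integral>\<^sup>+y. \<integral>\<^sup>+z. \<integral>\<^sup>+t. f (dil a b (x, y, z, t)) \<partial>lborel \<partial>lborel \<partial>lborel \<partial>lborel)"
    using a b by (simp add: ennreal_mult power2_eq_square mult.assoc)
  also have "(\<integral>\<^sup>+x. \<integral>\<^sup>+y. \<integral>\<^sup>+z. \<integral>\<^sup>+t. f (dil a b (x, y, z, t)) \<partial>lborel \<partial>lborel \<partial>lborel \<partial>lborel) = (\<integral>\<^sup>+p. f (dil a b p) \<partial>lborel)"
    by (rule nn_integral_4[symmetric]) simp
  finally show ?thesis .
qed

lemma lborel_dil:
  assumes a: "a > 0" and b: "b > 0"
  shows "lborel = density (distr lborel borel (dil a b)) (\<lambda>_. ennreal (a\<^sup>2 * b\<^sup>2))"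
proof (rule measure_eqI)
  fix A :: "r4 set" assume "A \<in> sets lborel"
  then have [measurable]: "A \<in> sets borel" by simp
  have "emeasure lborel A = (\<integral>\<^sup>+p. indicator A p \<partial>lborel)" by simp
  also have "\<dots> = ennreal (a\<^sup>2 * b\<^sup>2) * (\<integral>\<^sup>+p. indicator A (dil a b p) \<partial>lborel)"
    by (rule nn_integral_dil[OF _ a b]) simp
  also have "\<dots> = (\<integral>\<^sup>+p. ennreal (a\<^sup>2 * b\<^sup>2) * indicator A p \<partial>distr lborel borel (dil a b))"
    by (subst nn_integral_cmult, simp, subst nn_integral_distr) simp_all
  also have "\<dots> = emeasure (density (distr lborel borel (dil a b)) (\<lambda>_. ennreal (a\<^sup>2 * b\<^sup>2))) A"
    by (simp add: emeasure_density)
  finally show "emeasure lborel A = emeasure (density (distr lborel borel (dil a b)) (\<lambda>_. ennreal (a\<^sup>2 * b\<^sup>2))) A" .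
qed simp

lemma integral_dil:
  fixes f :: "r4 \<Rightarrow> complex"
  assumes [measurable]: "f \<in> borel_measurable borel" and a: "a > 0" and b: "b > 0"
  shows "(LINT p|lborel. f p) = of_real (a\<^sup>2 * b\<^sup>2) * (LINT p|lborel. f (dil a b p))"
  by (subst lborel_dil[OF a b], subst integral_density) (auto simp: integral_distr scaleR_conv_of_real)

lemma integrable_dil:
  fixes f :: "r4 \<Rightarrow> complex"
  assumes f: "integrable lborel f" and a: "a > 0" and b: "b > 0"
  shows "integrable lborel (\<lambda>p. f (dil a b p))"
proof -
  have [measurable]: "f \<in> borel_measurable borel" using f by auto
  have "integrable (density (distr lborel borel (dil a b)) (\<lambda>_. ennreal (a\<^sup>2 * b\<^sup>2))) f"
    using f lborel_dil[OF a b] by simp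
  then have "integrable (distr lborel borel (dil a b)) (\<lambda>p. (a\<^sup>2 * b\<^sup>2) *\<^sub>R f p)"
    by (subst (asm) integrable_density) auto
  from integrable_scaleR_right[OF this, of "1 / (a\<^sup>2 * b\<^sup>2)"]
  have "integrable (distr lborel borel (dil a b)) f"
    using a b by simp
  then show ?thesis
    by (subst (asm) integrable_distr_eq) auto
qed

text \<open>Substituting q = \<open>h \<cdot> dil a b p\<close> turns the superposition into an
  honest convolution, the density being transported and divided by the Jacobian a^2 b^2. This keeps
  it inside any ideal that contains f.\<close>

lemma act_dil:
  assumes W: "integrable lborel W" and f: "integrable lborel f" and a: "a > 0" and b: "b > 0"
  shows "\<exists>W'. integrable lborel W' \<and> act (\<lambda>p. h \<cdot> dil a b p) W f = conv W' f"
proof (intro exI conjI)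
  let ?W' = "\<lambda>q. W (dil (1/a) (1/b) (ginv h \<cdot> q)) / of_real (a\<^sup>2 * b\<^sup>2)"
  have [measurable]: "W \<in> borel_measurable borel" "f \<in> borel_measurable borel" using W f by auto
  have "integrable lborel (\<lambda>q. W (dil (1/a) (1/b) q))"
    using a b by (intro integrable_dil W) auto
  from integrable_gmul[OF this, of "ginv h"] show "integrable lborel ?W'" by simp
  show "act (\<lambda>p. h \<cdot> dil a b p) W f = conv ?W' f"
  proof
    fix g
    have "conv ?W' f g = (LINT q|lborel. ?W' (h \<cdot> q) * f (ginv (h \<cdot> q) \<cdot> g))"
      unfolding act_def by (rule integral_gmul[symmetric]) simp
    also have "\<dots> = of_real (a\<^sup>2 * b\<^sup>2) * (LINT p|lborel. ?W' (h \<cdot> dil a b p) * f (ginv (h \<cdot> dil a b p) \<cdot> g))"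
      by (rule integral_dil[OF _ a b]) simp
    also have "\<dots> = (LINT p|lborel. W p * f (ginv (h \<cdot> dil a b p) \<cdot> g))"
      using a b by (subst integral_mult_right_zero[symmetric]) (simp add: dil_inverse)
    finally show "act (\<lambda>p. h \<cdot> dil a b p) W f g = conv ?W' f g" by (simp add: act_def)
  qed
qed

lemma lborel_product:
  fixes f :: "'a::euclidean_space \<Rightarrow> complex" and g :: "'b::euclidean_space \<Rightarrow> complex"
  assumes f: "integrable lborel f" and g: "integrable lborel g"
  shows "integrable lborel (\<lambda>(x, y). f x * g y)"
    and "(LINT p|lborel. (case p of (x, y) \<Rightarrow> f x * g y)) = (LINT x|lborel. f x) * (LINT y|lborel. g y)"
proof -
  have [measurable]: "f \<in> borel_measurable borel" "g \<in> borel_measurable borel" using f g by auto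
  have I: "integrable (lborel \<Otimes>\<^sub>M lborel) (\<lambda>(x, y). f x * g y)"
    by (rule lborel_pair.Fubini_integrable) (use f g in \<open>auto simp: norm_mult\<close>)
  then show "integrable lborel (\<lambda>(x, y). f x * g y)" by (simp add: lborel_prod)
  have "(LINT p|(lborel \<Otimes>\<^sub>M lborel). (case p of (x, y) \<Rightarrow> f x * g y)) = (LINT x|lborel. LINT y|lborel. f x * g y)"
    using lborel_pair.integral_fst'[OF I] by simp
  then show "(LINT p|lborel. (case p of (x, y) \<Rightarrow> f x * g y)) = (LINT x|lborel. f x) * (LINT y|lborel. g y)"
    by (simp add: lborel_prod)
qed

abbreviation nrm :: "real \<Rightarrow> complex" where
  "nrm x \<equiv> complex_of_real (std_normal_density x)"

lemma nrm_integral: "integrable lborel nrm" "(LINT x|lborel. nrm x) = 1"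
  by simp_all

definition nrm4 :: "r4 \<Rightarrow> complex" where
  "nrm4 = (\<lambda>(x, y, z, t). nrm x * (nrm y * (nrm z * nrm t)))"

lemma nrm4_integral: "integrable lborel nrm4" "(LINT p|lborel. nrm4 p) = 1"
proof -
  note 2 = lborel_product[OF nrm_integral(1) nrm_integral(1)]
  note 3 = lborel_product[OF nrm_integral(1) 2(1)]
  note 4 = lborel_product[OF nrm_integral(1) 3(1)]
  have "nrm4 = (\<lambda>(x, y). nrm x * (case y of (y, q) \<Rightarrow> nrm y * (case q of (z, t) \<Rightarrow> nrm z * nrm t)))"
    by (auto simp: nrm4_def)
  then show "integrable lborel nrm4" "(LINT p|lborel. nrm4 p) = 1"
    using 4 3(2) 2(2) nrm_integral by simp_all
qed

lemma act_const: "act (\<lambda>p. h) W f = (\<lambda>g. (LINT p|lborel. W p) * trl h f g)"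
  by (rule ext) (simp add: act_def)

lemma act_add_left:
  assumes "j \<in> borel_measurable borel" "integrable lborel W" "integrable lborel W'" "integrable lborel b"
  shows "AE g in lborel. act j (\<lambda>p. W p + W' p) b g = act j W b g + act j W' b g"
  using lborel_pair.AE_integrable_snd[of "\<lambda>p g. W p * trl (j p) b g", OF act_integrable2[OF assms(1,2,4)]]
      lborel_pair.AE_integrable_snd[of "\<lambda>p g. W' p * trl (j p) b g", OF act_integrable2[OF assms(1,3,4)]]
  by eventually_elim (simp add: act_def distrib_right)

text \<open>b is the sum of all convolution powers of a. L^1 has no unit, so the inverse of 1 - a
  appears in the quasi-inverse form b = a + b * a.\<close>

lemma neumann_series:
  assumes a: "integrable lborel a" and lt: "L1norm a < 1"
  shows "\<exists>b. integrable lborel b \<and> (AE p in lborel. b p = a p + conv b a p)"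
proof -
  define A where "A n = ((\<lambda>f. conv f a) ^^ n) a" for n
  have A0: "A 0 = a" and AS: "A (Suc n) = conv (A n) a" for n by (simp_all add: A_def)
  have Ai: "integrable lborel (A n)" for n
    by (induction n) (simp_all add: A0 AS a conv_integrable)
  have An: "L1norm (A n) \<le> L1norm a ^ Suc n" for n
  proof (induction n)
    case (Suc n)
    have "L1norm (A (Suc n)) \<le> L1norm (A n) * L1norm a"
      unfolding AS by (rule act_norm) (use Ai a in auto)
    also have "\<dots> \<le> L1norm a ^ Suc n * L1norm a"
      by (intro mult_right_mono Suc.IH L1norm_nonneg)
    finally show ?case by (simp add: mult.commute)
  qed (simp add: A0)
  have summ: "summable (\<lambda>n. L1norm (A n))"
  proof (rule summable_comparison_test')
    show "summable (\<lambda>n. L1norm a ^ Suc n)"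
      using lt by (simp add: summable_geometric L1norm_nonneg)
    show "norm (L1norm (A n)) \<le> L1norm a ^ Suc n" for n
      using An[of n] by simp
  qed
  \<comment> \<open>The sum of the norms is finite, so the integral of the sum of absolute values is
    finite and the series converges absolutely almost everywhere.\<close>
  have ae: "AE p in lborel. summable (\<lambda>n. norm (A n p))"
  proof -
    have [measurable]: "A n \<in> borel_measurable borel" for n using Ai[of n] by auto
    have "(\<integral>\<^sup>+p. (\<Sum>n. ennreal (norm (A n p))) \<partial>lborel) = (\<Sum>n. \<integral>\<^sup>+p. ennreal (norm (A n p)) \<partial>lborel)"
      by (rule nn_integral_suminf) simp
    also have "\<dots> = (\<Sum>n. ennreal (L1norm (A n)))"
      using Ai by (intro suminf_cong nn_integral_eq_integral) auto
    also have "\<dots> = ennreal (\<Sum>n. L1norm (A n))"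
      by (rule suminf_ennreal2[OF _ summ]) (rule L1norm_nonneg)
    finally have "AE p in lborel. (\<Sum>n. ennreal (norm (A n p))) \<noteq> \<infinity>"
      by (intro nn_integral_PInf_AE) auto
    then show ?thesis
      by eventually_elim (rule summable_suminf_not_top, auto)
  qed
  define b where "b p = (\<Sum>n. A n p)" for p
  have b: "integrable lborel b"
    unfolding b_def by (rule integrable_suminf[OF Ai ae summ])
  define s where "s n p = (\<Sum>k\<le>n. A k p)" for n p
  have s: "integrable lborel (s n)" for n
    unfolding s_def by (intro Bochner_Integration.integrable_sum Ai)
  have slim: "(\<lambda>n. L1norm (\<lambda>p. b p - s n p)) \<longlonglongrightarrow> 0"
  proof -
    have "(\<lambda>n. L1norm (\<lambda>p. b p - s n p)) \<longlonglongrightarrow> (LINT p::r4|lborel. (0::real))"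
    proof (rule integral_dominated_convergence[where w = "\<lambda>p. 2 * (\<Sum>n. norm (A n p))"])
      show "integrable lborel (\<lambda>p. 2 * (\<Sum>n. norm (A n p)))"
        using Ai ae summ by (intro integrable_mult_right integrable_suminf) auto
      show "AE p in lborel. (\<lambda>n. cmod (b p - s n p)) \<longlonglongrightarrow> 0"
        using ae
      proof eventually_elim
        fix p assume S: "summable (\<lambda>n. norm (A n p))"
        have "(\<lambda>n. s n p) \<longlonglongrightarrow> b p"
          unfolding s_def b_def by (rule summable_LIMSEQ'[OF summable_norm_cancel[OF S]])
        then have "(\<lambda>n. b p - s n p) \<longlonglongrightarrow> b p - b p" by (intro tendsto_intros)
        then show "(\<lambda>n. cmod (b p - s n p)) \<longlonglongrightarrow> 0" by (simp add: tendsto_norm_zero)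
      qed
      show "AE p in lborel. norm (cmod (b p - s n p)) \<le> 2 * (\<Sum>n. norm (A n p))" for n
        using ae
      proof eventually_elim
        fix p assume S: "summable (\<lambda>n. norm (A n p))"
        have 1: "norm (b p) \<le> (\<Sum>n. norm (A n p))"
          unfolding b_def by (rule summable_norm[OF S])
        have "norm (s n p) \<le> (\<Sum>k\<le>n. norm (A k p))" unfolding s_def by (rule norm_sum)
        also have "\<dots> \<le> (\<Sum>n. norm (A n p))" by (rule sum_le_suminf[OF S]) auto
        finally show "norm (cmod (b p - s n p)) \<le> 2 * (\<Sum>n. norm (A n p))"
          using 1 norm_triangle_ineq4[of "b p" "s n p"] by simp
      qed
    qed (use b s in auto)
    then show ?thesis by simp
  qed
  \<comment> \<open>Multiplying a partial sum of powers by a shifts the index: everything up to the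
    next power appears except a itself.\<close>
  have step: "AE p in lborel. conv (s n) a p = s (Suc n) p - a p" for n
  proof (induction n)
    case 0
    then show ?case by (simp add: s_def A0 AS)
  next
    case (Suc n)
    have "AE p in lborel. conv (\<lambda>p. s n p + A (Suc n) p) a p = conv (s n) a p + conv (A (Suc n)) a p"
      by (rule act_add_left) (use s Ai a in auto)
    moreover have "(\<lambda>p. s n p + A (Suc n) p) = s (Suc n)" by (rule ext) (simp add: s_def)
    ultimately have "AE p in lborel. conv (s (Suc n)) a p = conv (s n) a p + A (Suc (Suc n)) p"
      by (simp add: AS)
    moreover have "s (Suc (Suc n)) p = s (Suc n) p + A (Suc (Suc n)) p" for p by (simp add: s_def)
    ultimately show ?case using Suc.IH by (auto elim: eventually_elim2)
  qed
  have key: "L1norm (\<lambda>p. b p - (a p + conv b a p)) \<le> L1norm (\<lambda>p. b p - s (Suc n) p) + L1norm (\<lambda>p. b p - s n p) * L1norm a" for n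
  proof -
    note c = conv_integrable[OF b a] conv_integrable[OF s a]
    have "L1norm (\<lambda>p. b p - (a p + conv b a p)) \<le> L1norm (\<lambda>p. b p - s (Suc n) p) + L1norm (\<lambda>p. s (Suc n) p - (a p + conv b a p))"
      by (intro L1norm_triangle b s Bochner_Integration.integrable_add a c)
    also have "L1norm (\<lambda>p. s (Suc n) p - (a p + conv b a p)) = L1norm (\<lambda>p. conv (s n) a p - conv b a p)"
    proof (rule integral_cong_AE)
      show "AE p in lborel. cmod (s (Suc n) p - (a p + conv b a p)) = cmod (conv (s n) a p - conv b a p)"
        using step[of n] by eventually_elim (simp only: diff_diff_eq)
    qed (use c c(2)[of n] s[of "Suc n"] a in simp_all)
    also have "\<dots> \<le> L1norm (\<lambda>p. s n p - b p) * L1norm a + L1norm b * L1norm (\<lambda>p. a p - a p)"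
      by (rule act_diff) (use s a b in auto)
    finally show ?thesis by (simp add: norm_minus_commute)
  qed
  have "(\<lambda>n. L1norm (\<lambda>p. b p - s (Suc n) p) + L1norm (\<lambda>p. b p - s n p) * L1norm a) \<longlonglongrightarrow> 0 + 0 * L1norm a"
    by (intro tendsto_intros slim LIMSEQ_Suc[OF slim])
  then have "L1norm (\<lambda>p. b p - (a p + conv b a p)) \<le> 0"
    using key by (intro LIMSEQ_le_const) auto
  then have "L1norm (\<lambda>p. b p - (a p + conv b a p)) = 0"
    using L1norm_nonneg by (intro antisym)
  then have "AE p in lborel. b p - (a p + conv b a p) = 0"
    using b a conv_integrable[OF b a] by (subst (asm) L1norm_eq_0_iff) auto
  then show ?thesis using b by (intro exI[of _ b]) simp
qed

section \<open>The kernel of an irreducible representation\<close>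

context L1_representation
begin

definition ker :: "(r4 \<Rightarrow> complex) set" where
  "ker = {f. integrable lborel f \<and> (\<forall>v\<in>carrier V. \<rho> f v = \<zero>\<^bsub>V\<^esub>)}"

lemma C_carrier [simp]: "c \<in> carrier complex_ring"
  by (simp add: complex_ring_def)

lemma zero_smult: "v \<in> carrier V \<Longrightarrow> 0 \<odot>\<^bsub>V\<^esub> v = \<zero>\<^bsub>V\<^esub>"
  using V.smult_l_null[of v] by (simp add: complex_ring_def)

lemma zero_fun: "v \<in> carrier V \<Longrightarrow> \<rho> (\<lambda>p. 0) v = \<zero>\<^bsub>V\<^esub>"
  using smult_fun[of "\<lambda>p. 0" v 0] zero_smult[of "\<rho> (\<lambda>p. 0) v"] closed[of "\<lambda>p. 0" v] by simp

lemma zero_vec: "integrable lborel f \<Longrightarrow> \<rho> f \<zero>\<^bsub>V\<^esub> = \<zero>\<^bsub>V\<^esub>"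
  using smult_vec[of f "\<zero>\<^bsub>V\<^esub>" 0] zero_smult[of "\<zero>\<^bsub>V\<^esub>"] zero_smult[of "\<rho> f \<zero>\<^bsub>V\<^esub>"] closed[of f "\<zero>\<^bsub>V\<^esub>"] by simp

lemma neg_smult: "v \<in> carrier V \<Longrightarrow> \<ominus>\<^bsub>V\<^esub> v = (-1) \<odot>\<^bsub>V\<^esub> v"
proof -
  assume v: "v \<in> carrier V"
  have "((-1) \<odot>\<^bsub>V\<^esub> v) \<oplus>\<^bsub>V\<^esub> v = ((-1) \<oplus>\<^bsub>complex_ring\<^esub> 1) \<odot>\<^bsub>V\<^esub> v"
    using V.smult_l_distr[of "-1" 1 v] V.smult_one[OF v] v by (simp add: complex_ring_def)
  also have "\<dots> = \<zero>\<^bsub>V\<^esub>" using zero_smult[OF v] by (simp add: complex_ring_def)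
  finally show ?thesis using v by (intro V.M.minus_equality) auto
qed

lemma diff_fun:
  assumes "integrable lborel f" "integrable lborel g" "v \<in> carrier V"
  shows "\<rho> (\<lambda>p. f p - g p) v = \<rho> f v \<ominus>\<^bsub>V\<^esub> \<rho> g v"
  using assms add_fun[of f "\<lambda>p. - 1 * g p" v] smult_fun[of g v "-1"] neg_smult[of "\<rho> g v"] closed[of g v]
  by (simp add: a_minus_def)

lemma submodule_criterion:
  assumes sub: "W \<subseteq> carrier V" and zero: "\<zero>\<^bsub>V\<^esub> \<in> W"
    and add: "\<And>a b. \<lbrakk>a \<in> W; b \<in> W\<rbrakk> \<Longrightarrow> a \<oplus>\<^bsub>V\<^esub> b \<in> W"
    and sm: "\<And>c a. a \<in> W \<Longrightarrow> c \<odot>\<^bsub>V\<^esub> a \<in> W"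
  shows "submodule W complex_ring V"
  using assms neg_smult by (intro V.submoduleI) auto

text \<open>The vectors N annihilated by the whole algebra form an invariant subspace, not all of V
  by nontriviality, hence zero. So the orbit W of v is a nonzero invariant subspace. Irreducibility
  is algebraic, so w is attained exactly and not merely approximated.\<close>

lemma cyclic:
  assumes v: "v \<in> carrier V" "v \<noteq> \<zero>\<^bsub>V\<^esub>" and w: "w \<in> carrier V"
  shows "\<exists>f. integrable lborel f \<and> \<rho> f v = w"
proof -
  define W where "W = {\<rho> f v | f. integrable lborel f}"
  define N where "N = {u \<in> carrier V. \<forall>f. integrable lborel f \<longrightarrow> \<rho> f u = \<zero>\<^bsub>V\<^esub>}"
  have "submodule N complex_ring V"
  proof (rule submodule_criterion)
    show "\<zero>\<^bsub>V\<^esub> \<in> N" by (simp add: N_def zero_vec)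
  qed (auto simp: N_def add_vec smult_vec)
  moreover have "\<rho> f u \<in> N" if "integrable lborel f" "u \<in> N" for f u
    using that by (auto simp: N_def zero_vec)
  ultimately have "N = {\<zero>\<^bsub>V\<^esub>} \<or> N = carrier V" by (rule irred)
  moreover have "N \<noteq> carrier V" using nontriv by (auto simp: N_def)
  ultimately have N: "N = {\<zero>\<^bsub>V\<^esub>}" by blast
  have "submodule W complex_ring V"
  proof (rule submodule_criterion)
    show "W \<subseteq> carrier V" using v closed by (auto simp: W_def)
    show "\<zero>\<^bsub>V\<^esub> \<in> W" unfolding W_def using zero_fun[OF v(1)] by force
    show "a \<oplus>\<^bsub>V\<^esub> b \<in> W" if ab: "a \<in> W" "b \<in> W" for a b
    proof -
      obtain f g where "integrable lborel f" "a = \<rho> f v" "integrable lborel g" "b = \<rho> g v"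
        using ab by (auto simp: W_def)
      then show ?thesis unfolding W_def using v(1)
        by (auto simp: add_fun[symmetric] intro!: exI[of _ "\<lambda>p. f p + g p"])
    qed
    show "c \<odot>\<^bsub>V\<^esub> a \<in> W" if a: "a \<in> W" for c a
    proof -
      obtain f where "integrable lborel f" "a = \<rho> f v" using a by (auto simp: W_def)
      then show ?thesis unfolding W_def using v(1)
        by (auto simp: smult_fun[symmetric] intro!: exI[of _ "\<lambda>p. c * f p"])
    qed
  qed
  moreover have "\<rho> f u \<in> W" if fu: "integrable lborel f" "u \<in> W" for f u
  proof -
    obtain g where g: "integrable lborel g" "u = \<rho> g v" using fu by (auto simp: W_def)
    then show ?thesis unfolding W_def using v(1) fu(1)
      by (auto simp: conv_fun[symmetric] intro!: exI[of _ "conv f g"] conv_integrable)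
  qed
  ultimately have "W = {\<zero>\<^bsub>V\<^esub>} \<or> W = carrier V" by (rule irred)
  moreover have "W \<noteq> {\<zero>\<^bsub>V\<^esub>}"
  proof
    assume "W = {\<zero>\<^bsub>V\<^esub>}"
    then have "v \<in> N" using v(1) by (auto simp: W_def N_def)
    then show False using N v(2) by simp
  qed
  ultimately have "w \<in> W" using w by blast
  then show ?thesis by (auto simp: W_def)
qed

text \<open>For the Neumann sum b of a, applying b = a + b * a to the fixed vector gives
  \<open>\<rho> b v\<close> = v + \<open>\<rho> b v\<close>.\<close>

lemma fixed_vector_small:
  assumes a: "integrable lborel a" "L1norm a < 1" and v: "v \<in> carrier V" "\<rho> a v = v"
  shows "v = \<zero>\<^bsub>V\<^esub>"
proof -
  obtain b where b: "integrable lborel b" "AE p in lborel. b p = a p + conv b a p"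
    using neumann_series[OF a] by blast
  have "\<rho> b v = \<rho> (\<lambda>p. a p + conv b a p) v"
    using cong_AE[OF b(1) _ b(2)] a(1) conv_integrable[OF b(1) a(1)] by simp
  also have "\<dots> = v \<oplus>\<^bsub>V\<^esub> \<rho> b v"
    using a(1) b(1) v by (simp add: add_fun conv_integrable conv_fun)
  finally show ?thesis
    using closed[OF b(1) v(1)] v(1) by (metis V.M.add.r_cancel_one')
qed

text \<open>Automatic continuity: if \<open>\<rho> f v \<noteq> 0\<close>, some \<open>\<rho> b\<close> maps it back to \<open>v\<close>, and then \<open>v\<close> is fixed by
  \<open>\<rho> (b * (f - g))\<close> for \<open>g\<close> in the kernel close to \<open>f\<close>, against the Neumann series.\<close>

lemma ker_closed:
  assumes f: "integrable lborel f" and approx: "\<And>e. e > 0 \<Longrightarrow> \<exists>g\<in>ker. L1norm (\<lambda>p. f p - g p) < e"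
  shows "f \<in> ker"
proof -
  have "\<rho> f v = \<zero>\<^bsub>V\<^esub>" if v: "v \<in> carrier V" for v
  proof (rule ccontr)
    assume nz: "\<rho> f v \<noteq> \<zero>\<^bsub>V\<^esub>"
    obtain b where b: "integrable lborel b" "\<rho> b (\<rho> f v) = v"
      using cyclic[OF closed[OF f v] nz v] by blast
    obtain g where g: "g \<in> ker" "L1norm (\<lambda>p. f p - g p) < 1 / (L1norm b + 1)"
      using approx[of "1 / (L1norm b + 1)"] L1norm_nonneg[of b] by (auto simp: add_nonneg_pos)
    have gi: "integrable lborel g" using g by (simp add: ker_def)
    define d where "d = (\<lambda>p. f p - g p)"
    have d: "integrable lborel d" unfolding d_def using f gi by simp
    have "L1norm (conv b d) \<le> L1norm b * L1norm d"
      by (rule act_norm) (use b d in auto)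
    also have "\<dots> \<le> L1norm b * (1 / (L1norm b + 1))"
      using g(2) by (intro mult_left_mono) (auto simp: d_def)
    also have "\<dots> < 1"
      using L1norm_nonneg[of b] by (simp add: divide_simps add_nonneg_pos)
    finally have small: "L1norm (conv b d) < 1" .
    have gv: "\<rho> g v = \<zero>\<^bsub>V\<^esub>" using g v by (simp add: ker_def)
    have "\<rho> (conv b d) v = \<rho> b (\<rho> d v)" by (rule conv_fun[OF b(1) d v])
    also have "\<rho> d v = \<rho> f v"
      unfolding d_def using diff_fun[OF f gi v] gv closed[OF f v] by (simp add: a_minus_def)
    finally have "v = \<zero>\<^bsub>V\<^esub>"
      using fixed_vector_small[OF conv_integrable[OF b(1) d] small v] b(2) by simp
    then show False using nz zero_vec[OF f] by simp
  qed
  then show ?thesis using f by (simp add: ker_def)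
qed

lemma ker_limit:
  assumes lim: "(\<lambda>n. L1norm (\<lambda>p. s n p - f p)) \<longlonglongrightarrow> 0" and s: "\<And>n. s n \<in> ker" and f: "integrable lborel f"
  shows "f \<in> ker"
proof (rule ker_closed[OF f])
  fix e :: real assume "e > 0"
  then obtain n where "L1norm (\<lambda>p. s n p - f p) < e"
    using eventually_happens[OF order_tendstoD(2)[OF lim]] sequentially_bot by blast
  then show "\<exists>g\<in>ker. L1norm (\<lambda>p. f p - g p) < e"
    using s[of n] by (intro bexI[of _ "s n"]) (simp_all add: norm_minus_commute)
qed

lemma ker_integrable: "f \<in> ker \<Longrightarrow> integrable lborel f"
  by (simp add: ker_def)

lemma ker_add: "f \<in> ker \<Longrightarrow> g \<in> ker \<Longrightarrow> (\<lambda>p. f p + g p) \<in> ker"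
  by (auto simp: ker_def add_fun)

lemma ker_scale: "f \<in> ker \<Longrightarrow> (\<lambda>p. c * f p) \<in> ker"
  using V.smult_r_null[of c] by (auto simp: ker_def smult_fun)

lemma ker_diff: "f \<in> ker \<Longrightarrow> g \<in> ker \<Longrightarrow> (\<lambda>p. f p - g p) \<in> ker"
  using ker_add[of f "\<lambda>p. -1 * g p"] ker_scale[of g "-1"] by simp

lemma ker_cong: "f \<in> ker \<Longrightarrow> integrable lborel g \<Longrightarrow> AE p in lborel. f p = g p \<Longrightarrow> g \<in> ker"
  using cong_AE[of f g] by (simp add: ker_def)

lemma ker_conv: "f \<in> ker \<Longrightarrow> integrable lborel b \<Longrightarrow> conv f b \<in> ker" "f \<in> ker \<Longrightarrow> integrable lborel b \<Longrightarrow> conv b f \<in> ker"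
  by (auto simp: ker_def conv_integrable conv_fun closed zero_vec)

text \<open>Translation by h is not convolution with a function. It is the limit of convolutions
  whose Gaussian weight shrinks to the point h, and the kernel is closed.\<close>

lemma ker_trl:
  assumes f: "f \<in> ker" shows "trl h f \<in> ker"
proof -
  define c where "c n = 1 / real (Suc n)" for n
  have c: "c n > 0" for n by (simp add: c_def)
  have clim: "c \<longlonglongrightarrow> 0" unfolding c_def using LIMSEQ_inverse_real_of_nat by (simp add: inverse_eq_divide)
  note fi = ker_integrable[OF f]
  have jl: "(\<lambda>n. h \<cdot> dil (c n) (c n) p) \<longlonglongrightarrow> h" for p
  proof -
    obtain x y z t where p: "p = (x, y, z, t)" by (cases p)
    have "(\<lambda>n. dil (c n) (c n) p) \<longlonglongrightarrow> (0 * x, 0 * y, 0 * z, 0 * t)"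
      unfolding p dil_simp by (intro tendsto_intros clim)
    then have "(\<lambda>n. dil (c n) (c n) p) \<longlonglongrightarrow> 0" by (simp add: zero_prod_def)
    moreover have "isCont (\<lambda>q. h \<cdot> q) 0"
      by (rule continuous_on_interior[of UNIV]) (auto intro!: continuous_intros)
    ultimately have "(\<lambda>n. h \<cdot> dil (c n) (c n) p) \<longlonglongrightarrow> h \<cdot> 0"
      by (rule isCont_tendsto_compose[rotated])
    then show ?thesis by simp
  qed
  have nm [measurable]: "nrm4 \<in> borel_measurable borel" using nrm4_integral(1) by auto
  have "(\<lambda>n. L1norm (\<lambda>g. act (\<lambda>p. h \<cdot> dil (c n) (c n) p) nrm4 f g - act (\<lambda>p. h) nrm4 f g)) \<longlonglongrightarrow> 0"
    by (rule act_limit(1)[where D = "\<lambda>p. cmod (nrm4 p)"])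
      (use fi jl nrm4_integral(1) in \<open>simp_all del: split_paired_All\<close>)
  moreover have "act (\<lambda>p. h \<cdot> dil (c n) (c n) p) nrm4 f \<in> ker" for n
    using act_dil[OF nrm4_integral(1) fi c[of n] c[of n], of h] ker_conv(2)[OF f] by auto
  ultimately have "act (\<lambda>p. h) nrm4 f \<in> ker"
    by (rule ker_limit) (rule act_integrable, use fi nrm4_integral(1) in simp_all)
  then show ?thesis by (simp add: act_const nrm4_integral(2))
qed

end

section \<open>Fourier integrals on the line\<close>

lemma gauss_fourier:
  assumes s: "s > 0"
  shows "integrable lborel (\<lambda>x. exp (- s * x\<^sup>2) :: real)"
    and "(CLINT x|lborel. complex_of_real (exp (- s * x\<^sup>2)) * iexp (t * x)) = sqrt (pi / s) * exp (- t\<^sup>2 / (4 * s))"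
proof -
  \<comment> \<open>The scale that turns exp (-s x^2) into a multiple of the standard normal
    density, whose Fourier transform is known as a characteristic function.\<close>
  define k where "k = 1 / sqrt (2 * s)"
  have k: "k > 0" using s by (simp add: k_def)
  have ksq: "s * k\<^sup>2 = 1 / 2" using s by (simp add: k_def power_divide)
  have e: "exp (- s * (k * x)\<^sup>2) = sqrt (2 * pi) * std_normal_density x" for x
  proof -
    have "- s * (k * x)\<^sup>2 = - (s * k\<^sup>2) * x\<^sup>2" by (simp add: power_mult_distrib)
    also have "\<dots> = - x\<^sup>2 / 2" by (simp add: ksq)
    finally show ?thesis by (simp add: std_normal_density_def)
  qed
  have "integrable lborel (\<lambda>x. exp (- s * (0 + k * x)\<^sup>2) :: real)"
    using e by simp
  then show "integrable lborel (\<lambda>x. exp (- s * x\<^sup>2) :: real)"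
    using lborel_integrable_real_affine_iff[of k "\<lambda>x. exp (- s * x\<^sup>2)" 0] k by simp
  have std: "(CLINT x|lborel. complex_of_real (std_normal_density x) * iexp (u * x)) = exp (- u\<^sup>2 / 2)" for u
  proof -
    have "(CLINT x|lborel. complex_of_real (std_normal_density x) * iexp (u * x)) = char std_normal_distribution u"
      unfolding char_def by (subst integral_density) (auto simp: scaleR_conv_of_real)
    then show ?thesis by (simp add: char_std_normal_distribution)
  qed
  have "(CLINT x|lborel. complex_of_real (exp (- s * x\<^sup>2)) * iexp (t * x))
    = k *\<^sub>R (CLINT x|lborel. complex_of_real (exp (- s * (0 + k * x)\<^sup>2)) * iexp (t * (0 + k * x)))"
    using k by (subst lborel_integral_real_affine[where c = k and t = 0]) auto
  also have "\<dots> = k * (CLINT x|lborel. sqrt (2 * pi) * (complex_of_real (std_normal_density x) * iexp ((t * k) * x)))"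
    using e by (simp add: scaleR_conv_of_real mult.assoc)
  also have "\<dots> = k * (sqrt (2 * pi) * exp (- (t * k)\<^sup>2 / 2))"
    by (simp only: integral_mult_right_zero std) (simp only: of_real_mult)
  also have "\<dots> = of_real (k * sqrt (2 * pi)) * of_real (exp (- (t * k)\<^sup>2 / 2))"
    by simp
  also have "k * sqrt (2 * pi) = sqrt (pi / s)"
    using s by (simp add: k_def real_sqrt_divide real_sqrt_mult)
  also have "- (t * k)\<^sup>2 / 2 = - t\<^sup>2 / (4 * s)"
    using s by (simp add: k_def power_mult_distrib power_divide)
  finally show "(CLINT x|lborel. complex_of_real (exp (- s * x\<^sup>2)) * iexp (t * x)) = sqrt (pi / s) * exp (- t\<^sup>2 / (4 * s))"
    by simp
qed

text \<open>The factor exp (-s t^2) makes Fubini legitimate. Its Fourier transform is an approximate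
  identity at x0, so s \<rightarrow> 0 needs continuity of f only there; dominated convergence on
  the other side uses the integrability of F.\<close>

lemma fourier_inversion:
  fixes f :: "real \<Rightarrow> complex"
  assumes f: "integrable lborel f" and bd: "\<And>x. cmod (f x) \<le> B" and cont: "isCont f x0"
  defines "F \<equiv> \<lambda>t. CLINT x|lborel. f x * iexp (t * x)"
  assumes F: "integrable lborel F"
  shows "(CLINT t|lborel. F t * iexp (- t * x0)) = 2 * pi * f x0"
proof -
  have [measurable]: "f \<in> borel_measurable borel" "F \<in> borel_measurable borel" using f F by auto
  \<comment> \<open>With this s the transformed Gaussian is the standard normal density contracted
    to width 1/(n+1) around x0, up to the factor 2 pi.\<close>
  define s where "s n = 1 / (2 * (real (Suc n))\<^sup>2)" for n
  have s: "s n > 0" for n by (simp add: s_def)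
  have slim: "s \<longlonglongrightarrow> 0"
    unfolding s_def by real_asymp
  define I where "I n = (CLINT t|lborel. F t * iexp (- t * x0) * exp (- s n * t\<^sup>2))" for n
  have lim1: "I \<longlonglongrightarrow> (CLINT t|lborel. F t * iexp (- t * x0))"
    unfolding I_def
  proof (rule integral_dominated_convergence[where w = "\<lambda>t. cmod (F t)"])
    show "AE t in lborel. (\<lambda>n. F t * iexp (- t * x0) * exp (- s n * t\<^sup>2)) \<longlonglongrightarrow> F t * iexp (- t * x0)"
    proof (rule AE_I2)
      fix t
      have "(\<lambda>n. F t * iexp (- t * x0) * complex_of_real (exp (- s n * t\<^sup>2))) \<longlonglongrightarrow> F t * iexp (- t * x0) * complex_of_real (exp (- 0 * t\<^sup>2))"
        by (intro tendsto_intros slim)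
      then show "(\<lambda>n. F t * iexp (- t * x0) * exp (- s n * t\<^sup>2)) \<longlonglongrightarrow> F t * iexp (- t * x0)" by simp
    qed
    show "AE t in lborel. norm (F t * iexp (- t * x0) * exp (- s n * t\<^sup>2)) \<le> cmod (F t)" for n
    proof (rule AE_I2)
      fix t
      have "exp (- s n * t\<^sup>2) \<le> 1" using s[of n] by simp
      then show "norm (F t * iexp (- t * x0) * exp (- s n * t\<^sup>2)) \<le> cmod (F t)"
        by (simp add: norm_mult mult_left_le del: of_real_exp)
    qed
  qed (use F in auto)
  have I_eq: "I n = of_real (2 * pi) * (CLINT u|lborel. f (x0 + u / Suc n) * std_normal_density u)" for n
  proof -
    let ?g = "\<lambda>t. complex_of_real (exp (- s n * t\<^sup>2))"
    have gi: "integrable lborel ?g" using gauss_fourier(1)[OF s[of n]] by (intro integrable_of_real)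
    have P: "integrable (lborel \<Otimes>\<^sub>M lborel) (\<lambda>(t, x). f x * iexp (t * x) * iexp (- t * x0) * ?g t)"
    proof (rule lborel_pair.Fubini_integrable)
      show "integrable lborel (\<lambda>t. LINT x|lborel. norm (case (t, x) of (t, x) \<Rightarrow> f x * iexp (t * x) * iexp (- t * x0) * ?g t))"
        using integrable_mult_left[OF gauss_fourier(1)[OF s[of n]], of "LINT x|lborel. cmod (f x)"]
        by (simp add: norm_mult del: of_real_exp)
      show "AE t in lborel. integrable lborel (\<lambda>x. case (t, x) of (t, x) \<Rightarrow> f x * iexp (t * x) * iexp (- t * x0) * ?g t)"
      proof (rule AE_I2)
        fix t
        show "integrable lborel (\<lambda>x. case (t, x) of (t, x) \<Rightarrow> f x * iexp (t * x) * iexp (- t * x0) * ?g t)"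
          by (rule Bochner_Integration.integrable_bound[OF integrable_norm[OF integrable_mult_left[OF f, of "?g t"]]])
            (auto simp: norm_mult)
      qed
    qed (simp add: case_prod_unfold)
    have "I n = (CLINT t|lborel. CLINT x|lborel. f x * iexp (t * x) * iexp (- t * x0) * ?g t)"
      unfolding I_def F_def by (simp only: integral_mult_left_zero)
    also have "\<dots> = (CLINT x|lborel. CLINT t|lborel. f x * iexp (t * x) * iexp (- t * x0) * ?g t)"
      by (rule lborel_pair.Fubini_integral[OF P, symmetric])
    also have "\<dots> = (CLINT x|lborel. f x * (CLINT t|lborel. ?g t * iexp ((x - x0) * t)))"
    proof (intro Bochner_Integration.integral_cong refl)
      fix x
      have "f x * iexp (t * x) * iexp (- t * x0) * ?g t = f x * (?g t * iexp ((x - x0) * t))" for t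
      proof -
        have "iexp (t * x) * iexp (- t * x0) = iexp ((x - x0) * t)"
          by (simp add: exp_add[symmetric] algebra_simps)
        then show ?thesis by (simp add: mult.assoc mult.left_commute)
      qed
      then show "(CLINT t|lborel. f x * iexp (t * x) * iexp (- t * x0) * ?g t) = f x * (CLINT t|lborel. ?g t * iexp ((x - x0) * t))"
        by (simp only: integral_mult_right_zero)
    qed
    also have "\<dots> = (CLINT x|lborel. f x * of_real (sqrt (pi / s n) * exp (- (x - x0)\<^sup>2 / (4 * s n))))"
      by (subst gauss_fourier(2)[OF s]) simp
    also have "\<dots> = (1 / Suc n) *\<^sub>R (CLINT u|lborel. f (x0 + (1 / Suc n) * u) * of_real (sqrt (pi / s n) * exp (- ((x0 + (1 / Suc n) * u) - x0)\<^sup>2 / (4 * s n))))"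
      by (subst lborel_integral_real_affine[where c = "1 / Suc n" and t = x0]) auto
    also have "\<dots> = (CLINT u|lborel. of_real (2 * pi) * (f (x0 + u / Suc n) * std_normal_density u))"
    proof -
      have h1: "- ((x0 + (1 / Suc n) * u) - x0)\<^sup>2 / (4 * s n) = - u\<^sup>2 / 2" for u
        by (simp add: s_def power_divide field_simps)
      have h2: "sqrt (pi / s n) = Suc n * sqrt (2 * pi)"
        by (simp add: s_def real_sqrt_mult mult.commute)
      have h3: "sqrt (2 * pi) * exp (- u\<^sup>2 / 2) = 2 * pi * std_normal_density u" for u
      proof -
        have "2 * pi = sqrt (2 * pi) * sqrt (2 * pi)" by simp
        then show ?thesis by (simp add: std_normal_density_def field_simps)
      qed
      have h4: "(1 / Suc n) * (sqrt (pi / s n) * exp (- ((x0 + (1 / Suc n) * u) - x0)\<^sup>2 / (4 * s n))) = 2 * pi * std_normal_density u" for u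
      proof -
        have "(1 / Suc n) * (Suc n * sqrt (2 * pi) * E) = sqrt (2 * pi) * E" for E :: real by simp
        then show ?thesis unfolding h1 h2 by (simp only: h3)
      qed
      have *: "(1 / Suc n) *\<^sub>R (f (x0 + (1 / Suc n) * u) * of_real (sqrt (pi / s n) * exp (- ((x0 + (1 / Suc n) * u) - x0)\<^sup>2 / (4 * s n))))
         = of_real (2 * pi) * (f (x0 + u / Suc n) * std_normal_density u)" for u
      proof -
        have "c *\<^sub>R (w * of_real r) = w * of_real (c * r)" for c r :: real and w :: complex
          by (simp add: scaleR_conv_of_real)
        then show ?thesis by (simp only: h4) (simp add: mult_ac)
      qed
      show ?thesis by (simp only: integral_scaleR_right[symmetric] *)
    qed
    finally show ?thesis by (simp only: integral_mult_right_zero)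
  qed
  have "(\<lambda>n. CLINT u|lborel. f (x0 + u / Suc n) * std_normal_density u) \<longlonglongrightarrow> (CLINT u|lborel. f x0 * std_normal_density u)"
  proof (rule integral_dominated_convergence[where w = "\<lambda>u. B * std_normal_density u"])
    show "AE u in lborel. (\<lambda>n. f (x0 + u / Suc n) * std_normal_density u) \<longlonglongrightarrow> f x0 * std_normal_density u"
    proof (rule AE_I2)
      fix u
      have "(\<lambda>n. x0 + u / Suc n) \<longlonglongrightarrow> x0" by real_asymp
      then have "(\<lambda>n. f (x0 + u / Suc n)) \<longlonglongrightarrow> f x0"
        by (rule isCont_tendsto_compose[OF cont])
      then show "(\<lambda>n. f (x0 + u / Suc n) * std_normal_density u) \<longlonglongrightarrow> f x0 * std_normal_density u"
        by (rule tendsto_mult_right)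
    qed
    show "AE u in lborel. norm (f (x0 + u / Suc n) * std_normal_density u) \<le> B * std_normal_density u" for n
      by (auto simp: norm_mult intro!: mult_right_mono bd)
  qed auto
  then have "(\<lambda>n. of_real (2 * pi) * (CLINT u|lborel. f (x0 + u / Suc n) * std_normal_density u)) \<longlonglongrightarrow> of_real (2 * pi) * f x0"
    by (intro tendsto_mult_left) simp
  then have "I \<longlonglongrightarrow> of_real (2 * pi) * f x0" unfolding I_eq .
  with lim1 show ?thesis by (simp add: LIMSEQ_unique)
qed

text \<open>Cauchy's theorem for two horizontal lines, by means of a primitive P on the convex
  domain: each integral is a limit of differences of P, and the contributions of the vertical sides
  tend to 0 with G.\<close>

lemma contour_shift:
  fixes f :: "complex \<Rightarrow> complex"
  assumes hol: "f holomorphic_on S" and S: "open S" "convex S"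
    and strip: "\<And>x y. y \<in> closed_segment c d \<Longrightarrow> Complex x y \<in> S"
    and bd: "\<And>x y. y \<in> closed_segment c d \<Longrightarrow> cmod (f (Complex x y)) \<le> G x"
    and G: "(G \<longlongrightarrow> 0) at_top" "(G \<longlongrightarrow> 0) at_bot"
    and int: "integrable lborel (\<lambda>x. f (Complex x c))" "integrable lborel (\<lambda>x. f (Complex x d))"
  shows "(CLINT x|lborel. f (Complex x c)) = (CLINT x|lborel. f (Complex x d))"
proof -
  have "\<exists>P. \<forall>z\<in>S. (P has_field_derivative f z) (at z within S)"
  proof (rule holomorphic_convex_primitive'[OF S(2,1) hol])
    fix g assume "\<And>x. x \<in> S \<Longrightarrow> (g has_field_derivative f x) (at x within S)"
    then show ?thesis by (intro exI[of _ g] ballI)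
  qed
  then obtain P where P: "\<forall>z\<in>S. (P has_field_derivative f z) (at z within S)" by (rule exE)
  have P': "(P has_field_derivative f z) (at z)" if "z \<in> S" for z
    using bspec[OF P that] unfolding at_within_open[OF that S(1)] .
  have contf: "continuous_on S f" using hol by (rule holomorphic_on_imp_continuous_on)
  have main: "(\<lambda>n. P (Complex (real n) y) - P (Complex (- real n) y)) \<longlonglongrightarrow> (CLINT x|lborel. f (Complex x y))"
    if y: "y \<in> closed_segment c d" and I: "integrable lborel (\<lambda>x. f (Complex x y))" for y
  proof -
    have "(CLINT x|lborel. indicator {- real n..real n} x *\<^sub>R f (Complex x y)) = P (Complex (real n) y) - P (Complex (- real n) y)" for n
    proof (rule integral_FTC_atLeastAtMost)
      show "((\<lambda>x. P (Complex x y)) has_vector_derivative f (Complex x y)) (at x within {- real n..real n})" for x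
      proof -
        have "((\<lambda>x. Complex x y) has_vector_derivative 1) (at x within {- real n..real n})"
          unfolding Complex_eq by (auto intro!: derivative_eq_intros simp: has_vector_derivative_def scaleR_conv_of_real)
        from field_vector_diff_chain_within[OF this has_field_derivative_at_within[OF P'[OF strip[OF y]]]]
        show ?thesis by (simp add: o_def)
      qed
      have "continuous_on UNIV (\<lambda>x. Complex x y)" unfolding Complex_eq by (intro continuous_intros)
      then show "continuous_on {- real n..real n} (\<lambda>x. f (Complex x y))"
        using strip[OF y] by (intro continuous_on_compose2[OF contf]) (auto intro: continuous_on_subset)
    qed simp
    moreover have "(\<lambda>n. CLINT x|lborel. indicator {- real n..real n} x *\<^sub>R f (Complex x y)) \<longlonglongrightarrow> (CLINT x|lborel. f (Complex x y))"
    proof (rule integral_dominated_convergence[where w = "\<lambda>x. cmod (f (Complex x y))"])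
      show "AE x in lborel. (\<lambda>n. indicator {- real n..real n} x *\<^sub>R f (Complex x y)) \<longlonglongrightarrow> f (Complex x y)"
      proof (rule AE_I2)
        fix x
        obtain N :: nat where N: "\<bar>x\<bar> \<le> real N" using real_arch_simple by blast
        have "eventually (\<lambda>n. indicator {- real n..real n} x *\<^sub>R f (Complex x y) = f (Complex x y)) sequentially"
          using N by (intro eventually_sequentiallyI[of N]) (auto simp: indicator_def)
        then show "(\<lambda>n. indicator {- real n..real n} x *\<^sub>R f (Complex x y)) \<longlonglongrightarrow> f (Complex x y)"
          by (rule tendsto_eventually)
      qed
    qed (use I in \<open>auto simp: indicator_def\<close>)
    ultimately show ?thesis by simp
  qed
  \<comment> \<open>The mean value inequality on a vertical segment of length |c - d|, where the
    derivative f of P is bounded by G.\<close>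
  have side: "(\<lambda>n. P (Complex (g n) c) - P (Complex (g n) d)) \<longlonglongrightarrow> 0"
    if g: "(\<lambda>n. G (g n)) \<longlonglongrightarrow> 0" for g :: "nat \<Rightarrow> real"
  proof (rule Lim_null_comparison)
    show "eventually (\<lambda>n. norm (P (Complex (g n) c) - P (Complex (g n) d)) \<le> G (g n) * \<bar>c - d\<bar>) sequentially"
    proof (intro always_eventually allI)
      fix n
      let ?T = "(\<lambda>y. Complex (g n) y) ` closed_segment c d"
      have T: "?T = closed_segment (Complex (g n) c) (Complex (g n) d)"
      proof -
        have "Complex (g n) ((1 - u) * c + u * d) = (1 - u) *\<^sub>R Complex (g n) c + u *\<^sub>R Complex (g n) d" for u
          by (simp add: complex_eq_iff algebra_simps)
        then show ?thesis by (auto simp: closed_segment_def image_iff) metis+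
      qed
      have "norm (P (Complex (g n) c) - P (Complex (g n) d)) \<le> G (g n) * norm (Complex (g n) c - Complex (g n) d)"
      proof (rule field_differentiable_bound[of ?T])
        show "convex ?T" unfolding T by simp
        show "(P has_field_derivative f z) (at z within ?T)" if "z \<in> ?T" for z
          using that P' strip by (auto intro: has_field_derivative_at_within)
        show "norm (f z) \<le> G (g n)" if "z \<in> ?T" for z using that bd by auto
      qed auto
      also have "norm (Complex (g n) c - Complex (g n) d) = \<bar>c - d\<bar>"
        by (simp add: cmod_def)
      finally show "norm (P (Complex (g n) c) - P (Complex (g n) d)) \<le> G (g n) * \<bar>c - d\<bar>" .
    qed
    show "(\<lambda>n. G (g n) * \<bar>c - d\<bar>) \<longlonglongrightarrow> 0"
      using tendsto_mult_right[OF g, of "\<bar>c - d\<bar>"] by simp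
  qed
  have G1: "(\<lambda>n. G (real n)) \<longlonglongrightarrow> 0" by (rule filterlim_compose[OF G(1) filterlim_real_sequentially])
  have G2: "(\<lambda>n. G (- real n)) \<longlonglongrightarrow> 0"
    by (rule filterlim_compose[OF G(2)]) (simp add: filterlim_uminus_at_bot filterlim_real_sequentially)
  have "(\<lambda>n. (P (Complex (real n) c) - P (Complex (- real n) c)) - (P (Complex (real n) d) - P (Complex (- real n) d)))
    \<longlonglongrightarrow> (CLINT x|lborel. f (Complex x c)) - (CLINT x|lborel. f (Complex x d))"
    using int by (intro tendsto_diff main) auto
  moreover have "(\<lambda>n. (P (Complex (real n) c) - P (Complex (- real n) c)) - (P (Complex (real n) d) - P (Complex (- real n) d))) \<longlonglongrightarrow> 0 - 0"
    using tendsto_diff[OF side[OF G1] side[OF G2]] by (simp add: algebra_simps)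
  ultimately show ?thesis
    using LIMSEQ_unique by fastforce
qed

text \<open>Differentiation costs a factor t on the Fourier side. Used twice, it produces the decay
  t^(-2).\<close>

lemma integral_by_parts_iexp:
  fixes p p' :: "real \<Rightarrow> complex"
  assumes der: "\<And>x. (p has_vector_derivative p' x) (at x)" and cont: "\<And>x. isCont p' x"
    and i: "integrable lborel p" "integrable lborel p'"
    and lim: "(p \<longlongrightarrow> 0) at_top" "(p \<longlongrightarrow> 0) at_bot"
  shows "(CLINT x|lborel. p' x * iexp (t * x)) = - \<i> * t * (CLINT x|lborel. p x * iexp (t * x))"
proof -
  let ?e = "\<lambda>x. iexp (t * x)"
  let ?f = "\<lambda>x. p' x * ?e x + p x * (\<i> * t * ?e x)"
  have ii: "integrable lborel (\<lambda>x. q x * ?e x)" if "integrable lborel q" for q :: "real \<Rightarrow> complex"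
    by (rule Bochner_Integration.integrable_bound[OF integrable_norm[OF that]]) (use that in \<open>auto simp: norm_mult\<close>)
  have I: "integrable lborel ?f"
    using ii[OF i(2)] integrable_mult_right[OF ii[OF i(1)], of "\<i> * t"]
    by (simp add: mult_ac)
  have pc: "isCont p x" for x using der[of x] by (rule has_vector_derivative_continuous)
  have "(LBINT x=-\<infinity>..\<infinity>. ?f x) = 0 - 0"
  proof (rule interval_integral_FTC_integrable[where F = "\<lambda>x. p x * ?e x"])
    show "((\<lambda>x. p x * ?e x) has_vector_derivative ?f x) (at x)" for x
    proof -
      have "((\<lambda>x. ?e x) has_vector_derivative (\<i> * t * ?e x)) (at x)"
      proof -
        have "((\<lambda>z. exp (\<i> * (complex_of_real t * z))) has_field_derivative (\<i> * t * exp (\<i> * (t * complex_of_real x)))) (at (complex_of_real x))"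
          by (auto intro!: derivative_eq_intros)
        from has_vector_derivative_real_field[OF this] show ?thesis by simp
      qed
      from has_vector_derivative_mult[OF der[of x] this] show ?thesis by (simp add: add.commute)
    qed
    show "isCont ?f x" for x by (intro continuous_intros cont pc)
    show "set_integrable lborel (einterval (-\<infinity>) \<infinity>) ?f"
      using I by (simp add: set_integrable_def einterval_def)
    have *: "((\<lambda>x. p x * ?e x) \<longlongrightarrow> 0) F" if "(p \<longlongrightarrow> 0) F" for F
      by (rule Lim_null_comparison[where g = "\<lambda>x. cmod (p x)"])
        (use that in \<open>auto simp: norm_mult tendsto_norm_zero\<close>)
    show "(((\<lambda>x. p x * ?e x) \<circ> real_of_ereal) \<longlongrightarrow> 0) (at_right (-\<infinity>))"
      using *[OF lim(2)] by (simp add: ereal_tendsto_simps1)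
    show "(((\<lambda>x. p x * ?e x) \<circ> real_of_ereal) \<longlongrightarrow> 0) (at_left \<infinity>)"
      using *[OF lim(1)] by (simp add: ereal_tendsto_simps1)
  qed simp
  then have "(CLINT x|lborel. ?f x) = 0"
    by (simp add: interval_lebesgue_integral_def set_lebesgue_integral_def einterval_def)
  moreover have "(CLINT x|lborel. ?f x) = (CLINT x|lborel. p' x * ?e x) + (CLINT x|lborel. \<i> * t * (p x * ?e x))"
    using ii[OF i(2)] integrable_mult_right[OF ii[OF i(1)], of "\<i> * t"]
    by (subst Bochner_Integration.integral_add[symmetric]) (auto simp: mult_ac)
  ultimately show ?thesis
    by (simp add: eq_neg_iff_add_eq_0 mult.assoc)
qed

section \<open>Gaussian functions on the strip and their Fourier transforms\<close>

text \<open>In the variable \<open>w = exp (\<pi> u)\<close> the last factor is \<open>exp (- \<epsilon> w)\<close>, bounded on the strip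
  \<open>\<bar>Im u\<bar> \<le> 1/2\<close>.\<close>

definition phi :: "real \<Rightarrow> real \<Rightarrow> complex \<Rightarrow> complex" where
  "phi \<sigma> \<epsilon> u = exp (- (of_real \<sigma> * u\<^sup>2) - of_real \<epsilon> * exp (of_real pi * u))"

text \<open>The first derivative of \<open>phi\<close>, as \<open>phi2\<close> is the second. Both
  are explicit because they must be bounded uniformly in \<epsilon> before integrating by parts
  twice.\<close>

definition phi1 :: "real \<Rightarrow> real \<Rightarrow> complex \<Rightarrow> complex" where
  "phi1 \<sigma> \<epsilon> u = (- (2 * of_real \<sigma> * u) - of_real \<epsilon> * of_real pi * exp (of_real pi * u)) * phi \<sigma> \<epsilon> u"

definition phi2 :: "real \<Rightarrow> real \<Rightarrow> complex \<Rightarrow> complex" where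
  "phi2 \<sigma> \<epsilon> u = ((- (2 * of_real \<sigma> * u) - of_real \<epsilon> * of_real pi * exp (of_real pi * u))\<^sup>2
     - 2 * of_real \<sigma> - of_real \<epsilon> * (of_real pi)\<^sup>2 * exp (of_real pi * u)) * phi \<sigma> \<epsilon> u"

lemma phi_deriv: "(phi \<sigma> \<epsilon> has_field_derivative phi1 \<sigma> \<epsilon> u) (at u)"
  unfolding phi_def[abs_def] phi1_def
  by (auto intro!: derivative_eq_intros simp: algebra_simps)

lemma phi1_deriv: "(phi1 \<sigma> \<epsilon> has_field_derivative phi2 \<sigma> \<epsilon> u) (at u)"
  unfolding phi1_def[abs_def]
  by (rule derivative_eq_intros phi_deriv refl)+
    (simp add: phi2_def phi1_def algebra_simps power2_eq_square)

lemma phi2_continuous: "continuous_on UNIV (phi2 \<sigma> \<epsilon>)"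
  unfolding phi2_def[abs_def] phi_def by (intro continuous_intros)

text \<open>On the strip Re (exp (pi u)) = exp (pi x) cos (pi y) is nonnegative, so the
  \<epsilon>-term only decreases the modulus, and Re (u^2) = x^2 - y^2 costs the factor exp
  (\<sigma>/4). The derivatives add growth at most K^2, which half of the Gaussian absorbs. The
  constant does not depend on \<epsilon>, as the limit \<epsilon> \<rightarrow> 0 requires.\<close>

lemma phi_bound:
  assumes \<sigma>: "\<sigma> > 0"
  shows "\<exists>C. \<forall>\<epsilon> x y. 0 \<le> \<epsilon> \<longrightarrow> \<epsilon> \<le> 1 \<longrightarrow> \<bar>y\<bar> \<le> 1/2 \<longrightarrow>
    cmod (phi \<sigma> \<epsilon> (Complex x y)) \<le> C * exp (- (\<sigma>/2) * x\<^sup>2) \<and>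
    cmod (phi1 \<sigma> \<epsilon> (Complex x y)) \<le> C * exp (- (\<sigma>/2) * x\<^sup>2) \<and>
    cmod (phi2 \<sigma> \<epsilon> (Complex x y)) \<le> C * exp (- (\<sigma>/2) * x\<^sup>2)"
proof -
  \<comment> \<open>A K bounds the logarithmic derivative and D K^2 the polynomial factor of the
    second derivative; 4 and 16 come from pi < 4.\<close>
  define A where "A = 2 * \<sigma> + 4"
  define D where "D = A\<^sup>2 + 2 * \<sigma> + 16"
  have A4: "A \<ge> 4" using \<sigma> by (simp add: A_def)
  then have "A * 1 \<le> A * A" by (intro mult_left_mono) auto
  then have "A \<le> A\<^sup>2" by (simp only: mult_1_right power2_eq_square)
  then have DA: "D \<ge> A" "D \<ge> 1" unfolding D_def using \<sigma> A4 by linarith+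
  \<comment> \<open>K \<le> 2 exp (4 |x|) gives K^2 \<le> 4 exp (8 |x|), and completing a square
    gives 8 |x| \<le> (\<sigma>/2) x^2 + 32/\<sigma>.\<close>
  define C where "C = D * 4 * exp (32 / \<sigma>) * exp (\<sigma> / 4)"
  show ?thesis
  proof (intro exI[of _ C] allI impI)
    fix \<epsilon> x y :: real assume e: "0 \<le> \<epsilon>" "\<epsilon> \<le> 1" and y: "\<bar>y\<bar> \<le> 1/2"
    define u where "u = Complex x y"
    define K where "K = 1 + \<bar>x\<bar> + exp (pi * x)"
    have K1: "K \<ge> 1" "exp (pi * x) \<le> K" "\<bar>x\<bar> + 1/2 \<le> K" by (auto simp: K_def)
    have KK: "K \<le> K\<^sup>2" "1 \<le> K\<^sup>2"
      using K1(1) self_le_power[of K 2] one_le_power[of K 2] by simp_all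
    have ex: "cmod (exp (of_real pi * u)) = exp (pi * x)" by (simp add: u_def)
    have y2: "y\<^sup>2 \<le> 1/4"
      using power_mono[OF y, of 2] by (simp add: power_divide)
    have "0 \<le> cos (pi * y)"
    proof (rule cos_ge_zero)
      have "\<bar>pi * y\<bar> \<le> pi / 2" using mult_left_mono[OF y, of pi] by (simp add: abs_mult)
      then show "- (pi / 2) \<le> pi * y" "pi * y \<le> pi / 2" by linarith+
    qed
    then have re: "0 \<le> Re (exp (of_real pi * u))" by (simp add: u_def Re_exp)
    have "Re (- (of_real \<sigma> * u\<^sup>2) - of_real \<epsilon> * exp (of_real pi * u)) = - \<sigma> * x\<^sup>2 + \<sigma> * y\<^sup>2 - \<epsilon> * Re (exp (of_real pi * u))"
      by (simp add: u_def Re_power2 algebra_simps)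
    also have "\<dots> \<le> - \<sigma> * x\<^sup>2 + \<sigma> / 4"
    proof -
      have "\<sigma> * y\<^sup>2 \<le> \<sigma> * (1/4)" using \<sigma> y2 by (intro mult_left_mono) auto
      then show ?thesis using mult_nonneg_nonneg[OF e(1) re] by linarith
    qed
    finally have ph: "cmod (phi \<sigma> \<epsilon> u) \<le> exp (\<sigma> / 4) * exp (- \<sigma> * x\<^sup>2)"
      unfolding phi_def norm_exp_eq_Re by (simp only: exp_add[symmetric] exp_le_cancel_iff add.commute)
    have q1: "cmod (- (2 * of_real \<sigma> * u) - of_real \<epsilon> * of_real pi * exp (of_real pi * u)) \<le> A * K"
    proof -
      have "cmod (- (2 * of_real \<sigma> * u) - of_real \<epsilon> * of_real pi * exp (of_real pi * u)) \<le> cmod (2 * of_real \<sigma> * u) + cmod (of_real \<epsilon> * of_real pi * exp (of_real pi * u))"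
        using norm_triangle_ineq4[of "- (2 * of_real \<sigma> * u)" "of_real \<epsilon> * of_real pi * exp (of_real pi * u)"] unfolding norm_minus_cancel .
      also have "cmod (2 * of_real \<sigma> * u) \<le> 2 * \<sigma> * K"
      proof -
        have "cmod u \<le> K" using cmod_le[of u] y K1(3) by (simp add: u_def)
        then show ?thesis using \<sigma> by (simp add: norm_mult)
      qed
      also have "cmod (of_real \<epsilon> * of_real pi * exp (of_real pi * u)) \<le> 4 * K"
      proof -
        have "\<epsilon> * pi \<le> 1 * 4" using e pi_less_4 by (intro mult_mono) auto
        then have "\<epsilon> * pi * exp (pi * x) \<le> 4 * K" using K1 by (intro mult_mono) auto
        then show ?thesis using e ex by (simp add: norm_mult)
      qed
      finally show ?thesis by (simp add: A_def algebra_simps)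
    qed
    have q2: "cmod ((- (2 * of_real \<sigma> * u) - of_real \<epsilon> * of_real pi * exp (of_real pi * u))\<^sup>2 - 2 * of_real \<sigma> - of_real \<epsilon> * (of_real pi)\<^sup>2 * exp (of_real pi * u)) \<le> D * K\<^sup>2"
    proof -
      have "cmod ((- (2 * of_real \<sigma> * u) - of_real \<epsilon> * of_real pi * exp (of_real pi * u))\<^sup>2 - 2 * of_real \<sigma> - of_real \<epsilon> * (of_real pi)\<^sup>2 * exp (of_real pi * u))
        \<le> cmod (- (2 * of_real \<sigma> * u) - of_real \<epsilon> * of_real pi * exp (of_real pi * u))^2 + cmod (2 * of_real \<sigma> :: complex) + cmod (of_real \<epsilon> * (of_real pi)\<^sup>2 * exp (of_real pi * u))"
        by (intro order_trans[OF norm_triangle_ineq4] add_mono order_refl) (simp add: norm_power)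
      also have "cmod (- (2 * of_real \<sigma> * u) - of_real \<epsilon> * of_real pi * exp (of_real pi * u))^2 \<le> (A * K)\<^sup>2"
        by (intro power_mono q1) simp
      also have "cmod (2 * of_real \<sigma> :: complex) \<le> 2 * \<sigma> * K\<^sup>2"
        using \<sigma> KK by simp
      also have "cmod (of_real \<epsilon> * (of_real pi)\<^sup>2 * exp (of_real pi * u)) \<le> 16 * K\<^sup>2"
      proof -
        have "pi\<^sup>2 \<le> 4\<^sup>2" using pi_less_4 by (intro power_mono) auto
        then have "\<epsilon> * pi\<^sup>2 \<le> 1 * 16" using e by (intro mult_mono) auto
        then have "\<epsilon> * pi\<^sup>2 * exp (pi * x) \<le> 16 * K\<^sup>2" using K1 KK by (intro mult_mono) auto
        then show ?thesis using e ex by (simp add: norm_mult norm_power)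
      qed
      finally show ?thesis by (simp add: D_def algebra_simps power_mult_distrib)
    qed
    have big: "K\<^sup>2 * (exp (\<sigma> / 4) * exp (- \<sigma> * x\<^sup>2)) \<le> (C / D) * exp (- (\<sigma>/2) * x\<^sup>2)"
    proof -
      have "1 + \<bar>x\<bar> \<le> exp (4 * \<bar>x\<bar>)"
        using exp_ge_add_one_self[of "\<bar>x\<bar>"] by (rule order_trans) simp
      moreover have "exp (pi * x) \<le> exp (4 * \<bar>x\<bar>)"
      proof -
        have "pi * x \<le> pi * \<bar>x\<bar>" by (intro mult_left_mono) auto
        also have "\<dots> \<le> 4 * \<bar>x\<bar>" using pi_less_4 by (intro mult_right_mono) auto
        finally show ?thesis by simp
      qed
      ultimately have "K \<le> 2 * exp (4 * \<bar>x\<bar>)" unfolding K_def by linarith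
      then have "K\<^sup>2 \<le> (2 * exp (4 * \<bar>x\<bar>))\<^sup>2" using K1 by (intro power_mono) auto
      also have "\<dots> = 4 * exp (8 * \<bar>x\<bar>)"
        by (simp add: power_mult_distrib power2_eq_square exp_add[symmetric])
      also have "\<dots> \<le> 4 * exp ((\<sigma>/2) * x\<^sup>2 + 32 / \<sigma>)"
      proof -
        have "0 \<le> (\<sigma> * \<bar>x\<bar> - 8)\<^sup>2" by simp
        then have "16 * \<sigma> * \<bar>x\<bar> \<le> \<sigma>\<^sup>2 * x\<^sup>2 + 64" by (simp add: power2_diff power_mult_distrib)
        then have "(16 * \<sigma> * \<bar>x\<bar>) / (2 * \<sigma>) \<le> (\<sigma>\<^sup>2 * x\<^sup>2 + 64) / (2 * \<sigma>)" using \<sigma> by (intro divide_right_mono) auto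
        then have "8 * \<bar>x\<bar> \<le> (\<sigma>/2) * x\<^sup>2 + 32 / \<sigma>" using \<sigma> by (simp add: field_simps power2_eq_square)
        then show ?thesis by simp
      qed
      finally have "K\<^sup>2 \<le> 4 * exp ((\<sigma>/2) * x\<^sup>2 + 32 / \<sigma>)" .
      then have "K\<^sup>2 * (exp (\<sigma> / 4) * exp (- \<sigma> * x\<^sup>2)) \<le> 4 * exp ((\<sigma>/2) * x\<^sup>2 + 32 / \<sigma>) * (exp (\<sigma> / 4) * exp (- \<sigma> * x\<^sup>2))"
        by (intro mult_right_mono) auto
      also have "\<dots> = 4 * exp (32 / \<sigma>) * exp (\<sigma> / 4) * exp ((\<sigma>/2) * x\<^sup>2 + - \<sigma> * x\<^sup>2)"
        by (simp only: exp_add mult_ac)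
      also have "(\<sigma>/2) * x\<^sup>2 + - \<sigma> * x\<^sup>2 = - (\<sigma>/2) * x\<^sup>2" by (simp add: algebra_simps)
      finally show ?thesis using DA by (simp add: C_def)
    qed
    have main: "cmod (q * phi \<sigma> \<epsilon> u) \<le> C * exp (- (\<sigma>/2) * x\<^sup>2)" if q: "cmod q \<le> D * K\<^sup>2" for q
    proof -
      have "cmod (q * phi \<sigma> \<epsilon> u) \<le> D * K\<^sup>2 * (exp (\<sigma> / 4) * exp (- \<sigma> * x\<^sup>2))"
        unfolding norm_mult using DA KK by (intro mult_mono q ph) auto
      also have "\<dots> \<le> D * ((C / D) * exp (- (\<sigma>/2) * x\<^sup>2))"
        using mult_left_mono[OF big, of D] DA by (simp add: mult.assoc)
      finally show ?thesis using DA by simp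
    qed
    have "1 * 1 \<le> D * K\<^sup>2" using DA KK by (intro mult_mono) auto
    moreover have "A * K \<le> D * K\<^sup>2" using DA KK K1 A4 by (intro mult_mono) auto
    ultimately show "cmod (phi \<sigma> \<epsilon> (Complex x y)) \<le> C * exp (- (\<sigma>/2) * x\<^sup>2) \<and>
      cmod (phi1 \<sigma> \<epsilon> (Complex x y)) \<le> C * exp (- (\<sigma>/2) * x\<^sup>2) \<and>
      cmod (phi2 \<sigma> \<epsilon> (Complex x y)) \<le> C * exp (- (\<sigma>/2) * x\<^sup>2)"
      unfolding u_def[symmetric] phi1_def phi2_def
      using main[of 1] main[OF order_trans[OF q1]] main[OF q2] by simp
  qed
qed

text \<open>Sign and factor are chosen so that integration against exp (-i t u) returns
  \<open>phi\<close> without a constant.\<close>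

definition phi_fourier :: "real \<Rightarrow> real \<Rightarrow> real \<Rightarrow> complex" where
  "phi_fourier \<sigma> \<epsilon> t = (1 / (2 * pi)) * (CLINT x|lborel. phi \<sigma> \<epsilon> (of_real x) * iexp (t * x))"

lemma gauss_tendsto_0:
  assumes s: "s > 0"
  shows "((\<lambda>x::real. C * exp (- s * x\<^sup>2)) \<longlongrightarrow> 0) at_top" "((\<lambda>x::real. C * exp (- s * x\<^sup>2)) \<longlongrightarrow> 0) at_bot"
  using s by real_asymp+

lemma has_vector_derivative_Complex:
  assumes "(f has_field_derivative f') (at (Complex x c))"
  shows "((\<lambda>x. f (Complex x c)) has_vector_derivative f') (at x)"
proof -
  have "((\<lambda>x. Complex x c) has_vector_derivative 1) (at x)"
    unfolding Complex_eq by (auto intro!: derivative_eq_intros simp: has_vector_derivative_def scaleR_conv_of_real)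
  from field_vector_diff_chain_at[OF this assms] show ?thesis by (simp add: o_def)
qed

context
  fixes \<sigma> C :: real
  assumes \<sigma>: "\<sigma> > 0"
    and C: "\<And>\<epsilon> x y. 0 \<le> \<epsilon> \<Longrightarrow> \<epsilon> \<le> 1 \<Longrightarrow> \<bar>y\<bar> \<le> 1/2 \<Longrightarrow> cmod (phi \<sigma> \<epsilon> (Complex x y)) \<le> C * exp (- (\<sigma>/2) * x\<^sup>2)"
    and C1: "\<And>\<epsilon> x y. 0 \<le> \<epsilon> \<Longrightarrow> \<epsilon> \<le> 1 \<Longrightarrow> \<bar>y\<bar> \<le> 1/2 \<Longrightarrow> cmod (phi1 \<sigma> \<epsilon> (Complex x y)) \<le> C * exp (- (\<sigma>/2) * x\<^sup>2)"
    and C2: "\<And>\<epsilon> x y. 0 \<le> \<epsilon> \<Longrightarrow> \<epsilon> \<le> 1 \<Longrightarrow> \<bar>y\<bar> \<le> 1/2 \<Longrightarrow> cmod (phi2 \<sigma> \<epsilon> (Complex x y)) \<le> C * exp (- (\<sigma>/2) * x\<^sup>2)"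
begin

lemma dominator_integrable: "integrable lborel (\<lambda>x. C * exp (- (\<sigma>/2) * x\<^sup>2))"
  using gauss_fourier(1)[of "\<sigma>/2"] \<sigma> by (intro integrable_mult_right) auto

lemma dominated_fourier: "integrable lborel f \<and> cmod (CLINT x|lborel. f x * iexp (t * x)) \<le> (LINT x|lborel. C * exp (- (\<sigma>/2) * x\<^sup>2))"
  if m: "f \<in> borel_measurable borel" and b: "\<And>x. cmod (f x) \<le> C * exp (- (\<sigma>/2) * x\<^sup>2)" for f :: "real \<Rightarrow> complex"
proof
  have C0: "0 \<le> C * exp (- (\<sigma>/2) * x\<^sup>2)" for x using b[of x] norm_ge_zero order_trans by blast
  show i: "integrable lborel f"
    by (rule Bochner_Integration.integrable_bound[OF dominator_integrable]) (use m b C0 in auto)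
  have i2: "integrable lborel (\<lambda>x. f x * iexp (t * x))"
    by (rule Bochner_Integration.integrable_bound[OF integrable_norm[OF i]]) (use m in \<open>auto simp: norm_mult\<close>)
  have "cmod (CLINT x|lborel. f x * iexp (t * x)) \<le> (LINT x|lborel. cmod (f x * iexp (t * x)))"
    by (rule integral_norm_bound)
  also have "\<dots> \<le> (LINT x|lborel. C * exp (- (\<sigma>/2) * x\<^sup>2))"
    using b integrable_norm[OF i] dominator_integrable by (intro integral_mono) (simp_all add: norm_mult)
  finally show "cmod (CLINT x|lborel. f x * iexp (t * x)) \<le> (LINT x|lborel. C * exp (- (\<sigma>/2) * x\<^sup>2))" .
qed

lemma line_measurable: "continuous_on UNIV f \<Longrightarrow> (\<lambda>x. f (Complex x c)) \<in> borel_measurable borel" for f :: "complex \<Rightarrow> complex"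
  unfolding Complex_eq
  by (intro borel_measurable_continuous_onI) (auto intro!: continuous_on_compose2[of UNIV f] continuous_intros)

lemma phi_cont: "continuous_on UNIV (phi \<sigma> \<epsilon>)" "continuous_on UNIV (phi1 \<sigma> \<epsilon>)"
  unfolding phi1_def[abs_def] phi_def[abs_def] by (intro continuous_intros)+

context
  fixes \<epsilon> :: real assumes e: "0 \<le> \<epsilon>" "\<epsilon> \<le> 1"
begin

text \<open>Moving the line of integration from Im = 0 to Im = c, where exp (i t z) acquires the
  factor exp (- t c).\<close>

lemma phi_fourier_shift:
  assumes c: "\<bar>c\<bar> \<le> 1/2"
  shows "phi_fourier \<sigma> \<epsilon> t * complex_of_real (exp (t * c)) = (1 / (2 * pi)) * (CLINT x|lborel. phi \<sigma> \<epsilon> (Complex x c) * iexp (t * x))"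
proof -
  let ?f = "\<lambda>z. phi \<sigma> \<epsilon> z * exp (\<i> * t * z)"
  have split: "exp (\<i> * t * Complex x y) = iexp (t * x) * complex_of_real (exp (- (t * y)))" for x y
    by (simp add: exp_add[symmetric] Complex_eq algebra_simps flip: exp_of_real)
  have b: "cmod (?f (Complex x y)) \<le> (C * exp (- (\<sigma>/2) * x\<^sup>2)) * exp \<bar>t\<bar>" if y: "\<bar>y\<bar> \<le> 1/2" for x y
  proof -
    have "- (t * y) \<le> \<bar>t\<bar> * \<bar>y\<bar>" by (metis abs_ge_minus_self abs_mult)
    also have "\<dots> \<le> \<bar>t\<bar> * 1" using y by (intro mult_left_mono) auto
    finally have "cmod (exp (\<i> * t * Complex x y)) \<le> exp \<bar>t\<bar>"
      unfolding split by (simp add: norm_mult flip: exp_of_real)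
    then show ?thesis
      unfolding norm_mult using C[OF e y, of x] by (intro mult_mono) (auto intro: order_trans[OF norm_ge_zero])
  qed
  have int: "integrable lborel (\<lambda>x. ?f (Complex x y))" if y: "\<bar>y\<bar> \<le> 1/2" for y
  proof (rule Bochner_Integration.integrable_bound[OF integrable_mult_left[OF dominator_integrable, of "exp \<bar>t\<bar>"]])
    show "(\<lambda>x. ?f (Complex x y)) \<in> borel_measurable lborel"
      using line_measurable[of ?f y] phi_cont(1) by (simp add: continuous_intros)
    show "AE x in lborel. norm (?f (Complex x y)) \<le> norm (C * exp (- (\<sigma>/2) * x\<^sup>2) * exp \<bar>t\<bar>)"
      using b[OF y] by (intro AE_I2) (auto intro: order_trans[OF _ abs_ge_self])
  qed
  have seg: "\<bar>y\<bar> \<le> 1/2" if "y \<in> closed_segment 0 c" for y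
    using that c by (auto simp: closed_segment_eq_real_ivl split: if_splits)
  have "(CLINT x|lborel. ?f (Complex x 0)) = (CLINT x|lborel. ?f (Complex x c))"
  proof (rule contour_shift[where S = UNIV and G = "\<lambda>x. (C * exp \<bar>t\<bar>) * exp (- (\<sigma>/2) * x\<^sup>2)"])
    show "?f holomorphic_on UNIV"
      unfolding phi_def by (intro holomorphic_intros)
    show "cmod (?f (Complex x y)) \<le> (C * exp \<bar>t\<bar>) * exp (- (\<sigma>/2) * x\<^sup>2)" if "y \<in> closed_segment 0 c" for x y
      using b[OF seg[OF that], of x] by (simp add: mult_ac)
  qed (use \<sigma> gauss_tendsto_0[of "\<sigma>/2"] int c in auto)
  also have "\<dots> = (CLINT x|lborel. phi \<sigma> \<epsilon> (Complex x c) * iexp (t * x) * complex_of_real (exp (- (t * c))))"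
    unfolding split by (simp only: mult.assoc)
  also have "\<dots> = (CLINT x|lborel. phi \<sigma> \<epsilon> (Complex x c) * iexp (t * x)) * complex_of_real (exp (- (t * c)))"
    by (simp only: integral_mult_left_zero)
  finally have "(CLINT x|lborel. phi \<sigma> \<epsilon> (of_real x) * iexp (t * x)) = (CLINT x|lborel. phi \<sigma> \<epsilon> (Complex x c) * iexp (t * x)) * complex_of_real (exp (- (t * c)))"
    by (simp add: complex_of_real_def[symmetric] mult.assoc)
  moreover have "complex_of_real (exp (- (t * c))) * complex_of_real (exp (t * c)) = 1"
    by (simp only: of_real_mult[symmetric] exp_add[symmetric]) simp
  ultimately show ?thesis unfolding phi_fourier_def by (simp only: mult.assoc) (simp only: mult_1_right)
qed

text \<open>The contour on the boundary of the strip gives exp (-|t|/2), and two integrations by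
  parts on that line give 1/(1 + t^2). Both are needed: the exponential only balances the growth of
  sqrt (cosh t), and integrability has to come from the second factor.\<close>

lemma phi_fourier_decay:
  "cmod (phi_fourier \<sigma> \<epsilon> t) \<le> (LINT x|lborel. C * exp (- (\<sigma>/2) * x\<^sup>2)) * (exp (- (\<bar>t\<bar>/2)) * inverse (1 + t\<^sup>2))"
proof -
  define I where "I = (LINT x|lborel. C * exp (- (\<sigma>/2) * x\<^sup>2))"
  \<comment> \<open>The side of the strip is chosen by the sign of t, so that exp (t c) is always
    large.\<close>
  define c :: real where "c = (if t \<ge> 0 then 1/2 else - (1/2))"
  have c: "\<bar>c\<bar> \<le> 1/2" "t * c = \<bar>t\<bar> / 2" by (auto simp: c_def)
  let ?J = "\<lambda>f. CLINT x|lborel. f (Complex x c) * iexp (t * x)"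
  have i0: "integrable lborel (\<lambda>x. phi \<sigma> \<epsilon> (Complex x c))" "cmod (?J (phi \<sigma> \<epsilon>)) \<le> I"
    using dominated_fourier[OF line_measurable[OF phi_cont(1)] C[OF e c(1)]] by (auto simp: I_def)
  have i1: "integrable lborel (\<lambda>x. phi1 \<sigma> \<epsilon> (Complex x c))"
    using dominated_fourier[OF line_measurable[OF phi_cont(2)] C1[OF e c(1)]] by auto
  have i2: "integrable lborel (\<lambda>x. phi2 \<sigma> \<epsilon> (Complex x c))" "cmod (?J (phi2 \<sigma> \<epsilon>)) \<le> I"
    using dominated_fourier[OF line_measurable[OF phi2_continuous] C2[OF e c(1)]] by (auto simp: I_def)
  have cc: "isCont (\<lambda>x. f (Complex x c)) x" if "continuous_on UNIV f" for f :: "complex \<Rightarrow> complex" and x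
  proof -
    have "continuous_on UNIV (\<lambda>x. f (Complex x c))"
      unfolding Complex_eq by (intro continuous_on_compose2[OF that]) (auto intro!: continuous_intros)
    then show ?thesis by (simp add: continuous_on_eq_continuous_at)
  qed
  have lim0: "((\<lambda>x. f (Complex x c)) \<longlongrightarrow> 0) at_top" "((\<lambda>x. f (Complex x c)) \<longlongrightarrow> 0) at_bot"
    if "\<And>x. cmod (f (Complex x c)) \<le> C * exp (- (\<sigma>/2) * x\<^sup>2)" for f
    using \<sigma> that by (auto intro!: Lim_null_comparison[OF always_eventually gauss_tendsto_0(1)[of "\<sigma>/2"]]
      Lim_null_comparison[OF always_eventually gauss_tendsto_0(2)[of "\<sigma>/2"]])
  have 1: "?J (phi1 \<sigma> \<epsilon>) = - \<i> * t * ?J (phi \<sigma> \<epsilon>)"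
    by (rule integral_by_parts_iexp[OF has_vector_derivative_Complex[OF phi_deriv] cc[OF phi_cont(2)] i0(1) i1 lim0[OF C[OF e c(1)]]])
  have 2: "?J (phi2 \<sigma> \<epsilon>) = - \<i> * t * ?J (phi1 \<sigma> \<epsilon>)"
    by (rule integral_by_parts_iexp[OF has_vector_derivative_Complex[OF phi1_deriv] cc[OF phi2_continuous] i1 i2(1) lim0[OF C1[OF e c(1)]]])
  have "?J (phi2 \<sigma> \<epsilon>) = - (t\<^sup>2) * ?J (phi \<sigma> \<epsilon>)"
    unfolding 2 1 by (simp add: power2_eq_square algebra_simps)
  then have "cmod (?J (phi2 \<sigma> \<epsilon>)) = t\<^sup>2 * cmod (?J (phi \<sigma> \<epsilon>))"
    by (simp add: norm_mult norm_power)
  then have "(1 + t\<^sup>2) * cmod (?J (phi \<sigma> \<epsilon>)) \<le> 2 * I"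
    using i0(2) i2(2) by (simp add: algebra_simps)
  then have J: "cmod (?J (phi \<sigma> \<epsilon>)) \<le> 2 * I * inverse (1 + t\<^sup>2)"
    by (simp add: field_simps add_pos_nonneg)
  have I0: "I \<ge> 0" using i0(2) norm_ge_zero order_trans by blast
  have "cmod (phi_fourier \<sigma> \<epsilon> t) * exp (\<bar>t\<bar>/2) = cmod (phi_fourier \<sigma> \<epsilon> t * complex_of_real (exp (t * c)))"
    by (simp add: norm_mult c(2) del: of_real_exp)
  also have "\<dots> = (1 / (2 * pi)) * cmod (?J (phi \<sigma> \<epsilon>))"
    by (simp only: phi_fourier_shift[OF c(1)] norm_mult) (simp add: norm_divide norm_mult)
  also have "\<dots> \<le> (1 / 2) * (2 * I * inverse (1 + t\<^sup>2))"
    using pi_ge_two I0 by (intro mult_mono J) (auto simp: field_simps)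
  finally have "cmod (phi_fourier \<sigma> \<epsilon> t) * exp (\<bar>t\<bar>/2) * exp (- (\<bar>t\<bar>/2)) \<le> I * inverse (1 + t\<^sup>2) * exp (- (\<bar>t\<bar>/2))"
    by (intro mult_right_mono) auto
  then show ?thesis
    by (simp add: I_def mult.assoc exp_add[symmetric] mult.commute[of "exp (- (\<bar>t\<bar>/2))"])
qed

lemma phi_fourier_measurable: "phi_fourier \<sigma> \<epsilon> \<in> borel_measurable borel"
proof -
  have [measurable]: "(\<lambda>x. phi \<sigma> \<epsilon> (of_real x)) \<in> borel_measurable borel"
    using line_measurable[OF phi_cont(1), where c = 0] by (simp add: complex_of_real_def[symmetric])
  show ?thesis unfolding phi_fourier_def[abs_def] by measurable
qed

lemma inverse_integrable: "integrable lborel (\<lambda>t::real. inverse (1 + t\<^sup>2))"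
  using integrable_inverse_1_plus_square by (simp add: set_integrable_def)

text \<open>Fourier inversion on the horizontal line through u, after
  \<open>phi_fourier_shift\<close> identifies the transform along that line. The boundary of the
  strip is included because the factor 1/(1 + t^2) survives there.\<close>

lemma phi_fourier_fourier:
  assumes u: "\<bar>Im u\<bar> \<le> 1/2"
  shows "integrable lborel (\<lambda>t. phi_fourier \<sigma> \<epsilon> t * exp (- \<i> * t * u))"
    and "(CLINT t|lborel. phi_fourier \<sigma> \<epsilon> t * exp (- \<i> * t * u)) = phi \<sigma> \<epsilon> u"
proof -
  define x0 c where "x0 = Re u" and "c = Im u"
  have uc: "u = Complex x0 c" by (simp add: x0_def c_def)
  have c: "\<bar>c\<bar> \<le> 1/2" using u by (simp add: c_def)
  define I where "I = (LINT x|lborel. C * exp (- (\<sigma>/2) * x\<^sup>2))"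
  have f: "integrable lborel (\<lambda>x. phi \<sigma> \<epsilon> (Complex x c))"
    using dominated_fourier[OF line_measurable[OF phi_cont(1)] C[OF e c(1)]] by (auto simp: I_def)
  define F where "F t = (CLINT x|lborel. phi \<sigma> \<epsilon> (Complex x c) * iexp (t * x))" for t
  have Fa: "F t = 2 * pi * (phi_fourier \<sigma> \<epsilon> t * complex_of_real (exp (t * c)))" for t
    by (simp only: phi_fourier_shift[OF c] F_def) simp
  have I0: "I \<ge> 0" unfolding I_def
    by (rule Bochner_Integration.integral_nonneg) (use C[OF e c] norm_ge_zero order_trans in blast)
  have fin: "cmod (phi_fourier \<sigma> \<epsilon> t * complex_of_real (exp (t * c))) \<le> I * inverse (1 + t\<^sup>2)" for t
  proof -
    have "t * c \<le> \<bar>t\<bar> * \<bar>c\<bar>" by (metis abs_ge_self abs_mult)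
    also have "\<dots> \<le> \<bar>t\<bar> * (1/2)" using c by (intro mult_left_mono) auto
    finally have "exp (t * c) \<le> exp (\<bar>t\<bar>/2)" by simp
    have "cmod (phi_fourier \<sigma> \<epsilon> t * complex_of_real (exp (t * c))) = cmod (phi_fourier \<sigma> \<epsilon> t) * exp (t * c)"
      by (simp add: norm_mult del: of_real_exp)
    also have "\<dots> \<le> (I * (exp (- (\<bar>t\<bar>/2)) * inverse (1 + t\<^sup>2))) * exp (\<bar>t\<bar>/2)"
      using phi_fourier_decay[of t] I0 \<open>exp (t * c) \<le> exp (\<bar>t\<bar>/2)\<close> unfolding I_def[symmetric] by (intro mult_mono) auto
    also have "\<dots> = I * inverse (1 + t\<^sup>2) * (exp (- (\<bar>t\<bar>/2)) * exp (\<bar>t\<bar>/2))" by (simp only: mult_ac)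
    finally show ?thesis by (simp add: exp_add[symmetric])
  qed
  have ai: "integrable lborel (\<lambda>t. phi_fourier \<sigma> \<epsilon> t * complex_of_real (exp (t * c)))"
  proof (rule Bochner_Integration.integrable_bound[OF integrable_mult_right[OF inverse_integrable, of I]])
    show "(\<lambda>t. phi_fourier \<sigma> \<epsilon> t * complex_of_real (exp (t * c))) \<in> borel_measurable lborel"
      using phi_fourier_measurable by measurable
    show "AE t in lborel. norm (phi_fourier \<sigma> \<epsilon> t * complex_of_real (exp (t * c))) \<le> norm (I * inverse (1 + t\<^sup>2))"
      using fin by (intro AE_I2) (auto intro: order_trans[OF _ abs_ge_self])
  qed
  have split: "exp (- \<i> * t * u) = complex_of_real (exp (t * c)) * iexp (- t * x0)" for t :: real
    by (simp add: uc Complex_eq exp_add[symmetric] algebra_simps flip: exp_of_real)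
  have eq: "phi_fourier \<sigma> \<epsilon> t * exp (- \<i> * t * u) = (phi_fourier \<sigma> \<epsilon> t * complex_of_real (exp (t * c))) * iexp (- t * x0)" for t
    unfolding split by (simp only: mult.assoc)
  show "integrable lborel (\<lambda>t. phi_fourier \<sigma> \<epsilon> t * exp (- \<i> * t * u))"
    unfolding eq by (rule Bochner_Integration.integrable_bound[OF integrable_norm[OF ai]])
      (use phi_fourier_measurable in \<open>auto simp: norm_mult\<close>)
  have "(CLINT t|lborel. F t * iexp (- t * x0)) = 2 * pi * phi \<sigma> \<epsilon> (Complex x0 c)"
    unfolding F_def
  proof (rule fourier_inversion[OF f])
    show "cmod (phi \<sigma> \<epsilon> (Complex x c)) \<le> C" for x
    proof -
      have "0 \<le> C * exp (- (\<sigma>/2) * 0\<^sup>2)" using C[OF e c, of 0] norm_ge_zero order_trans by blast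
      then have "0 \<le> C" by simp
      moreover have "exp (- (\<sigma>/2) * x\<^sup>2) \<le> 1" using \<sigma> by simp
      ultimately show ?thesis using C[OF e c, of x] mult_left_le order_trans by blast
    qed
    have "continuous_on UNIV (\<lambda>x. phi \<sigma> \<epsilon> (Complex x c))"
      unfolding Complex_eq by (intro continuous_on_compose2[OF phi_cont(1)]) (auto intro!: continuous_intros)
    then show "isCont (\<lambda>x. phi \<sigma> \<epsilon> (Complex x c)) x0" by (simp add: continuous_on_eq_continuous_at)
    show "integrable lborel (\<lambda>t. CLINT x|lborel. phi \<sigma> \<epsilon> (Complex x c) * iexp (t * x))"
      unfolding F_def[symmetric] Fa using ai by (intro integrable_mult_right)
  qed
  moreover have "F t * iexp (- t * x0) = 2 * pi * (phi_fourier \<sigma> \<epsilon> t * exp (- \<i> * t * u))" for t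
    unfolding Fa eq by (simp only: mult.assoc)
  ultimately have "2 * pi * (CLINT t|lborel. phi_fourier \<sigma> \<epsilon> t * exp (- \<i> * t * u)) = 2 * pi * phi \<sigma> \<epsilon> (Complex x0 c)"
    by (simp only: integral_mult_right_zero)
  then show "(CLINT t|lborel. phi_fourier \<sigma> \<epsilon> t * exp (- \<i> * t * u)) = phi \<sigma> \<epsilon> u"
    by (simp add: uc)
qed

end

lemma phi_fourier_tendsto:
  "(\<lambda>n. phi_fourier \<sigma> (1 / real (Suc n)) t) \<longlonglongrightarrow> phi_fourier \<sigma> 0 t"
proof -
  let ?e = "\<lambda>n. 1 / real (Suc n)"
  have c0: "\<bar>0::real\<bar> \<le> 1/2" by simp
  have "(\<lambda>n. CLINT x|lborel. phi \<sigma> (?e n) (of_real x) * iexp (t * x)) \<longlonglongrightarrow> (CLINT x|lborel. phi \<sigma> 0 (of_real x) * iexp (t * x))"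
  proof (rule integral_dominated_convergence[where w = "\<lambda>x. C * exp (- (\<sigma>/2) * x\<^sup>2)"])
    have m [measurable]: "(\<lambda>x. phi \<sigma> \<epsilon> (of_real x)) \<in> borel_measurable borel" for \<epsilon>
      using line_measurable[OF phi_cont(1), where c = 0] by (simp add: complex_of_real_def[symmetric])
    show "(\<lambda>x. phi \<sigma> 0 (of_real x) * iexp (t * x)) \<in> borel_measurable lborel"
      "(\<lambda>x. phi \<sigma> (?e n) (of_real x) * iexp (t * x)) \<in> borel_measurable lborel" for n by measurable
    show "integrable lborel (\<lambda>x. C * exp (- (\<sigma>/2) * x\<^sup>2))" by (rule dominator_integrable)
    show "AE x in lborel. (\<lambda>n. phi \<sigma> (?e n) (of_real x) * iexp (t * x)) \<longlonglongrightarrow> phi \<sigma> 0 (of_real x) * iexp (t * x)"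
    proof (rule AE_I2)
      fix x :: real
      have el: "?e \<longlonglongrightarrow> 0" by real_asymp
      have "(\<lambda>n. exp (- (\<sigma> * (complex_of_real x)\<^sup>2) - complex_of_real (?e n) * exp (pi * complex_of_real x)) * iexp (t * x))
        \<longlonglongrightarrow> exp (- (\<sigma> * (complex_of_real x)\<^sup>2) - complex_of_real 0 * exp (pi * complex_of_real x)) * iexp (t * x)"
        by (intro tendsto_intros el)
      then show "(\<lambda>n. phi \<sigma> (?e n) (of_real x) * iexp (t * x)) \<longlonglongrightarrow> phi \<sigma> 0 (of_real x) * iexp (t * x)"
        by (simp only: phi_def)
    qed
    show "AE x in lborel. norm (phi \<sigma> (?e n) (of_real x) * iexp (t * x)) \<le> C * exp (- (\<sigma>/2) * x\<^sup>2)" for n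
      using C[of "?e n" 0] by (intro AE_I2) (simp add: norm_mult complex_of_real_def[symmetric])
  qed
  then show ?thesis unfolding phi_fourier_def by (intro tendsto_mult_left)
qed

end

text \<open>For \<epsilon> = 0 the transform is the normal density of standard deviation b;
  shrinking \<sigma> = b^2/2 therefore contracts the element in the t direction.\<close>

lemma phi_fourier_gauss:
  assumes b: "b > 0"
  shows "phi_fourier (b\<^sup>2 / 2) 0 t = std_normal_density (t / b) / b"
proof -
  have "phi_fourier (b\<^sup>2 / 2) 0 t = (1 / (2 * pi)) * (CLINT x|lborel. complex_of_real (exp (- (b\<^sup>2/2) * x\<^sup>2)) * iexp (t * x))"
    unfolding phi_fourier_def phi_def by (simp flip: exp_of_real)
  also have "\<dots> = (1 / (2 * pi)) * complex_of_real (sqrt (pi / (b\<^sup>2 / 2)) * exp (- t\<^sup>2 / (4 * (b\<^sup>2 / 2))))"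
    using b by (subst gauss_fourier(2)) auto
  also have "\<dots> = complex_of_real ((1 / (2 * pi)) * (sqrt (pi / (b\<^sup>2 / 2)) * exp (- t\<^sup>2 / (4 * (b\<^sup>2 / 2)))))"
    by simp
  also have "(1 / (2 * pi)) * (sqrt (pi / (b\<^sup>2 / 2)) * exp (- t\<^sup>2 / (4 * (b\<^sup>2 / 2)))) = std_normal_density (t / b) / b"
  proof -
    have "sqrt (pi / (b\<^sup>2 / 2)) = sqrt (2 * pi) / b"
      using b by (simp add: real_sqrt_divide real_sqrt_mult)
    moreover have "2 * pi = sqrt (2 * pi) * sqrt (2 * pi)" by simp
    moreover have "exp (- t\<^sup>2 / (4 * (b\<^sup>2 / 2))) = exp (- (t / b)\<^sup>2 / 2)"
      using b by (simp add: power_divide)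
    moreover have "sqrt (2 * pi) > 0" by simp
    moreover have "(1 / (S * S)) * (S / b * E) = 1 / S * E / b" if "S > 0" for S E :: real
      using that b by (simp add: field_simps)
    ultimately show ?thesis
      unfolding std_normal_density_def by metis
  qed
  finally show ?thesis .
qed

section \<open>The Gaussian coefficient of the Schroedinger representation\<close>

definition gaussian :: "real \<Rightarrow> complex" where
  "gaussian v = of_real (exp (- (1/2) * v\<^sup>2))"

text \<open>The Heisenberg group acts with central character exp (i z), and t acts by the unitary
  dilation exp (t/2) f (exp t v).\<close>

definition schroedinger :: "r4 \<Rightarrow> (real \<Rightarrow> complex) \<Rightarrow> real \<Rightarrow> complex" where
  "schroedinger p f v = (case p of (x, y, z, t) \<Rightarrow> of_real (exp (t/2)) * iexp (z + y * v) * f (exp t * (v + x)))"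

text \<open>The transpose of the operator for the bilinear pairing \<integral> f g, without
  conjugation.\<close>

definition schroedinger_dual :: "r4 \<Rightarrow> (real \<Rightarrow> complex) \<Rightarrow> real \<Rightarrow> complex" where
  "schroedinger_dual p f v = (case p of (x, y, z, t) \<Rightarrow>
     of_real (exp (- t/2)) * iexp (z + y * (exp (- t) * v - x)) * f (exp (- t) * v - x))"

lemma schroedinger_mult: "schroedinger (p \<cdot> q) f = schroedinger p (schroedinger q f)"
proof
  fix v
  obtain x y z t where p: "p = (x, y, z, t)" by (cases p)
  obtain x' y' z' t' where q: "q = (x', y', z', t')" by (cases q)
  have e1: "exp (t + t') * (v + (x + exp (- t) * x')) = exp t' * (exp t * (v + x) + x')"
    by (simp add: exp_add exp_minus algebra_simps)
  have e2: "z + z' + x * (exp t * y') + (y + exp t * y') * v = (z + y * v) + (z' + y' * (exp t * (v + x)))"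
    by (simp add: algebra_simps)
  have e3: "exp ((t + t') / 2) = exp (t/2) * exp (t'/2)" by (simp add: exp_add[symmetric] add_divide_distrib)
  have e4: "iexp (r + s) = iexp r * iexp s" for r s :: real by (simp add: exp_add[symmetric] algebra_simps)
  have "schroedinger (p \<cdot> q) f v = of_real (exp ((t + t') / 2)) * iexp (z + z' + x * (exp t * y') + (y + exp t * y') * v) *
      f (exp (t + t') * (v + (x + exp (- t) * x')))"
    by (simp only: p q gmul_simp schroedinger_def prod.case)
  also have "\<dots> = (of_real (exp (t/2)) * of_real (exp (t'/2))) * (iexp (z + y * v) * iexp (z' + y' * (exp t * (v + x)))) *
      f (exp t' * (exp t * (v + x) + x'))"
    unfolding e1 e2 e3 e4 of_real_mult ..
  also have "\<dots> = schroedinger p (schroedinger q f) v"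
    by (simp only: p q schroedinger_def prod.case mult_ac)
  finally show "schroedinger (p \<cdot> q) f v = schroedinger p (schroedinger q f) v" .
qed

lemma schroedinger_dual_integral:
  assumes f [measurable]: "f \<in> borel_measurable borel" and g [measurable]: "g \<in> borel_measurable borel"
  shows "(CLINT v|lborel. f v * schroedinger p g v) = (CLINT v|lborel. schroedinger_dual p f v * g v)"
proof -
  obtain x y z t where p: "p = (x, y, z, t)" by (cases p)
  have "(CLINT v|lborel. f v * schroedinger p g v) = \<bar>exp (- t)\<bar> *\<^sub>R (CLINT v|lborel. f (- x + exp (- t) * v) * schroedinger p g (- x + exp (- t) * v))"
    by (rule lborel_integral_real_affine) simp
  also have "\<dots> = (CLINT v|lborel. exp (- t) *\<^sub>R (f (- x + exp (- t) * v) * schroedinger p g (- x + exp (- t) * v)))"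
    by simp
  also have "\<dots> = (CLINT v|lborel. schroedinger_dual p f v * g v)"
  proof (rule Bochner_Integration.integral_cong)
    fix v
    have e: "exp (- t) * exp (t/2) = exp (- t/2)" by (simp add: exp_add[symmetric])
    have a: "exp t * (- x + exp (- t) * v + x) = v" by (simp add: exp_minus)
    have b: "- x + exp (- t) * v = exp (- t) * v - x" by simp
    have "exp (- t) *\<^sub>R (f (- x + exp (- t) * v) * schroedinger p g (- x + exp (- t) * v))
      = of_real (exp (- t) * exp (t/2)) * iexp (z + y * (- x + exp (- t) * v)) * f (- x + exp (- t) * v) * g v"
      unfolding schroedinger_def p prod.case a scaleR_conv_of_real of_real_mult by (simp only: mult_ac)
    then show "exp (- t) *\<^sub>R (f (- x + exp (- t) * v) * schroedinger p g (- x + exp (- t) * v)) = schroedinger_dual p f v * g v"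
      by (simp only: e b schroedinger_dual_def p prod.case)
  qed simp
  finally show ?thesis .
qed

text \<open>The weights exp (2t) / (1 + exp (2t)) and 1 / (1 + exp (2t)), with sum 1, that appear
  when the square is completed in the overlap of Gaussians of widths 1 and exp (-t).\<close>

definition kp :: "real \<Rightarrow> real" where "kp t = exp t / (2 * cosh t)"
definition kq :: "real \<Rightarrow> real" where "kq t = exp (- t) / (2 * cosh t)"

lemma kp_pos: "kp t > 0" "kq t > 0"
  by (simp_all add: kp_def kq_def cosh_real_pos)

definition kap0 :: "r4 \<Rightarrow> complex" where
  "kap0 p = (case p of (x, y, z, t) \<Rightarrow>
     of_real (exp (- (kp t * x\<^sup>2 + kq t * y\<^sup>2) / 2) / sqrt (cosh t)) * iexp (z - kp t * x * y))"

text \<open>A Gaussian Fourier integral after completing the square; sqrt pi is the square of the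
  L^2 norm of \<open>gaussian\<close>.\<close>

lemma kap0_integral:
  "(CLINT v|lborel. gaussian v * schroedinger p gaussian v) = sqrt pi * kap0 p"
proof -
  obtain x y z t where p: "p = (x, y, z, t)" by (cases p)
  define A where "A = 1 + exp t * exp t"
  have A: "A > 0" by (simp add: A_def add_pos_pos)
  have Ac: "A = 2 * cosh t * exp t"
    by (simp add: A_def cosh_field_def field_simps exp_minus)
  have kpA: "kp t = exp t * exp t / A" and kqA: "kq t = 1 / A"
    unfolding kp_def kq_def Ac using cosh_real_pos[of t] by (simp_all add: exp_minus field_simps)
  have kA: "kp t + kq t = 1" unfolding kpA kqA using A by (simp add: add_divide_distrib[symmetric]) (simp add: A_def)
  \<comment> \<open>The exponent v^2 + exp (2t) (v + x)^2 has its minimum at v = - k, which becomes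
    the new origin.\<close>
  define k where "k = kp t * x"
  let ?F = "\<lambda>v. gaussian v * schroedinger p gaussian v"
  have "(CLINT v|lborel. ?F v) = (CLINT v|lborel. ?F (- k + 1 * v))"
  proof -
    have "(CLINT v|lborel. ?F v) = \<bar>1\<bar> *\<^sub>R (CLINT v|lborel. ?F (- k + 1 * v))"
      by (rule lborel_integral_real_affine) simp
    then show ?thesis by simp
  qed
  also have "\<dots> = (CLINT v|lborel. (of_real (exp (t/2) * exp (- (kp t * x\<^sup>2) / 2)) * iexp (z - kp t * x * y)) * (of_real (exp (- (A/2) * v\<^sup>2)) * iexp (y * v)))"
  proof (rule Bochner_Integration.integral_cong)
    fix v :: real
    have q: "- (1/2) * (- k + 1 * v)\<^sup>2 + - (1/2) * (exp t * (- k + 1 * v + x))\<^sup>2 = - (kp t * x\<^sup>2) / 2 + - (A/2) * v\<^sup>2"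
    proof -
      have T: "exp t * exp t = A - 1" by (simp add: A_def)
      have kA': "A * k = (A - 1) * x" using A unfolding k_def kpA T by simp
      have "(- k + v)\<^sup>2 + (exp t * (- k + v + x))\<^sup>2 = (- k + v)\<^sup>2 + (A - 1) * (- k + v + x)\<^sup>2"
        unfolding T[symmetric] by (simp add: power2_eq_square algebra_simps)
      also have "\<dots> = A * v\<^sup>2 + 2 * v * ((A - 1) * x - A * k) + A * k * k - 2 * (A - 1) * x * k + (A - 1) * x\<^sup>2"
        by (simp add: power2_eq_square algebra_simps)
      also have "\<dots> = A * v\<^sup>2 + (A - 1) * x * (x - k)"
        unfolding kA' by (simp add: power2_eq_square algebra_simps)
      also have "(A - 1) * x * (x - k) = kp t * x\<^sup>2"
      proof -
        have "x - k = kq t * x" unfolding k_def using kA by (simp add: algebra_simps) (metis add_diff_cancel_left' distrib_right mult.commute mult_1)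
        then show ?thesis unfolding kpA kqA T by (simp add: power2_eq_square)
      qed
      finally show ?thesis by simp
    qed
    have e4: "iexp (z + y * (- k + 1 * v)) = iexp (z - kp t * x * y) * iexp (y * v)"
      by (simp add: k_def exp_add[symmetric] algebra_simps)
    have "?F (- k + 1 * v) = of_real (exp (t/2) * (exp (- (1/2) * (- k + 1 * v)\<^sup>2) * exp (- (1/2) * (exp t * (- k + 1 * v + x))\<^sup>2))) * iexp (z + y * (- k + 1 * v))"
      by (simp only: p schroedinger_def prod.case gaussian_def of_real_mult mult_ac)
    also have "exp (- (1/2) * (- k + 1 * v)\<^sup>2) * exp (- (1/2) * (exp t * (- k + 1 * v + x))\<^sup>2) = exp (- (kp t * x\<^sup>2) / 2) * exp (- (A/2) * v\<^sup>2)"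
      by (simp only: exp_add[symmetric] q)
    finally show "?F (- k + 1 * v) = (of_real (exp (t/2) * exp (- (kp t * x\<^sup>2) / 2)) * iexp (z - kp t * x * y)) * (of_real (exp (- (A/2) * v\<^sup>2)) * iexp (y * v))"
      by (simp only: e4 of_real_mult mult_ac)
  qed simp
  also have "\<dots> = (of_real (exp (t/2) * exp (- (kp t * x\<^sup>2) / 2)) * iexp (z - kp t * x * y)) * of_real (sqrt (pi / (A/2)) * exp (- y\<^sup>2 / (4 * (A/2))))"
    using A by (subst integral_mult_right_zero, subst gauss_fourier(2)) auto
  also have "\<dots> = of_real (exp (t/2) * sqrt (pi / (A/2)) * (exp (- (kp t * x\<^sup>2) / 2) * exp (- y\<^sup>2 / (4 * (A/2))))) * iexp (z - kp t * x * y)"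
    by (simp only: of_real_mult mult_ac)
  also have "exp (t/2) * sqrt (pi / (A/2)) = sqrt pi / sqrt (cosh t)"
  proof -
    have "exp (t/2) = sqrt (exp t)"
      by (rule real_sqrt_unique[symmetric]) (simp_all add: power2_eq_square exp_add[symmetric])
    then have "exp (t/2) * sqrt (pi / (A/2)) = sqrt (exp t * (pi / (A/2)))" by (simp only: real_sqrt_mult)
    also have "exp t * (pi / (A/2)) = pi / cosh t" unfolding Ac by simp
    finally show ?thesis by (simp add: real_sqrt_divide)
  qed
  also have "exp (- (kp t * x\<^sup>2) / 2) * exp (- y\<^sup>2 / (4 * (A/2))) = exp (- (kp t * x\<^sup>2 + kq t * y\<^sup>2) / 2)"
    unfolding kqA exp_add[symmetric] using A by (simp add: field_simps)
  finally show ?thesis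
    by (simp add: p kap0_def)
qed

lemma sqrt_cosh_bounds:
  fixes t :: real
  shows "1 / sqrt (cosh t) \<le> sqrt 2 * exp (- (\<bar>t\<bar>/2))" "sqrt (cosh t) \<le> exp (\<bar>t\<bar>/2)"
proof -
  have s: "sqrt (exp \<bar>t\<bar>) = exp (\<bar>t\<bar>/2)"
    by (rule real_sqrt_unique) (simp_all add: power2_eq_square exp_add[symmetric])
  have c: "exp \<bar>t\<bar> / 2 \<le> cosh t" "cosh t \<le> exp \<bar>t\<bar>"
    by (auto simp: cosh_field_def abs_if)
  have "sqrt (exp \<bar>t\<bar> / 2) \<le> sqrt (cosh t)" using c(1) by (rule real_sqrt_le_mono)
  then have "1 / sqrt (cosh t) \<le> 1 / (exp (\<bar>t\<bar>/2) / sqrt 2)"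
    by (intro divide_left_mono) (auto simp: real_sqrt_divide s cosh_real_pos)
  then show "1 / sqrt (cosh t) \<le> sqrt 2 * exp (- (\<bar>t\<bar>/2))" by (simp add: exp_minus field_simps)
  show "sqrt (cosh t) \<le> exp (\<bar>t\<bar>/2)" using real_sqrt_le_mono[OF c(2)] s by simp
qed

text \<open>The branch of the logarithm turns \<open>Re w > 0\<close> into the strip where the growth of \<open>chi w\<close> is compensated by the
  factor \<open>1 / sqrt (cosh t)\<close> of \<open>kap0\<close>.\<close>

definition chi :: "complex \<Rightarrow> real \<Rightarrow> complex" where
  "chi w t = exp (- \<i> * t * (Ln w / pi))"

definition kap :: "complex \<Rightarrow> r4 \<Rightarrow> complex" where
  "kap w p = chi w (snd (snd (snd p))) * kap0 p"

lemma chi_add: "chi w (s + t) = chi w s * chi w t"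
  by (simp add: chi_def exp_add[symmetric] algebra_simps)

lemma Im_Ln_pi:
  assumes "Re w > 0" shows "\<bar>Im (Ln w / pi)\<bar> \<le> 1/2"
proof -
  have "w \<noteq> 0" using assms by auto
  then have "\<bar>Im (Ln w)\<bar> < pi / 2" using assms Re_Ln_pos_lt by blast
  then have "\<bar>Im (Ln w)\<bar> / pi \<le> (pi / 2) / pi" by (intro divide_right_mono) auto
  moreover have "\<bar>Im (Ln w / complex_of_real pi)\<bar> = \<bar>Im (Ln w)\<bar> / pi"
    by (simp only: Im_divide_of_real abs_divide abs_of_pos[OF pi_gt_zero])
  ultimately show ?thesis by simp
qed

lemma chi_norm:
  assumes "Re w > 0" shows "cmod (chi w t) \<le> exp (\<bar>t\<bar>/2)"
proof -
  have "cmod (chi w t) = exp (t * Im (Ln w / pi))" by (simp add: chi_def)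
  also have "t * Im (Ln w / pi) \<le> \<bar>t\<bar> * \<bar>Im (Ln w / pi)\<bar>" by (metis abs_ge_self abs_mult)
  also have "\<dots> \<le> \<bar>t\<bar> * (1/2)" by (intro mult_left_mono Im_Ln_pi assms) auto
  finally show ?thesis by simp
qed

lemma kap0_norm: "cmod (kap0 (x, y, z, t)) = exp (- (kp t * x\<^sup>2 + kq t * y\<^sup>2) / 2) / sqrt (cosh t)"
proof -
  have "0 \<le> exp (- (kp t * x\<^sup>2 + kq t * y\<^sup>2) / 2) / sqrt (cosh t)" by (simp add: cosh_real_nonneg)
  then show ?thesis
    by (simp only: kap0_def prod.case norm_mult norm_of_real norm_exp_i_times abs_of_nonneg mult_1_right)
qed

lemma kap_norm:
  assumes "Re w > 0" shows "cmod (kap w p) \<le> sqrt 2"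
proof -
  obtain x y z t where p: "p = (x, y, z, t)" by (cases p)
  have n: "0 \<le> kp t * x\<^sup>2 + kq t * y\<^sup>2"
    using kp_pos[of t] by (intro add_nonneg_nonneg mult_nonneg_nonneg) auto
  then have e1: "exp (- (kp t * x\<^sup>2 + kq t * y\<^sup>2) / 2) \<le> 1"
    by (simp only: exp_le_one_iff divide_le_0_iff neg_le_0_iff_le) simp
  have "cmod (kap w p) = cmod (chi w t) * (exp (- (kp t * x\<^sup>2 + kq t * y\<^sup>2) / 2) * (1 / sqrt (cosh t)))"
    by (simp add: kap_def p norm_mult kap0_norm)
  also have "\<dots> \<le> exp (\<bar>t\<bar>/2) * (1 * (sqrt 2 * exp (- (\<bar>t\<bar>/2))))"
    by (intro mult_mono chi_norm assms sqrt_cosh_bounds e1) (simp_all add: cosh_real_nonneg)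
  also have "\<dots> = sqrt 2 * (exp (\<bar>t\<bar>/2) * exp (- (\<bar>t\<bar>/2)))" by (simp only: mult_1_left mult_ac)
  also have "\<dots> = sqrt 2" by (simp add: exp_add[symmetric])
  finally show ?thesis .
qed

lemma kap_schroedinger: "kap w p = chi w (snd (snd (snd p))) * (of_real (1 / sqrt pi) * (CLINT v|lborel. gaussian v * schroedinger p gaussian v))"
proof -
  have "complex_of_real (1 / sqrt pi) * of_real (sqrt pi) = 1"
    by (simp only: of_real_mult[symmetric]) simp
  then have "complex_of_real (1 / sqrt pi) * (of_real (sqrt pi) * kap0 p) = kap0 p"
    by (simp only: mult.assoc[symmetric] mult_1_left)
  then show ?thesis by (simp only: kap_def kap0_integral)
qed

lemma continuous_on_kp [continuous_intros]:
  "continuous_on S f \<Longrightarrow> continuous_on S (\<lambda>x. kp (f x))" "continuous_on S f \<Longrightarrow> continuous_on S (\<lambda>x. kq (f x))"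
  unfolding kp_def kq_def by (intro continuous_intros; simp add: cosh_real_pos less_imp_neq[symmetric])+

lemma continuous_on_kap0: "continuous_on S kap0"
  unfolding kap0_def[abs_def] case_prod_unfold
  by (intro continuous_intros; simp add: cosh_real_pos less_imp_neq[symmetric])

lemma measurable_kap0 [measurable]: "kap0 \<in> borel_measurable borel"
  by (intro borel_measurable_continuous_onI continuous_on_kap0)

lemma measurable_chi [measurable]: "chi w \<in> borel_measurable borel"
  unfolding chi_def[abs_def] by (intro borel_measurable_continuous_onI continuous_intros)

lemma measurable_kap [measurable]: "kap w \<in> borel_measurable borel"
proof -
  have "(\<lambda>p::r4. snd (snd (snd p))) \<in> borel_measurable borel"
    by (intro borel_measurable_continuous_onI continuous_intros)
  from measurable_compose[OF this measurable_chi] show ?thesis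
    unfolding kap_def[abs_def] by measurable
qed

section \<open>Fubini with the x, y plane as inner integral\<close>

lemma measurable_cut:
  fixes f :: "'a::euclidean_space \<times> 'b::euclidean_space \<times> 'c::euclidean_space \<Rightarrow> 'd::topological_space"
  assumes "f \<in> borel_measurable borel"
  shows "(\<lambda>r. f (fst r, snd r, q)) \<in> borel_measurable borel"
  by (rule measurable_compose[OF _ assms]) (intro borel_measurable_continuous_onI continuous_intros)

lemma nn_integral_split4:
  fixes f :: "r4 \<Rightarrow> ennreal"
  assumes [measurable]: "f \<in> borel_measurable borel"
  shows "(\<integral>\<^sup>+p. f p \<partial>lborel) = (\<integral>\<^sup>+q. \<integral>\<^sup>+r. f (fst r, snd r, q) \<partial>lborel \<partial>lborel)"
proof -
  have *: "(\<integral>\<^sup>+p. g p \<partial>lborel) = (\<integral>\<^sup>+x. \<integral>\<^sup>+q. g (x, q) \<partial>lborel \<partial>lborel)"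
    if [measurable]: "g \<in> borel_measurable borel" for g :: "'c::euclidean_space \<times> 'd::euclidean_space \<Rightarrow> ennreal"
    by (subst lborel_prod[symmetric], subst lborel.nn_integral_fst[symmetric]) (auto simp: lborel_prod)
  have "(\<integral>\<^sup>+p. f p \<partial>lborel) = (\<integral>\<^sup>+x. \<integral>\<^sup>+s. f (x, s) \<partial>lborel \<partial>lborel)"
    by (rule *) simp
  also have "\<dots> = (\<integral>\<^sup>+x. \<integral>\<^sup>+y. \<integral>\<^sup>+q. f (x, y, q) \<partial>lborel \<partial>lborel \<partial>lborel)"
    by (intro nn_integral_cong *) simp
  also have "\<dots> = (\<integral>\<^sup>+x. \<integral>\<^sup>+q. \<integral>\<^sup>+y. f (x, y, q) \<partial>lborel \<partial>lborel \<partial>lborel)"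
    by (intro nn_integral_cong lborel_pair.Fubini') simp
  also have "\<dots> = (\<integral>\<^sup>+q. \<integral>\<^sup>+x. \<integral>\<^sup>+y. f (x, y, q) \<partial>lborel \<partial>lborel \<partial>lborel)"
    by (rule lborel_pair.Fubini') simp
  also have "\<dots> = (\<integral>\<^sup>+q. \<integral>\<^sup>+r. f (fst r, snd r, q) \<partial>lborel \<partial>lborel)"
    by (intro nn_integral_cong, subst *) (simp_all add: measurable_cut)
  finally show ?thesis .
qed

text \<open>Brings z, t to the front, so that the product theorems integrate over x, y for fixed z,
  t.\<close>

definition mix :: "(real \<times> real) \<times> (real \<times> real) \<Rightarrow> r4" where
  "mix p = (fst (snd p), snd (snd p), fst p)"

lemma measurable_mix [measurable]: "mix \<in> borel_measurable borel"
  unfolding mix_def by (intro borel_measurable_continuous_onI continuous_intros)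

lemma distr_mix: "distr (lborel \<Otimes>\<^sub>M lborel) borel mix = lborel"
proof (rule measure_eqI)
  fix A assume "A \<in> sets (distr (lborel \<Otimes>\<^sub>M lborel) borel mix)"
  then have [measurable]: "A \<in> sets borel" by simp
  have [measurable]: "mix \<in> (lborel \<Otimes>\<^sub>M lborel) \<rightarrow>\<^sub>M borel" by (simp add: lborel_prod)
  have "emeasure (distr (lborel \<Otimes>\<^sub>M lborel) borel mix) A = (\<integral>\<^sup>+p. indicator A p \<partial>distr (lborel \<Otimes>\<^sub>M lborel) borel mix)"
    by simp
  also have "\<dots> = (\<integral>\<^sup>+p. indicator A (mix p) \<partial>(lborel \<Otimes>\<^sub>M lborel))"
    by (rule nn_integral_distr) simp_all
  also have "\<dots> = (\<integral>\<^sup>+q. \<integral>\<^sup>+r. indicator A (mix (q, r)) \<partial>lborel \<partial>lborel)"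
    by (rule lborel.nn_integral_fst[symmetric]) simp
  also have "\<dots> = (\<integral>\<^sup>+p. indicator A p \<partial>lborel)"
    unfolding mix_def fst_conv snd_conv by (rule nn_integral_split4[symmetric]) simp
  also have "\<dots> = emeasure lborel A" by simp
  finally show "emeasure (distr (lborel \<Otimes>\<^sub>M lborel) borel mix) A = emeasure lborel A" .
qed simp

lemma integrable_split4:
  fixes F :: "r4 \<Rightarrow> complex"
  assumes m [measurable]: "F \<in> borel_measurable borel"
    and i: "\<And>q. integrable lborel (\<lambda>r. F (fst r, snd r, q))"
    and n: "integrable lborel (\<lambda>q. LINT r|lborel. cmod (F (fst r, snd r, q)))"
  shows "integrable lborel F"
proof -
  have mm [measurable]: "mix \<in> (lborel \<Otimes>\<^sub>M lborel) \<rightarrow>\<^sub>M borel" by (simp add: lborel_prod)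
  have "integrable (lborel \<Otimes>\<^sub>M lborel) (\<lambda>p. F (mix p))"
  proof (rule lborel_pair.Fubini_integrable)
    show "integrable lborel (\<lambda>q. LINT r|lborel. norm (F (mix (q, r))))"
      using n by (simp add: mix_def)
    show "AE q in lborel. integrable lborel (\<lambda>r. F (mix (q, r)))"
      using i by (simp add: mix_def)
  qed simp
  then have "integrable (distr (lborel \<Otimes>\<^sub>M lborel) borel mix) F"
    by (subst integrable_distr_eq) simp_all
  then show ?thesis by (simp add: distr_mix)
qed

lemma integral_split4:
  fixes F :: "r4 \<Rightarrow> complex"
  assumes F: "integrable lborel F"
  shows "(LINT p|lborel. F p) = (LINT q|lborel. LINT r|lborel. F (fst r, snd r, q))"
proof -
  have [measurable]: "F \<in> borel_measurable borel" using F by auto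
  have mm [measurable]: "mix \<in> (lborel \<Otimes>\<^sub>M lborel) \<rightarrow>\<^sub>M borel" by (simp add: lborel_prod)
  have I: "integrable (lborel \<Otimes>\<^sub>M lborel) (\<lambda>p. F (mix p))"
    using F by (subst integrable_distr_eq[symmetric, where N = borel]) (simp_all add: distr_mix)
  have "(LINT p|lborel. F p) = (LINT p|(distr (lborel \<Otimes>\<^sub>M lborel) borel mix). F p)"
    by (simp only: distr_mix)
  also have "\<dots> = (LINT p|(lborel \<Otimes>\<^sub>M lborel). F (mix p))"
    by (rule integral_distr) simp_all
  also have "\<dots> = (LINT q|lborel. LINT r|lborel. F (mix (q, r)))"
    by (rule lborel_pair.integral_fst'[OF I, symmetric])
  finally show ?thesis by (simp only: mix_def fst_conv snd_conv)
qed

section \<open>Schur orthogonality and elements with rank one coefficients\<close>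

lemma gaussian_integrable: "integrable lborel gaussian"
  unfolding gaussian_def[abs_def] using gauss_fourier(1)[of "1/2"] by (intro integrable_of_real) simp

lemma gaussian_measurable [measurable]: "gaussian \<in> borel_measurable borel"
  using gaussian_integrable by auto

lemma gaussian_norm: "cmod (gaussian v) \<le> 1"
  by (simp add: gaussian_def)

lemma gaussian_cont: "continuous_on UNIV gaussian"
  unfolding gaussian_def[abs_def] by (intro continuous_intros)

lemma kap0_cnj: "cnj (kap0 (x, y, 0, t)) = kap0 (x, - y, 0, t)"
  by (simp add: kap0_def exp_cnj)

text \<open>The Gaussian integral over the plane is 2 pi / sqrt (kp kq) = 4 pi cosh t, and
  \<open>kap0\<close> carries the factor 1 / sqrt (cosh t). The remaining growth sqrt (cosh t)
  dictates the integrability required of the weights a in t.\<close>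

lemma kap0_plane_integrable:
  "integrable lborel (\<lambda>r. kap0 (fst r, snd r, 0, t))"
  "(LINT r|lborel. cmod (kap0 (fst r, snd r, 0, t))) = 4 * pi * sqrt (cosh t)"
proof -
  let ?gx = "\<lambda>x::real. complex_of_real (exp (- (kp t / 2) * x\<^sup>2))"
  let ?gy = "\<lambda>x::real. complex_of_real (exp (- (kq t / 2) * x\<^sup>2))"
  have k: "kp t / 2 > 0" "kq t / 2 > 0" using kp_pos[of t] by auto
  have ix: "integrable lborel ?gx" and iy: "integrable lborel ?gy"
    using gauss_fourier(1)[OF k(1)] gauss_fourier(1)[OF k(2)] by (auto intro: integrable_of_real)
  have vx: "(CLINT x|lborel. ?gx x) = sqrt (pi / (kp t / 2))" and vy: "(CLINT x|lborel. ?gy x) = sqrt (pi / (kq t / 2))"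
    using gauss_fourier(2)[OF k(1), of 0] gauss_fourier(2)[OF k(2), of 0] by simp_all
  note P = lborel_product[OF ix iy]
  have eq: "complex_of_real (cmod (kap0 (fst r, snd r, 0, t))) = (case r of (x, y) \<Rightarrow> ?gx x * ?gy y) * of_real (1 / sqrt (cosh t))" for r
  proof (cases r)
    case (Pair x y)
    have "cmod (kap0 (x, y, 0, t)) = (exp (- (kp t / 2) * x\<^sup>2) * exp (- (kq t / 2) * y\<^sup>2)) * (1 / sqrt (cosh t))"
      unfolding kap0_norm exp_add[symmetric] by (simp add: field_simps)
    then show ?thesis by (simp only: Pair fst_conv snd_conv prod.case of_real_mult)
  qed
  have I: "integrable lborel (\<lambda>r. complex_of_real (cmod (kap0 (fst r, snd r, 0, t))))"
    unfolding eq by (rule integrable_mult_left[OF P(1)])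
  have Ir: "integrable lborel (\<lambda>r. cmod (kap0 (fst r, snd r, 0, t)))"
    using integrable_norm[OF I] by simp
  show "integrable lborel (\<lambda>r. kap0 (fst r, snd r, 0, t))"
  proof (rule Bochner_Integration.integrable_bound[OF Ir])
    have "continuous_on UNIV (\<lambda>r::real\<times>real. kap0 (fst r, snd r, 0, t))"
      by (intro continuous_on_compose2[OF continuous_on_kap0]) (auto intro!: continuous_intros)
    then show "(\<lambda>r::real\<times>real. kap0 (fst r, snd r, 0, t)) \<in> borel_measurable lborel"
      by (simp add: borel_measurable_continuous_onI)
  qed simp
  have "complex_of_real (LINT r|lborel. cmod (kap0 (fst r, snd r, 0, t))) = (CLINT r|lborel. (case r of (x, y) \<Rightarrow> ?gx x * ?gy y) * of_real (1 / sqrt (cosh t)))"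
    unfolding integral_complex_of_real[symmetric] eq ..
  also have "\<dots> = (CLINT r|lborel. (case r of (x, y) \<Rightarrow> ?gx x * ?gy y)) * of_real (1 / sqrt (cosh t))"
    by (rule integral_mult_left_zero)
  also have "\<dots> = complex_of_real (sqrt (pi / (kp t / 2)) * sqrt (pi / (kq t / 2)) * (1 / sqrt (cosh t)))"
    unfolding P(2) vx vy by simp
  also have "sqrt (pi / (kp t / 2)) * sqrt (pi / (kq t / 2)) * (1 / sqrt (cosh t)) = 4 * pi * sqrt (cosh t)"
  proof -
    have c: "cosh t > 0" by (rule cosh_real_pos)
    have "kp t * kq t = 1 / (4 * (cosh t)\<^sup>2)" using c
      by (simp add: kp_def kq_def power2_eq_square exp_minus)
    then have "(pi / (kp t / 2)) * (pi / (kq t / 2)) = (4 * pi * cosh t)\<^sup>2"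
      using c kp_pos[of t] by (simp add: field_simps power2_eq_square)
    then have "sqrt (pi / (kp t / 2)) * sqrt (pi / (kq t / 2)) = 4 * pi * cosh t"
      using c by (simp only: real_sqrt_mult[symmetric]) simp
    then have "sqrt (pi / (kp t / 2)) * sqrt (pi / (kq t / 2)) * (1 / sqrt (cosh t)) = 4 * pi * (cosh t / sqrt (cosh t))"
      by (simp only:) simp
    also have "cosh t / sqrt (cosh t) = sqrt (cosh t)" using c by (simp add: real_div_sqrt)
    finally show ?thesis .
  qed
  finally show "(LINT r|lborel. cmod (kap0 (fst r, snd r, 0, t))) = 4 * pi * sqrt (cosh t)"
    by (simp only: of_real_eq_iff)
qed

text \<open>The conjugate coefficient in x, y is what Schur orthogonality asks for; the densities in
  z and t then determine a scalar factor for each w.\<close>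

definition elem :: "(real \<Rightarrow> complex) \<Rightarrow> (real \<Rightarrow> complex) \<Rightarrow> r4 \<Rightarrow> complex" where
  "elem \<alpha> a p = (case p of (x, y, z, t) \<Rightarrow> \<alpha> z * a t * cnj (kap0 (x, y, 0, t)))"

lemma elem_props:
  assumes \<alpha>: "integrable lborel \<alpha>" and a: "integrable lborel (\<lambda>t. a t * of_real (sqrt (cosh t)))"
    and am [measurable]: "a \<in> borel_measurable borel"
  shows "integrable lborel (elem \<alpha> a)"
    and "L1norm (elem \<alpha> a) = 4 * pi * (LINT z|lborel. cmod (\<alpha> z)) * (LINT t|lborel. cmod (a t) * sqrt (cosh t))"
proof -
  have [measurable]: "\<alpha> \<in> borel_measurable borel" using \<alpha> by auto
  have c0 [simp]: "0 \<le> sqrt (cosh t)" for t :: real by (simp add: cosh_real_nonneg)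
  have m: "elem \<alpha> a \<in> borel_measurable borel"
  proof -
    have k: "(\<lambda>p::r4. kap0 (fst p, fst (snd p), 0, snd (snd (snd p)))) \<in> borel_measurable borel"
      by (intro borel_measurable_continuous_onI continuous_on_compose2[OF continuous_on_kap0[of UNIV]])
        (auto intro!: continuous_intros)
    have f: "(\<lambda>p::r4. fst (snd (snd p))) \<in> borel_measurable borel" "(\<lambda>p::r4. snd (snd (snd p))) \<in> borel_measurable borel"
      by (intro borel_measurable_continuous_onI continuous_intros)+
    have k': "(\<lambda>p::r4. cnj (kap0 (fst p, fst (snd p), 0, snd (snd (snd p))))) \<in> borel_measurable borel"
      by (rule measurable_compose[OF k]) (intro borel_measurable_continuous_onI continuous_intros)
    have "(\<lambda>p::r4. \<alpha> (fst (snd (snd p)))) \<in> borel_measurable borel" "(\<lambda>p::r4. a (snd (snd (snd p)))) \<in> borel_measurable borel"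
      using measurable_compose[OF f(1), of \<alpha>] measurable_compose[OF f(2) am] by simp_all
    with k' show ?thesis
      unfolding elem_def[abs_def] case_prod_unfold by (intro borel_measurable_times)
  qed
  have n: "(LINT r|lborel. cmod (elem \<alpha> a (fst r, snd r, q))) = 4 * pi * (cmod (\<alpha> (fst q)) * (cmod (a (snd q)) * sqrt (cosh (snd q))))" for q
    by (cases q) (simp add: elem_def norm_mult kap0_plane_integrable(2))
  have i: "integrable lborel (\<lambda>r. elem \<alpha> a (fst r, snd r, q))" for q
    by (cases q) (simp add: elem_def kap0_plane_integrable(1))
  note P = lborel_product[OF integrable_of_real[OF integrable_norm[OF \<alpha>]] integrable_of_real[OF integrable_norm[OF a]]]
  have eq: "complex_of_real (cmod (\<alpha> (fst q)) * (cmod (a (snd q)) * sqrt (cosh (snd q))))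
      = (case q of (z, t) \<Rightarrow> complex_of_real (cmod (\<alpha> z)) * complex_of_real (norm (a t * of_real (sqrt (cosh t)))))" for q
    by (cases q) (simp add: norm_mult)
  have I: "integrable lborel (\<lambda>q. cmod (\<alpha> (fst q)) * (cmod (a (snd q)) * sqrt (cosh (snd q))))"
  proof -
    have "integrable lborel (\<lambda>q. cmod (complex_of_real (cmod (\<alpha> (fst q)) * (cmod (a (snd q)) * sqrt (cosh (snd q))))))"
      unfolding eq by (rule integrable_norm[OF P(1)])
    then show ?thesis by (simp only: norm_of_real) (simp add: abs_mult)
  qed
  show E: "integrable lborel (elem \<alpha> a)"
    by (rule integrable_split4[OF m i]) (unfold n, intro integrable_mult_right I)
  have "complex_of_real (L1norm (elem \<alpha> a)) = (CLINT p|lborel. complex_of_real (cmod (elem \<alpha> a p)))"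
    by (rule integral_complex_of_real[symmetric])
  also have "\<dots> = (CLINT q|lborel. CLINT r|lborel. complex_of_real (cmod (elem \<alpha> a (fst r, snd r, q))))"
    by (rule integral_split4[OF integrable_of_real[OF integrable_norm[OF E]]])
  also have "\<dots> = (CLINT q|lborel. complex_of_real (4 * pi) * complex_of_real (cmod (\<alpha> (fst q)) * (cmod (a (snd q)) * sqrt (cosh (snd q)))))"
    by (simp only: integral_complex_of_real n of_real_mult)
  also have "\<dots> = complex_of_real (4 * pi) * (complex_of_real (LINT z|lborel. cmod (\<alpha> z)) * complex_of_real (LINT t|lborel. norm (a t * of_real (sqrt (cosh t)))))"
    unfolding eq integral_mult_right_zero P(2) integral_complex_of_real ..
  also have "\<dots> = complex_of_real (4 * pi * (LINT z|lborel. cmod (\<alpha> z)) * (LINT t|lborel. cmod (a t) * sqrt (cosh t)))"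
    by (simp add: norm_mult mult.assoc)
  finally show "L1norm (elem \<alpha> a) = 4 * pi * (LINT z|lborel. cmod (\<alpha> z)) * (LINT t|lborel. cmod (a t) * sqrt (cosh t))"
    by (simp only: of_real_eq_iff)
qed

lemma schroedinger_measurable [measurable]:
  assumes [measurable]: "f \<in> borel_measurable borel"
  shows "schroedinger p f \<in> borel_measurable borel" "schroedinger_dual p f \<in> borel_measurable borel"
  by (cases p; simp add: schroedinger_def[abs_def] schroedinger_dual_def[abs_def])+

text \<open>For fixed t, the y-integral is a Fourier inversion and leaves the double integral of
  \<Phi> \<Theta> over x and v. Substituting u = exp t (v + x) for x separates the variables. The
  result is independent of t, because the Jacobian cancels the two factors exp (t/2).\<close>

lemma schroedinger_orthogonality:
  assumes \<eta>: "integrable lborel \<eta>" and \<zeta> [measurable]: "\<zeta> \<in> borel_measurable borel" and B: "\<And>v. cmod (\<zeta> v) \<le> B"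
    and \<eta>B: "\<And>v. cmod (\<eta> v) \<le> B'"
  defines "M \<equiv> \<lambda>x y t. CLINT v|lborel. \<eta> v * schroedinger (x, y, 0, t) \<zeta> v"
  shows "(CLINT r|lborel. cnj (kap0 (fst r, snd r, 0, t)) * M (fst r) (snd r) t)
     = 2 * sqrt pi * ((CLINT v|lborel. \<eta> v * gaussian v) * (CLINT v|lborel. gaussian v * \<zeta> v))"
    and "integrable lborel (\<lambda>r. cnj (kap0 (fst r, snd r, 0, t)) * M (fst r) (snd r) t)"
proof -
  have \<eta>m [measurable]: "\<eta> \<in> borel_measurable borel" using \<eta> by auto
  have B0: "B \<ge> 0" using B[of 0] norm_ge_zero order_trans by blast
  define E where "E = complex_of_real (exp (t/2))"
  have E2: "E * E = of_real (exp t)" unfolding E_def of_real_mult[symmetric] exp_add[symmetric] by simp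
  \<comment> \<open>Functions of v whose Fourier transforms in y are M and sqrt pi times
    \<open>kap0\<close>.\<close>
  define \<Phi> where "\<Phi> x v = \<eta> v * (E * \<zeta> (exp t * (v + x)))" for x v
  define \<Theta> where "\<Theta> x v = gaussian v * (E * gaussian (exp t * (v + x)))" for x v
  have [measurable]: "\<Phi> x \<in> borel_measurable borel" "\<Theta> x \<in> borel_measurable borel" for x
    unfolding \<Phi>_def[abs_def] \<Theta>_def[abs_def] by measurable
  have \<Phi>i: "integrable lborel (\<Phi> x)" for x
  proof (rule Bochner_Integration.integrable_bound[OF integrable_mult_left[OF integrable_norm[OF \<eta>], of "cmod E * B"]])
    show "AE v in lborel. norm (\<Phi> x v) \<le> norm (cmod (\<eta> v) * (cmod E * B))"
      using B B0 by (intro AE_I2) (simp add: \<Phi>_def norm_mult mult_left_mono)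
  qed simp
  have \<Theta>i: "integrable lborel (\<Theta> x)" for x
  proof (rule Bochner_Integration.integrable_bound[OF integrable_mult_left[OF integrable_norm[OF gaussian_integrable], of "cmod E"]])
    show "AE v in lborel. norm (\<Theta> x v) \<le> norm (cmod (gaussian v) * cmod E)"
      by (intro AE_I2) (simp add: \<Theta>_def norm_mult mult_left_le gaussian_norm mult_left_mono)
  qed simp
  have M: "M x y t = (CLINT v|lborel. \<Phi> x v * iexp (y * v))" for x y
    unfolding M_def \<Phi>_def E_def schroedinger_def prod.case by (simp only: add_0_left mult_ac)
  have K: "sqrt pi * kap0 (x, y, 0, t) = (CLINT v|lborel. \<Theta> x v * iexp (y * v))" for x y
    unfolding kap0_integral[symmetric] \<Theta>_def E_def schroedinger_def prod.case by (simp only: add_0_left mult_ac)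
  have ky: "integrable lborel (\<lambda>y. kap0 (x, y, 0, t))" for x
  proof -
    have k: "kq t / 2 > 0" using kp_pos[of t] by auto
    show ?thesis
    proof (rule Bochner_Integration.integrable_bound[OF integrable_mult_right[OF gauss_fourier(1)[OF k], of "exp (- (kp t * x\<^sup>2) / 2) / sqrt (cosh t)"]])
      have "continuous_on UNIV (\<lambda>y. kap0 (x, y, 0, t))"
        by (intro continuous_on_compose2[OF continuous_on_kap0[of UNIV]]) (auto intro!: continuous_intros)
      then show "(\<lambda>y. kap0 (x, y, 0, t)) \<in> borel_measurable lborel" by (simp add: borel_measurable_continuous_onI)
      have "cmod (kap0 (x, y, 0, t)) = exp (- (kp t * x\<^sup>2) / 2) / sqrt (cosh t) * exp (- (kq t / 2) * y\<^sup>2)" for y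
      proof -
        have "exp (- (kp t * x\<^sup>2 + kq t * y\<^sup>2) / 2) = exp (- (kp t * x\<^sup>2) / 2) * exp (- (kq t / 2) * y\<^sup>2)"
          unfolding exp_add[symmetric] by (simp add: field_simps)
        then show ?thesis unfolding kap0_norm by simp
      qed
      then show "AE y in lborel. norm (kap0 (x, y, 0, t)) \<le> norm (exp (- (kp t * x\<^sup>2) / 2) / sqrt (cosh t) * exp (- (kq t / 2) * y\<^sup>2))"
        by (intro AE_I2) simp
    qed
  qed
  \<comment> \<open>Conjugating \<open>kap0\<close> reverses the sign of y, so this is the inverse
    transform of \<open>kap0\<close>; the constant is 2 pi / sqrt pi.\<close>
  have inv: "(CLINT y|lborel. cnj (kap0 (x, y, 0, t)) * iexp (y * v)) = 2 * sqrt pi * \<Theta> x v" for x v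
  proof -
    have "(CLINT y|lborel. (CLINT v|lborel. \<Theta> x v * iexp (y * v)) * iexp (- y * v)) = 2 * pi * \<Theta> x v"
    proof (rule fourier_inversion[OF \<Theta>i])
      show "cmod (\<Theta> x v) \<le> cmod E" for v
      proof -
        have "cmod (gaussian v) * (cmod E * cmod (gaussian (exp t * (v + x)))) \<le> 1 * (cmod E * 1)"
          by (intro mult_mono gaussian_norm) auto
        then show ?thesis by (simp add: \<Theta>_def norm_mult)
      qed
      have "continuous_on UNIV (\<Theta> x)"
        unfolding \<Theta>_def[abs_def] by (intro continuous_intros continuous_on_compose2[OF gaussian_cont]) auto
      then show "isCont (\<Theta> x) v" by (simp add: continuous_on_eq_continuous_at)
      show "integrable lborel (\<lambda>y. CLINT v|lborel. \<Theta> x v * iexp (y * v))"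
        unfolding K[symmetric] by (intro integrable_mult_right ky)
    qed
    then have "sqrt pi * (CLINT y|lborel. kap0 (x, y, 0, t) * iexp (- y * v)) = 2 * pi * \<Theta> x v"
      unfolding K[symmetric] by (simp only: mult.assoc integral_mult_right_zero)
    moreover have "(CLINT y|lborel. kap0 (x, y, 0, t) * iexp (- y * v)) = (CLINT y|lborel. cnj (kap0 (x, y, 0, t)) * iexp (y * v))"
      unfolding kap0_cnj
      using lborel_integral_real_affine[of "-1" "\<lambda>y. kap0 (x, y, 0, t) * iexp (- y * v)" 0] by simp
    moreover have "complex_of_real (sqrt pi) * (2 * sqrt pi * \<Theta> x v) = 2 * pi * \<Theta> x v"
    proof -
      have "complex_of_real (sqrt pi) * sqrt pi = pi" unfolding of_real_mult[symmetric] by simp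
      moreover have "complex_of_real (sqrt pi) * (2 * sqrt pi * \<Theta> x v) = 2 * (complex_of_real (sqrt pi) * sqrt pi) * \<Theta> x v"
        by (simp only: of_real_mult of_real_numeral mult_ac)
      ultimately show ?thesis by (simp only: of_real_mult of_real_numeral)
    qed
    ultimately have "complex_of_real (sqrt pi) * (CLINT y|lborel. cnj (kap0 (x, y, 0, t)) * iexp (y * v)) = complex_of_real (sqrt pi) * (2 * sqrt pi * \<Theta> x v)"
      by (simp only:)
    then show ?thesis by (simp only: mult_cancel_left) simp
  qed
  have inner: "(CLINT y|lborel. cnj (kap0 (x, y, 0, t)) * M x y t) = 2 * sqrt pi * (CLINT v|lborel. \<Phi> x v * \<Theta> x v)" for x
  proof -
    let ?k = "\<lambda>y. cnj (kap0 (x, y, 0, t))"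
    have ki: "integrable lborel ?k" using ky[of x] by simp
    note P = lborel_product(1)[OF ki \<Phi>i[of x]]
    have km [measurable]: "?k \<in> borel_measurable borel"
    proof -
      have "continuous_on UNIV (\<lambda>y. kap0 (x, - y, 0, t))"
        by (intro continuous_on_compose2[OF continuous_on_kap0[of UNIV]]) (auto intro!: continuous_intros)
      then show ?thesis unfolding kap0_cnj by (rule borel_measurable_continuous_onI)
    qed
    have P2: "integrable (lborel \<Otimes>\<^sub>M lborel) (\<lambda>(y, v). ?k y * (\<Phi> x v * iexp (y * v)))"
    proof (rule Bochner_Integration.integrable_bound)
      show "integrable (lborel \<Otimes>\<^sub>M lborel) (\<lambda>p. norm (case p of (y, v) \<Rightarrow> ?k y * \<Phi> x v))"
        using integrable_norm[OF P] by (simp add: lborel_prod)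
      show "AE p in lborel \<Otimes>\<^sub>M lborel. norm (case p of (y, v) \<Rightarrow> ?k y * (\<Phi> x v * iexp (y * v))) \<le> norm (norm (case p of (y, v) \<Rightarrow> ?k y * \<Phi> x v))"
        by (auto simp: norm_mult)
    qed (simp add: case_prod_unfold)
    have "(CLINT y|lborel. ?k y * M x y t) = (CLINT y|lborel. CLINT v|lborel. ?k y * (\<Phi> x v * iexp (y * v)))"
      unfolding M by (simp only: integral_mult_right_zero)
    also have "\<dots> = (CLINT v|lborel. CLINT y|lborel. ?k y * (\<Phi> x v * iexp (y * v)))"
      by (rule lborel_pair.Fubini_integral[OF P2, symmetric])
    also have "\<dots> = (CLINT v|lborel. \<Phi> x v * (2 * sqrt pi * \<Theta> x v))"
    proof (intro Bochner_Integration.integral_cong refl)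
      fix v
      have "(CLINT y|lborel. ?k y * (\<Phi> x v * iexp (y * v))) = (CLINT y|lborel. \<Phi> x v * (?k y * iexp (y * v)))"
        by (simp only: mult.left_commute)
      also have "\<dots> = \<Phi> x v * (2 * sqrt pi * \<Theta> x v)" by (simp only: integral_mult_right_zero inv)
      finally show "(CLINT y|lborel. ?k y * (\<Phi> x v * iexp (y * v))) = \<Phi> x v * (2 * sqrt pi * \<Theta> x v)" .
    qed
    also have "\<dots> = (CLINT v|lborel. 2 * sqrt pi * (\<Phi> x v * \<Theta> x v))" by (simp only: mult.left_commute)
    finally show ?thesis by (simp only: integral_mult_right_zero)
  qed
  have Mb: "cmod (M x y t) \<le> cmod E * B * (LINT v|lborel. cmod (\<eta> v))" for x y
  proof -
    have "cmod (M x y t) \<le> (LINT v|lborel. cmod (\<Phi> x v * iexp (y * v)))"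
      unfolding M by (rule integral_norm_bound)
    also have "\<dots> \<le> (LINT v|lborel. (cmod E * B) * cmod (\<eta> v))"
    proof (rule integral_mono)
      show "cmod (\<Phi> x v * iexp (y * v)) \<le> (cmod E * B) * cmod (\<eta> v)" for v
      proof -
        have "cmod (\<eta> v) * (cmod E * cmod (\<zeta> (exp t * (v + x)))) \<le> cmod (\<eta> v) * (cmod E * B)"
          by (intro mult_left_mono B) auto
        then show ?thesis by (simp add: \<Phi>_def norm_mult mult_ac)
      qed
      show "integrable lborel (\<lambda>v. cmod (\<Phi> x v * iexp (y * v)))"
        using integrable_norm[OF \<Phi>i[of x]] by (simp add: norm_mult)
    qed (use \<eta> in simp)
    finally show ?thesis by simp
  qed
  have Mm: "(\<lambda>r. M (fst r) (snd r) t) \<in> borel_measurable borel"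
  proof -
    have "(\<lambda>r. M (fst r) (snd r) t) \<in> borel_measurable (borel \<Otimes>\<^sub>M borel)"
      unfolding M \<Phi>_def by measurable
    then show ?thesis by (simp only: borel_prod)
  qed
  note k = kap0_plane_integrable(1)[of t]
  show R: "integrable lborel (\<lambda>r. cnj (kap0 (fst r, snd r, 0, t)) * M (fst r) (snd r) t)"
  proof (rule Bochner_Integration.integrable_bound[OF integrable_mult_left[OF integrable_norm[OF k], of "cmod E * B * (LINT v|lborel. cmod (\<eta> v))"]])
    show "(\<lambda>r. cnj (kap0 (fst r, snd r, 0, t)) * M (fst r) (snd r) t) \<in> borel_measurable lborel"
    proof (rule borel_measurable_times)
      have "integrable lborel (\<lambda>r. cnj (kap0 (fst r, snd r, 0, t)))" using k by simp
      then show "(\<lambda>r. cnj (kap0 (fst r, snd r, 0, t))) \<in> borel_measurable lborel"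
        by (rule borel_measurable_integrable)
      show "(\<lambda>r. M (fst r) (snd r) t) \<in> borel_measurable lborel" using Mm by simp
    qed
    show "AE r in lborel. norm (cnj (kap0 (fst r, snd r, 0, t)) * M (fst r) (snd r) t)
      \<le> norm (norm (kap0 (fst r, snd r, 0, t)) * (cmod E * B * (LINT v|lborel. cmod (\<eta> v))))"
    proof (rule AE_I2)
      fix r
      have "norm (kap0 (fst r, snd r, 0, t)) * cmod (M (fst r) (snd r) t) \<le> norm (kap0 (fst r, snd r, 0, t)) * (cmod E * B * (LINT v|lborel. cmod (\<eta> v)))"
        by (intro mult_left_mono Mb) simp
      then show "norm (cnj (kap0 (fst r, snd r, 0, t)) * M (fst r) (snd r) t)
        \<le> norm (norm (kap0 (fst r, snd r, 0, t)) * (cmod E * B * (LINT v|lborel. cmod (\<eta> v))))"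
        unfolding norm_mult complex_mod_cnj real_norm_def by (rule order_trans[OF _ abs_ge_self])
    qed
  qed
  have R': "integrable (lborel \<Otimes>\<^sub>M lborel) (\<lambda>r. cnj (kap0 (fst r, snd r, 0, t)) * M (fst r) (snd r) t)"
    using R by (simp add: lborel_prod)
  have "(CLINT r|lborel. cnj (kap0 (fst r, snd r, 0, t)) * M (fst r) (snd r) t)
     = (CLINT x|lborel. CLINT y|lborel. cnj (kap0 (x, y, 0, t)) * M x y t)"
    using lborel_pair.integral_fst'[OF R'] by (simp add: lborel_prod)
  also have "\<dots> = (CLINT x|lborel. 2 * sqrt pi * (CLINT v|lborel. \<Phi> x v * \<Theta> x v))"
    by (simp only: inner)
  also have "\<dots> = 2 * sqrt pi * (CLINT x|lborel. CLINT v|lborel. \<Phi> x v * \<Theta> x v)"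
    by (rule integral_mult_right_zero)
  also have "(CLINT x|lborel. CLINT v|lborel. \<Phi> x v * \<Theta> x v) = (CLINT v|lborel. CLINT x|lborel. \<Phi> x v * \<Theta> x v)"
  proof -
    let ?h = "\<lambda>u. gaussian u * \<zeta> u" and ?l = "\<lambda>v. \<eta> v * gaussian v"
    have hi: "integrable lborel ?h"
      by (rule Bochner_Integration.integrable_bound[OF integrable_mult_left[OF integrable_norm[OF gaussian_integrable], of B]])
        (use B B0 in \<open>auto simp: norm_mult intro!: mult_left_mono\<close>)
    have li: "integrable lborel ?l"
      by (rule Bochner_Integration.integrable_bound[OF integrable_norm[OF \<eta>]])
        (auto simp: norm_mult gaussian_norm mult_left_le)
    have "integrable (lborel \<Otimes>\<^sub>M lborel) (\<lambda>(v, x). \<Phi> x v * \<Theta> x v)"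
    proof (rule lborel_pair.Fubini_integrable)
      \<comment> \<open>The factor exp t is the Jacobian of the substitution in x, after which the
        x-integral no longer depends on v.\<close>
      have eq: "\<Phi> x v * \<Theta> x v = ?l v * (of_real (exp t) * ?h (exp t * v + exp t * x))" for x v
        unfolding \<Phi>_def \<Theta>_def E2[symmetric] by (simp add: algebra_simps)
      have hx: "integrable lborel (\<lambda>x. ?h (exp t * v + exp t * x))" for v
        by (rule lborel_integrable_real_affine[OF hi]) simp
      show "AE v in lborel. integrable lborel (\<lambda>x. case (v, x) of (v, x) \<Rightarrow> \<Phi> x v * \<Theta> x v)"
        unfolding prod.case eq by (intro AE_I2 integrable_mult_right hx)
      have "(LINT x|lborel. norm (\<Phi> x v * \<Theta> x v)) = norm (?l v) * (LINT u|lborel. norm (?h u))" for v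
      proof -
        have "(LINT x|lborel. norm (\<Phi> x v * \<Theta> x v)) = norm (?l v) * (\<bar>exp t\<bar> *\<^sub>R (LINT x|lborel. norm (?h (exp t * v + exp t * x))))"
          unfolding eq norm_mult[of "?l v"] norm_mult[of "of_real (exp t)"] by simp
        also have "\<bar>exp t\<bar> *\<^sub>R (LINT x|lborel. norm (?h (exp t * v + exp t * x))) = (LINT u|lborel. norm (?h u))"
          by (rule lborel_integral_real_affine[symmetric]) simp
        finally show ?thesis .
      qed
      then show "integrable lborel (\<lambda>v. LINT x|lborel. norm (case (v, x) of (v, x) \<Rightarrow> \<Phi> x v * \<Theta> x v))"
        unfolding prod.case using li by (simp only: integrable_mult_left integrable_norm)
    qed (unfold \<Phi>_def \<Theta>_def, measurable)
    from lborel_pair.Fubini_integral[OF this] show ?thesis .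
  qed
  also have "\<dots> = (CLINT v|lborel. (\<eta> v * gaussian v) * (CLINT u|lborel. gaussian u * \<zeta> u))"
  proof (intro Bochner_Integration.integral_cong refl)
    fix v
    have eq: "\<Phi> x v * \<Theta> x v = (\<eta> v * gaussian v) * (of_real (exp t) * (gaussian (exp t * v + exp t * x) * \<zeta> (exp t * v + exp t * x)))" for x
      unfolding \<Phi>_def \<Theta>_def E2[symmetric] by (simp add: algebra_simps)
    have "(CLINT x|lborel. \<Phi> x v * \<Theta> x v) = (\<eta> v * gaussian v) * (\<bar>exp t\<bar> *\<^sub>R (CLINT x|lborel. gaussian (exp t * v + exp t * x) * \<zeta> (exp t * v + exp t * x)))"
      unfolding eq integral_mult_right_zero by (simp add: scaleR_conv_of_real)
    also have "\<bar>exp t\<bar> *\<^sub>R (CLINT x|lborel. gaussian (exp t * v + exp t * x) * \<zeta> (exp t * v + exp t * x)) = (CLINT u|lborel. gaussian u * \<zeta> u)"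
      by (rule lborel_integral_real_affine[symmetric, where f = "\<lambda>u. gaussian u * \<zeta> u"]) simp
    finally show "(CLINT x|lborel. \<Phi> x v * \<Theta> x v) = (\<eta> v * gaussian v) * (CLINT u|lborel. gaussian u * \<zeta> u)" .
  qed
  also have "\<dots> = (CLINT v|lborel. \<eta> v * gaussian v) * (CLINT u|lborel. gaussian u * \<zeta> u)"
    by (rule integral_mult_left_zero)
  finally show "(CLINT r|lborel. cnj (kap0 (fst r, snd r, 0, t)) * M (fst r) (snd r) t)
     = 2 * sqrt pi * ((CLINT v|lborel. \<eta> v * gaussian v) * (CLINT v|lborel. gaussian v * \<zeta> v))" .
qed

lemma gaussian_affine_bound: "integrable lborel (schroedinger_dual p gaussian)" "cmod (schroedinger_dual p gaussian v) \<le> exp (- snd (snd (snd p)) / 2)"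
  "cmod (schroedinger p gaussian v) \<le> exp (snd (snd (snd p)) / 2)"
proof -
  obtain x y z t where p: "p = (x, y, z, t)" by (cases p)
  have n: "cmod (schroedinger_dual p gaussian v) = exp (- t / 2) * cmod (gaussian (- x + exp (- t) * v))" for v
    by (simp add: p schroedinger_dual_def norm_mult)
  have "integrable lborel (\<lambda>v. gaussian (- x + exp (- t) * v))"
    by (rule lborel_integrable_real_affine[OF gaussian_integrable]) simp
  then have I: "integrable lborel (\<lambda>v. exp (- t / 2) * cmod (gaussian (- x + exp (- t) * v)))"
    by (intro integrable_mult_right integrable_norm)
  show "integrable lborel (schroedinger_dual p gaussian)"
    by (rule Bochner_Integration.integrable_bound[OF I]) (simp_all add: n)
  show "cmod (schroedinger_dual p gaussian v) \<le> exp (- snd (snd (snd p)) / 2)"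
    unfolding n by (simp add: p mult_left_le gaussian_norm)
  show "cmod (schroedinger p gaussian v) \<le> exp (snd (snd (snd p)) / 2)"
    by (simp add: p schroedinger_def norm_mult mult_left_le gaussian_norm)
qed

text \<open>The left translation h moves to one Gaussian by transposition and h' acts on the other
  one, so what remains is a coefficient at (x, y, 0, t). The coordinates z and t split off as
  characters.\<close>

lemma kap_translate:
  "kap w (h \<cdot> ((x, y, z, t) \<cdot> h')) = (chi w (snd (snd (snd h))) * chi w (snd (snd (snd h'))) * of_real (1 / sqrt pi)) *
     (chi w t * iexp z * (CLINT v|lborel. schroedinger_dual h gaussian v * schroedinger (x, y, 0, t) (schroedinger h' gaussian) v))"
proof -
  have t: "snd (snd (snd (h \<cdot> ((x, y, z, t) \<cdot> h')))) = snd (snd (snd h)) + (t + snd (snd (snd h')))"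
    by (cases h; cases h') simp
  have s: "schroedinger (x, y, z, t) f v = iexp z * schroedinger (x, y, 0, t) f v" for f v
  proof -
    have "iexp (z + y * v) = iexp z * iexp (0 + y * v)" by (simp add: exp_add[symmetric] algebra_simps)
    then show ?thesis by (simp only: schroedinger_def prod.case mult_ac)
  qed
  have "(CLINT v|lborel. gaussian v * schroedinger (h \<cdot> ((x, y, z, t) \<cdot> h')) gaussian v)
      = (CLINT v|lborel. schroedinger_dual h gaussian v * schroedinger (x, y, z, t) (schroedinger h' gaussian) v)"
    unfolding schroedinger_mult by (rule schroedinger_dual_integral) simp_all
  also have "\<dots> = iexp z * (CLINT v|lborel. schroedinger_dual h gaussian v * schroedinger (x, y, 0, t) (schroedinger h' gaussian) v)"
    unfolding s[of "schroedinger h' gaussian"] by (simp only: mult.left_commute[of _ "iexp z"] integral_mult_right_zero)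
  finally show ?thesis
    unfolding kap_schroedinger t chi_add by (simp only: mult_ac)
qed

lemma exp_le_sqrt_cosh: "exp (\<bar>t\<bar>/2) \<le> sqrt 2 * sqrt (cosh t)" for t :: real
proof -
  have s: "sqrt (exp \<bar>t\<bar>) = exp (\<bar>t\<bar>/2)"
    by (rule real_sqrt_unique) (simp_all add: power2_eq_square exp_add[symmetric])
  have "exp \<bar>t\<bar> \<le> 2 * cosh t" by (auto simp: cosh_field_def abs_if)
  from real_sqrt_le_mono[OF this] show ?thesis by (simp add: s real_sqrt_mult)
qed

lemma chi_integrable:
  assumes a: "integrable lborel (\<lambda>t. a t * of_real (sqrt (cosh t)))" and am [measurable]: "a \<in> borel_measurable borel"
    and w: "Re w > 0"
  shows "integrable lborel (\<lambda>t. a t * chi w t)"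
proof (rule Bochner_Integration.integrable_bound[OF integrable_mult_left[OF integrable_norm[OF a], of "sqrt 2"]])
  show "AE t in lborel. norm (a t * chi w t) \<le> norm (norm (a t * of_real (sqrt (cosh t))) * sqrt 2)"
  proof (rule AE_I2)
    fix t :: real
    have "norm (a t) * cmod (chi w t) \<le> norm (a t) * (sqrt 2 * sqrt (cosh t))"
      by (intro mult_left_mono order_trans[OF chi_norm[OF w] exp_le_sqrt_cosh]) simp
    then show "norm (a t * chi w t) \<le> norm (norm (a t * of_real (sqrt (cosh t))) * sqrt 2)"
      by (simp add: norm_mult abs_mult cosh_real_nonneg mult_ac)
  qed
qed simp

text \<open>The orthogonality integral over x, y does not depend on z and t, so the outer integral
  is a product of two transforms. In the representation at w the element thus acts as a scalar times
  the projection onto the Gaussian: its coefficient splits into a function of h and a function of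
  h'.\<close>

lemma reproducing:
  assumes \<alpha>: "integrable lborel \<alpha>" and a: "integrable lborel (\<lambda>t. a t * of_real (sqrt (cosh t)))"
    and am [measurable]: "a \<in> borel_measurable borel" and w: "Re w > 0"
  shows "(CLINT g|lborel. elem \<alpha> a g * kap w (h \<cdot> (g \<cdot> h')))
    = (2 * (CLINT z|lborel. \<alpha> z * iexp z) * (CLINT t|lborel. a t * chi w t)) * of_real pi * (kap w h * kap w h')"
proof -
  define \<eta> where "\<eta> = schroedinger_dual h gaussian"
  define \<zeta> where "\<zeta> = schroedinger h' gaussian"
  define X where "X = chi w (snd (snd (snd h))) * chi w (snd (snd (snd h'))) * of_real (1 / sqrt pi)"
  define M where "M x y t = (CLINT v|lborel. \<eta> v * schroedinger (x, y, 0, t) \<zeta> v)" for x y t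
  have \<zeta>m: "\<zeta> \<in> borel_measurable borel" by (simp add: \<zeta>_def)
  have \<eta>i: "integrable lborel \<eta>" unfolding \<eta>_def by (rule gaussian_affine_bound)
  have \<eta>b: "cmod (\<eta> v) \<le> exp (- snd (snd (snd h)) / 2)" for v unfolding \<eta>_def by (rule gaussian_affine_bound)
  have \<zeta>b: "cmod (\<zeta> v) \<le> exp (snd (snd (snd h')) / 2)" for v unfolding \<zeta>_def by (rule gaussian_affine_bound)
  note orth = schroedinger_orthogonality[OF \<eta>i \<zeta>m \<zeta>b \<eta>b, folded M_def]
  define I1 I2 where "I1 = (CLINT v|lborel. \<eta> v * gaussian v)" and "I2 = (CLINT v|lborel. gaussian v * \<zeta> v)"
  have e: "integrable lborel (elem \<alpha> a)" by (rule elem_props(1)[OF \<alpha> a am])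
  have [measurable]: "elem \<alpha> a \<in> borel_measurable borel" using borel_measurable_integrable[OF e] by simp
  have eI: "integrable lborel (\<lambda>g. elem \<alpha> a g * kap w (h \<cdot> (g \<cdot> h')))"
  proof (rule Bochner_Integration.integrable_bound[OF integrable_mult_left[OF integrable_norm[OF e], of "sqrt 2"]])
    show "AE g in lborel. norm (elem \<alpha> a g * kap w (h \<cdot> (g \<cdot> h'))) \<le> norm (norm (elem \<alpha> a g) * sqrt 2)"
    proof (rule AE_I2)
      fix g
      have "norm (elem \<alpha> a g) * cmod (kap w (h \<cdot> (g \<cdot> h'))) \<le> norm (elem \<alpha> a g) * sqrt 2"
        by (intro mult_left_mono kap_norm w) simp
      then show "norm (elem \<alpha> a g * kap w (h \<cdot> (g \<cdot> h'))) \<le> norm (norm (elem \<alpha> a g) * sqrt 2)"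
        by (simp only: norm_mult real_norm_def abs_of_nonneg norm_ge_zero abs_norm_cancel)
    qed
  qed simp
  have "(CLINT g|lborel. elem \<alpha> a g * kap w (h \<cdot> (g \<cdot> h')))
    = (CLINT q|lborel. CLINT r|lborel. elem \<alpha> a (fst r, snd r, q) * kap w (h \<cdot> ((fst r, snd r, q) \<cdot> h')))"
    by (rule integral_split4[OF eI])
  also have "\<dots> = (CLINT q|lborel. (X * (2 * sqrt pi * (I1 * I2))) * (case q of (z, t) \<Rightarrow> (\<alpha> z * iexp z) * (a t * chi w t)))"
  proof (intro Bochner_Integration.integral_cong refl)
    fix q :: "real \<times> real"
    obtain z t where q: "q = (z, t)" by (cases q)
    have "(CLINT r|lborel. elem \<alpha> a (fst r, snd r, z, t) * kap w (h \<cdot> ((fst r, snd r, z, t) \<cdot> h')))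
      = (CLINT r|lborel. (X * ((\<alpha> z * iexp z) * (a t * chi w t))) * (cnj (kap0 (fst r, snd r, 0, t)) * M (fst r) (snd r) t))"
      unfolding kap_translate elem_def prod.case X_def[symmetric] \<eta>_def[symmetric] \<zeta>_def[symmetric] M_def[symmetric]
      by (simp only: mult_ac)
    also have "\<dots> = (X * ((\<alpha> z * iexp z) * (a t * chi w t))) * (2 * sqrt pi * (I1 * I2))"
      by (simp only: integral_mult_right_zero orth I1_def I2_def)
    finally show "(CLINT r|lborel. elem \<alpha> a (fst r, snd r, q) * kap w (h \<cdot> ((fst r, snd r, q) \<cdot> h')))
      = (X * (2 * sqrt pi * (I1 * I2))) * (case q of (z, t) \<Rightarrow> (\<alpha> z * iexp z) * (a t * chi w t))"
      unfolding q prod.case by (simp only: mult_ac)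
  qed
  also have "\<dots> = (X * (2 * sqrt pi * (I1 * I2))) * ((CLINT z|lborel. \<alpha> z * iexp z) * (CLINT t|lborel. a t * chi w t))"
  proof -
    have "integrable lborel (\<lambda>z. \<alpha> z * iexp z)"
      by (rule Bochner_Integration.integrable_bound[OF integrable_norm[OF \<alpha>]])
        (use borel_measurable_integrable[OF \<alpha>] in \<open>auto simp: norm_mult\<close>)
    from lborel_product(2)[OF this chi_integrable[OF a am w]] show ?thesis
      by (simp only: integral_mult_right_zero)
  qed
  also have "X * (2 * sqrt pi * (I1 * I2)) = 2 * of_real pi * (kap w h * kap w h')"
  proof -
    have kh: "kap w h = chi w (snd (snd (snd h))) * (of_real (1 / sqrt pi) * I1)"
      unfolding kap_schroedinger I1_def \<eta>_def by (subst schroedinger_dual_integral) simp_all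
    have kh': "kap w h' = chi w (snd (snd (snd h'))) * (of_real (1 / sqrt pi) * I2)"
      unfolding kap_schroedinger I2_def \<zeta>_def ..
    have s: "complex_of_real pi * of_real (1 / sqrt pi) = of_real (sqrt pi)"
      unfolding of_real_mult[symmetric] by (simp add: real_div_sqrt)
    have "2 * complex_of_real pi * (kap w h * kap w h') = X * (2 * (complex_of_real pi * of_real (1 / sqrt pi)) * (I1 * I2))"
      unfolding kh kh' X_def by (simp only: mult_ac)
    then show ?thesis unfolding s by simp
  qed
  finally show ?thesis by (simp only: mult_ac)
qed

section \<open>Coefficients of integrable functions\<close>

definition LamW :: "complex \<Rightarrow> r4 \<Rightarrow> r4 \<Rightarrow> (r4 \<Rightarrow> complex) \<Rightarrow> complex" where
  "LamW w h h' f = (CLINT g|lborel. f g * kap w (h \<cdot> (g \<cdot> h')))"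

lemma LamW_integrable:
  assumes f: "integrable lborel f" and w: "Re w > 0"
  shows "integrable lborel (\<lambda>g. f g * kap w (h \<cdot> (g \<cdot> h')))" "cmod (LamW w h h' f) \<le> sqrt 2 * L1norm f"
proof -
  have [measurable]: "f \<in> borel_measurable borel" using f by auto
  have b: "cmod (f g * kap w (h \<cdot> (g \<cdot> h'))) \<le> sqrt 2 * cmod (f g)" for g
    unfolding norm_mult mult.commute[of "sqrt 2"] by (intro mult_left_mono kap_norm w) simp
  show I: "integrable lborel (\<lambda>g. f g * kap w (h \<cdot> (g \<cdot> h')))"
  proof (rule Bochner_Integration.integrable_bound[OF integrable_mult_right[OF integrable_norm[OF f], of "sqrt 2"]])
    show "AE g in lborel. norm (f g * kap w (h \<cdot> (g \<cdot> h'))) \<le> norm (sqrt 2 * norm (f g))"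
    proof (rule AE_I2)
      fix g show "norm (f g * kap w (h \<cdot> (g \<cdot> h'))) \<le> norm (sqrt 2 * norm (f g))"
        using b[of g] by simp
    qed
  qed simp
  have "cmod (LamW w h h' f) \<le> (LINT g|lborel. cmod (f g * kap w (h \<cdot> (g \<cdot> h'))))"
    unfolding LamW_def by (rule integral_norm_bound)
  also have "\<dots> \<le> (LINT g|lborel. sqrt 2 * cmod (f g))"
    using integrable_norm[OF I] integrable_mult_right[OF integrable_norm[OF f], of "sqrt 2"] b by (rule integral_mono)
  finally show "cmod (LamW w h h' f) \<le> sqrt 2 * L1norm f" by simp
qed

lemma LamW_diff:
  assumes "integrable lborel f" "integrable lborel g" "Re w > 0"
  shows "LamW w h h' (\<lambda>p. f p - g p) = LamW w h h' f - LamW w h h' g"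
  using LamW_integrable(1)[OF assms(1,3)] LamW_integrable(1)[OF assms(2,3)]
  by (simp add: LamW_def left_diff_distrib)

lemma LamW_act:
  assumes "j \<in> borel_measurable borel" "integrable lborel W" "integrable lborel b" "Re w > 0"
  shows "LamW w h h' (act j W b) = (CLINT p|lborel. W p * LamW w (h \<cdot> j p) h' b)"
  using integral_act(1)[OF assms(1-3), of "\<lambda>g. kap w (h \<cdot> (g \<cdot> h'))" "sqrt 2"] kap_norm[OF assms(4)]
  unfolding LamW_def gmul_assoc by simp

lemma fubini_bounded:
  fixes f :: "'a::euclidean_space \<Rightarrow> complex" and g :: "'b::euclidean_space \<Rightarrow> complex" and k :: "'a \<Rightarrow> 'b \<Rightarrow> complex"
  assumes f: "integrable lborel f" and g: "integrable lborel g"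
    and k: "(\<lambda>(x, y). k x y) \<in> borel_measurable (lborel \<Otimes>\<^sub>M lborel)" and b: "\<And>x y. cmod (k x y) \<le> C"
  shows "(CLINT x|lborel. f x * (CLINT y|lborel. g y * k x y)) = (CLINT y|lborel. g y * (CLINT x|lborel. f x * k x y))"
proof -
  have [measurable]: "f \<in> borel_measurable borel" "g \<in> borel_measurable borel" using f g by auto
  have C0: "C \<ge> 0" using b[of undefined undefined] norm_ge_zero order_trans by blast
  have P: "integrable (lborel \<Otimes>\<^sub>M lborel) (\<lambda>(x, y). f x * g y)"
    using lborel_product(1)[OF f g] by (simp add: lborel_prod)
  have I: "integrable (lborel \<Otimes>\<^sub>M lborel) (\<lambda>(x, y). (f x * g y) * k x y)"
  proof (rule Bochner_Integration.integrable_bound[OF integrable_mult_left[OF integrable_norm[OF P], of C]])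
    have "(\<lambda>p. (case p of (x, y) \<Rightarrow> f x * g y) * (case p of (x, y) \<Rightarrow> k x y)) \<in> borel_measurable (lborel \<Otimes>\<^sub>M lborel)"
      by (intro borel_measurable_times k borel_measurable_integrable[OF P])
    then show "(\<lambda>(x, y). (f x * g y) * k x y) \<in> borel_measurable (lborel \<Otimes>\<^sub>M lborel)"
      by (simp only: case_prod_unfold)
    show "AE p in lborel \<Otimes>\<^sub>M lborel. norm (case p of (x, y) \<Rightarrow> (f x * g y) * k x y) \<le> norm (norm (case p of (x, y) \<Rightarrow> f x * g y) * C)"
    proof (rule AE_I2)
      fix p :: "'a \<times> 'b"
      obtain x y where p: "p = (x, y)" by (cases p)
      have "norm (f x * g y) * norm (k x y) \<le> norm (f x * g y) * C" by (intro mult_left_mono b) simp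
      then show "norm (case p of (x, y) \<Rightarrow> (f x * g y) * k x y) \<le> norm (norm (case p of (x, y) \<Rightarrow> f x * g y) * C)"
        unfolding p prod.case norm_mult[of "f x * g y"] using C0 by simp
    qed
  qed
  have "(CLINT x|lborel. f x * (CLINT y|lborel. g y * k x y)) = (CLINT x|lborel. CLINT y|lborel. (f x * g y) * k x y)"
    by (simp only: integral_mult_right_zero[symmetric] mult.assoc)
  also have "\<dots> = (CLINT y|lborel. CLINT x|lborel. (f x * g y) * k x y)"
    by (rule lborel_pair.Fubini_integral[OF I, symmetric])
  also have "\<dots> = (CLINT y|lborel. g y * (CLINT x|lborel. f x * k x y))"
    by (simp only: integral_mult_right_zero[symmetric] mult_ac)
  finally show ?thesis .
qed

text \<open>Convolution from the right averages over h', as \<open>LamW_act\<close> averages over h.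
  A condition imposed for all h and h' is therefore stable on both sides.\<close>

lemma LamW_conv_right:
  assumes f: "integrable lborel f" and b: "integrable lborel b" and w: "Re w > 0"
  shows "LamW w h h' (conv f b) = (CLINT g|lborel. b g * LamW w h (g \<cdot> h') f)"
proof -
  have "LamW w h h' (conv f b) = (CLINT p|lborel. f p * (CLINT g|lborel. b g * kap w (h \<cdot> (p \<cdot> (g \<cdot> h')))))"
    by (subst LamW_act) (use f b w in \<open>simp_all add: LamW_def gmul_assoc\<close>)
  also have "\<dots> = (CLINT g|lborel. b g * (CLINT p|lborel. f p * kap w (h \<cdot> (p \<cdot> (g \<cdot> h')))))"
    by (rule fubini_bounded[OF f b _ kap_norm[OF w]]) (simp add: case_prod_unfold)
  finally show ?thesis by (simp only: LamW_def)
qed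

section \<open>A closed ideal at infinity of the half plane\<close>

text \<open>The integral over Re w = A does not depend on A \<ge> 1, and the bound C / (A^2 + r^2)
  sends it to 0 as A \<rightarrow> \<infinity>.\<close>

lemma halfplane_vanish:
  fixes F :: "complex \<Rightarrow> complex"
  assumes hol: "F holomorphic_on {w. Re w > 0}" and bd: "\<And>w. Re w > 0 \<Longrightarrow> cmod (F w) \<le> C / (cmod w)\<^sup>2"
  shows "(CLINT r|lborel. F (Complex 1 r)) = 0"
proof -
  \<comment> \<open>A quarter turn makes the vertical lines horizontal, as
    \<open>contour_shift\<close> expects.\<close>
  define f where "f z = F (\<i> * z)" for z
  have f: "f (Complex x y) = F (Complex (- y) x)" for x y
    unfolding f_def by (rule arg_cong[where f = F]) (simp add: complex_eq_iff)
  have C0: "C \<ge> 0" using order_trans[OF norm_ge_zero[of "F 1"] bd[of 1]] by simp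
  have b: "cmod (F (Complex A r)) \<le> C * inverse (A\<^sup>2 + r\<^sup>2)" if "A > 0" for A r
    using bd[of "Complex A r"] that by (simp add: cmod_power2 divide_inverse)
  have b1: "C * inverse (A\<^sup>2 + r\<^sup>2) \<le> C * inverse (1 + r\<^sup>2)" if A: "A \<ge> 1" for A r :: real
  proof -
    have "1 + r\<^sup>2 \<le> A\<^sup>2 + r\<^sup>2" using A by simp
    then have "inverse (A\<^sup>2 + r\<^sup>2) \<le> inverse (1 + r\<^sup>2)"
      by (rule le_imp_inverse_le) (simp add: add_pos_nonneg)
    then show ?thesis using C0 by (rule mult_left_mono)
  qed
  have inv: "integrable lborel (\<lambda>r::real. C * inverse (1 + r\<^sup>2))"
    using integrable_inverse_1_plus_square by (intro integrable_mult_right) (simp add: set_integrable_def)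
  have meas: "(\<lambda>r. F (Complex A r)) \<in> borel_measurable borel" if A: "A > 0" for A
  proof -
    have "continuous_on UNIV (\<lambda>r. F (Complex A r))"
      by (rule continuous_on_compose2[OF holomorphic_on_imp_continuous_on[OF hol], of _ "Complex A"])
        (use A in \<open>auto simp: Complex_eq intro!: continuous_intros\<close>)
    then show ?thesis by (rule borel_measurable_continuous_onI)
  qed
  have int: "integrable lborel (\<lambda>r. F (Complex A r))" if A: "A \<ge> 1" for A
  proof (rule Bochner_Integration.integrable_bound[OF inv])
    show "(\<lambda>r. F (Complex A r)) \<in> borel_measurable lborel" using meas[of A] A by simp
    show "AE r in lborel. norm (F (Complex A r)) \<le> norm (C * inverse (1 + r\<^sup>2))"
    proof (rule AE_I2)
      fix r
      have "norm (F (Complex A r)) \<le> C * inverse (1 + r\<^sup>2)"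
        using order_trans[OF b b1[OF A]] A by simp
      then show "norm (F (Complex A r)) \<le> norm (C * inverse (1 + r\<^sup>2))"
        unfolding real_norm_def by (rule order_trans[OF _ abs_ge_self])
    qed
  qed
  have eq: "(CLINT r|lborel. F (Complex 1 r)) = (CLINT r|lborel. F (Complex A r))" if A: "A \<ge> 1" for A
  proof -
    have "(CLINT x|lborel. f (Complex x (- 1))) = (CLINT x|lborel. f (Complex x (- A)))"
    proof (rule contour_shift[where S = "{z. Im z < 0}" and G = "\<lambda>x. C * inverse (1 + x\<^sup>2)"])
      show "f holomorphic_on {z. Im z < 0}"
        unfolding f_def by (rule holomorphic_on_compose_gen[OF _ hol, unfolded o_def]) (auto intro!: holomorphic_intros)
      show "open {z. Im z < 0}" by (rule open_halfspace_Im_lt)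
      show "convex {z. Im z < 0}" by (rule convex_halfspace_Im_lt)
      have seg: "- y \<ge> 1" if "y \<in> closed_segment (- 1) (- A)" for y
        using that A by (auto simp: closed_segment_eq_real_ivl split: if_splits)
      show "Complex x y \<in> {z. Im z < 0}" if "y \<in> closed_segment (- 1) (- A)" for x y
        using seg[OF that] by simp
      show "cmod (f (Complex x y)) \<le> C * inverse (1 + x\<^sup>2)" if "y \<in> closed_segment (- 1) (- A)" for x y
        unfolding f using order_trans[OF b b1[OF seg[OF that]]] seg[OF that] by simp
      show "((\<lambda>x::real. C * inverse (1 + x\<^sup>2)) \<longlongrightarrow> 0) at_top" "((\<lambda>x::real. C * inverse (1 + x\<^sup>2)) \<longlongrightarrow> 0) at_bot"
        by real_asymp+
      show "integrable lborel (\<lambda>x. f (Complex x (- 1)))" "integrable lborel (\<lambda>x. f (Complex x (- A)))"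
        unfolding f using int[of 1] int[OF A] by simp_all
    qed
    then show ?thesis unfolding f by simp
  qed
  have "(\<lambda>n. CLINT r|lborel. F (Complex (real (Suc n)) r)) \<longlonglongrightarrow> (CLINT r::real|lborel. 0)"
  proof (rule integral_dominated_convergence[where w = "\<lambda>r. C * inverse (1 + r\<^sup>2)"])
    show "integrable lborel (\<lambda>r::real. C * inverse (1 + r\<^sup>2))" by (rule inv)
    show "AE r in lborel. (\<lambda>n. F (Complex (real (Suc n)) r)) \<longlonglongrightarrow> 0"
    proof (rule AE_I2)
      fix r :: real
      have "(\<lambda>n. C * inverse ((real (Suc n))\<^sup>2 + r\<^sup>2)) \<longlonglongrightarrow> 0" by real_asymp
      then show "(\<lambda>n. F (Complex (real (Suc n)) r)) \<longlonglongrightarrow> 0"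
        by (rule Lim_null_comparison[rotated]) (use b in \<open>auto intro!: always_eventually\<close>)
    qed
    show "(\<lambda>r. F (Complex (real (Suc n)) r)) \<in> borel_measurable lborel" for n
      using meas[of "real (Suc n)"] by simp
    show "AE r in lborel. norm (F (Complex (real (Suc n)) r)) \<le> C * inverse (1 + r\<^sup>2)" for n
      using order_trans[OF b b1] by (intro AE_I2) simp
  qed simp
  moreover have "(CLINT r|lborel. F (Complex (real (Suc n)) r)) = (CLINT r|lborel. F (Complex 1 r))" for n
    using eq[of "real (Suc n)"] by simp
  ultimately have "(\<lambda>n::nat. CLINT r|lborel. F (Complex 1 r)) \<longlonglongrightarrow> 0" by simp
  then show ?thesis by (simp add: LIMSEQ_const_iff)
qed

text \<open>The function exp (\<tau> w) / w^2 on the line w = 1 + i r: the numerator cancels a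
  divisor exp (- \<tau> w), the denominator provides integrability and the bound of
  \<open>halfplane_vanish\<close>.\<close>

definition wgt :: "real \<Rightarrow> real \<Rightarrow> complex" where
  "wgt \<tau> r = exp (of_real \<tau> * Complex 1 r) / (Complex 1 r)\<^sup>2"

lemma wgt_norm: "cmod (wgt \<tau> r) = exp \<tau> * inverse (1 + r\<^sup>2)"
  by (simp add: wgt_def norm_divide norm_inverse norm_mult norm_power cmod_power2 divide_inverse)

lemma line_ne: "1 + \<i> * complex_of_real r \<noteq> 0"
  by (simp add: complex_eq_iff)

lemma wgt_measurable [measurable]: "wgt \<tau> \<in> borel_measurable borel"
proof -
  have "continuous_on UNIV (wgt \<tau>)"
    unfolding wgt_def[abs_def] Complex_eq
    by (intro continuous_intros) (simp_all add: line_ne)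
  then show ?thesis by (rule borel_measurable_continuous_onI)
qed

lemma wgt_integrable: "integrable lborel (wgt \<tau>)"
proof -
  have inv: "integrable lborel (\<lambda>r::real. exp \<tau> * inverse (1 + r\<^sup>2))"
    using integrable_inverse_1_plus_square by (intro integrable_mult_right) (simp add: set_integrable_def)
  show ?thesis by (rule Bochner_Integration.integrable_bound[OF inv]) (simp_all add: wgt_norm)
qed

text \<open>If all these integrals vanished, the Fourier transform of \<open>(1 + ir)\<^sup>-\<^sup>2\<close> would be zero.\<close>

lemma wgt_integral_nonzero: "\<exists>\<tau>>0. (CLINT r|lborel. wgt \<tau> r) \<noteq> 0"
proof (rule ccontr)
  assume "\<not> ?thesis"
  then have pos: "(CLINT r|lborel. wgt \<tau> r) = 0" if "\<tau> > 0" for \<tau> using that by blast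
  \<comment> \<open>For \<tau> \<le> 0 the exponential is bounded on the half plane, so the integral
    vanishes anyway; with the assumption for \<tau> > 0 the whole Fourier transform is zero.\<close>
  have neg: "(CLINT r|lborel. wgt \<tau> r) = 0" if \<tau>: "\<tau> \<le> 0" for \<tau>
    unfolding wgt_def
  proof (rule halfplane_vanish[where C = 1])
    show "(\<lambda>w. exp (of_real \<tau> * w) / w\<^sup>2) holomorphic_on {w. Re w > 0}"
      by (intro holomorphic_intros) auto
    show "cmod (exp (of_real \<tau> * w) / w\<^sup>2) \<le> 1 / (cmod w)\<^sup>2" if "Re w > 0" for w
    proof -
      have "\<tau> * Re w \<le> 0" using \<tau> that by (simp add: mult_nonpos_nonneg)
      then show ?thesis by (simp add: norm_divide norm_power divide_right_mono)
    qed
  qed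
  have z: "(CLINT r|lborel. wgt \<tau> r) = 0" for \<tau> using pos[of \<tau>] neg[of \<tau>] by linarith
  have w0: "wgt \<tau> r = of_real (exp \<tau>) * (wgt 0 r * iexp (\<tau> * r))" for \<tau> r
    by (simp add: wgt_def Complex_eq exp_add ring_distribs mult_ac flip: exp_of_real)
  have F0: "(CLINT r|lborel. wgt 0 r * iexp (\<tau> * r)) = 0" for \<tau>
  proof -
    have "of_real (exp \<tau>) * (CLINT r|lborel. wgt 0 r * iexp (\<tau> * r)) = 0"
      using z[of \<tau>] unfolding w0[of \<tau>] by (simp only: integral_mult_right_zero)
    then show ?thesis by simp
  qed
  have "(CLINT t|lborel. (CLINT r|lborel. wgt 0 r * iexp (t * r)) * iexp (- t * 0)) = 2 * pi * wgt 0 0"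
  proof (rule fourier_inversion[OF wgt_integrable])
    show "cmod (wgt 0 r) \<le> 1" for r by (simp add: wgt_norm inverse_le_1_iff)
    have "continuous_on UNIV (wgt 0)"
      unfolding wgt_def[abs_def] Complex_eq
      by (intro continuous_intros) (simp_all add: line_ne)
    then show "isCont (wgt 0) 0" by (simp add: continuous_on_eq_continuous_at)
    show "integrable lborel (\<lambda>t. CLINT r|lborel. wgt 0 r * iexp (t * r))" unfolding F0 by simp
  qed
  then have "wgt 0 0 = 0" unfolding F0 by simp
  then show False using wgt_norm[of 0 0] by simp
qed

section \<open>The functionals on the line Re w = 1 and their common kernel\<close>

lemma line_re: "Re (Complex 1 r) > 0" by simp

lemma line_chi_measurable: "(\<lambda>p::real \<times> real. chi (Complex 1 (fst p)) (snd p)) \<in> borel_measurable borel"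
proof -
  have "continuous_on UNIV (\<lambda>p::real \<times> real. chi (Complex 1 (fst p)) (snd p))"
    unfolding chi_def Complex_eq
    by (intro continuous_intros) (auto simp: complex_nonpos_Reals_iff)
  then show ?thesis by (rule borel_measurable_continuous_onI)
qed

lemma line_kap_measurable [measurable (raw)]:
  assumes [measurable]: "f \<in> borel_measurable M" "g \<in> borel_measurable M"
  shows "(\<lambda>x. kap (Complex 1 (f x)) (g x)) \<in> borel_measurable M"
proof -
  have 1: "(\<lambda>p::real \<times> r4. (fst p, snd (snd (snd (snd p))))) \<in> borel_measurable borel"
    by (intro borel_measurable_continuous_onI continuous_intros)
  have 2: "(\<lambda>p::real \<times> r4. kap0 (snd p)) \<in> borel_measurable borel"
    by (intro borel_measurable_continuous_onI continuous_on_compose2[OF continuous_on_kap0[of UNIV]]) (auto intro!: continuous_intros)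
  have "(\<lambda>p::real \<times> r4. kap (Complex 1 (fst p)) (snd p)) \<in> borel_measurable borel"
    unfolding kap_def using borel_measurable_times[OF measurable_compose[OF 1 line_chi_measurable] 2] by simp
  moreover have "(\<lambda>x. (f x, g x)) \<in> borel_measurable M" by simp
  ultimately show ?thesis
    using measurable_compose[of "\<lambda>x. (f x, g x)" M borel "\<lambda>p. kap (Complex 1 (fst p)) (snd p)" borel] by simp
qed

text \<open>A contour integral of the coefficient function; as a functional of f it is bounded by
  the L^1 norm, uniformly in h and h'.\<close>

definition Lam :: "real \<Rightarrow> r4 \<Rightarrow> r4 \<Rightarrow> (r4 \<Rightarrow> complex) \<Rightarrow> complex" where
  "Lam \<tau> h h' f = (CLINT r|lborel. wgt \<tau> r * LamW (Complex 1 r) h h' f)"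

lemma LamW_measurable:
  assumes [measurable]: "f \<in> borel_measurable borel"
  shows "(\<lambda>r. LamW (Complex 1 r) h h' f) \<in> borel_measurable borel"
  unfolding LamW_def by measurable

lemma Lam_integrable:
  assumes f: "integrable lborel f"
  shows "integrable lborel (\<lambda>r. wgt \<tau> r * LamW (Complex 1 r) h h' f)"
    and "cmod (Lam \<tau> h h' f) \<le> (LINT r|lborel. cmod (wgt \<tau> r)) * (sqrt 2 * L1norm f)"
proof -
  have [measurable]: "f \<in> borel_measurable borel" using f by auto
  note [measurable] = LamW_measurable
  have b: "cmod (wgt \<tau> r * LamW (Complex 1 r) h h' f) \<le> cmod (wgt \<tau> r) * (sqrt 2 * L1norm f)" for r
    unfolding norm_mult by (intro mult_left_mono LamW_integrable f line_re) simp
  note w = integrable_mult_left[OF integrable_norm[OF wgt_integrable[of \<tau>]], of "sqrt 2 * L1norm f"]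
  show I: "integrable lborel (\<lambda>r. wgt \<tau> r * LamW (Complex 1 r) h h' f)"
    by (rule Bochner_Integration.integrable_bound[OF w])
      (use b in \<open>simp_all add: AE_I2 order_trans[OF _ abs_ge_self]\<close>)
  have "cmod (Lam \<tau> h h' f) \<le> (LINT r|lborel. cmod (wgt \<tau> r * LamW (Complex 1 r) h h' f))"
    unfolding Lam_def by (rule integral_norm_bound)
  also have "\<dots> \<le> (LINT r|lborel. cmod (wgt \<tau> r) * (sqrt 2 * L1norm f))"
    by (rule integral_mono[OF integrable_norm[OF I] w b])
  finally show "cmod (Lam \<tau> h h' f) \<le> (LINT r|lborel. cmod (wgt \<tau> r)) * (sqrt 2 * L1norm f)" by simp
qed

lemma Lam_diff:
  assumes "integrable lborel f" "integrable lborel g"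
  shows "Lam \<tau> h h' (\<lambda>p. f p - g p) = Lam \<tau> h h' f - Lam \<tau> h h' g"
  unfolding Lam_def
  using Lam_integrable(1)[OF assms(1)] Lam_integrable(1)[OF assms(2)]
  by (simp add: LamW_diff[OF assms] right_diff_distrib)

lemma Lam_scale: "Lam \<tau> h h' (\<lambda>p. c * f p) = c * Lam \<tau> h h' f"
  unfolding Lam_def LamW_def
  by (simp only: mult.assoc integral_mult_right_zero mult.left_commute[of _ c])

lemma Lam_add:
  assumes "integrable lborel f" "integrable lborel g"
  shows "Lam \<tau> h h' (\<lambda>p. f p + g p) = Lam \<tau> h h' f + Lam \<tau> h h' g"
  using Lam_diff[of f "\<lambda>p. -1 * g p" \<tau> h h'] Lam_scale[of \<tau> h h' "-1" g] assms by simp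

text \<open>By \<open>halfplane_vanish\<close> this contains every \<open>f\<close> whose coefficients are divisible by \<open>exp (- \<tau> w)\<close>.\<close>

definition line_ideal :: "real \<Rightarrow> (r4 \<Rightarrow> complex) set" where
  "line_ideal \<tau> = {f. integrable lborel f \<and> (\<forall>h h'. Lam \<tau> h h' f = 0)}"

lemma Lam_average:
  assumes f: "integrable lborel f" and a: "integrable lborel a"
    and [measurable]: "k \<in> borel_measurable borel" "k' \<in> borel_measurable borel"
  shows "(CLINT r|lborel. wgt \<tau> r * (CLINT p|lborel. a p * LamW (Complex 1 r) (k p) (k' p) f))
     = (CLINT p|lborel. a p * Lam \<tau> (k p) (k' p) f)"
proof -
  have [measurable]: "f \<in> borel_measurable borel" using f by auto
  have "(\<lambda>(r, p). LamW (Complex 1 r) (k p) (k' p) f) \<in> borel_measurable (lborel \<Otimes>\<^sub>M lborel)"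
    unfolding LamW_def by measurable
  from fubini_bounded[OF wgt_integrable a this LamW_integrable(2)[OF f line_re]]
  show ?thesis unfolding Lam_def .
qed

text \<open>Convolution from the left or right averages the functionals over h or h', and all of
  these vanish. Closedness is the L^1 continuity of each functional.\<close>

lemma line_ideal_L1_ideal: "L1_ideal (line_ideal \<tau>)"
proof -
  have cl: "f \<in> line_ideal \<tau>" if f: "integrable lborel f" and ap: "\<forall>e>0. \<exists>g\<in>line_ideal \<tau>. L1norm (\<lambda>p. f p - g p) < e" for f
  proof -
    have "Lam \<tau> h h' f = 0" for h h'
    proof (rule ccontr)
      assume nz: "Lam \<tau> h h' f \<noteq> 0"
      define K where "K = (LINT r|lborel. cmod (wgt \<tau> r)) * sqrt 2"
      have K0: "K \<ge> 0" unfolding K_def by (intro mult_nonneg_nonneg Bochner_Integration.integral_nonneg) auto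
      obtain g where g: "g \<in> line_ideal \<tau>" "L1norm (\<lambda>p. f p - g p) < cmod (Lam \<tau> h h' f) / (K + 1)"
        using ap[rule_format, of "cmod (Lam \<tau> h h' f) / (K + 1)"] nz K0 by (auto simp: add_nonneg_pos)
      have gi: "integrable lborel g" "Lam \<tau> h h' g = 0" using g(1) unfolding line_ideal_def by blast+
      have "cmod (Lam \<tau> h h' f) = cmod (Lam \<tau> h h' (\<lambda>p. f p - g p))"
        unfolding Lam_diff[OF f gi(1)] gi(2) by simp
      also have "\<dots> \<le> K * L1norm (\<lambda>p. f p - g p)"
        using Lam_integrable(2)[of "\<lambda>p. f p - g p" \<tau> h h'] f gi(1) by (simp add: K_def mult.assoc)
      also have "\<dots> \<le> K * (cmod (Lam \<tau> h h' f) / (K + 1))" using g(2) K0 by (intro mult_left_mono) auto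
      also have "\<dots> < cmod (Lam \<tau> h h' f)"
        using nz K0 by (simp add: divide_simps add_nonneg_pos)
      finally show False by simp
    qed
    then show ?thesis using f by (simp add: line_ideal_def)
  qed
  have left: "conv g f \<in> line_ideal \<tau>" if f: "f \<in> line_ideal \<tau>" and g: "integrable lborel g" for f g
  proof -
    have fi: "integrable lborel f" and z: "Lam \<tau> h h' f = 0" for h h' using f unfolding line_ideal_def by blast+
    have "Lam \<tau> h h' (conv g f) = 0" for h h'
    proof -
      have "Lam \<tau> h h' (conv g f) = (CLINT r|lborel. wgt \<tau> r * (CLINT p|lborel. g p * LamW (Complex 1 r) (h \<cdot> p) h' f))"
        unfolding Lam_def by (subst LamW_act) (use fi g in simp_all)
      also have "\<dots> = (CLINT p|lborel. g p * Lam \<tau> (h \<cdot> p) h' f)"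
        by (rule Lam_average[OF fi g]) simp_all
      finally show ?thesis unfolding z by simp
    qed
    then show ?thesis using conv_integrable[OF g fi] by (simp add: line_ideal_def)
  qed
  have right: "conv f g \<in> line_ideal \<tau>" if f: "f \<in> line_ideal \<tau>" and g: "integrable lborel g" for f g
  proof -
    have fi: "integrable lborel f" and z: "Lam \<tau> h h' f = 0" for h h' using f unfolding line_ideal_def by blast+
    have "Lam \<tau> h h' (conv f g) = 0" for h h'
    proof -
      have "Lam \<tau> h h' (conv f g) = (CLINT r|lborel. wgt \<tau> r * (CLINT p|lborel. g p * LamW (Complex 1 r) h (p \<cdot> h') f))"
        unfolding Lam_def by (subst LamW_conv_right[OF fi g line_re]) simp
      also have "\<dots> = (CLINT p|lborel. g p * Lam \<tau> h (p \<cdot> h') f)"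
        by (rule Lam_average[OF fi g]) simp_all
      finally show ?thesis unfolding z by simp
    qed
    then show ?thesis using conv_integrable[OF fi g] by (simp add: line_ideal_def)
  qed
  show ?thesis
    unfolding L1_ideal_def
  proof (intro conjI ballI allI impI)
    have z: "Lam \<tau> h h' (\<lambda>p. 0) = 0" for h h' by (simp add: Lam_def LamW_def)
    show "(\<lambda>p. 0) \<in> line_ideal \<tau>" unfolding line_ideal_def mem_Collect_eq z by simp
    show "integrable lborel f" if "f \<in> line_ideal \<tau>" for f using that unfolding line_ideal_def by blast
    show "(\<lambda>p. f p + g p) \<in> line_ideal \<tau>" if "f \<in> line_ideal \<tau>" "g \<in> line_ideal \<tau>" for f g
      using that Lam_add[of f g \<tau>] unfolding line_ideal_def by fastforce
    show "(\<lambda>p. c * f p) \<in> line_ideal \<tau>" if "f \<in> line_ideal \<tau>" for f c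
      using that unfolding line_ideal_def mem_Collect_eq Lam_scale by simp
  qed (use cl left right in blast)+
qed

section \<open>Products that land in the ideal\<close>

lemma phi_boundE:
  assumes "\<sigma> > 0"
  obtains C where "\<And>\<epsilon> x y. 0 \<le> \<epsilon> \<Longrightarrow> \<epsilon> \<le> 1 \<Longrightarrow> \<bar>y\<bar> \<le> 1/2 \<Longrightarrow> cmod (phi \<sigma> \<epsilon> (Complex x y)) \<le> C * exp (- (\<sigma>/2) * x\<^sup>2)"
     "\<And>\<epsilon> x y. 0 \<le> \<epsilon> \<Longrightarrow> \<epsilon> \<le> 1 \<Longrightarrow> \<bar>y\<bar> \<le> 1/2 \<Longrightarrow> cmod (phi1 \<sigma> \<epsilon> (Complex x y)) \<le> C * exp (- (\<sigma>/2) * x\<^sup>2)"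
     "\<And>\<epsilon> x y. 0 \<le> \<epsilon> \<Longrightarrow> \<epsilon> \<le> 1 \<Longrightarrow> \<bar>y\<bar> \<le> 1/2 \<Longrightarrow> cmod (phi2 \<sigma> \<epsilon> (Complex x y)) \<le> C * exp (- (\<sigma>/2) * x\<^sup>2)"
proof -
  from phi_bound[OF assms] show ?thesis by (elim exE) (rule that; blast)
qed

lemma phi_fourier_facts:
  assumes \<sigma>: "\<sigma> > 0" and e: "0 \<le> \<epsilon>" "\<epsilon> \<le> 1"
  shows "phi_fourier \<sigma> \<epsilon> \<in> borel_measurable borel"
    and "integrable lborel (\<lambda>t. phi_fourier \<sigma> \<epsilon> t * of_real (sqrt (cosh t)))"
    and "Re w > 0 \<Longrightarrow> (CLINT t|lborel. phi_fourier \<sigma> \<epsilon> t * chi w t) = phi \<sigma> \<epsilon> (Ln w / pi)"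
proof -
  obtain C where C: "\<And>\<epsilon> x y. 0 \<le> \<epsilon> \<Longrightarrow> \<epsilon> \<le> 1 \<Longrightarrow> \<bar>y\<bar> \<le> 1/2 \<Longrightarrow> cmod (phi \<sigma> \<epsilon> (Complex x y)) \<le> C * exp (- (\<sigma>/2) * x\<^sup>2)"
     "\<And>\<epsilon> x y. 0 \<le> \<epsilon> \<Longrightarrow> \<epsilon> \<le> 1 \<Longrightarrow> \<bar>y\<bar> \<le> 1/2 \<Longrightarrow> cmod (phi1 \<sigma> \<epsilon> (Complex x y)) \<le> C * exp (- (\<sigma>/2) * x\<^sup>2)"
     "\<And>\<epsilon> x y. 0 \<le> \<epsilon> \<Longrightarrow> \<epsilon> \<le> 1 \<Longrightarrow> \<bar>y\<bar> \<le> 1/2 \<Longrightarrow> cmod (phi2 \<sigma> \<epsilon> (Complex x y)) \<le> C * exp (- (\<sigma>/2) * x\<^sup>2)"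
    using phi_boundE[OF \<sigma>] by blast
  note A = \<sigma> C
  show m [measurable]: "phi_fourier \<sigma> \<epsilon> \<in> borel_measurable borel" by (rule phi_fourier_measurable[OF A e])
  define I where "I = (LINT x|lborel. C * exp (- (\<sigma>/2) * x\<^sup>2))"
  note dec = phi_fourier_decay[OF A e, folded I_def]
  have bd: "cmod (phi_fourier \<sigma> \<epsilon> t) * sqrt (cosh t) \<le> \<bar>I\<bar> * inverse (1 + t\<^sup>2)" for t
  proof -
    have "cmod (phi_fourier \<sigma> \<epsilon> t) * sqrt (cosh t) \<le> (\<bar>I\<bar> * (exp (- (\<bar>t\<bar>/2)) * inverse (1 + t\<^sup>2))) * exp (\<bar>t\<bar>/2)"
    proof (rule mult_mono)
      have "I * (exp (- (\<bar>t\<bar>/2)) * inverse (1 + t\<^sup>2)) \<le> \<bar>I\<bar> * (exp (- (\<bar>t\<bar>/2)) * inverse (1 + t\<^sup>2))"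
        by (intro mult_right_mono) auto
      then show "cmod (phi_fourier \<sigma> \<epsilon> t) \<le> \<bar>I\<bar> * (exp (- (\<bar>t\<bar>/2)) * inverse (1 + t\<^sup>2))" using dec[of t] by linarith
    qed (auto simp: sqrt_cosh_bounds cosh_real_nonneg)
    also have "\<dots> = \<bar>I\<bar> * inverse (1 + t\<^sup>2) * (exp (- (\<bar>t\<bar>/2)) * exp (\<bar>t\<bar>/2))" by (simp only: mult_ac)
    finally show ?thesis by (simp add: exp_add[symmetric])
  qed
  show "integrable lborel (\<lambda>t. phi_fourier \<sigma> \<epsilon> t * of_real (sqrt (cosh t)))"
  proof (rule Bochner_Integration.integrable_bound)
    show "integrable lborel (\<lambda>t::real. \<bar>I\<bar> * inverse (1 + t\<^sup>2))"
      using integrable_inverse_1_plus_square by (intro integrable_mult_right) (simp add: set_integrable_def)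
    show "AE t in lborel. norm (phi_fourier \<sigma> \<epsilon> t * of_real (sqrt (cosh t))) \<le> norm (\<bar>I\<bar> * inverse (1 + t\<^sup>2))"
      using bd by (intro AE_I2) (simp add: norm_mult abs_mult cosh_real_nonneg)
  qed (simp add: cosh_field_def)
  show "(CLINT t|lborel. phi_fourier \<sigma> \<epsilon> t * chi w t) = phi \<sigma> \<epsilon> (Ln w / pi)" if "Re w > 0"
    using phi_fourier_fourier(2)[OF A e Im_Ln_pi[OF that]] unfolding chi_def .
qed

text \<open>Dominated convergence: the decay estimate is uniform in \<epsilon>, and multiplied by
  sqrt (cosh t) it is still a multiple of 1/(1 + t^2).\<close>

lemma phi_fourier_limit:
  assumes \<sigma>: "\<sigma> > 0"
  shows "(\<lambda>n. LINT t|lborel. cmod (phi_fourier \<sigma> (1 / real (Suc n)) t - phi_fourier \<sigma> 0 t) * sqrt (cosh t)) \<longlonglongrightarrow> 0"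
proof -
  obtain C where C: "\<And>\<epsilon> x y. 0 \<le> \<epsilon> \<Longrightarrow> \<epsilon> \<le> 1 \<Longrightarrow> \<bar>y\<bar> \<le> 1/2 \<Longrightarrow> cmod (phi \<sigma> \<epsilon> (Complex x y)) \<le> C * exp (- (\<sigma>/2) * x\<^sup>2)"
     "\<And>\<epsilon> x y. 0 \<le> \<epsilon> \<Longrightarrow> \<epsilon> \<le> 1 \<Longrightarrow> \<bar>y\<bar> \<le> 1/2 \<Longrightarrow> cmod (phi1 \<sigma> \<epsilon> (Complex x y)) \<le> C * exp (- (\<sigma>/2) * x\<^sup>2)"
     "\<And>\<epsilon> x y. 0 \<le> \<epsilon> \<Longrightarrow> \<epsilon> \<le> 1 \<Longrightarrow> \<bar>y\<bar> \<le> 1/2 \<Longrightarrow> cmod (phi2 \<sigma> \<epsilon> (Complex x y)) \<le> C * exp (- (\<sigma>/2) * x\<^sup>2)"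
    using phi_boundE[OF \<sigma>] by blast
  note A = \<sigma> C
  define I where "I = (LINT x|lborel. C * exp (- (\<sigma>/2) * x\<^sup>2))"
  let ?e = "\<lambda>n. 1 / real (Suc n)"
  have e: "0 \<le> ?e n" "?e n \<le> 1" for n by simp_all
  have dec: "cmod (phi_fourier \<sigma> \<epsilon> t) \<le> I * (exp (- (\<bar>t\<bar>/2)) * inverse (1 + t\<^sup>2))" if "0 \<le> \<epsilon>" "\<epsilon> \<le> 1" for \<epsilon> t
    unfolding I_def by (rule phi_fourier_decay[OF A that])
  have [measurable]: "phi_fourier \<sigma> (?e n) \<in> borel_measurable borel" "phi_fourier \<sigma> 0 \<in> borel_measurable borel" for n
    using phi_fourier_facts(1)[OF \<sigma> e[of n]] phi_fourier_facts(1)[OF \<sigma>, of 0] by simp_all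
  have cm [measurable]: "(\<lambda>t::real. sqrt (cosh t)) \<in> borel_measurable borel" by (simp add: cosh_field_def)
  have "(\<lambda>n. LINT t|lborel. cmod (phi_fourier \<sigma> (?e n) t - phi_fourier \<sigma> 0 t) * sqrt (cosh t)) \<longlonglongrightarrow> (LINT t::real|lborel. (0::real))"
  proof (rule integral_dominated_convergence[where w = "\<lambda>t. (2 * I) * inverse (1 + t\<^sup>2)"])
    show "integrable lborel (\<lambda>t::real. (2 * I) * inverse (1 + t\<^sup>2))"
      using integrable_inverse_1_plus_square by (intro integrable_mult_right) (simp add: set_integrable_def)
    show "AE t in lborel. (\<lambda>n. cmod (phi_fourier \<sigma> (?e n) t - phi_fourier \<sigma> 0 t) * sqrt (cosh t)) \<longlonglongrightarrow> 0"
    proof (rule AE_I2)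
      fix t
      have "(\<lambda>n. cmod (phi_fourier \<sigma> (?e n) t - phi_fourier \<sigma> 0 t) * sqrt (cosh t)) \<longlonglongrightarrow> cmod (phi_fourier \<sigma> 0 t - phi_fourier \<sigma> 0 t) * sqrt (cosh t)"
        by (intro tendsto_intros phi_fourier_tendsto[OF A])
      then show "(\<lambda>n. cmod (phi_fourier \<sigma> (?e n) t - phi_fourier \<sigma> 0 t) * sqrt (cosh t)) \<longlonglongrightarrow> 0" by simp
    qed
    show "AE t in lborel. norm (cmod (phi_fourier \<sigma> (?e n) t - phi_fourier \<sigma> 0 t) * sqrt (cosh t)) \<le> (2 * I) * inverse (1 + t\<^sup>2)" for n
    proof (rule AE_I2)
      fix t
      have nn: "0 \<le> I * (exp (- (\<bar>t\<bar>/2)) * inverse (1 + t\<^sup>2))"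
        using dec[of 0 t] norm_ge_zero[of "phi_fourier \<sigma> 0 t"] by linarith
      have "cmod (phi_fourier \<sigma> (?e n) t - phi_fourier \<sigma> 0 t) \<le> 2 * (I * (exp (- (\<bar>t\<bar>/2)) * inverse (1 + t\<^sup>2)))"
        using norm_triangle_ineq4[of "phi_fourier \<sigma> (?e n) t" "phi_fourier \<sigma> 0 t"] dec[OF e[of n], of t] dec[of 0 t] by simp
      then have "cmod (phi_fourier \<sigma> (?e n) t - phi_fourier \<sigma> 0 t) * sqrt (cosh t) \<le> 2 * (I * (exp (- (\<bar>t\<bar>/2)) * inverse (1 + t\<^sup>2))) * exp (\<bar>t\<bar>/2)"
        using nn by (intro mult_mono) (simp_all add: sqrt_cosh_bounds cosh_real_nonneg mult_ac)
      also have "\<dots> = (2 * I) * inverse (1 + t\<^sup>2) * (exp (- (\<bar>t\<bar>/2)) * exp (\<bar>t\<bar>/2))" by (simp only: mult_ac)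
      finally show "norm (cmod (phi_fourier \<sigma> (?e n) t - phi_fourier \<sigma> 0 t) * sqrt (cosh t)) \<le> (2 * I) * inverse (1 + t\<^sup>2)"
        by (simp add: exp_add[symmetric] abs_mult cosh_real_nonneg)
    qed
  qed measurable
  then show ?thesis by simp
qed

text \<open>Since exp (pi u) = w for u = Ln w / pi, the \<epsilon>-term of \<open>phi\<close> is exp
  (- \<epsilon> w). The other factor stays bounded because |Im u| \<le> 1/2.\<close>

lemma phi_Ln:
  assumes "Re w > 0"
  shows "phi \<sigma> \<epsilon> (Ln w / pi) = exp (- (of_real \<sigma> * (Ln w / pi)\<^sup>2)) * exp (- (of_real \<epsilon> * w))"
    and "\<sigma> \<ge> 0 \<Longrightarrow> cmod (exp (- (of_real \<sigma> * (Ln w / pi)\<^sup>2))) \<le> exp (\<sigma> / 4)"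
proof -
  have "w \<noteq> 0" using assms by auto
  then have "exp (of_real pi * (Ln w / pi)) = w" by simp
  then show "phi \<sigma> \<epsilon> (Ln w / pi) = exp (- (of_real \<sigma> * (Ln w / pi)\<^sup>2)) * exp (- (of_real \<epsilon> * w))"
    unfolding phi_def exp_add[symmetric] by simp
  assume \<sigma>: "\<sigma> \<ge> 0"
  define u where "u = Ln w / complex_of_real pi"
  have "(Im u)\<^sup>2 \<le> (1/2)\<^sup>2"
    using Im_Ln_pi[OF assms] unfolding u_def[symmetric] by (metis abs_ge_zero power2_abs power_mono)
  then have "(Im u)\<^sup>2 - (Re u)\<^sup>2 \<le> 1 / 4" by (simp add: power_divide) (smt (verit) zero_le_power2)
  then have "\<sigma> * ((Im u)\<^sup>2 - (Re u)\<^sup>2) \<le> \<sigma> * (1/4)" using \<sigma> by (intro mult_left_mono)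
  moreover have "Re (- (of_real \<sigma> * u\<^sup>2)) = \<sigma> * ((Im u)\<^sup>2 - (Re u)\<^sup>2)"
    by (simp add: Re_power2 algebra_simps)
  ultimately show "cmod (exp (- (of_real \<sigma> * (Ln w / pi)\<^sup>2))) \<le> exp (\<sigma> / 4)"
    unfolding u_def[symmetric] norm_exp_eq_Re by simp
qed

text \<open>The exponentials combine to exp ((\<tau> - N \<epsilon>) w), of modulus at most 1 on the
  half plane, and all other factors are bounded apart from 1/w^2. The character with arbitrary s is
  carried along because coefficients are superpositions of such characters.\<close>

lemma vanish_power:
  assumes \<sigma>: "\<sigma> > 0" and \<epsilon>: "\<epsilon> \<ge> 0" and N: "real N * \<epsilon> \<ge> \<tau>"
  shows "(CLINT r|lborel. (wgt \<tau> r * phi \<sigma> \<epsilon> (Ln (Complex 1 r) / pi) ^ N) * chi (Complex 1 r) s) = 0"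
  unfolding wgt_def
proof (rule halfplane_vanish[where C = "exp (\<sigma>/4) ^ N * exp (\<bar>s\<bar>/2)"])
  have ne: "w \<notin> \<real>\<^sub>\<le>\<^sub>0" "w \<noteq> 0" if "Re w > 0" for w
    using that by (auto simp: complex_nonpos_Reals_iff)
  show "(\<lambda>w. exp (of_real \<tau> * w) / w\<^sup>2 * phi \<sigma> \<epsilon> (Ln w / pi) ^ N * chi w s) holomorphic_on {w. Re w > 0}"
    unfolding phi_def chi_def by (intro holomorphic_intros) (use ne in auto)
  fix w assume w: "Re w > 0"
  have "cmod (exp (of_real \<tau> * w) / w\<^sup>2 * phi \<sigma> \<epsilon> (Ln w / pi) ^ N * chi w s)
     = (exp (\<tau> * Re w) * exp (- (\<epsilon> * Re w)) ^ N) * (cmod (exp (- (of_real \<sigma> * (Ln w / pi)\<^sup>2))) ^ N * cmod (chi w s)) / (cmod w)\<^sup>2"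
    unfolding phi_Ln(1)[OF w] by (simp add: norm_mult norm_divide norm_power power_mult_distrib)
  also have "exp (\<tau> * Re w) * exp (- (\<epsilon> * Re w)) ^ N = exp ((\<tau> - real N * \<epsilon>) * Re w)"
    by (simp add: exp_of_nat_mult[symmetric] exp_add[symmetric] algebra_simps)
  also have "\<dots> * (cmod (exp (- (of_real \<sigma> * (Ln w / pi)\<^sup>2))) ^ N * cmod (chi w s)) / (cmod w)\<^sup>2
     \<le> 1 * (exp (\<sigma>/4) ^ N * exp (\<bar>s\<bar>/2)) / (cmod w)\<^sup>2"
    using \<sigma> w N by (intro divide_right_mono mult_mono power_mono phi_Ln(2) chi_norm) (auto simp: mult_nonpos_nonneg)
  finally show "cmod (exp (of_real \<tau> * w) / w\<^sup>2 * phi \<sigma> \<epsilon> (Ln w / pi) ^ N * chi w s) \<le> exp (\<sigma>/4) ^ N * exp (\<bar>s\<bar>/2) / (cmod w)\<^sup>2"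
    by simp
qed

text \<open>The coefficient of b at w superposes the functions w \<mapsto> \<open>chi w t\<close>
  with weights free of w, and \<open>chi w\<close> is multiplicative. So vanishing against all
  characters survives multiplication by this coefficient; this takes the place of its
  holomorphy.\<close>

lemma vanish_LamW:
  assumes F: "integrable lborel F" and b: "integrable lborel b"
    and van: "\<And>s. (CLINT r|lborel. F r * chi (Complex 1 r) s) = 0"
  shows "(CLINT r|lborel. (F r * LamW (Complex 1 r) 0 0 b) * chi (Complex 1 r) s) = 0"
    and "integrable lborel (\<lambda>r. F r * LamW (Complex 1 r) 0 0 b)"
proof -
  have [measurable]: "F \<in> borel_measurable borel" "b \<in> borel_measurable borel" using F b by auto
  note [measurable] = LamW_measurable
  show "integrable lborel (\<lambda>r. F r * LamW (Complex 1 r) 0 0 b)"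
  proof (rule Bochner_Integration.integrable_bound[OF integrable_mult_left[OF integrable_norm[OF F], of "sqrt 2 * L1norm b"]])
    show "AE r in lborel. norm (F r * LamW (Complex 1 r) 0 0 b) \<le> norm (norm (F r) * (sqrt 2 * L1norm b))"
    proof (rule AE_I2)
      fix r
      have "norm (F r) * norm (LamW (Complex 1 r) 0 0 b) \<le> norm (F r) * (sqrt 2 * L1norm b)"
        by (intro mult_left_mono LamW_integrable b line_re) simp
      then show "norm (F r * LamW (Complex 1 r) 0 0 b) \<le> norm (norm (F r) * (sqrt 2 * L1norm b))"
        unfolding norm_mult[of "F r"] real_norm_def by (rule order_trans[OF _ abs_ge_self])
    qed
  qed measurable
  define k where "k r g = kap (Complex 1 r) g * chi (Complex 1 r) s" for r g
  have km: "(\<lambda>(r, g). k r g) \<in> borel_measurable (lborel \<Otimes>\<^sub>M lborel)"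
  proof -
    have "(\<lambda>p::real \<times> r4. (fst p, s)) \<in> borel_measurable borel"
      by (intro borel_measurable_continuous_onI continuous_intros)
    from measurable_compose[OF this line_chi_measurable]
    have "(\<lambda>p::real \<times> r4. chi (Complex 1 (fst p)) s) \<in> borel_measurable (lborel \<Otimes>\<^sub>M lborel)" by (simp add: lborel_prod)
    then show ?thesis unfolding k_def case_prod_unfold by measurable
  qed
  have kb: "cmod (k r g) \<le> sqrt 2 * exp (\<bar>s\<bar>/2)" for r g
    unfolding k_def norm_mult by (intro mult_mono kap_norm chi_norm line_re) auto
  have "(CLINT r|lborel. (F r * LamW (Complex 1 r) 0 0 b) * chi (Complex 1 r) s)
      = (CLINT r|lborel. F r * (CLINT g|lborel. b g * k r g))"
  proof (intro Bochner_Integration.integral_cong refl)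
    fix r
    have "LamW (Complex 1 r) 0 0 b * chi (Complex 1 r) s = (CLINT g|lborel. b g * k r g)"
      unfolding LamW_def k_def gmul_one mult.assoc[symmetric] by (rule integral_mult_left_zero[symmetric])
    then show "(F r * LamW (Complex 1 r) 0 0 b) * chi (Complex 1 r) s = F r * (CLINT g|lborel. b g * k r g)"
      by (simp only: mult.assoc)
  qed
  also have "\<dots> = (CLINT g|lborel. b g * (CLINT r|lborel. F r * k r g))"
    by (rule fubini_bounded[OF F b km kb])
  also have "\<dots> = (CLINT g|lborel. b g * 0)"
  proof (intro Bochner_Integration.integral_cong refl arg_cong2[where f = "(*)"])
    fix g
    have "F r * k r g = kap0 g * (F r * chi (Complex 1 r) (snd (snd (snd g)) + s))" for r
      unfolding k_def kap_def chi_add by (simp only: mult_ac)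
    then show "(CLINT r|lborel. F r * k r g) = 0"
      by (simp only: integral_mult_right_zero van mult_zero_right)
  qed
  finally show "(CLINT r|lborel. (F r * LamW (Complex 1 r) 0 0 b) * chi (Complex 1 r) s) = 0" by simp
qed

text \<open>Each further coefficient of b is absorbed by \<open>vanish_LamW\<close>. The induction
  runs over all s at once, since that lemma uses every character.\<close>

lemma vanish_product:
  assumes \<sigma>: "\<sigma> > 0" and \<epsilon>: "\<epsilon> \<ge> 0" "\<epsilon> \<le> 1" and N: "real N * \<epsilon> \<ge> \<tau>" and b: "integrable lborel b"
  shows "(CLINT r|lborel. (wgt \<tau> r * phi \<sigma> \<epsilon> (Ln (Complex 1 r) / pi) ^ N * LamW (Complex 1 r) 0 0 b ^ n) * chi (Complex 1 r) s) = 0"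
    and "integrable lborel (\<lambda>r. wgt \<tau> r * phi \<sigma> \<epsilon> (Ln (Complex 1 r) / pi) ^ N * LamW (Complex 1 r) 0 0 b ^ n)"
proof (induction n arbitrary: s)
  case 0
  {
    case 1
    show ?case using vanish_power[OF \<sigma> \<epsilon>(1) N] by simp
  next
    case 2
    have m: "(\<lambda>r. phi \<sigma> \<epsilon> (Ln (Complex 1 r) / pi)) \<in> borel_measurable borel"
    proof -
      have "continuous_on UNIV (\<lambda>r. phi \<sigma> \<epsilon> (Ln (Complex 1 r) / pi))"
        unfolding phi_def Complex_eq by (intro continuous_intros) (auto simp: complex_nonpos_Reals_iff)
      then show ?thesis by (rule borel_measurable_continuous_onI)
    qed
    show ?case
    proof (rule Bochner_Integration.integrable_bound[OF integrable_mult_left[OF integrable_norm[OF wgt_integrable[of \<tau>]], of "exp (\<sigma>/4) ^ N"]])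
      show "AE r in lborel. norm (wgt \<tau> r * phi \<sigma> \<epsilon> (Ln (Complex 1 r) / pi) ^ N * LamW (Complex 1 r) 0 0 b ^ 0) \<le> norm (norm (wgt \<tau> r) * exp (\<sigma>/4) ^ N)"
      proof (rule AE_I2)
        fix r
        have "cmod (phi \<sigma> \<epsilon> (Ln (Complex 1 r) / pi)) \<le> exp (\<sigma>/4) * 1"
          unfolding phi_Ln(1)[OF line_re] norm_mult using \<sigma> \<epsilon> by (intro mult_mono phi_Ln(2) line_re) auto
        then have "norm (wgt \<tau> r) * cmod (phi \<sigma> \<epsilon> (Ln (Complex 1 r) / pi)) ^ N \<le> norm (wgt \<tau> r) * exp (\<sigma>/4) ^ N"
          by (intro mult_left_mono power_mono) auto
        then show "norm (wgt \<tau> r * phi \<sigma> \<epsilon> (Ln (Complex 1 r) / pi) ^ N * LamW (Complex 1 r) 0 0 b ^ 0) \<le> norm (norm (wgt \<tau> r) * exp (\<sigma>/4) ^ N)"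
          by (simp add: norm_mult norm_power)
      qed
    qed (use m in simp)
  }
next
  case (Suc n)
  let ?F = "\<lambda>r. wgt \<tau> r * phi \<sigma> \<epsilon> (Ln (Complex 1 r) / pi) ^ N * LamW (Complex 1 r) 0 0 b ^ n"
  have eq: "wgt \<tau> r * phi \<sigma> \<epsilon> (Ln (Complex 1 r) / pi) ^ N * LamW (Complex 1 r) 0 0 b ^ Suc n = ?F r * LamW (Complex 1 r) 0 0 b" for r
    by (simp only: power_Suc mult_ac)
  note v = vanish_LamW[OF Suc.IH(2) b Suc.IH(1)]
  { case 1 show ?case unfolding eq by (rule v(1)) next case 2 show ?case unfolding eq by (rule v(2)) }
qed

text \<open>The density in z is left open so that it can later be contracted together with the one
  in t.\<close>

definition elem0 :: "(real \<Rightarrow> complex) \<Rightarrow> real \<Rightarrow> real \<Rightarrow> r4 \<Rightarrow> complex" where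
  "elem0 \<alpha> \<sigma> \<epsilon> = elem \<alpha> (phi_fourier \<sigma> \<epsilon>)"

lemma elem0_props:
  assumes \<alpha>: "integrable lborel \<alpha>" and \<sigma>: "\<sigma> > 0" and e: "0 \<le> \<epsilon>" "\<epsilon> \<le> 1"
  shows "integrable lborel (elem0 \<alpha> \<sigma> \<epsilon>)"
    and "Re w > 0 \<Longrightarrow> LamW w h h' (elem0 \<alpha> \<sigma> \<epsilon>) =
      (2 * pi * (CLINT z|lborel. \<alpha> z * iexp z)) * phi \<sigma> \<epsilon> (Ln w / pi) * (kap w h * kap w h')"
proof -
  note a = phi_fourier_facts[OF \<sigma> e]
  show "integrable lborel (elem0 \<alpha> \<sigma> \<epsilon>)" unfolding elem0_def by (rule elem_props(1)[OF \<alpha> a(2,1)])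
  show "LamW w h h' (elem0 \<alpha> \<sigma> \<epsilon>) = (2 * pi * (CLINT z|lborel. \<alpha> z * iexp z)) * phi \<sigma> \<epsilon> (Ln w / pi) * (kap w h * kap w h')"
    if w: "Re w > 0"
    unfolding LamW_def elem0_def reproducing[OF \<alpha> a(2,1) w] a(3)[OF w]
    by (simp only: of_real_mult of_real_numeral mult_ac)
qed

text \<open>If \<open>\<rho> b\<close> sends \<open>\<rho> e v\<close> to \<open>v\<close>, all these elements act on \<open>v\<close> as \<open>e\<close> does.\<close>

fun alternating :: "(r4 \<Rightarrow> complex) \<Rightarrow> (r4 \<Rightarrow> complex) \<Rightarrow> nat \<Rightarrow> r4 \<Rightarrow> complex" where
  "alternating e b 0 = e"
| "alternating e b (Suc n) = conv e (conv b (alternating e b n))"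

lemma alternating_integrable:
  "integrable lborel e \<Longrightarrow> integrable lborel b \<Longrightarrow> integrable lborel (alternating e b n)"
  by (induction n) (simp_all add: conv_integrable)

text \<open>The coefficient of e has rank one, so a factor b between two copies of e contributes
  only its scalar coefficient at the Gaussian.\<close>

lemma LamW_alternating:
  assumes e: "integrable lborel e" and b: "integrable lborel b" and w: "Re w > 0"
    and rep: "\<And>h h'. LamW w h h' e = A * (kap w h * kap w h')"
  shows "LamW w h h' (alternating e b n) = A ^ Suc n * LamW w 0 0 b ^ n * (kap w h * kap w h')"
proof (induction n arbitrary: h h')
  case 0
  then show ?case by (simp add: rep)
next
  case (Suc n)
  let ?c = "A ^ Suc n * LamW w 0 0 b ^ n * kap w h'"
  note i = alternating_integrable[OF e b]
  have "LamW w h h' (alternating e b (Suc n)) = (CLINT p|lborel. e p * LamW w (h \<cdot> p) h' (conv b (alternating e b n)))"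
    unfolding alternating.simps by (rule LamW_act) (use e b w i conv_integrable in simp_all)
  also have "\<dots> = (CLINT p|lborel. e p * (CLINT q|lborel. b q * LamW w (h \<cdot> p \<cdot> q) h' (alternating e b n)))"
    by (subst LamW_act) (use e b w i in simp_all)
  also have "\<dots> = (CLINT p|lborel. ?c * (e p * (CLINT q|lborel. b q * kap w (h \<cdot> (p \<cdot> q)))))"
  proof (intro Bochner_Integration.integral_cong refl)
    fix p
    have "(CLINT q|lborel. b q * LamW w (h \<cdot> p \<cdot> q) h' (alternating e b n)) = (CLINT q|lborel. ?c * (b q * kap w (h \<cdot> (p \<cdot> q))))"
      unfolding Suc.IH gmul_assoc by (simp only: mult_ac)
    also have "\<dots> = ?c * (CLINT q|lborel. b q * kap w (h \<cdot> (p \<cdot> q)))" by (rule integral_mult_right_zero)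
    finally have *: "(CLINT q|lborel. b q * LamW w (h \<cdot> p \<cdot> q) h' (alternating e b n)) = ?c * (CLINT q|lborel. b q * kap w (h \<cdot> (p \<cdot> q)))" .
    show "e p * (CLINT q|lborel. b q * LamW w (h \<cdot> p \<cdot> q) h' (alternating e b n)) = ?c * (e p * (CLINT q|lborel. b q * kap w (h \<cdot> (p \<cdot> q))))"
      unfolding * by (rule mult.left_commute)
  qed
  also have "\<dots> = ?c * (CLINT p|lborel. e p * (CLINT q|lborel. b q * kap w (h \<cdot> (p \<cdot> q))))"
    by (rule integral_mult_right_zero)
  also have "(CLINT p|lborel. e p * (CLINT q|lborel. b q * kap w (h \<cdot> (p \<cdot> q)))) = (CLINT q|lborel. b q * LamW w h q e)"
    unfolding LamW_def by (rule fubini_bounded[OF e b _ kap_norm[OF w]]) (simp add: case_prod_unfold)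
  also have "\<dots> = (CLINT q|lborel. (A * kap w h) * (b q * kap w q))"
    unfolding rep by (simp only: mult_ac)
  also have "\<dots> = (A * kap w h) * LamW w 0 0 b"
    unfolding LamW_def gmul_one by (rule integral_mult_right_zero)
  finally show ?case by (simp only: power_Suc mult_ac)
qed

text \<open>The n-th alternating product contains n + 1 copies of e, hence the power
  \<open>Suc n\<close> of \<open>phi\<close>. What h and h' contribute is a constant and one
  character, both allowed by \<open>vanish_product\<close>.\<close>

lemma alternating_in_line_ideal:
  assumes \<alpha>: "integrable lborel \<alpha>" and \<sigma>: "\<sigma> > 0" and e: "0 \<le> \<epsilon>" "\<epsilon> \<le> 1" and n: "real (Suc n) * \<epsilon> \<ge> \<tau>"
    and b: "integrable lborel b"
  shows "alternating (elem0 \<alpha> \<sigma> \<epsilon>) b n \<in> line_ideal \<tau>"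
proof -
  note E = elem0_props[OF \<alpha> \<sigma> e]
  define c where "c = 2 * pi * (CLINT z|lborel. \<alpha> z * iexp z)"
  have "Lam \<tau> h h' (alternating (elem0 \<alpha> \<sigma> \<epsilon>) b n) = 0" for h h'
  proof -
    let ?K = "c ^ Suc n * (kap0 h * kap0 h')"
    let ?s = "snd (snd (snd h)) + snd (snd (snd h'))"
    have "Lam \<tau> h h' (alternating (elem0 \<alpha> \<sigma> \<epsilon>) b n) = (CLINT r|lborel. ?K *
      ((wgt \<tau> r * phi \<sigma> \<epsilon> (Ln (Complex 1 r) / pi) ^ Suc n * LamW (Complex 1 r) 0 0 b ^ n) * chi (Complex 1 r) ?s))"
      unfolding Lam_def
    proof (intro Bochner_Integration.integral_cong refl)
      fix r
      have "LamW (Complex 1 r) h h' (alternating (elem0 \<alpha> \<sigma> \<epsilon>) b n)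
        = (c * phi \<sigma> \<epsilon> (Ln (Complex 1 r) / pi)) ^ Suc n * LamW (Complex 1 r) 0 0 b ^ n * (kap (Complex 1 r) h * kap (Complex 1 r) h')"
        using LamW_alternating[OF E(1) b line_re E(2)[OF line_re]] unfolding c_def .
      then show "wgt \<tau> r * LamW (Complex 1 r) h h' (alternating (elem0 \<alpha> \<sigma> \<epsilon>) b n) = ?K *
        ((wgt \<tau> r * phi \<sigma> \<epsilon> (Ln (Complex 1 r) / pi) ^ Suc n * LamW (Complex 1 r) 0 0 b ^ n) * chi (Complex 1 r) ?s)"
        unfolding kap_def chi_add power_mult_distrib by (simp only: mult_ac)
    qed
    also have "\<dots> = 0"
      by (simp only: integral_mult_right_zero vanish_product(1)[OF \<sigma> e n b] mult_zero_right)
    finally show ?thesis .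
  qed
  then show ?thesis
    using alternating_integrable[OF E(1) b] unfolding line_ideal_def by simp
qed

text \<open>At h = h' = 0 the coefficient of \<open>elem0\<close> with \<epsilon> = 0 tends to a
  nonzero constant as \<sigma> \<rightarrow> 0, so its functional tends to a nonzero multiple of the
  integral of \<open>wgt\<close>.\<close>

lemma line_ideal_proper: "\<exists>\<tau>>0. \<exists>f. integrable lborel f \<and> f \<notin> line_ideal \<tau>"
proof -
  obtain \<tau> where \<tau>: "\<tau> > 0" "(CLINT r|lborel. wgt \<tau> r) \<noteq> 0" using wgt_integral_nonzero by blast
  define c where "c = 2 * pi * (CLINT z|lborel. nrm z * iexp z)"
  \<comment> \<open>The constant c contains the Fourier transform of the normal density at 1, the
    value of the central character; it has no zeros.\<close>
  have "(CLINT z|lborel. nrm z * iexp (1 * z)) = char std_normal_distribution 1"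
    unfolding char_def by (subst integral_density) (auto simp: scaleR_conv_of_real)
  then have c: "c \<noteq> 0" by (simp add: c_def char_std_normal_distribution)
  let ?s = "\<lambda>n. 1 / real (Suc n)"
  have s: "?s n > 0" "?s n \<le> 1" for n by simp_all
  have k0: "kap w 0 = 1" for w by (simp add: kap_def kap0_def chi_def zero_prod_def)
  have L: "Lam \<tau> 0 0 (elem0 nrm (?s n) 0) = c * (CLINT r|lborel. wgt \<tau> r * phi (?s n) 0 (Ln (Complex 1 r) / pi))" for n
  proof -
    have "Lam \<tau> 0 0 (elem0 nrm (?s n) 0) = (CLINT r|lborel. c * (wgt \<tau> r * phi (?s n) 0 (Ln (Complex 1 r) / pi)))"
      unfolding Lam_def
    proof (intro Bochner_Integration.integral_cong refl)
      fix r
      have "LamW (Complex 1 r) 0 0 (elem0 nrm (?s n) 0) = c * phi (?s n) 0 (Ln (Complex 1 r) / pi)"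
        using elem0_props(2)[OF nrm_integral(1) s(1)[of n] order_refl zero_le_one line_re, of r 0 0] unfolding k0 c_def by simp
      then show "wgt \<tau> r * LamW (Complex 1 r) 0 0 (elem0 nrm (?s n) 0) = c * (wgt \<tau> r * phi (?s n) 0 (Ln (Complex 1 r) / pi))"
        by (simp only: mult_ac)
    qed
    then show ?thesis by (simp only: integral_mult_right_zero)
  qed
  have lim: "(\<lambda>n. CLINT r|lborel. wgt \<tau> r * phi (?s n) 0 (Ln (Complex 1 r) / pi)) \<longlonglongrightarrow> (CLINT r|lborel. wgt \<tau> r)"
  proof (rule integral_dominated_convergence[where w = "\<lambda>r. cmod (wgt \<tau> r) * exp (1/4)"])
    show "integrable lborel (\<lambda>r. cmod (wgt \<tau> r) * exp (1/4))"
      by (intro integrable_mult_left integrable_norm wgt_integrable)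
    have co: "continuous_on UNIV (\<lambda>r. phi (?s n) 0 (Ln (Complex 1 r) / pi))" for n
      unfolding phi_def Complex_eq by (intro continuous_intros) (auto simp: complex_nonpos_Reals_iff)
    show "(\<lambda>r. wgt \<tau> r * phi (?s n) 0 (Ln (Complex 1 r) / pi)) \<in> borel_measurable lborel" for n
      using borel_measurable_continuous_onI[OF co] by measurable
    show "AE r in lborel. (\<lambda>n. wgt \<tau> r * phi (?s n) 0 (Ln (Complex 1 r) / pi)) \<longlonglongrightarrow> wgt \<tau> r"
    proof (rule AE_I2)
      fix r
      have sl: "?s \<longlonglongrightarrow> 0" by real_asymp
      have "(\<lambda>n. wgt \<tau> r * exp (- (complex_of_real (?s n) * (Ln (Complex 1 r) / pi)\<^sup>2))) \<longlonglongrightarrow> wgt \<tau> r * exp (- (complex_of_real 0 * (Ln (Complex 1 r) / pi)\<^sup>2))"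
        by (intro tendsto_intros sl)
      then show "(\<lambda>n. wgt \<tau> r * phi (?s n) 0 (Ln (Complex 1 r) / pi)) \<longlonglongrightarrow> wgt \<tau> r"
        unfolding phi_Ln(1)[OF line_re] by simp
    qed
    show "AE r in lborel. norm (wgt \<tau> r * phi (?s n) 0 (Ln (Complex 1 r) / pi)) \<le> cmod (wgt \<tau> r) * exp (1/4)" for n
    proof (rule AE_I2)
      fix r
      have "cmod (phi (?s n) 0 (Ln (Complex 1 r) / pi)) \<le> exp (?s n / 4)"
        unfolding phi_Ln(1)[OF line_re] using phi_Ln(2)[OF line_re[of r], of "?s n"] by simp
      also have "\<dots> \<le> exp (1/4)" using s(2)[of n] by simp
      finally show "norm (wgt \<tau> r * phi (?s n) 0 (Ln (Complex 1 r) / pi)) \<le> cmod (wgt \<tau> r) * exp (1/4)"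
        unfolding norm_mult by (intro mult_left_mono) auto
    qed
  qed simp
  show ?thesis
  proof (rule ccontr)
    assume "\<not> ?thesis"
    then have "elem0 nrm (?s n) 0 \<in> line_ideal \<tau>" for n
      using \<tau>(1) elem0_props(1)[OF nrm_integral(1) s(1)[of n], of 0] by auto
    then have "Lam \<tau> 0 0 (elem0 nrm (?s n) 0) = 0" for n unfolding line_ideal_def by blast
    then have "(CLINT r|lborel. wgt \<tau> r * phi (?s n) 0 (Ln (Complex 1 r) / pi)) = 0" for n
      using c unfolding L by simp
    then have "(\<lambda>n::nat. 0) \<longlonglongrightarrow> (CLINT r|lborel. wgt \<tau> r)" using lim by simp
    then show False using \<tau>(2) by (simp add: LIMSEQ_const_iff)
  qed
qed

section \<open>Gaussian limits and weights on the x, y plane\<close>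

text \<open>The central limit theorem for coin tossing in terms of characteristic functions. It
  produces a Gaussian factor from the cosines that conjugation makes available.\<close>

lemma cos_power_limit: "(\<lambda>n. cos (u / sqrt (real (Suc n))) ^ Suc n) \<longlonglongrightarrow> exp (- u\<^sup>2 / 2)"
proof (cases "u = 0")
  case False
  \<comment> \<open>The asymptotic expansion is taken for v > 0; evenness of the cosine covers
    negative u.\<close>
  have "(\<lambda>n. cos (v / sqrt (real (Suc n))) ^ Suc n) \<longlonglongrightarrow> exp (- (v * v) / 2)" if "v > 0" for v :: real
    using that by real_asymp
  from this[of "\<bar>u\<bar>"] False
  have "(\<lambda>n. cos (\<bar>u\<bar> / sqrt (real (Suc n))) ^ Suc n) \<longlonglongrightarrow> exp (- u\<^sup>2 / 2)"
    by (simp add: power2_eq_square)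
  moreover have "cos (\<bar>u\<bar> / r) = cos (u / r)" for r by (cases "u \<ge> 0") (simp_all add: abs_if)
  ultimately show ?thesis by simp
qed simp

lemma kp_lower:
  assumes "\<bar>s\<bar> \<le> \<bar>t\<bar>"
  shows "1 / (1 + exp (2 * \<bar>t\<bar>)) \<le> kp s" and "1 / (1 + exp (2 * \<bar>t\<bar>)) \<le> kq s"
proof -
  have *: "1 / (1 + exp (2 * \<bar>t\<bar>)) \<le> exp r / (2 * cosh r)" if "\<bar>r\<bar> \<le> \<bar>t\<bar>" for r
  proof -
    have "2 * cosh r = exp r * (1 + exp (- (2 * r)))"
      by (simp add: cosh_field_def distrib_left exp_add[symmetric])
    then have "exp r / (2 * cosh r) = 1 / (1 + exp (- (2 * r)))" by simp
    moreover have "exp (- (2 * r)) \<le> exp (2 * \<bar>t\<bar>)" using that by simp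
    ultimately show ?thesis by (simp add: frac_le add_pos_pos)
  qed
  show "1 / (1 + exp (2 * \<bar>t\<bar>)) \<le> kp s" unfolding kp_def by (rule *[OF assms])
  show "1 / (1 + exp (2 * \<bar>t\<bar>)) \<le> kq s" unfolding kq_def using *[of "- s"] assms by simp
qed

text \<open>With c a lower bound of both weights and r = x^2 + y^2, exp (c r/4) \<ge> 1 + c r/4
  \<ge> (c/4) (1 + r) yields polynomial decay in x, y at the cost of c^(-2) \<le> 4 exp (4 |t|). The
  Gaussian in t pays for this. The bound holds for all s with |s| \<le> |t|, so it survives
  contraction in t.\<close>

lemma gauss_plane_bound:
  fixes x y t :: real
  assumes "\<bar>s\<bar> \<le> \<bar>t\<bar>"
  shows "exp (- (kp s * x\<^sup>2 + kq s * y\<^sup>2) / 2) * exp (- t\<^sup>2 / 2)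
    \<le> inverse (1 + x\<^sup>2) * (inverse (1 + y\<^sup>2) * (64 * exp 16 * exp (- (1/4) * t\<^sup>2)))"
proof -
  define c where "c = 1 / (1 + exp (2 * \<bar>t\<bar>))"
  have c: "0 < c" "c \<le> 1" by (simp_all add: c_def add_pos_pos)
  define r where "r = x\<^sup>2 + y\<^sup>2"
  have r: "r \<ge> 0" by (simp add: r_def)
  have "c * r \<le> kp s * x\<^sup>2 + kq s * y\<^sup>2"
    unfolding r_def distrib_left c_def by (intro add_mono mult_right_mono kp_lower assms) auto
  then have 1: "exp (- (kp s * x\<^sup>2 + kq s * y\<^sup>2) / 2) \<le> exp (- (c * r) / 2)" by simp
  have "c / 4 * (1 + r) \<le> 1 + c * r / 4" using c by (simp add: algebra_simps)
  also have "\<dots> \<le> exp (c * r / 4)" by (rule exp_ge_add_one_self)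
  finally have "(c / 4 * (1 + r))\<^sup>2 \<le> (exp (c * r / 4))\<^sup>2"
    using c r by (intro power_mono) auto
  also have "\<dots> = exp (c * r / 2)" by (simp add: power2_eq_square exp_add[symmetric])
  finally have 2: "c\<^sup>2 * (1 + r)\<^sup>2 / 16 \<le> exp (c * r / 2)" by (simp add: power_mult_distrib power_divide)
  have p: "c\<^sup>2 * (1 + r)\<^sup>2 / 16 > 0" using c r by (simp add: add_pos_nonneg)
  have "exp (- (c * r) / 2) = inverse (exp (c * r / 2))" by (simp add: exp_minus[symmetric])
  also have "\<dots> \<le> inverse (c\<^sup>2 * (1 + r)\<^sup>2 / 16)" by (rule le_imp_inverse_le[OF 2 p])
  also have "\<dots> = 16 * (1 + exp (2 * \<bar>t\<bar>))\<^sup>2 * inverse ((1 + r)\<^sup>2)"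
    by (simp add: c_def field_simps)
  finally have 3: "exp (- (c * r) / 2) \<le> 16 * (1 + exp (2 * \<bar>t\<bar>))\<^sup>2 * inverse ((1 + r)\<^sup>2)" .
  have "(1 + x\<^sup>2) * (1 + y\<^sup>2) \<le> (1 + r) * (1 + r)"
    unfolding r_def by (intro mult_mono) auto
  then have 4: "inverse ((1 + r)\<^sup>2) \<le> inverse (1 + x\<^sup>2) * inverse (1 + y\<^sup>2)"
    unfolding inverse_mult_distrib[symmetric] power2_eq_square[of "1 + r"]
    by (rule le_imp_inverse_le) (simp add: add_pos_nonneg)
  have "(1 + exp (2 * \<bar>t\<bar>))\<^sup>2 \<le> (2 * exp (2 * \<bar>t\<bar>))\<^sup>2" by (intro power_mono) auto
  also have "\<dots> = 4 * exp (4 * \<bar>t\<bar>)" by (simp add: power2_eq_square exp_add[symmetric])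
  finally have 5: "16 * (1 + exp (2 * \<bar>t\<bar>))\<^sup>2 \<le> 64 * exp (4 * \<bar>t\<bar>)" by simp
  \<comment> \<open>This square says 4 |t| \<le> t^2/4 + 16, so half of the exponent t^2/2 is spent;
    hence exp 16.\<close>
  have "0 \<le> (\<bar>t\<bar> / 2 - 4)\<^sup>2" by simp
  then have "4 * \<bar>t\<bar> - t\<^sup>2 / 2 \<le> 16 - (1/4) * t\<^sup>2" by (simp add: power2_diff power_divide)
  then have "exp (4 * \<bar>t\<bar> + - t\<^sup>2 / 2) \<le> exp (16 + - (1/4) * t\<^sup>2)" by simp
  then have 6: "exp (4 * \<bar>t\<bar>) * exp (- t\<^sup>2 / 2) \<le> exp 16 * exp (- (1/4) * t\<^sup>2)" by (simp only: exp_add)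
  have "exp (- (kp s * x\<^sup>2 + kq s * y\<^sup>2) / 2) * exp (- t\<^sup>2 / 2)
      \<le> ((64 * exp (4 * \<bar>t\<bar>)) * (inverse (1 + x\<^sup>2) * inverse (1 + y\<^sup>2))) * exp (- t\<^sup>2 / 2)"
    by (intro mult_right_mono order_trans[OF 1] order_trans[OF 3] mult_mono 4 5) auto
  also have "\<dots> = (64 * (inverse (1 + x\<^sup>2) * inverse (1 + y\<^sup>2))) * (exp (4 * \<bar>t\<bar>) * exp (- t\<^sup>2 / 2))"
    by (simp only: mult_ac)
  also have "\<dots> \<le> (64 * (inverse (1 + x\<^sup>2) * inverse (1 + y\<^sup>2))) * (exp 16 * exp (- (1/4) * t\<^sup>2))"
    by (intro mult_left_mono 6) auto
  finally show ?thesis by (simp only: mult_ac)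
qed

text \<open>What remains of \<open>elem0\<close> after z and t have been rescaled by s: the scale
  survives only in the argument of \<open>kap0\<close>, so s = 0 is meaningful.\<close>

definition plane_weight :: "real \<Rightarrow> r4 \<Rightarrow> complex" where
  "plane_weight s p = (case p of (x, y, z, t) \<Rightarrow> nrm z * nrm t * cnj (kap0 (x, y, 0, s * t)))"

text \<open>Nonnegative, but complex valued and nested as a product, to match the form of
  \<open>lborel_product\<close>.\<close>

definition plane_dominator :: "r4 \<Rightarrow> complex" where
  "plane_dominator = (\<lambda>(x, y, z, t). complex_of_real (inverse (1 + x\<^sup>2)) * (complex_of_real (inverse (1 + y\<^sup>2)) *
     (nrm z * complex_of_real (64 * exp 16 * exp (- (1/4) * t\<^sup>2)))))"

lemma plane_weight_dominator_integrable: "integrable lborel plane_dominator"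
proof -
  have "integrable lborel (\<lambda>x::real. inverse (1 + x\<^sup>2))"
    using integrable_inverse_1_plus_square by (simp add: set_integrable_def)
  then have 1: "integrable lborel (\<lambda>x::real. complex_of_real (inverse (1 + x\<^sup>2)))"
    by (rule integrable_of_real)
  have "integrable lborel (\<lambda>t::real. exp (- (1/4) * t\<^sup>2))" by (rule gauss_fourier(1)) simp
  then have 2: "integrable lborel (\<lambda>t::real. complex_of_real (64 * exp 16 * exp (- (1/4) * t\<^sup>2)))"
    by (intro integrable_of_real integrable_mult_right)
  have "plane_dominator = (\<lambda>(x, y). complex_of_real (inverse (1 + x\<^sup>2)) * (case y of (y, q) \<Rightarrow> complex_of_real (inverse (1 + y\<^sup>2)) *
     (case q of (z, t) \<Rightarrow> nrm z * complex_of_real (64 * exp 16 * exp (- (1/4) * t\<^sup>2)))))"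
    by (auto simp: plane_dominator_def)
  then show ?thesis
    using lborel_product(1)[OF 1 lborel_product(1)[OF 1 lborel_product(1)[OF nrm_integral(1) 2]]] by simp
qed

lemma plane_weight_bound:
  assumes "0 \<le> s" "s \<le> 1"
  shows "cmod (plane_weight s p) \<le> cmod (plane_dominator p)"
proof -
  obtain x y z t where p: "p = (x, y, z, t)" by (cases p)
  have st: "\<bar>s * t\<bar> \<le> \<bar>t\<bar>" unfolding abs_mult using assms by (simp add: mult_left_le_one_le)
  have n0: "0 \<le> std_normal_density r" for r by simp
  have "cmod (kap0 (x, y, 0, s * t)) \<le> exp (- (kp (s * t) * x\<^sup>2 + kq (s * t) * y\<^sup>2) / 2)"
    unfolding kap0_norm using cosh_real_ge_1[of "s * t"] by (simp add: divide_le_eq)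
  moreover have "std_normal_density t \<le> exp (- t\<^sup>2 / 2)"
  proof -
    have "1 \<le> sqrt (2 * pi)" using pi_ge_two by simp
    then show ?thesis by (simp add: normal_density_def divide_le_eq)
  qed
  ultimately have "cmod (kap0 (x, y, 0, s * t)) * std_normal_density t
      \<le> exp (- (kp (s * t) * x\<^sup>2 + kq (s * t) * y\<^sup>2) / 2) * exp (- t\<^sup>2 / 2)"
    by (intro mult_mono) auto
  also note gauss_plane_bound[OF st, of x y]
  finally have "std_normal_density z * (cmod (kap0 (x, y, 0, s * t)) * std_normal_density t)
     \<le> std_normal_density z * (inverse (1 + x\<^sup>2) * (inverse (1 + y\<^sup>2) * (64 * exp 16 * exp (- (1/4) * t\<^sup>2))))"
    by (rule mult_left_mono) simp
  moreover have "cmod (plane_weight s p) = std_normal_density z * (cmod (kap0 (x, y, 0, s * t)) * std_normal_density t)"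
    unfolding p plane_weight_def prod.case norm_mult complex_mod_cnj norm_of_real abs_of_nonneg[OF n0] by (simp only: mult_ac)
  moreover have "cmod (plane_dominator p) = std_normal_density z * (inverse (1 + x\<^sup>2) * (inverse (1 + y\<^sup>2) * (64 * exp 16 * exp (- (1/4) * t\<^sup>2))))"
    unfolding p plane_dominator_def prod.case norm_mult norm_of_real abs_of_nonneg[OF n0] by (simp add: mult_ac)
  ultimately show ?thesis by simp
qed

lemma plane_weight_measurable [measurable]: "plane_weight s \<in> borel_measurable borel"
proof -
  have [measurable]: "(\<lambda>p::r4. (fst p, fst (snd p), 0::real, s * snd (snd (snd p)))) \<in> borel_measurable borel"
    by (intro borel_measurable_continuous_onI continuous_intros)
  have [measurable]: "(\<lambda>p::r4. fst (snd (snd p))) \<in> borel_measurable borel" "(\<lambda>p::r4. snd (snd (snd p))) \<in> borel_measurable borel"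
    by (intro borel_measurable_continuous_onI continuous_intros)+
  have [measurable]: "(\<lambda>p. cnj (kap0 (fst p, fst (snd p), 0::real, s * snd (snd (snd p))))) \<in> borel_measurable borel"
    by (rule borel_measurable_continuous_onI) (intro continuous_intros continuous_on_compose2[OF continuous_on_kap0[of UNIV]], auto)
  show ?thesis unfolding plane_weight_def[abs_def] case_prod_unfold by measurable
qed

lemma plane_weight_0_integrable: "integrable lborel (plane_weight 0)"
  using plane_weight_dominator_integrable plane_weight_bound[of 0]
  by (intro Bochner_Integration.integrable_bound[OF integrable_norm[OF plane_weight_dominator_integrable]]) (simp_all add: AE_I2 del: split_paired_All)

lemma plane_weight_tendsto:
  assumes "s \<longlonglongrightarrow> 0" shows "(\<lambda>n. plane_weight (s n) p) \<longlonglongrightarrow> plane_weight 0 p"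
proof -
  obtain x y z t where p: "p = (x, y, z, t)" by (cases p)
  have "(\<lambda>n. (x, y, 0::real, s n * t)) \<longlonglongrightarrow> (x, y, 0, 0 * t)" by (intro tendsto_intros assms)
  moreover have "isCont kap0 q" for q
    using continuous_on_kap0[of UNIV] by (simp add: continuous_on_eq_continuous_at del: split_paired_All)
  ultimately have "(\<lambda>n. kap0 (x, y, 0, s n * t)) \<longlonglongrightarrow> kap0 (x, y, 0, 0 * t)" by (rule isCont_tendsto_compose[rotated])
  then show ?thesis unfolding p plane_weight_def prod.case by (intro tendsto_intros)
qed

lemma dil_tendsto:
  assumes "a \<longlonglongrightarrow> a'" "b \<longlonglongrightarrow> b'" shows "(\<lambda>n. dil (a n) (b n) p) \<longlonglongrightarrow> dil a' b' p"
proof -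
  obtain x y z t where p: "p = (x, y, z, t)" by (cases p)
  show ?thesis unfolding p dil_simp by (intro tendsto_intros assms)
qed

text \<open>With this \<alpha> and \<sigma> = s^2/2 the densities in z and t are both normal of
  width s. Substituting \<open>dil 1 s\<close> normalises them, the Jacobian s^2 cancelling their
  two factors 1/s.\<close>

lemma conv_elem0:
  assumes s: "s > 0"
  defines "\<alpha> \<equiv> \<lambda>z. nrm (z / s) / s"
  shows "integrable lborel \<alpha>"
    and "b \<in> borel_measurable borel \<Longrightarrow> conv (elem0 \<alpha> (s\<^sup>2 / 2) 0) b = act (dil 1 s) (plane_weight s) b"
proof -
  have "integrable lborel (\<lambda>z. nrm (0 + (1 / s) * z))" using s by (intro lborel_integrable_real_affine nrm_integral(1)) simp
  then show \<alpha>i: "integrable lborel \<alpha>" unfolding \<alpha>_def using s by simp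
  have a: "phi_fourier (s\<^sup>2 / 2) 0 = \<alpha>" unfolding \<alpha>_def using phi_fourier_gauss[OF s] by (intro ext) simp
  have g: "of_real (1\<^sup>2 * s\<^sup>2) * elem0 \<alpha> (s\<^sup>2 / 2) 0 (dil 1 s p) = plane_weight s p" for p
    unfolding elem0_def a using s by (cases p) (simp add: elem_def \<alpha>_def plane_weight_def power2_eq_square)
  have "integrable lborel (elem0 \<alpha> (s\<^sup>2 / 2) 0)" using s by (intro elem0_props \<alpha>i) simp_all
  then have m [measurable]: "elem0 \<alpha> (s\<^sup>2 / 2) 0 \<in> borel_measurable borel" by auto
  show "conv (elem0 \<alpha> (s\<^sup>2 / 2) 0) b = act (dil 1 s) (plane_weight s) b" if [measurable]: "b \<in> borel_measurable borel"
  proof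
    fix h
    have "conv (elem0 \<alpha> (s\<^sup>2 / 2) 0) b h = of_real (1\<^sup>2 * s\<^sup>2) * (LINT p|lborel. elem0 \<alpha> (s\<^sup>2 / 2) 0 (dil 1 s p) * b (ginv (dil 1 s p) \<cdot> h))"
      unfolding act_def by (rule integral_dil[OF _ zero_less_one s]) simp
    also have "\<dots> = (LINT p|lborel. plane_weight s p * b (ginv (dil 1 s p) \<cdot> h))"
      unfolding integral_mult_right_zero[symmetric] mult.assoc[symmetric] g ..
    finally show "conv (elem0 \<alpha> (s\<^sup>2 / 2) 0) b h = act (dil 1 s) (plane_weight s) b h" unfolding act_def .
  qed
qed

text \<open>The element (0, 0, c, 0) is central, and the twist sees only t, so it acts by the same
  scalar for every w.\<close>

lemma LamW_central: "LamW w (k \<cdot> ((0, 0, c, 0) \<cdot> m)) k' b = iexp c * LamW w (k \<cdot> m) k' b"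
proof -
  have "(k \<cdot> ((0, 0, c, 0) \<cdot> m)) \<cdot> q = (0, 0, c, 0) \<cdot> ((k \<cdot> m) \<cdot> q)" for q
    by (cases k; cases m; cases q) (simp add: algebra_simps)
  moreover have "kap w ((0, 0, c, 0) \<cdot> q) = iexp c * kap w q" for q
    by (cases q) (simp add: kap_def kap0_def exp_add[symmetric] algebra_simps)
  ultimately show ?thesis
    unfolding LamW_def by (simp only: mult.left_commute[of _ "iexp c"] integral_mult_right_zero)
qed

section \<open>Representations that kill the ideal\<close>

locale halfplane_representation = L1_representation V \<rho>
  for V :: "(complex, 'v) module" and \<rho> :: "(r4 \<Rightarrow> complex) \<Rightarrow> 'v \<Rightarrow> 'v" +
  fixes \<tau> :: real
  assumes line_ideal_ker: "f \<in> line_ideal \<tau> \<Longrightarrow> f \<in> ker"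
begin

lemma elem0_in_ker:
  assumes \<alpha>: "integrable lborel \<alpha>" and \<sigma>: "\<sigma> > 0" and \<epsilon>: "0 < \<epsilon>" "\<epsilon> \<le> 1"
  shows "elem0 \<alpha> \<sigma> \<epsilon> \<in> ker"
proof -
  let ?e = "elem0 \<alpha> \<sigma> \<epsilon>"
  have e: "integrable lborel ?e" using \<epsilon> by (intro elem0_props \<alpha> \<sigma>) auto
  have "\<rho> ?e v = \<zero>\<^bsub>V\<^esub>" if v: "v \<in> carrier V" for v
  proof (rule ccontr)
    assume nz: "\<rho> ?e v \<noteq> \<zero>\<^bsub>V\<^esub>"
    obtain b where b: "integrable lborel b" "\<rho> b (\<rho> ?e v) = v"
      using cyclic[OF closed[OF e v] nz v] by blast
    have alt: "\<rho> (alternating ?e b n) v = \<rho> ?e v" for n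
      by (induction n) (simp_all add: conv_fun conv_integrable alternating_integrable e b v)
    \<comment> \<open>The product with index n has n + 1 factors e, so the rounded-up quotient is
      more than enough.\<close>
    define n where "n = nat \<lceil>\<tau> / \<epsilon>\<rceil>"
    have "\<tau> / \<epsilon> \<le> real (Suc n)" unfolding n_def by linarith
    then have "\<tau> \<le> real (Suc n) * \<epsilon>" using \<epsilon> by (simp add: divide_le_eq)
    then have "alternating ?e b n \<in> ker"
      using \<epsilon> by (intro line_ideal_ker alternating_in_line_ideal \<alpha> \<sigma> b) auto
    then show False using v nz alt[of n] by (simp add: ker_def)
  qed
  then show ?thesis using e by (simp add: ker_def)
qed

text \<open>\<open>elem\<close> is linear in its second argument, so the distance to the limit is a
  weighted L^1 norm of the difference of Fourier transforms; the kernel is closed.\<close>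

lemma elem0_0_in_ker:
  assumes \<alpha>: "integrable lborel \<alpha>" and \<sigma>: "\<sigma> > 0"
  shows "elem0 \<alpha> \<sigma> 0 \<in> ker"
proof (rule ker_limit)
  let ?s = "\<lambda>n. 1 / real (Suc n)"
  show "elem0 \<alpha> \<sigma> (?s n) \<in> ker" for n by (rule elem0_in_ker[OF \<alpha> \<sigma>]) simp_all
  show "integrable lborel (elem0 \<alpha> \<sigma> 0)" by (rule elem0_props[OF \<alpha> \<sigma>]) simp_all
  have "L1norm (\<lambda>p. elem0 \<alpha> \<sigma> (?s n) p - elem0 \<alpha> \<sigma> 0 p) = 4 * pi * (LINT z|lborel. cmod (\<alpha> z)) *
      (LINT t|lborel. cmod (phi_fourier \<sigma> (?s n) t - phi_fourier \<sigma> 0 t) * sqrt (cosh t))" for n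
  proof -
    have n: "0 \<le> ?s n" "?s n \<le> 1" by simp_all
    note f = phi_fourier_facts[OF \<sigma> n] phi_fourier_facts[OF \<sigma> order_refl zero_le_one]
    note [measurable] = f(1,4)
    have i: "integrable lborel (\<lambda>t. (phi_fourier \<sigma> (?s n) t - phi_fourier \<sigma> 0 t) * of_real (sqrt (cosh t)))"
      unfolding left_diff_distrib by (intro Bochner_Integration.integrable_diff f)
    have m: "(\<lambda>t. phi_fourier \<sigma> (?s n) t - phi_fourier \<sigma> 0 t) \<in> borel_measurable borel" by measurable
    have eq: "elem0 \<alpha> \<sigma> (?s n) p - elem0 \<alpha> \<sigma> 0 p = elem \<alpha> (\<lambda>t. phi_fourier \<sigma> (?s n) t - phi_fourier \<sigma> 0 t) p" for p
      unfolding elem0_def elem_def case_prod_unfold by (simp only: left_diff_distrib right_diff_distrib)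
    show ?thesis unfolding eq by (rule elem_props(2)[OF \<alpha> i m])
  qed
  then show "(\<lambda>n. L1norm (\<lambda>p. elem0 \<alpha> \<sigma> (?s n) p - elem0 \<alpha> \<sigma> 0 p)) \<longlonglongrightarrow> 0"
    using tendsto_mult_right_zero[OF phi_fourier_limit[OF \<sigma>]] by (simp only:)
qed

text \<open>Since \<open>dil 1 0\<close> sends (x, y, z, t) to (x, y, 0, 0), W stands for its
  marginal on the plane; the integral is a superposition of translates along that plane. Keeping z,
  t as dummy variables lets all limits use \<open>act_limit\<close>.\<close>

definition planar :: "(r4 \<Rightarrow> complex) set" where
  "planar = {W. integrable lborel W \<and> (\<forall>b. integrable lborel b \<longrightarrow> act (dil 1 0) W b \<in> ker)}"

text \<open>Contract the elements with \<epsilon> = 0 in the z and t directions; the positions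
  converge to the plane and the weights are dominated by \<open>plane_dominator\<close>.\<close>

lemma plane_weight_0_planar: "plane_weight 0 \<in> planar"
proof -
  let ?s = "\<lambda>n. 1 / real (Suc n)"
  have sl: "?s \<longlonglongrightarrow> 0" by real_asymp
  have s: "0 < ?s n" for n by simp
  have "act (dil 1 0) (plane_weight 0) b \<in> ker" if b: "integrable lborel b" for b
  proof (rule ker_limit)
    show "act (dil 1 (?s n)) (plane_weight (?s n)) b \<in> ker" for n
    proof -
      have "conv (elem0 (\<lambda>z. nrm (z / ?s n) / ?s n) ((?s n)\<^sup>2 / 2) 0) b \<in> ker"
        by (intro ker_conv(1) b elem0_0_in_ker conv_elem0(1) s) (simp add: s)
      then show ?thesis using conv_elem0(2)[OF s borel_measurable_integrable[OF b, simplified]] by simp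
    qed
    show "(\<lambda>n. L1norm (\<lambda>g. act (dil 1 (?s n)) (plane_weight (?s n)) b g - act (dil 1 0) (plane_weight 0) b g)) \<longlonglongrightarrow> 0"
      by (rule act_limit(1)[OF _ _ _ _ integrable_norm[OF plane_weight_dominator_integrable] plane_weight_bound plane_weight_tendsto[OF sl] dil_tendsto[OF tendsto_const sl] b])
        simp_all
  qed (intro act_integrable b plane_weight_0_integrable measurable_dil)
  then show ?thesis using plane_weight_0_integrable by (simp add: planar_def)
qed

text \<open>Conjugation by \<open>(p, q, 0, 0)\<close> multiplies \<open>(x, y, 0, 0)\<close> by the central element \<open>(0, 0, p y - q x, 0)\<close>, which all
  coefficients turn into the factor \<open>exp (i (p y - q x))\<close>; the difference is therefore in the ideal.\<close>

lemma planar_modulate: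
  assumes W: "W \<in> planar"
  shows "(\<lambda>u. iexp (p * fst (snd u) - q * fst u) * W u) \<in> planar"
proof -
  let ?W = "\<lambda>u. iexp (p * fst (snd u) - q * fst u) * W u"
  have Wi: "integrable lborel W" using W by (simp add: planar_def)
  then have m: "W \<in> borel_measurable borel" by auto
  have m': "(\<lambda>u::r4. iexp (p * fst (snd u) - q * fst u)) \<in> borel_measurable borel"
    by (intro borel_measurable_continuous_onI continuous_intros)
  have Wi': "integrable lborel ?W"
    by (rule Bochner_Integration.integrable_bound[OF Wi]) (use borel_measurable_times[OF m' m] in \<open>simp_all add: norm_mult\<close>)
  have "act (dil 1 0) ?W b \<in> ker" if b: "integrable lborel b" for b
  proof -
    define h :: r4 where "h = (p, q, 0, 0)"
    have b': "integrable lborel (trl (ginv h) b)" by (rule integrable_gmul[OF b])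
    \<comment> \<open>The superposition along the conjugated plane. It is the translate by h of a
      planar superposition of a translate of b, hence in the kernel; B is the modulated one with the
      same coefficients.\<close>
    define A where "A = act (\<lambda>u. h \<cdot> (dil 1 0 u \<cdot> ginv h)) W b"
    define B where "B = act (dil 1 0) ?W b"
    have "A = trl h (act (dil 1 0) W (trl (ginv h) b))"
      by (rule ext) (simp only: A_def act_def ginv_gmul gmul_assoc)
    then have Ak: "A \<in> ker" using W b' ker_trl by (simp add: planar_def)
    have jm: "(\<lambda>u. h \<cdot> (dil 1 0 u \<cdot> ginv h)) \<in> borel_measurable borel" by measurable
    have Ai: "integrable lborel A" unfolding A_def by (rule act_integrable[OF jm Wi b])
    have Bi: "integrable lborel B" unfolding B_def by (rule act_integrable[OF measurable_dil Wi' b])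
    have j: "h \<cdot> (dil 1 0 u \<cdot> ginv h) = (0, 0, p * fst (snd u) - q * fst u, 0) \<cdot> dil 1 0 u" for u
      by (cases u) (simp add: h_def algebra_simps)
    have "LamW w k k' A = LamW w k k' B" if w: "Re w > 0" for w k k'
      unfolding A_def B_def LamW_act[OF jm Wi b w] LamW_act[OF measurable_dil Wi' b w]
      unfolding j LamW_central by (simp only: mult_ac)
    then have "Lam \<tau> k k' A = Lam \<tau> k k' B" for k k' unfolding Lam_def using line_re by simp
    then have "(\<lambda>g. A g - B g) \<in> line_ideal \<tau>"
      using Ai Bi by (simp add: line_ideal_def Lam_diff del: split_paired_All)
    from ker_diff[OF Ak line_ideal_ker[OF this]] show ?thesis unfolding B_def[symmetric] by simp
  qed
  then show ?thesis using Wi' by (simp add: planar_def)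
qed

lemma planar_add:
  assumes "W \<in> planar" "W' \<in> planar"
  shows "(\<lambda>u. W u + W' u) \<in> planar"
proof -
  have i: "integrable lborel W" "integrable lborel W'" using assms by (auto simp: planar_def)
  have "act (dil 1 0) (\<lambda>u. W u + W' u) b \<in> ker" if b: "integrable lborel b" for b
  proof (rule ker_cong)
    show "(\<lambda>g. act (dil 1 0) W b g + act (dil 1 0) W' b g) \<in> ker"
      using assms b by (intro ker_add) (auto simp: planar_def)
    show "integrable lborel (act (dil 1 0) (\<lambda>u. W u + W' u) b)"
      by (intro act_integrable Bochner_Integration.integrable_add i b measurable_dil)
    show "AE g in lborel. act (dil 1 0) W b g + act (dil 1 0) W' b g = act (dil 1 0) (\<lambda>u. W u + W' u) b g"
      using act_add_left[OF measurable_dil[of 1 0] i b] by eventually_elim simp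
  qed
  then show ?thesis using i by (simp add: planar_def)
qed

lemma planar_scale:
  assumes "W \<in> planar" shows "(\<lambda>u. c * W u) \<in> planar"
proof -
  have "act (dil 1 0) (\<lambda>u. c * W u) b = (\<lambda>g. c * act (dil 1 0) W b g)" for b
    by (rule ext) (simp only: act_def mult.assoc integral_mult_right_zero)
  then show ?thesis using assms by (simp add: planar_def ker_scale)
qed

lemma planar_cos:
  assumes W: "W \<in> planar"
  shows "(\<lambda>u. of_real (cos (p * fst (snd u) - q * fst u)) * W u) \<in> planar"
proof -
  have "(\<lambda>u. (1/2) * (iexp (p * fst (snd u) - q * fst u) * W u + iexp (- p * fst (snd u) - - q * fst u) * W u)) \<in> planar"
    by (intro planar_scale planar_add planar_modulate W)
  also have "(\<lambda>u. (1/2) * (iexp (p * fst (snd u) - q * fst u) * W u + iexp (- p * fst (snd u) - - q * fst u) * W u))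
     = (\<lambda>u. of_real (cos (p * fst (snd u) - q * fst u)) * W u)"
  proof
    fix u :: r4
    have "of_real (cos r) = (1/2) * (iexp r + iexp (- r))" for r :: real
      unfolding cos_of_real[symmetric] cos_exp_eq by simp
    note * = this[of "p * fst (snd u) - q * fst u"]
    have **: "- p * fst (snd u) - - q * fst u = - (p * fst (snd u) - q * fst u)" by simp
    show "(1/2) * (iexp (p * fst (snd u) - q * fst u) * W u + iexp (- p * fst (snd u) - - q * fst u) * W u)
      = of_real (cos (p * fst (snd u) - q * fst u)) * W u"
      unfolding * ** by (simp only: distrib_right mult.assoc)
  qed
  finally show ?thesis .
qed

text \<open>Powers of cosines in x and in y stay planar and are bounded by 1, so the Gaussian factor
  of \<open>cos_power_limit\<close> is obtained by dominated convergence.\<close>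

lemma planar_gauss:
  assumes W: "W \<in> planar"
  shows "(\<lambda>u. of_real (exp (- (s * fst (snd u))\<^sup>2 / 2) * exp (- (s * fst u)\<^sup>2 / 2)) * W u) \<in> planar" (is "?G \<in> planar")
proof -
  let ?c = "\<lambda>r n. cos (s * r / sqrt (real (Suc n)))"
  let ?W = "\<lambda>n k u. of_real ((?c (fst (snd u)) n * ?c (fst u) n) ^ k) * W u"
  have Wi: "integrable lborel W" using W by (simp add: planar_def)
  then have [measurable]: "W \<in> borel_measurable borel" by auto
  have Wk: "?W n k \<in> planar" for n k
  proof (induction k)
    case (Suc k)
    \<comment> \<open>One more power uses two modulations, by (p, 0) and by (0, p) with p = s / sqrt
      (n + 1).\<close>
    have "(\<lambda>u. of_real (cos (s / sqrt (real (Suc n)) * fst (snd u) - 0 * fst u)) *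
        (of_real (cos (0 * fst (snd u) - (s / sqrt (real (Suc n))) * fst u)) * ?W n k u)) \<in> planar"
      by (intro planar_cos Suc.IH)
    then show ?case by (simp add: mult_ac)
  qed (use W in simp)
  have fm [measurable]: "fst \<in> borel_measurable (borel :: r4 measure)" "(\<lambda>u::r4. fst (snd u)) \<in> borel_measurable borel"
    by (intro borel_measurable_continuous_onI continuous_intros)+
  have c1: "\<bar>(?c a n * ?c b n) ^ k\<bar> \<le> 1" for a b n k
    unfolding power_abs abs_mult by (intro power_le_one mult_le_one) auto
  have lim: "(\<lambda>n. ?W n (Suc n) u) \<longlonglongrightarrow> ?G u" for u
    unfolding power_mult_distrib[of "cos a" "cos b" for a b] by (intro tendsto_intros cos_power_limit)
  have bd: "cmod (?W n k u) \<le> cmod (W u)" for n k u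
    unfolding norm_mult norm_of_real by (rule mult_left_le_one_le) (use c1 in auto)
  have m: "?W n (Suc n) \<in> borel_measurable borel" "?G \<in> borel_measurable borel" for n
    by measurable
  have Gi: "integrable lborel ?G"
    by (rule act_limit(3)[OF measurable_dil[of 1 0] measurable_dil[of 1 0] m integrable_norm[OF Wi] bd lim tendsto_const Wi])
  have "act (dil 1 0) ?G b \<in> ker" if b: "integrable lborel b" for b
  proof (rule ker_limit)
    show "act (dil 1 0) (?W n (Suc n)) b \<in> ker" for n using Wk[of n "Suc n"] b by (simp only: planar_def mem_Collect_eq)
    show "(\<lambda>n. L1norm (\<lambda>g. act (dil 1 0) (?W n (Suc n)) b g - act (dil 1 0) ?G b g)) \<longlonglongrightarrow> 0"
      by (rule act_limit(1)[OF measurable_dil measurable_dil m integrable_norm[OF Wi] bd lim tendsto_const b])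
  qed (rule act_integrable[OF measurable_dil Gi b])
  then show ?thesis using Gi by (simp only: planar_def mem_Collect_eq) blast
qed

text \<open>A Gaussian factor of width 1/m in x, y concentrates the planar weight at the identity.
  After rescaling x and y by 1/m the weights converge to a constant times a probability density and
  the positions to 0, so the superpositions converge to a nonzero multiple of b.\<close>

lemma ker_everything:
  assumes b: "integrable lborel b" shows "b \<in> ker"
proof -
  let ?s = "\<lambda>n. 1 / real (Suc n)"
  have sl: "?s \<longlonglongrightarrow> 0" by real_asymp
  have s: "0 < ?s n" for n by simp
  let ?g = "\<lambda>u::r4. exp (- (fst (snd u))\<^sup>2 / 2) * exp (- (fst u)\<^sup>2 / 2)"
  let ?U = "\<lambda>n u. of_real (?g u) * plane_weight 0 (dil (?s n) 1 u)"
  \<comment> \<open>The two unnormalised Gaussians in x and y account for 2 pi.\<close>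
  let ?N = "\<lambda>u. (2 * pi) * nrm4 u"
  have [measurable]: "fst \<in> borel_measurable (borel :: r4 measure)" "(\<lambda>u::r4. fst (snd u)) \<in> borel_measurable borel"
    by (intro borel_measurable_continuous_onI continuous_intros)+
  have [measurable]: "b \<in> borel_measurable borel" "nrm4 \<in> borel_measurable borel" using b nrm4_integral by auto
  have n4: "complex_of_real (?g (x, y, z, t)) * (nrm z * nrm t) = ?N (x, y, z, t)" for x y z t
  proof -
    have "?g (x, y, z, t) = 2 * pi * (std_normal_density x * std_normal_density y)"
      by (simp add: normal_density_def mult.commute)
    then show ?thesis by (simp add: nrm4_def mult.assoc)
  qed
  have U: "act (dil (?s n) 0) (?U n) b \<in> ker" for n
  proof -
    define m where "m = real (Suc n)"
    have m: "m > 0" "?s n = 1 / m" by (simp_all add: m_def)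
    \<comment> \<open>The factor has width 1/m, so substituting \<open>dil (1/m) 1\<close> makes it
      the fixed Gaussian of \<open>?U\<close> and moves the contraction into the positions and into
      \<open>kap0\<close>.\<close>
    let ?V = "\<lambda>u. of_real (exp (- (m * fst (snd u))\<^sup>2 / 2) * exp (- (m * fst u)\<^sup>2 / 2)) * plane_weight 0 u"
    have V: "act (dil 1 0) ?V b \<in> ker" using planar_gauss[OF plane_weight_0_planar, of m] b by (simp add: planar_def)
    have eq: "?V (dil (1/m) 1 u) * b (ginv (dil 1 0 (dil (1/m) 1 u)) \<cdot> h) = ?U n u * b (ginv (dil (1/m) 0 u) \<cdot> h)" for u h
      unfolding m(2) using m(1) by (cases u) simp
    have "act (dil 1 0) ?V b h = of_real ((1/m)\<^sup>2 * 1\<^sup>2) * act (dil (1/m) 0) (?U n) b h" for h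
    proof -
      have "act (dil 1 0) ?V b h = of_real ((1/m)\<^sup>2 * 1\<^sup>2) * (LINT u|lborel. ?V (dil (1/m) 1 u) * b (ginv (dil 1 0 (dil (1/m) 1 u)) \<cdot> h))"
        unfolding act_def by (rule integral_dil) (use m(1) in simp_all)
      then show ?thesis unfolding eq act_def .
    qed
    then have "act (dil (1/m) 0) (?U n) b = (\<lambda>h. of_real (m\<^sup>2) * act (dil 1 0) ?V b h)"
      using m(1) by (simp add: power_divide)
    then show ?thesis unfolding m(2) using ker_scale[OF V] by simp
  qed
  have U_eq: "?U n (x, y, z, t) = of_real (?g (x, y, z, t)) * (nrm z * nrm t) * cnj (kap0 (?s n * x, ?s n * y, 0, 0))" for n x y z t
    by (simp add: plane_weight_def)
  have bd: "cmod (?U n u) \<le> cmod (?N u)" for n u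
  proof -
    obtain x y z t where u: "u = (x, y, z, t)" by (cases u)
    have "cmod (kap0 (?s n * x, ?s n * y, 0, 0)) \<le> 1"
    proof -
      have "0 \<le> kp 0 * (?s n * x)\<^sup>2 + kq 0 * (?s n * y)\<^sup>2"
        using kp_pos[of 0] by (intro add_nonneg_nonneg mult_nonneg_nonneg) auto
      then show ?thesis unfolding kap0_norm by simp
    qed
    then have "cmod (of_real (?g u) * (nrm z * nrm t)) * cmod (kap0 (?s n * x, ?s n * y, 0, 0)) \<le> cmod (of_real (?g u) * (nrm z * nrm t))"
      by (intro mult_right_le_one_le) auto
    then show ?thesis unfolding u U_eq n4 norm_mult[of "?N (x, y, z, t)"] complex_mod_cnj .
  qed
  have lim: "(\<lambda>n. ?U n u) \<longlonglongrightarrow> ?N u" for u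
  proof -
    obtain x y z t where u: "u = (x, y, z, t)" by (cases u)
    have "(\<lambda>n. (?s n * x, ?s n * y, 0::real, 0::real)) \<longlonglongrightarrow> (0 * x, 0 * y, 0, 0)" by (intro tendsto_intros sl)
    moreover have "isCont kap0 q" for q
      using continuous_on_kap0[of UNIV] by (simp add: continuous_on_eq_continuous_at del: split_paired_All)
    ultimately have "(\<lambda>n. kap0 (?s n * x, ?s n * y, 0, 0)) \<longlonglongrightarrow> kap0 (0 * x, 0 * y, 0, 0)" by (rule isCont_tendsto_compose[rotated])
    then have "(\<lambda>n. of_real (?g u) * (nrm z * nrm t) * cnj (kap0 (?s n * x, ?s n * y, 0, 0)))
        \<longlonglongrightarrow> of_real (?g u) * (nrm z * nrm t) * cnj (kap0 (0 * x, 0 * y, 0, 0))"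
      by (intro tendsto_intros)
    moreover have "kap0 (0 * x, 0 * y, 0, 0) = 1" by (simp add: kap0_def)
    ultimately have "(\<lambda>n. of_real (?g u) * (nrm z * nrm t) * cnj (kap0 (?s n * x, ?s n * y, 0, 0))) \<longlonglongrightarrow> of_real (?g u) * (nrm z * nrm t)"
      by (simp only: complex_cnj_one mult_1_right)
    then show ?thesis unfolding u U_eq n4 .
  qed
  have Ni: "integrable lborel ?N" by (intro integrable_mult_right nrm4_integral)
  have "act (dil 0 0) ?N b \<in> ker"
  proof (rule ker_limit)
    show "(\<lambda>n. L1norm (\<lambda>g. act (dil (?s n) 0) (?U n) b g - act (dil 0 0) ?N b g)) \<longlonglongrightarrow> 0"
      by (rule act_limit(1)[OF _ _ _ _ integrable_norm[OF Ni] bd lim dil_tendsto[OF sl tendsto_const] b]) measurable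
    show "act (dil (?s n) 0) (?U n) b \<in> ker" for n by (rule U)
  qed (rule act_integrable[OF measurable_dil Ni b])
  \<comment> \<open>All positions have collapsed to the identity, and \<open>nrm4\<close> has
    integral 1.\<close>
  moreover have "dil 0 0 = (\<lambda>p. 0)" by (auto simp: dil_def zero_prod_def)
  ultimately have "(\<lambda>g. (2 * pi) * b g) \<in> ker"
    by (simp add: act_const nrm4_integral)
  from ker_scale[OF this, of "1 / (2 * pi)"] show ?thesis by simp
qed

lemma contradiction: False
  using nontriv ker_everything by (auto simp: ker_def)

end

theorem corollary9:
  shows "\<not> weakly_wiener_group G49 G49_topology"
proof -
  obtain \<tau> f where f: "integrable lborel f" "f \<notin> line_ideal \<tau>" using line_ideal_proper by blast
  have "\<not> weakly_wiener L1alg"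
  proof (rule not_weakly_wiener_L1I[OF line_ideal_L1_ideal])
    show "\<exists>f. integrable lborel f \<and> f \<notin> line_ideal \<tau>" using f by blast
    fix V :: "(complex, ((real^3^3) \<times> real \<Rightarrow> complex) set) module" and \<rho>
    assume R: "L1_representation V \<rho>" and z: "\<And>f v. f \<in> line_ideal \<tau> \<Longrightarrow> v \<in> carrier V \<Longrightarrow> \<rho> f v = \<zero>\<^bsub>V\<^esub>"
    interpret L1_representation V \<rho> by (rule R)
    interpret halfplane_representation V \<rho> \<tau>
      by unfold_locales (use z L1_idealD(1)[OF line_ideal_L1_ideal] in \<open>auto simp: ker_def\<close>)
    show False by (rule contradiction)
  qed
  \<comment> \<open>The group property quantifies over all left Haar measures, so failure for
    \<open>G49_haar\<close> refutes it.\<close>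
  then show ?thesis using left_haar_measure_G49 unfolding weakly_wiener_group_def by blast
qed

end
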